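(* $p$-group canonization is in $n^{\min\{(1/2)\log_p n + O(p),\ \log_p n\}}$ time.
   Context: All groups are finite; $p$ is a prime, and a $p$-group is a group whose order is a power of $p$. Here $n$ denotes the order of the input $p$-group $G$, which is given by its multiplication table. A canonical form for a class of objects is a function that maps each object to a unique representative of its isomorphism class; for groups, this is a function $\mathrm{Can}$ with $\mathrm{Can}(G) \cong G$ for all $G$ in the class, and $\mathrm{Can}(G) = \mathrm{Can}(H)$ whenever $G \cong H$, the representative being given as a multiplication table. $p$-group canonization is the problem of computing such a canonical form for $p$-groups.
   Formalization: The time bound is taken up to a factor polynomial in n, i.e. an additive O(1) in the exponent: literally it fails for n = p, where the exponent is at most 1 but the output multiplication table has n^2 entries. *)

theory Defs
  imports
    "HOL-Computational_Algebra.Primes"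
    "HOL-Library.Log_Nat"
    "HOL-Library.Landau_Symbols"
    "HOL-Algebra.Coset"
begin

section \<open>Groups given by multiplication tables\<close>

definition p_group :: "nat \<Rightarrow> ('a, 'b) monoid_scheme \<Rightarrow> bool" where
  "p_group p G \<longleftrightarrow> group G \<and> (\<exists>k. order G = p ^ k)"

text \<open>A table lists its rows; the elements of a group of order \<open>n\<close> are named \<open>0, \<dots>, n - 1\<close>,
  and the identity may be any of them.\<close>

type_synonym table = "nat list list"

definition table_group :: "table \<Rightarrow> nat monoid" where
  "table_group T =
     \<lparr>carrier = {..<length T},
      mult = (\<lambda>i j. T ! i ! j),
      one = (THE e. e < length T \<and> (\<forall>i<length T. T ! e ! i = i \<and> T ! i ! e = i))\<rparr>"

definition p_group_tables :: "nat \<Rightarrow> table set" where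
  "p_group_tables p = {T. (\<forall>r\<in>set T. length r = length T) \<and> p_group p (table_group T)}"

definition canonical_form :: "table set \<Rightarrow> (table \<Rightarrow> table) \<Rightarrow> bool" where
  "canonical_form K Can \<longleftrightarrow>
     (\<forall>S\<in>K. Can S \<in> K \<and> table_group (Can S) \<cong> table_group S) \<and>
     (\<forall>S\<in>K. \<forall>T\<in>K. table_group S \<cong> table_group T \<longrightarrow> Can S = Can T)"


section \<open>Random access machines with logarithmic cost\<close>

text \<open>A program is a finite list of instructions, so it names only finitely many registers. All
  other storage is the memory, reached by indirect addressing. Execution stops when the program
  counter leaves the program.\<close>

datatype instr =
    Const nat nat     \<comment> \<open>\<open>Const r k\<close>: register \<open>r\<close> becomes \<open>k\<close>\<close>
  | Add nat nat nat   \<comment> \<open>\<open>Add r s t\<close>: register \<open>r\<close> becomes the sum of registers \<open>s\<close> and \<open>t\<close>\<close>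
  | Sub nat nat nat   \<comment> \<open>as \<open>Add\<close>, with truncated subtraction\<close>
  | Load nat nat      \<comment> \<open>\<open>Load r s\<close>: register \<open>r\<close> becomes the memory cell addressed by register \<open>s\<close>\<close>
  | Store nat nat     \<comment> \<open>\<open>Store r s\<close>: the memory cell addressed by register \<open>r\<close> becomes register \<open>s\<close>\<close>
  | Jz nat nat        \<comment> \<open>\<open>Jz r l\<close>: jump to instruction \<open>l\<close> if register \<open>r\<close> is zero\<close>

record config =
  pc :: nat
  reg :: "nat \<Rightarrow> nat"
  mem :: "nat \<Rightarrow> nat"

fun step :: "instr \<Rightarrow> config \<Rightarrow> config" where
  "step (Const r k) c = c\<lparr>pc := pc c + 1, reg := (reg c)(r := k)\<rparr>"
| "step (Add r s t) c = c\<lparr>pc := pc c + 1, reg := (reg c)(r := reg c s + reg c t)\<rparr>"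
| "step (Sub r s t) c = c\<lparr>pc := pc c + 1, reg := (reg c)(r := reg c s - reg c t)\<rparr>"
| "step (Load r s) c = c\<lparr>pc := pc c + 1, reg := (reg c)(r := mem c (reg c s))\<rparr>"
| "step (Store r s) c = c\<lparr>pc := pc c + 1, mem := (mem c)(reg c r := reg c s)\<rparr>"
| "step (Jz r l) c = c\<lparr>pc := (if reg c r = 0 then l else pc c + 1)\<rparr>"

text \<open>An instruction costs one plus the binary lengths of the data and addresses it handles
  (\<open>floorlog 2\<close> is the number of binary digits).\<close>

fun cost :: "instr \<Rightarrow> config \<Rightarrow> nat" where
  "cost (Const r k) c = 1 + floorlog 2 k"
| "cost (Add r s t) c = 1 + floorlog 2 (reg c s) + floorlog 2 (reg c t)"
| "cost (Sub r s t) c = 1 + floorlog 2 (reg c s) + floorlog 2 (reg c t)"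
| "cost (Load r s) c = 1 + floorlog 2 (reg c s) + floorlog 2 (mem c (reg c s))"
| "cost (Store r s) c = 1 + floorlog 2 (reg c r) + floorlog 2 (reg c s)"
| "cost (Jz r l) c = 1 + floorlog 2 (reg c r)"

inductive exec :: "instr list \<Rightarrow> config \<Rightarrow> nat \<Rightarrow> config \<Rightarrow> bool" for P where
  halt: "length P \<le> pc c \<Longrightarrow> exec P c 0 c"
| next_instr: "pc c < length P \<Longrightarrow> exec P (step (P ! pc c) c) t c' \<Longrightarrow>
    exec P c (cost (P ! pc c) c + t) c'"

text \<open>Input and output convention: register 0 holds the order \<open>n\<close>, and memory cells
  \<open>0, \<dots>, n\<^sup>2 - 1\<close> hold the table row by row.\<close>

definition input_config :: "table \<Rightarrow> config" where
  "input_config T =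
     \<lparr>pc = 0,
      reg = (\<lambda>_. 0)(0 := length T),
      mem = (\<lambda>a. if a < length (concat T) then concat T ! a else 0)\<rparr>"

definition output_table :: "config \<Rightarrow> table \<Rightarrow> bool" where
  "output_table c T \<longleftrightarrow>
     reg c 0 = length T \<and> (\<forall>a<length (concat T). mem c a = concat T ! a)"

definition computes_in_time :: "instr list \<Rightarrow> table \<Rightarrow> table \<Rightarrow> real \<Rightarrow> bool" where
  "computes_in_time P S T b \<longleftrightarrow>
     (\<exists>t c. exec P (input_config S) t c \<and> output_table c T \<and> real t \<le> b)"

text \<open>One program must serve all primes, and the constants hidden in a time bound
  \<open>n\<^bsup>e(n,p)\<^esup>\<close> must not depend on \<open>p\<close>. The bound is understood up to a factor polynomial in \<open>n\<close>.
  This cannot be avoided: for \<open>n = p\<close> the exponent \<open>min {(1/2) log\<^sub>p n + O(p), log\<^sub>p n}\<close> is at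
  most 1, whereas the output table alone has \<open>n\<^sup>2\<close> entries.\<close>

definition p_group_canonization_in_time :: "(nat \<Rightarrow> nat \<Rightarrow> real) \<Rightarrow> bool" where
  "p_group_canonization_in_time e \<longleftrightarrow>
     (\<exists>P Can a b. \<forall>p. prime p \<longrightarrow>
        canonical_form (p_group_tables p) Can \<and>
        (\<forall>T\<in>p_group_tables p.
           computes_in_time P T (Can T)
             (a * real (length T) powr b * real (length T) powr e (length T) p)))"

end

theory Submission
  imports Defs
    "HOL-Algebra.Group_Action"
    "HOL-Algebra.Multiplicative_Group"
    "HOL-Number_Theory.Cong"
    "HOL-Combinatorics.Permutations"
    "HOL-Library.List_Lexorder"
begin

text \<open>
  A group of order \<open>n = p\<^sup>k\<close> has a chain of subgroups \<open>N\<^sub>0 < \<dots> < N\<^sub>k\<close> with each \<open>N\<^sub>i\<close> normal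
  of index \<open>p\<close> in the next. Choosing a coset \<open>x\<^sub>i N\<^sub>i\<close> that generates \<open>N\<^sub>i\<^sub>+\<^sub>1\<close> over \<open>N\<^sub>i\<close> for every \<open>i\<close>
  leaves \<open>n / p\<^sup>i\<close> possibilities each, that is \<open>n\<^bsup>(k+1)/2\<^esup>\<close> in total, and all of them are tried.
  A choice of cosets names the elements of the group by \<open>k\<close>-digit numbers up to a group of
  permutations of the numbers below \<open>n\<close>, which is contained in the Sylow \<open>p\<close>-subgroup of the
  symmetric group that consists of iterated rotations of a \<open>p\<close>-ary tree.

  It remains to canonize a multiplication table under this Sylow subgroup in polynomial time. The
  sums of \<open>(x choose a) (y choose b) (xy choose c)\<close> over all \<open>x\<close> and \<open>y\<close>, taken modulo \<open>p\<close>, determine the table,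
  and by Lucas' theorem a tree rotation changes a binomial coefficient modulo \<open>p\<close> only by
  coefficients of lower index. Hence, on the stabilizer of the preceding sums, the change of each sum is
  a homomorphism into the integers modulo \<open>p\<close>, so that the sum can be made zero unless the
  stabilizer fixes it, and the next stabilizer is the kernel. Linear algebra on
  generators in echelon form carries this out. The least table found is the canonical form.
\<close>

text \<open>The rotation group has order p^((n-1)/(p-1)), far too large to enumerate. It is
  tractable because it acts on the moments modulo p by unitriangular matrices. If two labellings
  agree in all earlier moments, a rotation changes the next moment of both by the same amount; so on
  the stabilizer of the earlier moments the change is additive, and being trivial or onto it lets
  every moment that moves at all be made zero. Which moments can move depends only on the earlier
  ones, hence all normalized labellings in an orbit have the same moments, though they may differ as
  labellings. Stabilizers are never listed: k n generators describe them, ordered along a filtration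
  in which a p-th power always moves one step deeper, so that dropping one generator describes the
  kernel. Cosets depend on the earlier choices and have no fixed names. A counter whose digit i is
  below n / p^i therefore runs through ranks of least coset representatives, and choices that give
  no chain are discarded. Only the length of this count exceeds polynomial time.\<close>

section \<open>Executions of bounded cost\<close>

text \<open>Unlike \<open>exec\<close>, a run may stop anywhere, so runs compose and fragments of
  code can be analysed separately.\<close>

inductive runs :: "instr list \<Rightarrow> config \<Rightarrow> nat \<Rightarrow> config \<Rightarrow> bool" for P where
  runs_stop: "runs P c 0 c"
| runs_step: "pc c < length P \<Longrightarrow> runs P (step (P ! pc c) c) t c' \<Longrightarrow>
    runs P c (cost (P ! pc c) c + t) c'"

lemma runs_trans: "runs P c t c' \<Longrightarrow> runs P c' t' c'' \<Longrightarrow> runs P c (t + t') c''"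
  by (induction rule: runs.induct) (auto simp: add.assoc intro: runs.intros)

lemma runs_exec: "runs P c t c' \<Longrightarrow> length P \<le> pc c' \<Longrightarrow> exec P c t c'"
  by (induction rule: runs.induct) (auto intro: exec.intros)

text \<open>Time is counted in instructions. When V bounds all numbers handled, an instruction costs
  at most 2 V + 1, because it charges at most two binary lengths.\<close>

definition reach ::
  "instr list \<Rightarrow> nat \<Rightarrow> nat \<Rightarrow> (nat \<Rightarrow> nat) \<Rightarrow> (nat \<Rightarrow> nat) \<Rightarrow> nat \<Rightarrow> nat \<Rightarrow> (nat \<Rightarrow> nat) \<Rightarrow> (nat \<Rightarrow> nat) \<Rightarrow> bool"
where
  "reach P V s R m N s' R' m' \<longleftrightarrow>
     (\<exists>t \<le> N * (2 * V + 1). runs P \<lparr>pc = s, reg = R, mem = m\<rparr> t \<lparr>pc = s', reg = R', mem = m'\<rparr>)"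

lemma reach_refl: "reach P V s R m 0 s R m"
  by (auto simp: reach_def intro: runs_stop)

lemma reach_trans:
  assumes "reach P V s R m N s' R' m'" "reach P V s' R' m' N' s'' R'' m''"
  shows "reach P V s R m (N + N') s'' R'' m''"
proof -
  from assms obtain t t' where
    "t \<le> N * (2 * V + 1)" "runs P \<lparr>pc = s, reg = R, mem = m\<rparr> t \<lparr>pc = s', reg = R', mem = m'\<rparr>"
    "t' \<le> N' * (2 * V + 1)" "runs P \<lparr>pc = s', reg = R', mem = m'\<rparr> t' \<lparr>pc = s'', reg = R'', mem = m''\<rparr>"
    unfolding reach_def by blast
  moreover from this have "t + t' \<le> (N + N') * (2 * V + 1)"
    by (simp only: add_mult_distrib)
  ultimately show ?thesis unfolding reach_def by (blast intro: runs_trans)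
qed

lemma reach_mono:
  assumes "reach P V s R m N s' R' m'" "N \<le> N'"
  shows "reach P V s R m N' s' R' m'"
proof -
  have "N * (2 * V + 1) \<le> N' * (2 * V + 1)" using assms(2) by (rule mult_le_mono1)
  with assms(1) show ?thesis unfolding reach_def by (meson order_trans)
qed

text \<open>The linear bound is wasteful but harmless, since all numbers handled will be polynomial
  in n.\<close>

lemma floorlog_le_self: "floorlog 2 x \<le> x"
proof -
  have "floorlog 2 x \<le> floorlog 2 (2 ^ x - 1)"
    by (rule floorlog_mono) (use less_exp[of x] in linarith)
  also have "\<dots> \<le> x" by (rule floorlog_leI) auto
  finally show ?thesis .
qed

lemma reach_cast:
  "reach P V s R m N s' R' m' \<Longrightarrow> N = N' \<Longrightarrow> s' = s'' \<Longrightarrow> m' = m'' \<Longrightarrow> reach P V s R m N' s'' R' m''"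
  by simp

lemma reach_instr:
  assumes "s < length P" "P ! s = i"
    "step i \<lparr>pc = s, reg = R, mem = m\<rparr> = \<lparr>pc = sa, reg = Ra, mem = ma\<rparr>"
    "cost i \<lparr>pc = s, reg = R, mem = m\<rparr> \<le> 2 * V + 1"
    "reach P V sa Ra ma N s' R' m'"
  shows "reach P V s R m (Suc N) s' R' m'"
proof -
  from assms(5) obtain t where
    t: "t \<le> N * (2 * V + 1)" "runs P \<lparr>pc = sa, reg = Ra, mem = ma\<rparr> t \<lparr>pc = s', reg = R', mem = m'\<rparr>"
    unfolding reach_def by blast
  have "runs P \<lparr>pc = s, reg = R, mem = m\<rparr>
      (cost (P ! pc \<lparr>pc = s, reg = R, mem = m\<rparr>) \<lparr>pc = s, reg = R, mem = m\<rparr> + t)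
      \<lparr>pc = s', reg = R', mem = m'\<rparr>"
    by (rule runs_step) (use assms(1-3) t(2) in simp_all)
  moreover have "cost (P ! pc \<lparr>pc = s, reg = R, mem = m\<rparr>) \<lparr>pc = s, reg = R, mem = m\<rparr> + t
      \<le> Suc N * (2 * V + 1)"
    using assms(2,4) t(1) by simp
  ultimately show ?thesis unfolding reach_def by blast
qed

section \<open>Symbolic execution of straight-line code\<close>

fun located :: "instr list \<Rightarrow> nat \<Rightarrow> instr list \<Rightarrow> bool" where
  "located P s [] \<longleftrightarrow> True"
| "located P s (i # is) \<longleftrightarrow> s < length P \<and> P ! s = i \<and> located P (Suc s) is"

lemma located_append [simp]:
  "located P s (xs @ ys) \<longleftrightarrow> located P s xs \<and> located P (s + length xs) ys"
  by (induction xs arbitrary: s) auto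

lemma located_infix: "P = xs @ is @ ys \<Longrightarrow> located P (length xs) is"
proof (induction "is" arbitrary: xs)
  case (Cons i "is")
  then have "located P (length (xs @ [i])) is" by (intro Cons.IH) simp
  with Cons.prems show ?case by (auto simp: nth_append)
qed simp

text \<open>Stated as a predicate on the final state so that the simplifier executes concrete code
  and leaves exactly the side conditions that no number exceeds V.\<close>

fun straight ::
  "nat \<Rightarrow> instr list \<Rightarrow> (nat \<Rightarrow> nat) \<Rightarrow> (nat \<Rightarrow> nat) \<Rightarrow> (nat \<Rightarrow> nat) \<Rightarrow> (nat \<Rightarrow> nat) \<Rightarrow> bool"
where
  "straight V [] R m R' m' \<longleftrightarrow> R' = R \<and> m' = m"
| "straight V (Const r k # is) R m R' m' \<longleftrightarrow> k \<le> V \<and> straight V is (R(r := k)) m R' m'"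
| "straight V (Add r a b # is) R m R' m' \<longleftrightarrow>
     R a \<le> V \<and> R b \<le> V \<and> straight V is (R(r := R a + R b)) m R' m'"
| "straight V (Sub r a b # is) R m R' m' \<longleftrightarrow>
     R a \<le> V \<and> R b \<le> V \<and> straight V is (R(r := R a - R b)) m R' m'"
| "straight V (Load r a # is) R m R' m' \<longleftrightarrow>
     R a \<le> V \<and> m (R a) \<le> V \<and> straight V is (R(r := m (R a))) m R' m'"
| "straight V (Store r a # is) R m R' m' \<longleftrightarrow>
     R r \<le> V \<and> R a \<le> V \<and> straight V is R (m(R r := R a)) R' m'"
| "straight V (Jz r l # is) R m R' m' \<longleftrightarrow> False"

lemma straight_reach:
  "located P s is \<Longrightarrow> straight V is R m R' m' \<Longrightarrow> reach P V s R m (length is) (s + length is) R' m'"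
proof (induction "is" arbitrary: s R m)
  case Nil
  then show ?case by (simp add: reach_refl)
next
  case (Cons i "is")
  have *: "reach P V s R m (length (i # is)) (s + length (i # is)) R' m'"
    if "straight V is Ra ma R' m'" "step i \<lparr>pc = s, reg = R, mem = m\<rparr> = \<lparr>pc = Suc s, reg = Ra, mem = ma\<rparr>"
      "cost i \<lparr>pc = s, reg = R, mem = m\<rparr> \<le> 2 * V + 1" for Ra ma
    using reach_instr[OF _ _ that(2,3) Cons.IH[OF _ that(1)]] Cons.prems(1) by simp
  show ?case
  proof (cases i)
    case (Const r k)
    then show ?thesis using Cons.prems floorlog_le_self[of k] by (intro *) auto
  next
    case (Add r a b)
    then show ?thesis
      using Cons.prems floorlog_le_self[of "R a"] floorlog_le_self[of "R b"] by (intro *) auto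
  next
    case (Sub r a b)
    then show ?thesis
      using Cons.prems floorlog_le_self[of "R a"] floorlog_le_self[of "R b"] by (intro *) auto
  next
    case (Load r a)
    then show ?thesis
      using Cons.prems floorlog_le_self[of "R a"] floorlog_le_self[of "m (R a)"] by (intro *) auto
  next
    case (Store r a)
    then show ?thesis
      using Cons.prems floorlog_le_self[of "R r"] floorlog_le_self[of "R a"] by (intro *) auto
  next
    case (Jz r l)
    then show ?thesis using Cons.prems by simp
  qed
qed

lemma reach_Jz:
  assumes "located P s [Jz r l]" "R r \<le> V"
  shows "reach P V s R m 1 (if R r = 0 then l else s + 1) R m"
  unfolding One_nat_def
  by (rule reach_instr[OF _ _ _ _ reach_refl])
    (use assms floorlog_le_self[of "R r"] in auto)

section \<open>A language of arithmetic expressions and bounded loops\<close>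

datatype exp =
    Num nat | Var nat | Arr nat exp | Cell exp
  | Plus exp exp | Minus exp exp | Times exp exp | Rem exp exp | Summ nat exp exp

type_synonym store = "nat \<Rightarrow> nat \<Rightarrow> nat"

fun eval :: "exp \<Rightarrow> (nat \<Rightarrow> nat) \<Rightarrow> store \<Rightarrow> nat" where
  "eval (Num k) \<rho> A = k"
| "eval (Var v) \<rho> A = \<rho> v"
| "eval (Arr a e) \<rho> A = A a (eval e \<rho> A)"
| "eval (Cell e) \<rho> A = A (eval e \<rho> A mod 32) (eval e \<rho> A div 32)"
| "eval (Plus e f) \<rho> A = eval e \<rho> A + eval f \<rho> A"
| "eval (Minus e f) \<rho> A = eval e \<rho> A - eval f \<rho> A"
| "eval (Times e f) \<rho> A = eval e \<rho> A * eval f \<rho> A"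
| "eval (Rem e f) \<rho> A = eval e \<rho> A mod eval f \<rho> A"
| "eval (Summ v e f) \<rho> A = (\<Sum>i<eval e \<rho> A. eval f (\<rho>(v := i)) A)"

text \<open>\<open>SetCell\<close>, like \<open>Cell\<close> among the expressions, addresses raw
  memory, as the input and output conventions demand. All loops are bounded in advance, so a
  polynomial cost can be read off the syntax.\<close>

datatype com =
    Assign nat exp exp | SetCell exp exp | Seq com com | Cond exp com | For nat exp com

text \<open>Stored values are cut off at \<open>q\<close>, which keeps all data polynomially bounded.\<close>

fun sem :: "com \<Rightarrow> nat \<Rightarrow> (nat \<Rightarrow> nat) \<Rightarrow> store \<Rightarrow> store" where
  "sem (Assign a i e) q \<rho> A = A(a := (A a)(eval i \<rho> A := min (eval e \<rho> A) q))"
| "sem (SetCell i e) q \<rho> A =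
     A(eval i \<rho> A mod 32 := (A (eval i \<rho> A mod 32))(eval i \<rho> A div 32 := min (eval e \<rho> A) q))"
| "sem (Seq c d) q \<rho> A = sem d q \<rho> (sem c q \<rho> A)"
| "sem (Cond e c) q \<rho> A = (if eval e \<rho> A = 0 then A else sem c q \<rho> A)"
| "sem (For v e c) q \<rho> A = fold (\<lambda>i. sem c q (\<rho>(v := i))) [0..<eval e \<rho> A] A"

fun wf_exp :: "exp \<Rightarrow> bool" where
  "wf_exp (Num k) = True"
| "wf_exp (Var v) = True"
| "wf_exp (Arr a e) = (a < 32 \<and> wf_exp e)"
| "wf_exp (Cell e) = wf_exp e"
| "wf_exp (Plus e f) = (wf_exp e \<and> wf_exp f)"
| "wf_exp (Minus e f) = (wf_exp e \<and> wf_exp f)"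
| "wf_exp (Times e f) = (wf_exp e \<and> wf_exp f)"
| "wf_exp (Rem e f) = (wf_exp e \<and> wf_exp f)"
| "wf_exp (Summ v e f) = (wf_exp e \<and> wf_exp f)"

fun wf_com :: "com \<Rightarrow> bool" where
  "wf_com (Assign a i e) = (a < 32 \<and> wf_exp i \<and> wf_exp e)"
| "wf_com (SetCell i e) = (wf_exp i \<and> wf_exp e)"
| "wf_com (Seq c d) = (wf_com c \<and> wf_com d)"
| "wf_com (Cond e c) = (wf_exp e \<and> wf_com c)"
| "wf_com (For v e c) = (wf_exp e \<and> wf_com c)"

text \<open>The 32 arrays are interleaved in the memory.\<close>

definition flat :: "store \<Rightarrow> nat \<Rightarrow> nat" where
  "flat A j = A (j mod 32) (j div 32)"

lemma flat_address [simp]: "a < 32 \<Longrightarrow> flat A (32 * i + a) = A a i"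
  by (simp add: flat_def)

lemma flat_upd_cell:
  "(flat A)(j := x) = flat (A(j mod 32 := (A (j mod 32))(j div 32 := x)))"
proof
  fix l
  have "l = j" if "l mod 32 = j mod 32" "l div 32 = j div 32"
    using that by (metis div_mult_mod_eq)
  then show "((flat A)(j := x)) l = flat (A(j mod 32 := (A (j mod 32))(j div 32 := x))) l"
    by (auto simp: flat_def)
qed

lemma flat_upd:
  "a < 32 \<Longrightarrow> (flat A)(32 * i + a := x) = flat (A(a := (A a)(i := x)))"
  by (simp add: flat_upd_cell)

section \<open>Compilation\<close>

text \<open>Register d holds the number of rounds, d+1 the round, d+2 the sum so far; the body
  leaves its summand in d+3. Jumps are absolute, so the code depends on its own address s: the test
  is at s+2, and s + length body + 9 is the first address behind the loop. A constant zero followed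
  by \<open>Jz\<close> is an unconditional jump.\<close>

definition loop :: "nat \<Rightarrow> nat \<Rightarrow> instr list \<Rightarrow> instr list" where
  "loop d s body =
     [Const (d+1) 0, Const (d+2) 0] @ [Sub (d+3) d (d+1)] @ [Jz (d+3) (s + length body + 9)] @ body @
     [Add (d+2) (d+2) (d+3), Const (d+3) 1, Add (d+1) (d+1) (d+3), Const (d+3) 0] @ [Jz (d+3) (s+2)]"

definition times32 :: "nat \<Rightarrow> instr list" where
  "times32 d = [Add d d d, Add d d d, Add d d d, Add d d d, Add d d d]"

fun exp_len :: "exp \<Rightarrow> nat" where
  "exp_len (Num k) = 1"
| "exp_len (Var v) = 2"
| "exp_len (Arr a e) = exp_len e + 8"
| "exp_len (Cell e) = exp_len e + 1"
| "exp_len (Plus e f) = exp_len e + exp_len f + 1"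
| "exp_len (Minus e f) = exp_len e + exp_len f + 1"
| "exp_len (Times e f) = exp_len e + exp_len f + 11"
| "exp_len (Rem e f) = exp_len e + exp_len f + 8"
| "exp_len (Summ v e f) = exp_len e + exp_len f + 11"

text \<open>The code for \<open>e\<close>, placed at address \<open>s\<close>, leaves its value in register \<open>d\<close> and uses only
  registers from \<open>d\<close> on; variable \<open>v\<close> is held by register \<open>\<mu> v\<close>.\<close>

fun exp_code :: "(nat \<Rightarrow> nat) \<Rightarrow> nat \<Rightarrow> nat \<Rightarrow> exp \<Rightarrow> instr list" where
  "exp_code \<mu> d s (Num k) = [Const d k]"
| "exp_code \<mu> d s (Var v) = [Const (d+1) 0, Add d (\<mu> v) (d+1)]"
| "exp_code \<mu> d s (Arr a e) =
     exp_code \<mu> d s e @ times32 d @ [Const (d+1) a, Add d d (d+1), Load d d]"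
| "exp_code \<mu> d s (Cell e) = exp_code \<mu> d s e @ [Load d d]"
| "exp_code \<mu> d s (Plus e f) = exp_code \<mu> d s e @ exp_code \<mu> (d+1) (s + exp_len e) f @ [Add d d (d+1)]"
| "exp_code \<mu> d s (Minus e f) = exp_code \<mu> d s e @ exp_code \<mu> (d+1) (s + exp_len e) f @ [Sub d d (d+1)]"
| "exp_code \<mu> d s (Times e f) =
     exp_code \<mu> d s e @ loop d (s + exp_len e) (exp_code \<mu> (d+3) (s + exp_len e + 4) f) @
     [Const (d+3) 0, Add d (d+2) (d+3)]"
| "exp_code \<mu> d s (Rem e f) =
     exp_code \<mu> d s e @ exp_code \<mu> (d+1) (s + exp_len e) f @
     (let l = s + exp_len e + exp_len f in
      [Jz (d+1) (l+8), Sub (d+2) (d+1) d, Jz (d+2) (l+5), Const (d+2) 0, Jz (d+2) (l+8),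
       Sub d d (d+1), Const (d+2) 0, Jz (d+2) l])"
| "exp_code \<mu> d s (Summ v e f) =
     exp_code \<mu> d s e @ loop d (s + exp_len e) (exp_code (\<mu>(v := d+1)) (d+3) (s + exp_len e + 4) f) @
     [Const (d+3) 0, Add d (d+2) (d+3)]"

lemma length_loop [simp]: "length (loop d s body) = length body + 9"
  by (simp add: loop_def)

lemma length_times32 [simp]: "length (times32 d) = 5"
  by (simp add: times32_def)

lemma length_exp_code [simp]: "length (exp_code \<mu> d s e) = exp_len e"
  by (induction e arbitrary: \<mu> d s) (auto simp: Let_def)

text \<open>\<open>exp_size e B\<close> bounds all numbers handled and \<open>exp_steps e B\<close> the number of steps, when the
  variables and the memory hold numbers up to \<open>B\<close>.\<close>

fun exp_size :: "exp \<Rightarrow> nat \<Rightarrow> nat" where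
  "exp_size (Num k) B = k"
| "exp_size (Var v) B = B"
| "exp_size (Arr a e) B = 32 * exp_size e B + a + B"
| "exp_size (Cell e) B = exp_size e B + B"
| "exp_size (Plus e f) B = exp_size e B + exp_size f B"
| "exp_size (Minus e f) B = exp_size e B + exp_size f B"
| "exp_size (Times e f) B = exp_size e B + exp_size f B + exp_size e B * exp_size f B + 1"
| "exp_size (Rem e f) B = exp_size e B + exp_size f B"
| "exp_size (Summ v e f) B =
     exp_size e B + exp_size f (B + exp_size e B) + exp_size e B * exp_size f (B + exp_size e B) + 1"

fun exp_steps :: "exp \<Rightarrow> nat \<Rightarrow> nat" where
  "exp_steps (Num k) B = 1"
| "exp_steps (Var v) B = 2"
| "exp_steps (Arr a e) B = exp_steps e B + 8"
| "exp_steps (Cell e) B = exp_steps e B + 1"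
| "exp_steps (Plus e f) B = exp_steps e B + exp_steps f B + 1"
| "exp_steps (Minus e f) B = exp_steps e B + exp_steps f B + 1"
| "exp_steps (Times e f) B = exp_steps e B + 6 + exp_size e B * (exp_steps f B + 7)"
| "exp_steps (Rem e f) B = exp_steps e B + exp_steps f B + 5 + 6 * exp_size e B"
| "exp_steps (Summ v e f) B =
     exp_steps e B + 6 + exp_size e B * (exp_steps f (B + exp_size e B) + 7)"

lemma located_loop:
  assumes "located P s (loop d s body)"
  shows "located P s [Const (d+1) 0, Const (d+2) 0]"
    "located P (s+2) [Sub (d+3) d (d+1)]"
    "located P (s+3) [Jz (d+3) (s + length body + 9)]"
    "located P (s+4) body"
    "located P (s+4+length body)
      [Add (d+2) (d+2) (d+3), Const (d+3) 1, Add (d+1) (d+1) (d+3), Const (d+3) 0]"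
    "located P (s+8+length body) [Jz (d+3) (s+2)]"
  using assms unfolding loop_def located_append by (simp_all add: ac_simps eval_nat_numeral)

text \<open>One lemma for both uses of loops: in expressions the memories \<open>ms\<close> are
  constant and \<open>g\<close> gives the summands, in commands \<open>g\<close> is zero and
  \<open>ms\<close> is the sequence of stores. The induction runs over the remaining rounds, each
  starting at the test.\<close>

lemma loop_head:
  assumes "located P s (loop d s body)" "R d = N" "i \<le> N" "N < V"
    and R1: "R1 (d+1) = i" "R1 (d+2) = (\<Sum>j<i. g j)" "\<And>r. r \<le> d \<Longrightarrow> R1 r = R r"
    and sum: "(\<Sum>j<N. g j) \<le> V" "\<And>i. i < N \<Longrightarrow> g i \<le> V"
    and body: "\<And>i R1. i < N \<Longrightarrow> (\<And>r. r \<le> d \<Longrightarrow> R1 r = R r) \<Longrightarrow> R1 (d+1) = i \<Longrightarrow>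
      \<exists>R2. reach P V (s+4) R1 (ms i) nb (s+4+length body) R2 (ms (Suc i)) \<and>
        (\<forall>r<d+3. R2 r = R1 r) \<and> R2 (d+3) = g i"
  shows "\<exists>R'. reach P V (s+2) R1 (ms i) (2 + (N - i) * (nb + 7)) (s + length body + 9) R' (ms N) \<and>
    R' (d+2) = (\<Sum>j<N. g j) \<and> (\<forall>r\<le>d. R' r = R r)"
  using \<open>i \<le> N\<close> R1
proof (induction "N - i" arbitrary: i R1)
  case 0
  then have [simp]: "i = N" by simp
  let ?R1 = "R1(d+3 := 0)"
  have "reach P V (s+2) R1 (ms i) 1 (s+3) ?R1 (ms i)"
    using straight_reach[OF located_loop(2)[OF assms(1)], of V R1 "ms i" ?R1 "ms i"] 0 assms(2,4)
    by (simp add: eval_nat_numeral)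
  moreover have "reach P V (s+3) ?R1 (ms i) 1 (s + length body + 9) ?R1 (ms i)"
    using reach_Jz[OF located_loop(3)[OF assms(1)], of ?R1 V "ms i"] by simp
  ultimately have "reach P V (s+2) R1 (ms i) (1 + 1) (s + length body + 9) ?R1 (ms i)"
    by (rule reach_trans)
  then show ?case using 0 by (auto simp: numeral_2_eq_2)
next
  case (Suc x)
  then have iN: "i < N" by simp
  let ?R1 = "R1(d+3 := N - i)"
  have pre1: "reach P V (s+2) R1 (ms i) 1 (s+3) ?R1 (ms i)"
    using straight_reach[OF located_loop(2)[OF assms(1)], of V R1 "ms i" ?R1 "ms i"]
      Suc.prems iN assms(2,4) by (simp add: eval_nat_numeral)
  have pre2: "reach P V (s+3) ?R1 (ms i) 1 (s+4) ?R1 (ms i)"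
    using reach_Jz[OF located_loop(3)[OF assms(1)], of ?R1 V "ms i"] iN assms(4)
    by (simp add: eval_nat_numeral)
  obtain R2 where R2: "reach P V (s+4) ?R1 (ms i) nb (s+4+length body) R2 (ms (Suc i))"
    "\<forall>r<d+3. R2 r = ?R1 r" "R2 (d+3) = g i"
    using body[of i ?R1] iN Suc.prems by auto
  have sg: "(\<Sum>j<i. g j) \<le> V"
    by (rule order_trans[OF _ sum(1)], rule sum_mono2) (use iN in auto)
  let ?R3 = "R2(d+2 := (\<Sum>j<Suc i. g j), d+3 := 1, d+1 := Suc i, d+3 := 0)"
  have *: "R2 (d+2) = (\<Sum>j<i. g j)" "R2 (d+1) = i" using R2(2) Suc.prems by auto
  have post1: "reach P V (s+4+length body) R2 (ms (Suc i)) 4 (s+8+length body) ?R3 (ms (Suc i))"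
    using straight_reach[OF located_loop(5)[OF assms(1)], of V R2 "ms (Suc i)" ?R3 "ms (Suc i)"]
      * R2(3) sg sum(2)[OF iN] iN assms(4) by (simp add: eval_nat_numeral)
  have post2: "reach P V (s+8+length body) ?R3 (ms (Suc i)) 1 (s+2) ?R3 (ms (Suc i))"
    using reach_Jz[OF located_loop(6)[OF assms(1)], of ?R3 V "ms (Suc i)"] by simp
  have "\<exists>R'. reach P V (s+2) ?R3 (ms (Suc i)) (2 + (N - Suc i) * (nb + 7)) (s + length body + 9) R' (ms N) \<and>
    R' (d+2) = (\<Sum>j<N. g j) \<and> (\<forall>r\<le>d. R' r = R r)"
    by (rule Suc.hyps) (use Suc.hyps(2) Suc.prems R2(2) iN in auto)
  then obtain R' where R': "reach P V (s+2) ?R3 (ms (Suc i)) (2 + (N - Suc i) * (nb + 7)) (s + length body + 9) R' (ms N)"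
    "R' (d+2) = (\<Sum>j<N. g j)" "\<forall>r\<le>d. R' r = R r" by blast
  \<comment> \<open>A round takes 2 instructions for the test, nb for the body and 5 for the update
    and the jump back.\<close>
  have eq: "1 + 1 + nb + 4 + 1 + (2 + (N - Suc i) * (nb + 7)) = 2 + (N - i) * (nb + 7)"
  proof -
    from iN obtain y where "N - i = Suc y" "N - Suc i = y" by (metis Suc_diff_Suc)
    then show ?thesis by simp
  qed
  show ?case
    by (intro exI[of _ R'] conjI R'(2,3)
      reach_trans[OF reach_trans[OF reach_trans[OF reach_trans[OF reach_trans[OF pre1 pre2] R2(1)] post1] post2] R'(1), unfolded eq])
qed

lemma loop_reach:
  assumes "located P s (loop d s body)" "R d = N" "N < V"
    and sum: "(\<Sum>j<N. g j) \<le> V" "\<And>i. i < N \<Longrightarrow> g i \<le> V"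
    and body: "\<And>i R1. i < N \<Longrightarrow> (\<And>r. r \<le> d \<Longrightarrow> R1 r = R r) \<Longrightarrow> R1 (d+1) = i \<Longrightarrow>
      \<exists>R2. reach P V (s+4) R1 (ms i) nb (s+4+length body) R2 (ms (Suc i)) \<and>
        (\<forall>r<d+3. R2 r = R1 r) \<and> R2 (d+3) = g i"
  shows "\<exists>R'. reach P V s R (ms 0) (4 + N * (nb + 7)) (s + length body + 9) R' (ms N) \<and>
    R' (d+2) = (\<Sum>j<N. g j) \<and> (\<forall>r\<le>d. R' r = R r)"
proof -
  let ?R1 = "R(d+1 := 0, d+2 := 0)"
  have pre: "reach P V s R (ms 0) 2 (s+2) ?R1 (ms 0)"
    using straight_reach[OF located_loop(1)[OF assms(1)], of V R "ms 0" ?R1 "ms 0"]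
    by (simp add: eval_nat_numeral)
  have "\<exists>R'. reach P V (s+2) ?R1 (ms 0) (2 + (N - 0) * (nb + 7)) (s + length body + 9) R' (ms N) \<and>
    R' (d+2) = (\<Sum>j<N. g j) \<and> (\<forall>r\<le>d. R' r = R r)"
    by (rule loop_head[where R = R, OF assms(1,2) _ assms(3)]) (use sum body in auto)
  then obtain R' where R': "reach P V (s+2) ?R1 (ms 0) (2 + N * (nb + 7)) (s + length body + 9) R' (ms N)"
    "R' (d+2) = (\<Sum>j<N. g j)" "\<forall>r\<le>d. R' r = R r" by auto
  have eq: "2 + (2 + N * (nb + 7)) = 4 + N * (nb + 7)" by simp
  show ?thesis
    by (intro exI[of _ R'] conjI R'(2,3) reach_trans[OF pre R'(1), unfolded eq])
qed

lemma eval_le_exp_size: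
  "(\<And>v. \<rho> v \<le> B) \<Longrightarrow> (\<And>a i. A a i \<le> B) \<Longrightarrow> eval e \<rho> A \<le> exp_size e B"
proof (induction e arbitrary: \<rho> B)
  case (Arr a e)
  from Arr.prems(2)[of a "eval e \<rho> A"] show ?case by simp
next
  case (Cell e)
  from Cell.prems(2)[of "eval e \<rho> A mod 32" "eval e \<rho> A div 32"] show ?case by simp
next
  case (Times e f)
  then have "eval e \<rho> A * eval f \<rho> A \<le> exp_size e B * exp_size f B" by (intro mult_le_mono) auto
  then show ?case by simp
next
  case (Rem e f)
  have "eval e \<rho> A mod eval f \<rho> A \<le> eval e \<rho> A" by simp
  also have "\<dots> \<le> exp_size e B" by (rule Rem.IH) (use Rem.prems in auto)
  finally show ?case by simp
next
  case (Summ v e f)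
  let ?B = "B + exp_size e B"
  have e: "eval e \<rho> A \<le> exp_size e B" by (rule Summ.IH) (use Summ.prems in auto)
  have "eval f (\<rho>(v := i)) A \<le> exp_size f ?B" if "i < eval e \<rho> A" for i
    by (rule Summ.IH) (use Summ.prems e that in \<open>auto intro: order_trans trans_le_add1\<close>)
  then have "(\<Sum>i<eval e \<rho> A. eval f (\<rho>(v := i)) A) \<le> of_nat (card {..<eval e \<rho> A}) * exp_size f ?B"
    by (intro sum_bounded_above) auto
  also have "\<dots> \<le> exp_size e B * exp_size f ?B" using e by simp
  finally show ?case by simp
qed (simp_all add: add_mono trans_le_add1 le_diff_conv)

lemma straight_times32:
  "32 * R d \<le> V \<Longrightarrow> straight V (times32 d @ is) R m R' m' \<longleftrightarrow> straight V is (R(d := 32 * R d)) m R' m'"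
  by (simp add: times32_def mult_2[symmetric])

text \<open>Repeated subtraction: 6 instructions per subtraction and at most 5 to finish. The
  initial jump catches divisor zero, where the dividend is left alone, in agreement with
  \<open>mod\<close> in HOL.\<close>

lemma rem_reach:
  assumes code: "located P l [Jz (d+1) (l+8)]" "located P (l+1) [Sub (d+2) (d+1) d]"
      "located P (l+2) [Jz (d+2) (l+5)]" "located P (l+3) [Const (d+2) 0]"
      "located P (l+4) [Jz (d+2) (l+8)]" "located P (l+5) [Sub d d (d+1), Const (d+2) 0]"
      "located P (l+7) [Jz (d+2) l]"
    and "R d \<le> V" "R (d+1) \<le> V"
  shows "\<exists>R'. reach P V l R m (5 + 6 * R d) (l+8) R' m \<and> R' d = R d mod R (d+1) \<and> (\<forall>r<d. R' r = R r)"
  using assms(8,9)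
proof (induction "R d" arbitrary: R rule: less_induct)
  case less
  have j0: "reach P V l R m 1 (if R (d+1) = 0 then l+8 else l+1) R m"
    by (rule reach_Jz[OF code(1)]) (use less.prems in auto)
  show ?case
  proof (cases "R (d+1) = 0")
    case True
    with j0 show ?thesis by (auto intro!: exI[of _ R] elim!: reach_mono)
  next
    case False
    let ?R1 = "R(d+2 := R (d+1) - R d)"
    have j1: "reach P V (l+1) R m 1 (l+2) ?R1 m"
      using straight_reach[OF code(2), of V R m ?R1 m] less.prems by simp
    have j2: "reach P V (l+2) ?R1 m 1 (if R (d+1) \<le> R d then l+5 else l+3) ?R1 m"
      using reach_Jz[OF code(3), of ?R1 V m] less.prems
      by (cases "R (d+1) \<le> R d") (auto simp add: eval_nat_numeral)
    show ?thesis
    proof (cases "R (d+1) \<le> R d")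
      case ge: True
      let ?R2 = "R(d := R d - R (d+1), d+2 := 0)"
      have j3: "reach P V (l+5) ?R1 m 2 (l+7) ?R2 m"
        using straight_reach[OF code(6), of V ?R1 m ?R2 m] less.prems
        by (simp add: eval_nat_numeral fun_upd_twist)
      have j4: "reach P V (l+7) ?R2 m 1 l ?R2 m"
        using reach_Jz[OF code(7), of ?R2 V m] by simp
      have "\<exists>R'. reach P V l ?R2 m (5 + 6 * ?R2 d) (l+8) R' m \<and> R' d = ?R2 d mod ?R2 (d+1) \<and>
          (\<forall>r<d. R' r = ?R2 r)"
        by (rule less.hyps) (use less.prems ge False in auto)
      then obtain R' where R': "reach P V l ?R2 m (5 + 6 * (R d - R (d+1))) (l+8) R' m"
        "R' d = (R d - R (d+1)) mod R (d+1)" "\<forall>r<d. R' r = R r" by auto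
      have "reach P V l R m (1 + 1 + 1 + 2 + 1 + (5 + 6 * (R d - R (d+1)))) (l+8) R' m"
        by (rule reach_trans[OF reach_trans[OF reach_trans[OF reach_trans[OF reach_trans]]]])
          (use j0 j1 j2 j3 j4 False ge R'(1) in \<open>auto split: if_splits\<close>)
      then have "reach P V l R m (5 + 6 * R d) (l+8) R' m"
        by (rule reach_mono) (use False ge in simp)
      with R' ge show ?thesis by (auto simp: le_mod_geq intro!: exI[of _ R'])
    next
      case lt: False
      let ?R2 = "R(d+2 := 0)"
      have j3: "reach P V (l+3) ?R1 m 1 (l+4) ?R2 m"
        using straight_reach[OF code(4), of V ?R1 m ?R2 m] by (simp add: add.commute)
      have j4: "reach P V (l+4) ?R2 m 1 (l+8) ?R2 m"
        using reach_Jz[OF code(5), of ?R2 V m] by simp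
      have "reach P V l R m (1 + 1 + 1 + 1 + 1) (l+8) ?R2 m"
        by (rule reach_trans[OF reach_trans[OF reach_trans[OF reach_trans]]])
          (use j0 j1 j2 j3 j4 False lt in \<open>auto split: if_splits\<close>)
      then have "reach P V l R m (5 + 6 * R d) (l+8) ?R2 m"
        by (rule reach_mono) simp
      with lt show ?thesis by (auto intro!: exI[of _ ?R2])
    qed
  qed
qed

text \<open>Variables live in registers below d and the code for an expression writes only from d
  on, so values computed earlier survive the evaluation of subexpressions.\<close>

lemma exp_reach:
  "located P s (exp_code \<mu> d s e) \<Longrightarrow> (\<And>v. \<mu> v < d) \<Longrightarrow> (\<And>v. R (\<mu> v) \<le> B) \<Longrightarrow> (\<And>a i. A a i \<le> B) \<Longrightarrow>
   wf_exp e \<Longrightarrow> exp_size e B < V \<Longrightarrow>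
   \<exists>R'. reach P V s R (flat A) (exp_steps e B) (s + exp_len e) R' (flat A) \<and>
     R' d = eval e (\<lambda>v. R (\<mu> v)) A \<and> (\<forall>r<d. R' r = R r)"
proof (induction e arbitrary: \<mu> d s R B)
  case (Num k)
  let ?R = "R(d := k)"
  have "reach P V s R (flat A) 1 (s+1) ?R (flat A)"
    using straight_reach[OF Num.prems(1)[unfolded exp_code.simps], of V R "flat A" ?R "flat A"] Num.prems
    by simp
  then show ?case by (auto intro!: exI[of _ ?R])
next
  case (Var v)
  let ?R = "R(d+1 := 0, d := R (\<mu> v))"
  have "\<mu> v < d" by fact
  then have "reach P V s R (flat A) 2 (s+2) ?R (flat A)"
    using straight_reach[OF Var.prems(1)[unfolded exp_code.simps], of V R "flat A" ?R "flat A"]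
      Var.prems(6) order.strict_trans1[OF Var.prems(3)[of v]]
    by (simp add: less_imp_le numeral_2_eq_2)
  moreover have "?R d = eval (Var v) (\<lambda>v. R (\<mu> v)) A" "\<forall>r<d. ?R r = R r" by simp_all
  ultimately show ?case unfolding exp_steps.simps exp_len.simps by blast
next
  case (Arr a e)
  from Arr.prems have loc: "located P s (exp_code \<mu> d s e)"
    "located P (s + exp_len e) (times32 d @ [Const (d+1) a, Add d d (d+1), Load d d])"
    by (auto simp: add.assoc)
  from Arr.IH[where R = R and \<mu> = \<mu> and B = B, OF loc(1) Arr.prems(2-4)] Arr.prems(5,6) obtain R1 where
    R1: "reach P V s R (flat A) (exp_steps e B) (s + exp_len e) R1 (flat A)"
      "R1 d = eval e (\<lambda>v. R (\<mu> v)) A" "\<forall>r<d. R1 r = R r" by auto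
  let ?R2 = "R1(d+1 := a, d := A a (R1 d))"
  have le: "R1 d \<le> exp_size e B"
    unfolding R1(2) using Arr.prems by (intro eval_le_exp_size) auto
  moreover have "A a (R1 d) \<le> B" by fact
  ultimately have "reach P V (s + exp_len e) R1 (flat A) 8 (s + exp_len e + 8) ?R2 (flat A)"
    using straight_reach[OF loc(2), of V R1 "flat A" ?R2 "flat A"] Arr.prems(5,6)
    by (simp add: straight_times32 fun_upd_twist)
  note step = reach_trans[OF R1(1) this]
  show ?case
    by (rule exI[of _ ?R2], intro conjI, rule reach_cast[OF step _ _ refl])
      (use R1(2,3) in \<open>auto simp: add.assoc\<close>)
next
  case (Cell e)
  from Cell.prems have loc: "located P s (exp_code \<mu> d s e)" "located P (s + exp_len e) [Load d d]"
    by auto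
  from Cell.IH[where R = R and \<mu> = \<mu> and B = B, OF loc(1) Cell.prems(2-4)] Cell.prems(5,6) obtain R1 where
    R1: "reach P V s R (flat A) (exp_steps e B) (s + exp_len e) R1 (flat A)"
      "R1 d = eval e (\<lambda>v. R (\<mu> v)) A" "\<forall>r<d. R1 r = R r" by auto
  let ?R2 = "R1(d := flat A (R1 d))"
  have le: "R1 d \<le> exp_size e B"
    unfolding R1(2) using Cell.prems by (intro eval_le_exp_size) auto
  moreover have "flat A (R1 d) \<le> B" using Cell.prems by (simp add: flat_def)
  ultimately have "reach P V (s + exp_len e) R1 (flat A) 1 (s + exp_len e + 1) ?R2 (flat A)"
    using straight_reach[OF loc(2), of V R1 "flat A" ?R2 "flat A"] Cell.prems(5,6) by simp
  note step = reach_trans[OF R1(1) this]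
  show ?case
    by (rule exI[of _ ?R2], intro conjI, rule reach_cast[OF step _ _ refl])
      (use R1(2,3) in \<open>auto simp: flat_def\<close>)
next
  case (Plus e f)
  from Plus.prems have loc: "located P s (exp_code \<mu> d s e)"
    "located P (s + exp_len e) (exp_code \<mu> (d+1) (s + exp_len e) f)"
    "located P (s + exp_len e + exp_len f) [Add d d (d+1)]" by auto
  from Plus.IH(1)[where R = R and \<mu> = \<mu> and B = B, OF loc(1) Plus.prems(2-4)] Plus.prems(5,6) obtain R1 where
    R1: "reach P V s R (flat A) (exp_steps e B) (s + exp_len e) R1 (flat A)"
      "R1 d = eval e (\<lambda>v. R (\<mu> v)) A" "\<forall>r<d. R1 r = R r" by auto
  have \<mu>: "(\<lambda>v. R1 (\<mu> v)) = (\<lambda>v. R (\<mu> v))" using R1(3) Plus.prems(2) by auto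
  from Plus.IH(2)[OF loc(2), of R1 B] Plus.prems R1(3) less_SucI obtain R2 where
    R2: "reach P V (s + exp_len e) R1 (flat A) (exp_steps f B) (s + exp_len e + exp_len f) R2 (flat A)"
      "R2 (d+1) = eval f (\<lambda>v. R (\<mu> v)) A" "\<forall>r<d+1. R2 r = R1 r" by (auto simp: \<mu>)
  have "R2 d \<le> exp_size e B" "R2 (d+1) \<le> exp_size f B"
    using R1(2) R2(2,3) Plus.prems by (auto intro!: eval_le_exp_size)
  then have "reach P V (s + exp_len e + exp_len f) R2 (flat A) 1 (s + exp_len e + exp_len f + 1)
      (R2(d := R2 d + R2 (d+1))) (flat A)"
    using straight_reach[OF loc(3), of V R2 "flat A" "R2(d := R2 d + R2 (d+1))" "flat A"] Plus.prems(6)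
    by simp
  note step = reach_trans[OF reach_trans[OF R1(1) R2(1)] this]
  show ?case
    by (rule exI[of _ "R2(d := R2 d + R2 (d+1))"], intro conjI, rule reach_cast[OF step _ _ refl])
      (use R1 R2 in \<open>auto simp: add.assoc\<close>)
next
  case (Minus e f)
  from Minus.prems have loc: "located P s (exp_code \<mu> d s e)"
    "located P (s + exp_len e) (exp_code \<mu> (d+1) (s + exp_len e) f)"
    "located P (s + exp_len e + exp_len f) [Sub d d (d+1)]" by auto
  from Minus.IH(1)[where R = R and \<mu> = \<mu> and B = B, OF loc(1) Minus.prems(2-4)] Minus.prems(5,6) obtain R1 where
    R1: "reach P V s R (flat A) (exp_steps e B) (s + exp_len e) R1 (flat A)"
      "R1 d = eval e (\<lambda>v. R (\<mu> v)) A" "\<forall>r<d. R1 r = R r" by auto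
  have \<mu>: "(\<lambda>v. R1 (\<mu> v)) = (\<lambda>v. R (\<mu> v))" using R1(3) Minus.prems(2) by auto
  from Minus.IH(2)[OF loc(2), of R1 B] Minus.prems R1(3) less_SucI obtain R2 where
    R2: "reach P V (s + exp_len e) R1 (flat A) (exp_steps f B) (s + exp_len e + exp_len f) R2 (flat A)"
      "R2 (d+1) = eval f (\<lambda>v. R (\<mu> v)) A" "\<forall>r<d+1. R2 r = R1 r" by (auto simp: \<mu>)
  have "R2 d \<le> exp_size e B" "R2 (d+1) \<le> exp_size f B"
    using R1(2) R2(2,3) Minus.prems by (auto intro!: eval_le_exp_size)
  then have "reach P V (s + exp_len e + exp_len f) R2 (flat A) 1 (s + exp_len e + exp_len f + 1)
      (R2(d := R2 d - R2 (d+1))) (flat A)"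
    using straight_reach[OF loc(3), of V R2 "flat A" "R2(d := R2 d - R2 (d+1))" "flat A"] Minus.prems(6)
    by simp
  note step = reach_trans[OF reach_trans[OF R1(1) R2(1)] this]
  show ?case
    by (rule exI[of _ "R2(d := R2 d - R2 (d+1))"], intro conjI, rule reach_cast[OF step _ _ refl])
      (use R1 R2 in \<open>auto simp: add.assoc\<close>)
next
  case (Times e f)
  from Times.prems have loc: "located P s (exp_code \<mu> d s e)"
    "located P (s + exp_len e) (loop d (s + exp_len e) (exp_code \<mu> (d+3) (s + exp_len e + 4) f))"
    "located P (s + exp_len e + exp_len f + 9) [Const (d+3) 0, Add d (d+2) (d+3)]" 
    by (auto simp: add.assoc)
  from Times.IH(1)[where R = R and \<mu> = \<mu> and B = B, OF loc(1) Times.prems(2-4)] Times.prems(5,6) obtain R1 where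
    R1: "reach P V s R (flat A) (exp_steps e B) (s + exp_len e) R1 (flat A)"
      "R1 d = eval e (\<lambda>v. R (\<mu> v)) A" "\<forall>r<d. R1 r = R r" by auto
  have e: "eval e (\<lambda>v. R (\<mu> v)) A \<le> exp_size e B" and f: "eval f (\<lambda>v. R (\<mu> v)) A \<le> exp_size f B"
    using Times.prems by (auto intro!: eval_le_exp_size)
  have ef: "eval e (\<lambda>v. R (\<mu> v)) A * eval f (\<lambda>v. R (\<mu> v)) A \<le> exp_size e B * exp_size f B"
    using e f by (rule mult_le_mono)
  have "\<exists>R'. reach P V (s + exp_len e) R1 (flat A) (4 + eval e (\<lambda>v. R (\<mu> v)) A * (exp_steps f B + 7))
        (s + exp_len e + length (exp_code \<mu> (d+3) (s + exp_len e + 4) f) + 9) R' (flat A) \<and>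
      R' (d+2) = (\<Sum>j<eval e (\<lambda>v. R (\<mu> v)) A. eval f (\<lambda>v. R (\<mu> v)) A) \<and> (\<forall>r\<le>d. R' r = R1 r)"
  proof (rule loop_reach[where R = R1, OF loc(2) R1(2), where ms = "\<lambda>_. flat A"])
    fix i R2
    assume *: "\<And>r. r \<le> d \<Longrightarrow> R2 r = R1 r"
    have \<mu>: "(\<lambda>v. R2 (\<mu> v)) = (\<lambda>v. R (\<mu> v))" using R1(3) Times.prems(2) * by (auto simp: less_imp_le)
    have "located P (s + exp_len e + 4) (exp_code \<mu> (d+3) (s + exp_len e + 4) f)"
      using located_loop(4)[OF loc(2)] .
    then have "\<exists>R3. reach P V (s + exp_len e + 4) R2 (flat A) (exp_steps f B)
        (s + exp_len e + 4 + exp_len f) R3 (flat A) \<and>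
        R3 (d+3) = eval f (\<lambda>v. R2 (\<mu> v)) A \<and> (\<forall>r<d+3. R3 r = R2 r)"
      by (rule Times.IH(2)[where \<mu> = \<mu> and R = R2])
        (use Times.prems fun_cong[OF \<mu>] in \<open>auto intro: trans_less_add1\<close>)
    then show "\<exists>R3. reach P V (s + exp_len e + 4) R2 (flat A) (exp_steps f B)
        (s + exp_len e + 4 + length (exp_code \<mu> (d + 3) (s + exp_len e + 4) f)) R3 (flat A) \<and>
        (\<forall>r<d + 3. R3 r = R2 r) \<and> R3 (d + 3) = eval f (\<lambda>v. R (\<mu> v)) A" by (auto simp: \<mu>)
  qed (use e f ef Times.prems(6) in auto)
  then obtain R2 where
    R2: "reach P V (s + exp_len e) R1 (flat A) (4 + eval e (\<lambda>v. R (\<mu> v)) A * (exp_steps f B + 7))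
        (s + exp_len e + exp_len f + 9) R2 (flat A)"
      "R2 (d+2) = eval e (\<lambda>v. R (\<mu> v)) A * eval f (\<lambda>v. R (\<mu> v)) A" "\<forall>r\<le>d. R2 r = R1 r" by auto
  let ?R3 = "R2(d+3 := 0, d := R2 (d+2))"
  have "reach P V (s + exp_len e + exp_len f + 9) R2 (flat A) 2 (s + exp_len e + exp_len f + 11) ?R3 (flat A)"
    using straight_reach[OF loc(3), of V R2 "flat A" ?R3 "flat A"] Times.prems(6) ef R2(2)
    by (simp add: eval_nat_numeral)
  from reach_trans[OF reach_trans[OF R1(1) R2(1)] this]
  have "reach P V s R (flat A) (exp_steps (Times e f) B) (s + exp_len e + exp_len f + 11) ?R3 (flat A)"
    by (rule reach_mono) (use e in simp)
  note step = this
  show ?case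
    by (rule exI[of _ ?R3], intro conjI, rule reach_cast[OF step _ _ refl])
      (use R1 R2 in \<open>auto simp: add.assoc\<close>)
next
  case (Rem e f)
  let ?l = "s + exp_len e + exp_len f"
  from Rem.prems have loc: "located P s (exp_code \<mu> d s e)"
    "located P (s + exp_len e) (exp_code \<mu> (d+1) (s + exp_len e) f)" by auto
  have loc': "located P ?l [Jz (d+1) (?l+8)]" "located P (?l+1) [Sub (d+2) (d+1) d]"
      "located P (?l+2) [Jz (d+2) (?l+5)]" "located P (?l+3) [Const (d+2) 0]"
      "located P (?l+4) [Jz (d+2) (?l+8)]" "located P (?l+5) [Sub d d (d+1), Const (d+2) 0]"
      "located P (?l+7) [Jz (d+2) ?l]"
    using Rem.prems(1) by (simp_all add: Let_def eval_nat_numeral)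
  from Rem.IH(1)[where R = R and \<mu> = \<mu> and B = B, OF loc(1) Rem.prems(2-4)] Rem.prems(5,6) obtain R1 where
    R1: "reach P V s R (flat A) (exp_steps e B) (s + exp_len e) R1 (flat A)"
      "R1 d = eval e (\<lambda>v. R (\<mu> v)) A" "\<forall>r<d. R1 r = R r" by auto
  have \<mu>: "(\<lambda>v. R1 (\<mu> v)) = (\<lambda>v. R (\<mu> v))" using R1(3) Rem.prems(2) by auto
  from Rem.IH(2)[OF loc(2), of R1 B] Rem.prems R1(3) less_SucI obtain R2 where
    R2: "reach P V (s + exp_len e) R1 (flat A) (exp_steps f B) (s + exp_len e + exp_len f) R2 (flat A)"
      "R2 (d+1) = eval f (\<lambda>v. R (\<mu> v)) A" "\<forall>r<d+1. R2 r = R1 r" by (auto simp: \<mu>)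
  have le: "R2 d \<le> exp_size e B" "R2 (d+1) \<le> exp_size f B"
    using R1(2) R2(2,3) Rem.prems by (auto intro!: eval_le_exp_size)
  obtain R3 where R3: "reach P V ?l R2 (flat A) (5 + 6 * R2 d) (?l+8) R3 (flat A)"
    "R3 d = R2 d mod R2 (d+1)" "\<forall>r<d. R3 r = R2 r"
    using rem_reach[OF loc', of R2 V "flat A"] le Rem.prems(6) by auto
  from reach_trans[OF reach_trans[OF R1(1) R2(1)] R3(1)]
  have "reach P V s R (flat A) (exp_steps (Rem e f) B) (?l+8) R3 (flat A)"
    by (rule reach_mono) (use le in simp)
  note step = this
  show ?case
    by (rule exI[of _ R3], intro conjI, rule reach_cast[OF step _ _ refl])
      (use R1 R2 R3 in \<open>auto simp: add.assoc\<close>)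
next
  case (Summ v e f)
  \<comment> \<open>The bound variable runs below the value of e, so inside the sum the variables
    are bounded only by this larger number.\<close>
  let ?B = "B + exp_size e B" and ?\<mu> = "\<mu>(v := d+1)"
  from Summ.prems have loc: "located P s (exp_code \<mu> d s e)"
    "located P (s + exp_len e) (loop d (s + exp_len e) (exp_code ?\<mu> (d+3) (s + exp_len e + 4) f))"
    "located P (s + exp_len e + exp_len f + 9) [Const (d+3) 0, Add d (d+2) (d+3)]" 
    by (auto simp: add.assoc)
  from Summ.IH(1)[where R = R and \<mu> = \<mu> and B = B, OF loc(1) Summ.prems(2-4)] Summ.prems(5,6) obtain R1 where
    R1: "reach P V s R (flat A) (exp_steps e B) (s + exp_len e) R1 (flat A)"
      "R1 d = eval e (\<lambda>v. R (\<mu> v)) A" "\<forall>r<d. R1 r = R r" by auto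
  let ?N = "eval e (\<lambda>v. R (\<mu> v)) A" and ?g = "\<lambda>i. eval f ((\<lambda>v. R (\<mu> v))(v := i)) A"
  have e: "?N \<le> exp_size e B"
    using Summ.prems by (auto intro!: eval_le_exp_size)
  have f: "?g i \<le> exp_size f ?B" if "i < ?N" for i
    using Summ.prems that e
    by (intro eval_le_exp_size) (auto intro: trans_le_add1)
  have "(\<Sum>i<?N. ?g i) \<le> of_nat (card {..<?N}) * exp_size f ?B"
    by (rule sum_bounded_above) (use f in auto)
  also have "\<dots> \<le> exp_size e B * exp_size f ?B" using e by simp
  finally have ef: "(\<Sum>i<?N. ?g i) \<le> exp_size e B * exp_size f ?B" .
  have "\<exists>R'. reach P V (s + exp_len e) R1 (flat A) (4 + ?N * (exp_steps f ?B + 7))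
        (s + exp_len e + length (exp_code ?\<mu> (d+3) (s + exp_len e + 4) f) + 9) R' (flat A) \<and>
      R' (d+2) = (\<Sum>j<?N. ?g j) \<and> (\<forall>r\<le>d. R' r = R1 r)"
  proof (rule loop_reach[where R = R1, OF loc(2) R1(2), where ms = "\<lambda>_. flat A"])
    fix i R2
    assume i: "i < ?N" and *: "\<And>r. r \<le> d \<Longrightarrow> R2 r = R1 r" "R2 (d+1) = i"
    have \<mu>: "(\<lambda>v. R2 (?\<mu> v)) = (\<lambda>v. R (\<mu> v))(v := i)"
      using R1(3) Summ.prems(2) * by (auto simp: less_imp_le)
    have l: "located P (s + exp_len e + 4) (exp_code ?\<mu> (d+3) (s + exp_len e + 4) f)"
      using located_loop(4)[OF loc(2)] .
    have "R2 (?\<mu> u) \<le> ?B" for u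
    proof -
      have "R2 (?\<mu> u) = ((\<lambda>v. R (\<mu> v))(v := i)) u" using fun_cong[OF \<mu>, of u] by simp
      with i e Summ.prems(3) show ?thesis by (auto intro: trans_le_add1)
    qed
    then have "\<exists>R3. reach P V (s + exp_len e + 4) R2 (flat A) (exp_steps f ?B)
        (s + exp_len e + 4 + exp_len f) R3 (flat A) \<and>
        R3 (d+3) = eval f (\<lambda>v. R2 (?\<mu> v)) A \<and> (\<forall>r<d+3. R3 r = R2 r)"
      by (intro Summ.IH(2)[where \<mu> = ?\<mu> and R = R2, OF l])
        (use Summ.prems in \<open>auto intro: trans_less_add1 trans_le_add1\<close>)
    then show "\<exists>R3. reach P V (s + exp_len e + 4) R2 (flat A) (exp_steps f ?B)
        (s + exp_len e + 4 + length (exp_code ?\<mu> (d + 3) (s + exp_len e + 4) f)) R3 (flat A) \<and>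
        (\<forall>r<d + 3. R3 r = R2 r) \<and> R3 (d + 3) = ?g i" unfolding \<mu> by auto
  next
    fix i
    assume "i < ?N"
    from f[OF this] Summ.prems(6) show "?g i \<le> V" by simp
  qed (use e ef Summ.prems(6) in auto)
  then obtain R2 where
    R2: "reach P V (s + exp_len e) R1 (flat A) (4 + ?N * (exp_steps f ?B + 7))
        (s + exp_len e + exp_len f + 9) R2 (flat A)"
      "R2 (d+2) = (\<Sum>j<?N. ?g j)" "\<forall>r\<le>d. R2 r = R1 r" by auto
  let ?R3 = "R2(d+3 := 0, d := R2 (d+2))"
  have "reach P V (s + exp_len e + exp_len f + 9) R2 (flat A) 2 (s + exp_len e + exp_len f + 11) ?R3 (flat A)"
    using straight_reach[OF loc(3), of V R2 "flat A" ?R3 "flat A"] Summ.prems(6) ef R2(2)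
    by (simp add: eval_nat_numeral)
  from reach_trans[OF reach_trans[OF R1(1) R2(1)] this]
  have "reach P V s R (flat A) (exp_steps (Summ v e f) B) (s + exp_len e + exp_len f + 11) ?R3 (flat A)"
    by (rule reach_mono) (use e in simp)
  note step = this
  show ?case
    by (rule exI[of _ ?R3], intro conjI, rule reach_cast[OF step _ _ refl])
      (use R1 R2 in \<open>auto simp: add.assoc\<close>)
qed

section \<open>Compilation of commands\<close>

fun com_len :: "com \<Rightarrow> nat" where
  "com_len (Assign a i e) = exp_len i + exp_len e + 10"
| "com_len (SetCell i e) = exp_len i + exp_len e + 3"
| "com_len (Seq c c') = com_len c + com_len c'"
| "com_len (Cond e c) = exp_len e + com_len c + 1"
| "com_len (For v e c) = exp_len e + com_len c + 10"

text \<open>Register 1 holds the bound at which stored values are cut off.\<close>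

fun com_code :: "(nat \<Rightarrow> nat) \<Rightarrow> nat \<Rightarrow> nat \<Rightarrow> com \<Rightarrow> instr list" where
  "com_code \<mu> d s (Assign a i e) =
     exp_code \<mu> d s i @ exp_code \<mu> (d+1) (s + exp_len i) e @ times32 d @
     [Const (d+2) a, Add d d (d+2), Sub (d+2) (d+1) 1, Sub (d+1) (d+1) (d+2), Store d (d+1)]"
| "com_code \<mu> d s (SetCell i e) =
     exp_code \<mu> d s i @ exp_code \<mu> (d+1) (s + exp_len i) e @
     [Sub (d+2) (d+1) 1, Sub (d+1) (d+1) (d+2), Store d (d+1)]"
| "com_code \<mu> d s (Seq c c') = com_code \<mu> d s c @ com_code \<mu> d (s + com_len c) c'"
| "com_code \<mu> d s (Cond e c) =
     exp_code \<mu> d s e @ [Jz d (s + exp_len e + 1 + com_len c)] @ com_code \<mu> d (s + exp_len e + 1) c"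
| "com_code \<mu> d s (For v e c) =
     exp_code \<mu> d s e @
     loop d (s + exp_len e) (com_code (\<mu>(v := d+1)) (d+3) (s + exp_len e + 4) c @ [Const (d+3) 0])"

lemma length_com_code [simp]: "length (com_code \<mu> d s c) = com_len c"
  by (induction c arbitrary: \<mu> d s) auto

fun com_size :: "com \<Rightarrow> nat \<Rightarrow> nat" where
  "com_size (Assign a i e) B = 32 * exp_size i B + exp_size e B + a + B"
| "com_size (SetCell i e) B = exp_size i B + exp_size e B + B"
| "com_size (Seq c c') B = com_size c B + com_size c' B"
| "com_size (Cond e c) B = exp_size e B + com_size c B"
| "com_size (For v e c) B = exp_size e B + com_size c (B + exp_size e B) + 1"

fun com_steps :: "com \<Rightarrow> nat \<Rightarrow> nat" where
  "com_steps (Assign a i e) B = exp_steps i B + exp_steps e B + 10"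
| "com_steps (SetCell i e) B = exp_steps i B + exp_steps e B + 3"
| "com_steps (Seq c c') B = com_steps c B + com_steps c' B"
| "com_steps (Cond e c) B = exp_steps e B + com_steps c B + 1"
| "com_steps (For v e c) B =
     exp_steps e B + 4 + exp_size e B * (com_steps c (B + exp_size e B) + 8)"

text \<open>This is the gain from the cut-off: the contents of the memory stay below q after any
  number of rounds, so \<open>com_size\<close> for a loop does not have to iterate the size of its
  body.\<close>

lemma sem_le:
  "(\<And>a i. A a i \<le> q) \<Longrightarrow> sem c q \<rho> A a i \<le> q"
proof (induction c arbitrary: \<rho> A a i)
  case (For v e c)
  have "fold (\<lambda>i. sem c q (\<rho>(v := i))) xs A a i \<le> q" for xs
    using For.prems
  proof (induction xs arbitrary: A)
    case (Cons x xs)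
    show ?case unfolding fold_Cons comp_apply
      by (rule Cons.IH, rule For.IH) (rule Cons.prems)
  qed auto
  then show ?case by simp
qed auto

lemma com_reach:
  "located P s (com_code \<mu> d s c) \<Longrightarrow> (\<And>v. \<mu> v < d) \<Longrightarrow> (\<And>v. R (\<mu> v) \<le> B) \<Longrightarrow>
   (\<And>a i. A a i \<le> q) \<Longrightarrow> 1 < d \<Longrightarrow> R 1 = q \<Longrightarrow> q \<le> B \<Longrightarrow> wf_com c \<Longrightarrow> com_size c B < V \<Longrightarrow>
   \<exists>R'. reach P V s R (flat A) (com_steps c B) (s + com_len c) R' (flat (sem c q (\<lambda>v. R (\<mu> v)) A)) \<and>
     (\<forall>r<d. R' r = R r)"
proof (induction c arbitrary: \<mu> d s R B A)
  case (Assign a i e)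
  have AB: "\<And>a i. A a i \<le> B" using Assign.prems(4,7) order_trans by blast
  from Assign.prems have loc: "located P s (exp_code \<mu> d s i)"
    "located P (s + exp_len i) (exp_code \<mu> (d+1) (s + exp_len i) e)"
    "located P (s + exp_len i + exp_len e) (times32 d @
      [Const (d+2) a, Add d d (d+2), Sub (d+2) (d+1) 1, Sub (d+1) (d+1) (d+2), Store d (d+1)])"
    by (auto simp: add.assoc)
  from exp_reach[where A = A and V = V and R = R and \<mu> = \<mu> and B = B, OF loc(1) Assign.prems(2,3) AB] Assign.prems(8,9) obtain R1 where
    R1: "reach P V s R (flat A) (exp_steps i B) (s + exp_len i) R1 (flat A)"
      "R1 d = eval i (\<lambda>v. R (\<mu> v)) A" "\<forall>r<d. R1 r = R r" by auto
  have \<mu>: "(\<lambda>v. R1 (\<mu> v)) = (\<lambda>v. R (\<mu> v))" using R1(3) Assign.prems(2) by auto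
  from exp_reach[OF loc(2), of R1 B A V] Assign.prems AB R1(3) less_SucI obtain R2 where
    R2: "reach P V (s + exp_len i) R1 (flat A) (exp_steps e B) (s + exp_len i + exp_len e) R2 (flat A)"
      "R2 (d+1) = eval e (\<lambda>v. R (\<mu> v)) A" "\<forall>r<d+1. R2 r = R1 r" by (auto simp: \<mu>)
  have le: "R2 d \<le> exp_size i B" "R2 (d+1) \<le> exp_size e B" "R2 1 = q"
    using R1 R2(2,3) Assign.prems AB by (auto intro!: eval_le_exp_size)
  let ?A = "sem (Assign a i e) q (\<lambda>v. R (\<mu> v)) A"
  \<comment> \<open>With truncated subtraction, x - (x - q) is the minimum of x and q.\<close>
  let ?x = "min (R2 (d+1)) q"
  let ?R3 = "R2(d := 32 * R2 d + a, d+2 := R2 (d+1) - q, d+1 := ?x)"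
  have d: "d \<noteq> 1" "d \<noteq> 0" using Assign.prems(5) by auto
  have "straight V (times32 d @
      [Const (d+2) a, Add d d (d+2), Sub (d+2) (d+1) 1, Sub (d+1) (d+1) (d+2), Store d (d+1)]) R2 (flat A)
      ?R3 ((flat A)(32 * R2 d + a := ?x))"
    using Assign.prems(7,9) le d
    by (auto simp add: straight_times32 fun_upd_twist min_def)
  moreover have "(flat A)(32 * R2 d + a := ?x) = flat ?A"
    using flat_upd[of a A "R2 d" ?x] Assign.prems(8) R1(2) R2(2,3) by simp
  ultimately have "reach P V (s + exp_len i + exp_len e) R2 (flat A) 10 (s + exp_len i + exp_len e + 10) ?R3 (flat ?A)"
    using straight_reach[OF loc(3), of V R2 "flat A" ?R3 "flat ?A"] by simp
  note step = reach_trans[OF reach_trans[OF R1(1) R2(1)] this]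
  show ?case
    by (rule exI[of _ ?R3], intro conjI, rule reach_cast[OF step _ _ refl])
      (use R1 R2 in \<open>auto simp: add.assoc\<close>)
next
  case (SetCell i e)
  have AB: "\<And>a i. A a i \<le> B" using SetCell.prems(4,7) order_trans by blast
  from SetCell.prems have loc: "located P s (exp_code \<mu> d s i)"
    "located P (s + exp_len i) (exp_code \<mu> (d+1) (s + exp_len i) e)"
    "located P (s + exp_len i + exp_len e)
      [Sub (d+2) (d+1) 1, Sub (d+1) (d+1) (d+2), Store d (d+1)]"
    by (auto simp: add.assoc)
  from exp_reach[where A = A and V = V and R = R and \<mu> = \<mu> and B = B, OF loc(1) SetCell.prems(2,3) AB] SetCell.prems(8,9) obtain R1 where
    R1: "reach P V s R (flat A) (exp_steps i B) (s + exp_len i) R1 (flat A)"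
      "R1 d = eval i (\<lambda>v. R (\<mu> v)) A" "\<forall>r<d. R1 r = R r" by auto
  have \<mu>: "(\<lambda>v. R1 (\<mu> v)) = (\<lambda>v. R (\<mu> v))" using R1(3) SetCell.prems(2) by auto
  from exp_reach[OF loc(2), of R1 B A V] SetCell.prems AB R1(3) less_SucI obtain R2 where
    R2: "reach P V (s + exp_len i) R1 (flat A) (exp_steps e B) (s + exp_len i + exp_len e) R2 (flat A)"
      "R2 (d+1) = eval e (\<lambda>v. R (\<mu> v)) A" "\<forall>r<d+1. R2 r = R1 r" by (auto simp: \<mu>)
  have le: "R2 d \<le> exp_size i B" "R2 (d+1) \<le> exp_size e B" "R2 1 = q"
    using R1 R2(2,3) SetCell.prems AB by (auto intro!: eval_le_exp_size)
  let ?A = "sem (SetCell i e) q (\<lambda>v. R (\<mu> v)) A"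
  let ?x = "min (R2 (d+1)) q"
  let ?R3 = "R2(d+2 := R2 (d+1) - q, d+1 := ?x)"
  have d: "d \<noteq> 1" "d \<noteq> 0" using SetCell.prems(5) by auto
  have "straight V [Sub (d+2) (d+1) 1, Sub (d+1) (d+1) (d+2), Store d (d+1)] R2 (flat A)
      ?R3 ((flat A)(R2 d := ?x))"
    using SetCell.prems(7,9) le d
    by (simp add: min_def) (intro impI, linarith) 
  moreover have "(flat A)(R2 d := ?x) = flat ?A"
    using flat_upd_cell[of A "R2 d" ?x] R1(2) R2(2,3) by simp
  ultimately have "reach P V (s + exp_len i + exp_len e) R2 (flat A) 3 (s + exp_len i + exp_len e + 3) ?R3 (flat ?A)"
    using straight_reach[OF loc(3), of V R2 "flat A" ?R3 "flat ?A"]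
    by (simp add: numeral_3_eq_3 del: sem.simps)
  note step = reach_trans[OF reach_trans[OF R1(1) R2(1)] this]
  show ?case
    by (rule exI[of _ ?R3], intro conjI, rule reach_cast[OF step _ _ refl])
      (use R1 R2 in \<open>auto simp: add.assoc\<close>)
next
  case (Seq c c')
  from Seq.prems have loc: "located P s (com_code \<mu> d s c)"
    "located P (s + com_len c) (com_code \<mu> d (s + com_len c) c')" by auto
  from Seq.IH(1)[where \<mu> = \<mu> and R = R and A = A, OF loc(1) Seq.prems(2-7)] Seq.prems(8,9) obtain R1 where
    R1: "reach P V s R (flat A) (com_steps c B) (s + com_len c) R1 (flat (sem c q (\<lambda>v. R (\<mu> v)) A))"
      "\<forall>r<d. R1 r = R r" by auto
  have \<mu>: "(\<lambda>v. R1 (\<mu> v)) = (\<lambda>v. R (\<mu> v))" using R1(2) Seq.prems(2) by auto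
  have "\<exists>R'. reach P V (s + com_len c) R1 (flat (sem c q (\<lambda>v. R (\<mu> v)) A)) (com_steps c' B)
      (s + com_len c + com_len c') R' (flat (sem c' q (\<lambda>v. R1 (\<mu> v)) (sem c q (\<lambda>v. R (\<mu> v)) A))) \<and>
     (\<forall>r<d. R' r = R1 r)"
    by (rule Seq.IH(2)[where \<mu> = \<mu> and R = R1, OF loc(2) Seq.prems(2)]) (use Seq.prems R1(2) sem_le in auto)
  then obtain R2 where
    R2: "reach P V (s + com_len c) R1 (flat (sem c q (\<lambda>v. R (\<mu> v)) A)) (com_steps c' B)
      (s + com_len c + com_len c') R2 (flat (sem c' q (\<lambda>v. R (\<mu> v)) (sem c q (\<lambda>v. R (\<mu> v)) A)))"
     "\<forall>r<d. R2 r = R1 r" unfolding \<mu> by blast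
  note step = reach_trans[OF R1(1) R2(1)]
  show ?case
    by (rule exI[of _ R2], intro conjI, rule reach_cast[OF step])
      (use R1(2) R2(2) in \<open>auto simp: add.assoc\<close>)
next
  case (Cond e c)
  have AB: "\<And>a i. A a i \<le> B" using Cond.prems(4,7) order_trans by blast
  from Cond.prems have loc: "located P s (exp_code \<mu> d s e)"
    "located P (s + exp_len e) [Jz d (s + exp_len e + 1 + com_len c)]"
    "located P (s + exp_len e + 1) (com_code \<mu> d (s + exp_len e + 1) c)" by auto
  from exp_reach[where A = A and V = V and R = R and \<mu> = \<mu> and B = B, OF loc(1) Cond.prems(2,3) AB] Cond.prems(8,9) obtain R1 where
    R1: "reach P V s R (flat A) (exp_steps e B) (s + exp_len e) R1 (flat A)"
      "R1 d = eval e (\<lambda>v. R (\<mu> v)) A" "\<forall>r<d. R1 r = R r" by auto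
  have \<mu>: "(\<lambda>v. R1 (\<mu> v)) = (\<lambda>v. R (\<mu> v))" using R1(3) Cond.prems(2) by auto
  have "R1 d \<le> exp_size e B" unfolding R1(2) using Cond.prems AB by (intro eval_le_exp_size) auto
  then have j: "reach P V (s + exp_len e) R1 (flat A) 1
      (if R1 d = 0 then s + exp_len e + 1 + com_len c else s + exp_len e + 1) R1 (flat A)"
    by (intro reach_Jz loc(2)) (use Cond.prems(9) in auto)
  show ?case
  proof (cases "R1 d = 0")
    case True
    with j reach_trans[OF R1(1), of 1 "s + exp_len e + 1 + com_len c" R1 "flat A"]
    have "reach P V s R (flat A) (exp_steps e B + 1) (s + exp_len e + 1 + com_len c) R1 (flat A)" by simp
    then have "reach P V s R (flat A) (com_steps (Cond e c) B) (s + exp_len e + 1 + com_len c) R1 (flat A)"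
      by (rule reach_mono) simp
    moreover from True R1(2) have "sem (Cond e c) q (\<lambda>v. R (\<mu> v)) A = A" by simp
    ultimately show ?thesis using R1(3) by (auto simp: ac_simps)
  next
    case False
    have "\<exists>R'. reach P V (s + exp_len e + 1) R1 (flat A) (com_steps c B)
        (s + exp_len e + 1 + com_len c) R' (flat (sem c q (\<lambda>v. R1 (\<mu> v)) A)) \<and> (\<forall>r<d. R' r = R1 r)"
      by (rule Cond.IH[where \<mu> = \<mu> and R = R1, OF loc(3) Cond.prems(2)]) (use Cond.prems R1(3) in auto)
    then obtain R2 where R2: "reach P V (s + exp_len e + 1) R1 (flat A) (com_steps c B)
        (s + exp_len e + 1 + com_len c) R2 (flat (sem c q (\<lambda>v. R (\<mu> v)) A))" "\<forall>r<d. R2 r = R1 r"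
      unfolding \<mu> by blast
    from j False have "reach P V (s + exp_len e) R1 (flat A) 1 (s + exp_len e + 1) R1 (flat A)" by simp
    note step = reach_trans[OF reach_trans[OF R1(1) this] R2(1)]
    from False R1(2) have "sem (Cond e c) q (\<lambda>v. R (\<mu> v)) A = sem c q (\<lambda>v. R (\<mu> v)) A" by simp
    then show ?thesis
      by (intro exI[of _ R2] conjI reach_cast[OF step]) (use R1(3) R2(2) in auto)
  qed
next
  case (For v e c)
  let ?B = "B + exp_size e B" and ?\<mu> = "\<mu>(v := d+1)"
  \<comment> \<open>The appended constant makes every summand of the loop zero.\<close>
  let ?body = "com_code ?\<mu> (d+3) (s + exp_len e + 4) c @ [Const (d+3) 0]"
  have AB: "\<And>a i. A a i \<le> B" using For.prems(4,7) order_trans by blast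
  from For.prems have loc: "located P s (exp_code \<mu> d s e)"
    "located P (s + exp_len e) (loop d (s + exp_len e) ?body)" by auto
  from exp_reach[where A = A and V = V and R = R and \<mu> = \<mu> and B = B, OF loc(1) For.prems(2,3) AB] For.prems(8,9) obtain R1 where
    R1: "reach P V s R (flat A) (exp_steps e B) (s + exp_len e) R1 (flat A)"
      "R1 d = eval e (\<lambda>v. R (\<mu> v)) A" "\<forall>r<d. R1 r = R r" by auto
  let ?N = "eval e (\<lambda>v. R (\<mu> v)) A"
  define As where "As i = fold (\<lambda>i. sem c q ((\<lambda>v. R (\<mu> v))(v := i))) [0..<i] A" for i
  have AsS: "As (Suc i) = sem c q ((\<lambda>v. R (\<mu> v))(v := i)) (As i)" for i by (simp add: As_def)
  have As_le: "As i a j \<le> q" for i a j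
  proof (induction i arbitrary: a j)
    case (Suc i)
    then show ?case unfolding AsS by (intro sem_le)
  qed (use For.prems(4) in \<open>simp add: As_def\<close>)
  have e: "?N \<le> exp_size e B"
    using For.prems AB by (auto intro!: eval_le_exp_size)
  have "\<exists>R'. reach P V (s + exp_len e) R1 (flat (As 0)) (4 + ?N * ((com_steps c ?B + 1) + 7))
        (s + exp_len e + length ?body + 9) R' (flat (As ?N)) \<and>
      R' (d+2) = (\<Sum>j<?N. 0) \<and> (\<forall>r\<le>d. R' r = R1 r)"
  proof (rule loop_reach[where R = R1, OF loc(2) R1(2), where ms = "\<lambda>i. flat (As i)"])
    fix i R2
    assume i: "i < ?N" and *: "\<And>r. r \<le> d \<Longrightarrow> R2 r = R1 r" "R2 (d+1) = i"
    have \<mu>: "(\<lambda>v. R2 (?\<mu> v)) = (\<lambda>v. R (\<mu> v))(v := i)"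
      using R1(3) For.prems(2) * by (auto simp: less_imp_le)
    have l: "located P (s + exp_len e + 4) (com_code ?\<mu> (d+3) (s + exp_len e + 4) c)"
      "located P (s + exp_len e + 4 + com_len c) [Const (d+3) 0]"
      using located_loop(4)[OF loc(2)] unfolding located_append by auto
    have R2B: "R2 (?\<mu> u) \<le> ?B" for u
    proof -
      have "R2 (?\<mu> u) = ((\<lambda>v. R (\<mu> v))(v := i)) u" using fun_cong[OF \<mu>, of u] by simp
      with i e For.prems(3) show ?thesis by (auto intro: trans_le_add1)
    qed
    have "\<exists>R'. reach P V (s + exp_len e + 4) R2 (flat (As i)) (com_steps c ?B)
        (s + exp_len e + 4 + com_len c) R' (flat (sem c q (\<lambda>v. R2 (?\<mu> v)) (As i))) \<and> (\<forall>r<d+3. R' r = R2 r)"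
      by (rule For.IH[where \<mu> = ?\<mu> and R = R2, OF l(1)])
        (use For.prems R1(3) * R2B As_le in \<open>auto intro: trans_less_add1 trans_le_add1\<close>)
    then obtain R3 where R3: "reach P V (s + exp_len e + 4) R2 (flat (As i)) (com_steps c ?B)
        (s + exp_len e + 4 + com_len c) R3 (flat (As (Suc i)))" "\<forall>r<d+3. R3 r = R2 r"
      unfolding \<mu> AsS by blast
    have "reach P V (s + exp_len e + 4 + com_len c) R3 (flat (As (Suc i))) 1
        (s + exp_len e + 4 + com_len c + 1) (R3(d+3 := 0)) (flat (As (Suc i)))"
      using straight_reach[OF l(2), of V R3 "flat (As (Suc i))" "R3(d+3 := 0)" "flat (As (Suc i))"] by simp
    note step = reach_trans[OF R3(1) this]
    show "\<exists>R3. reach P V (s + exp_len e + 4) R2 (flat (As i)) (com_steps c ?B + 1)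
        (s + exp_len e + 4 + length ?body) R3 (flat (As (Suc i))) \<and>
        (\<forall>r<d + 3. R3 r = R2 r) \<and> R3 (d + 3) = 0"
      by (rule exI[of _ "R3(d+3 := 0)"], intro conjI, rule reach_cast[OF step _ _ refl])
        (use R3(2) in \<open>auto simp: add.assoc\<close>)
  qed (use e For.prems(9) in \<open>auto intro: order_trans\<close>)
  then obtain R2 where
    R2: "reach P V (s + exp_len e) R1 (flat A) (4 + ?N * (com_steps c ?B + 8))
        (s + exp_len e + com_len c + 10) R2 (flat (As ?N))" "\<forall>r\<le>d. R2 r = R1 r"
    by (auto simp: As_def[of 0] ac_simps)
  from reach_trans[OF R1(1) R2(1)]
  have "reach P V s R (flat A) (com_steps (For v e c) B) (s + exp_len e + com_len c + 10) R2 (flat (As ?N))"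
    by (rule reach_mono) (use e in simp)
  note step = this
  show ?case
    by (rule exI[of _ R2], intro conjI, rule reach_cast[OF step])
      (use R1 R2 in \<open>auto simp: add.assoc As_def\<close>)
qed

text \<open>From B = 2 on every constant lies below a power of B, so a single exponent expresses a
  polynomial bound.\<close>

definition poly_bounded :: "(nat \<Rightarrow> nat) \<Rightarrow> bool" where
  "poly_bounded f \<longleftrightarrow> (\<exists>K. \<forall>B\<ge>2. f B \<le> B ^ K)"

lemma poly_bounded_const: "poly_bounded (\<lambda>_. k)"
proof -
  have "k \<le> B ^ k" if "2 \<le> B" for B :: nat
    using less_exp[of k] power_mono[OF that, of k] by linarith
  then show ?thesis unfolding poly_bounded_def by blast
qed

lemma poly_bounded_id: "poly_bounded (\<lambda>B. B)"
  unfolding poly_bounded_def by (rule exI[of _ 1]) simp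

lemma poly_bounded_add:
  assumes "poly_bounded f" "poly_bounded g"
  shows "poly_bounded (\<lambda>B. f B + g B)"
proof -
  from assms obtain K L where K: "\<forall>B\<ge>2. f B \<le> B ^ K" and L: "\<forall>B\<ge>2. g B \<le> B ^ L"
    unfolding poly_bounded_def by blast
  have "f B + g B \<le> B ^ (K + L + 1)" if "2 \<le> B" for B
  proof -
    have "f B \<le> B ^ (K + L)" "g B \<le> B ^ (K + L)"
      using K L that by (meson le_add1 le_add2 one_le_numeral order_trans power_increasing)+
    then have "f B + g B \<le> 2 * B ^ (K + L)" by simp
    also have "\<dots> \<le> B * B ^ (K + L)" using that by (rule mult_le_mono1)
    finally show ?thesis by simp
  qed
  then show ?thesis unfolding poly_bounded_def by blast
qed

lemma poly_bounded_mult: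
  assumes "poly_bounded f" "poly_bounded g"
  shows "poly_bounded (\<lambda>B. f B * g B)"
proof -
  from assms obtain K L where K: "\<forall>B\<ge>2. f B \<le> B ^ K" and L: "\<forall>B\<ge>2. g B \<le> B ^ L"
    unfolding poly_bounded_def by blast
  then have "\<forall>B\<ge>2. f B * g B \<le> B ^ (K + L)" by (auto simp: power_add intro: mult_le_mono)
  then show ?thesis unfolding poly_bounded_def by blast
qed

text \<open>The argument has the form of the enlarged bound under a bound variable or a loop
  counter.\<close>

lemma poly_bounded_comp:
  assumes "poly_bounded f" "poly_bounded g"
  shows "poly_bounded (\<lambda>B. f (B + g B))"
proof -
  from assms obtain K where K: "\<forall>B\<ge>2. f B \<le> B ^ K"
    unfolding poly_bounded_def by blast
  from poly_bounded_add[OF poly_bounded_id assms(2)] obtain L where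
    L: "\<forall>B\<ge>2. B + g B \<le> B ^ L" unfolding poly_bounded_def by blast
  have "f (B + g B) \<le> B ^ (L * K)" if "2 \<le> B" for B
  proof -
    have "f (B + g B) \<le> (B + g B) ^ K" using K that by simp
    also have "\<dots> \<le> (B ^ L) ^ K" using L that by (intro power_mono) auto
    finally show ?thesis by (simp add: power_mult)
  qed
  then show ?thesis unfolding poly_bounded_def by blast
qed

lemma poly_bounded_Suc: "poly_bounded f \<Longrightarrow> poly_bounded (\<lambda>B. Suc (f B))"
  using poly_bounded_add[OF poly_bounded_const[of 1]] by simp

lemmas poly_bounded_intros =
  poly_bounded_const poly_bounded_id poly_bounded_Suc poly_bounded_add poly_bounded_mult

lemma poly_bounded_exp_size: "poly_bounded (exp_size e)"
  by (induction e) (simp_all add: poly_bounded_intros poly_bounded_comp)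

lemma poly_bounded_exp_steps: "poly_bounded (exp_steps e)"
  by (induction e)
    (simp_all add: poly_bounded_intros poly_bounded_exp_size poly_bounded_comp)

lemma poly_bounded_com_size: "poly_bounded (com_size c)"
  by (induction c) (simp_all add: poly_bounded_intros poly_bounded_exp_size poly_bounded_comp)

lemma poly_bounded_com_steps: "poly_bounded (com_steps c)"
  by (induction c)
    (simp_all add: poly_bounded_intros poly_bounded_exp_size poly_bounded_exp_steps poly_bounded_comp)

text \<open>The outer loop is a jump back to a test and not a \<open>For\<close>, because its number
  of rounds is not polynomially bounded. Register 0 keeps the order n, register 1 receives the
  cut-off value, and all code works from register 2 on.\<close>

definition program :: "exp \<Rightarrow> com \<Rightarrow> exp \<Rightarrow> com \<Rightarrow> com \<Rightarrow> instr list" where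
  "program cap init e body final =
     (let \<mu> = \<lambda>_. 0; s1 = exp_len cap; s2 = s1 + com_len init; s3 = s2 + exp_len e + 1;
          s4 = s3 + com_len body + 2
      in exp_code \<mu> 1 0 cap @ com_code \<mu> 2 s1 init @ exp_code \<mu> 2 s2 e @ [Jz 2 s4] @
         com_code \<mu> 2 s3 body @ [Const 2 0] @ [Jz 2 s2] @ com_code \<mu> 2 s4 final)"

text \<open>The exponent K comes from the syntax of the program alone. It is chosen before the
  table, hence it serves all orders and all primes.\<close>

theorem program_run:
  assumes wf: "wf_exp cap" "wf_com init" "wf_exp e" "wf_com body" "wf_com final"
  shows "\<exists>K. \<forall>T A q \<rho> J.
    A = (\<lambda>a i. mem (input_config T) (32 * i + a)) \<longrightarrow> \<rho> = (\<lambda>_. length T) \<longrightarrow> q = eval cap \<rho> A \<longrightarrow>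
    (\<forall>j. mem (input_config T) j \<le> q) \<longrightarrow> length T \<le> q \<longrightarrow>
    (\<forall>j<J. eval e \<rho> ((sem body q \<rho> ^^ j) (sem init q \<rho> A)) \<noteq> 0) \<longrightarrow>
    eval e \<rho> ((sem body q \<rho> ^^ J) (sem init q \<rho> A)) = 0 \<longrightarrow>
    (\<exists>t c. exec (program cap init e body final) (input_config T) t c \<and> reg c 0 = length T \<and>
       mem c = flat (sem final q \<rho> ((sem body q \<rho> ^^ J) (sem init q \<rho> A))) \<and>
       t \<le> (J + 1) * (q + 2) ^ K)"
proof -
  define S where "S B = exp_steps cap B + com_steps init B + exp_steps e B + com_steps body B +
    com_steps final B + 3" for B
  define W where "W B = exp_size cap B + com_size init B + exp_size e B + com_size body B +
    com_size final B + 1" for B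
  have "poly_bounded (\<lambda>B. S B * (2 * W B + 1))"
    unfolding S_def W_def
    by (intro poly_bounded_intros poly_bounded_exp_size poly_bounded_exp_steps poly_bounded_com_size
      poly_bounded_com_steps)
  then obtain K where K: "S B * (2 * W B + 1) \<le> B ^ K" if "2 \<le> B" for B
    unfolding poly_bounded_def by blast
  let ?\<mu> = "\<lambda>_::nat. 0::nat"
  define s1 where "s1 = exp_len cap"
  define s2 where "s2 = s1 + com_len init"
  define s3 where "s3 = s2 + exp_len e + 1"
  define s4 where "s4 = s3 + com_len body + 2"
  define P where "P = program cap init e body final"
  have P: "P = exp_code ?\<mu> 1 0 cap @ com_code ?\<mu> 2 s1 init @ exp_code ?\<mu> 2 s2 e @ [Jz 2 s4] @
         com_code ?\<mu> 2 s3 body @ [Const 2 0] @ [Jz 2 s2] @ com_code ?\<mu> 2 s4 final"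
    unfolding P_def program_def Let_def s1_def s2_def s3_def s4_def ..
  have lenP: "length P = s4 + com_len final"
    unfolding P by (simp add: s1_def s2_def s3_def s4_def)
  have "located P (length ([] :: instr list)) P" by (rule located_infix[where ys = "[]"]) simp
  then have "located P 0 (exp_code ?\<mu> 1 0 cap @ com_code ?\<mu> 2 s1 init @ exp_code ?\<mu> 2 s2 e @ [Jz 2 s4] @
         com_code ?\<mu> 2 s3 body @ [Const 2 0] @ [Jz 2 s2] @ com_code ?\<mu> 2 s4 final)"
    by (subst (asm) (2) P) simp
  then have loc: "located P 0 (exp_code ?\<mu> 1 0 cap)" "located P s1 (com_code ?\<mu> 2 s1 init)"
    "located P s2 (exp_code ?\<mu> 2 s2 e)" "located P (s2 + exp_len e) [Jz 2 s4]"
    "located P s3 (com_code ?\<mu> 2 s3 body)" "located P (s3 + com_len body) [Const 2 0]"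
    "located P (s3 + com_len body + 1) [Jz 2 s2]" "located P s4 (com_code ?\<mu> 2 s4 final)"
    unfolding located_append by (simp_all add: s1_def s2_def s3_def s4_def add.assoc)
  have "\<exists>t c. exec P (input_config T) t c \<and> reg c 0 = length T \<and>
       mem c = flat (sem final q \<rho> ((sem body q \<rho> ^^ J) (sem init q \<rho> A))) \<and>
       t \<le> (J + 1) * (q + 2) ^ K"
    if A: "A = (\<lambda>a i. mem (input_config T) (32 * i + a))" and \<rho>: "\<rho> = (\<lambda>_. length T)"
      and q: "q = eval cap \<rho> A" and cells: "\<forall>j. mem (input_config T) j \<le> q" and n: "length T \<le> q"
      and pos: "\<forall>j<J. eval e \<rho> ((sem body q \<rho> ^^ j) (sem init q \<rho> A)) \<noteq> 0"
      and zero: "eval e \<rho> ((sem body q \<rho> ^^ J) (sem init q \<rho> A)) = 0"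
    for T A q \<rho> J
  proof -
    \<comment> \<open>The summand 2 provides the hypothesis 2 \<le> B of polynomial bounds.\<close>
    define B where "B = q + 2"
    define V where "V = W B"
    define As where "As j = (sem body q \<rho> ^^ j) (sem init q \<rho> A)" for j
    have AsS: "As (Suc j) = sem body q \<rho> (As j)" for j by (simp add: As_def)
    have A_le: "A a i \<le> q" for a i using cells by (simp add: A)
    have As_le: "As j a i \<le> q" for j a i
    proof (induction j arbitrary: a i)
      case 0
      then show ?case using A_le by (simp add: As_def sem_le)
    qed (simp add: AsS sem_le)
    have le_B: "q \<le> B" "\<And>a i. A a i \<le> B" "\<And>j a i. As j a i \<le> B" "length T \<le> B"
      using A_le As_le n trans_le_add1 unfolding B_def by blast+
    have size: "exp_size cap B < V" "com_size init B < V" "exp_size e B < V" "com_size body B < V"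
      "com_size final B < V" by (simp_all add: V_def W_def)
    let ?R0 = "(\<lambda>_. 0)(0 := length T)"
    have \<rho>': "(\<lambda>v. R (?\<mu> v)) = \<rho>" if "R 0 = length T" for R
      using that \<rho> by simp
    have flatA: "flat A = mem (input_config T)" by (simp add: A flat_def fun_eq_iff)
    have "\<exists>R'. reach P V 0 ?R0 (flat A) (exp_steps cap B) (0 + exp_len cap) R' (flat A) \<and>
        R' 1 = eval cap (\<lambda>v. ?R0 (?\<mu> v)) A \<and> (\<forall>r<1. R' r = ?R0 r)"
      by (rule exp_reach[OF loc(1)]) (use le_B size wf in auto)
    then obtain R1 where R1: "reach P V 0 ?R0 (flat A) (exp_steps cap B) s1 R1 (flat A)"
      "R1 1 = q" "R1 0 = length T" by (auto simp: q s1_def \<rho>)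
    have "\<exists>R'. reach P V s1 R1 (flat A) (com_steps init B) (s1 + com_len init) R'
        (flat (sem init q (\<lambda>v. R1 (?\<mu> v)) A)) \<and> (\<forall>r<2. R' r = R1 r)"
      by (rule com_reach[OF loc(2)]) (use le_B A_le size wf R1 in auto)
    then obtain R2 where R2: "reach P V s1 R1 (flat A) (com_steps init B) s2 R2 (flat (As 0))"
      "R2 1 = q" "R2 0 = length T"
      using R1(2,3) unfolding \<rho>'[of R1, OF R1(3)] s2_def As_def[of 0] by auto
    have test: "\<exists>R'. reach P V s2 R (flat (As j)) (exp_steps e B + 1)
        (if eval e \<rho> (As j) = 0 then s4 else s3) R' (flat (As j)) \<and> R' 0 = length T \<and> R' 1 = q"
      if R: "R 0 = length T" "R 1 = q" for R j
    proof -
      have "\<exists>R'. reach P V s2 R (flat (As j)) (exp_steps e B) (s2 + exp_len e) R' (flat (As j)) \<and>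
          R' 2 = eval e (\<lambda>v. R (?\<mu> v)) (As j) \<and> (\<forall>r<2. R' r = R r)"
        by (rule exp_reach[OF loc(3)]) (use le_B size wf R in auto)
      then obtain R' where
        R': "reach P V s2 R (flat (As j)) (exp_steps e B) (s2 + exp_len e) R' (flat (As j))"
          "R' 2 = eval e \<rho> (As j)" "R' 0 = length T" "R' 1 = q"
        using R unfolding \<rho>'[of R, OF R(1)] by auto
      have "eval e \<rho> (As j) \<le> exp_size e B"
        by (rule eval_le_exp_size) (use le_B \<rho> in auto)
      then have "reach P V (s2 + exp_len e) R' (flat (As j)) 1
          (if R' 2 = 0 then s4 else s2 + exp_len e + 1) R' (flat (As j))"
        by (intro reach_Jz loc(4)) (use size R'(2) in auto)
      from reach_trans[OF R'(1) this] R' show ?thesis by (auto simp: s3_def)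
    qed
    have iter: "\<exists>R'. reach P V s2 R (flat (As j)) (exp_steps e B + 1 + com_steps body B + 2) s2 R'
        (flat (As (Suc j))) \<and> R' 0 = length T \<and> R' 1 = q"
      if R: "R 0 = length T" "R 1 = q" and "eval e \<rho> (As j) \<noteq> 0" for R j
    proof -
      from test[OF R, of j] that(3) obtain R' where
        R': "reach P V s2 R (flat (As j)) (exp_steps e B + 1) s3 R' (flat (As j))"
          "R' 0 = length T" "R' 1 = q" by auto
      have "\<exists>R''. reach P V s3 R' (flat (As j)) (com_steps body B) (s3 + com_len body) R''
        (flat (sem body q (\<lambda>v. R' (?\<mu> v)) (As j))) \<and> (\<forall>r<2. R'' r = R' r)"
        by (rule com_reach[OF loc(5)]) (use le_B As_le size wf R' in auto)
      then obtain R'' where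
        R'': "reach P V s3 R' (flat (As j)) (com_steps body B) (s3 + com_len body) R'' (flat (As (Suc j)))"
          "R'' 0 = length T" "R'' 1 = q"
        using R'(2,3) unfolding \<rho>'[of R', OF R'(2)] AsS by auto
      have "reach P V (s3 + com_len body) R'' (flat (As (Suc j))) 1 (s3 + com_len body + 1)
          (R''(2 := 0)) (flat (As (Suc j)))"
        using straight_reach[OF loc(6), of V R'' _ "R''(2 := 0)" "flat (As (Suc j))"] by simp
      moreover have "reach P V (s3 + com_len body + 1) (R''(2 := 0)) (flat (As (Suc j))) 1 s2
          (R''(2 := 0)) (flat (As (Suc j)))"
        using reach_Jz[OF loc(7), of "R''(2 := 0)" V] by simp
      ultimately have "reach P V (s3 + com_len body) R'' (flat (As (Suc j))) 2 s2
          (R''(2 := 0)) (flat (As (Suc j)))"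
        by (metis reach_trans one_add_one)
      from reach_trans[OF reach_trans[OF R'(1) R''(1)] this] R'' show ?thesis
        by (intro exI[of _ "R''(2 := 0)"]) simp
    qed
    have "\<exists>R'. reach P V s2 R2 (flat (As 0)) (j * (exp_steps e B + 1 + com_steps body B + 2)) s2 R'
        (flat (As j)) \<and> R' 0 = length T \<and> R' 1 = q" if "j \<le> J" for j
      using that
    proof (induction j)
      case 0
      show ?case
        by (intro exI[of _ R2] conjI R2(2,3) reach_cast[OF reach_refl]) auto
    next
      case (Suc j)
      then obtain R' where
        R': "reach P V s2 R2 (flat (As 0)) (j * (exp_steps e B + 1 + com_steps body B + 2)) s2 R' (flat (As j))"
        "R' 0 = length T" "R' 1 = q" by auto
      from iter[OF R'(2,3), of j] pos Suc.prems obtain R'' where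
        R'': "reach P V s2 R' (flat (As j)) (exp_steps e B + 1 + com_steps body B + 2) s2 R''
          (flat (As (Suc j)))" "R'' 0 = length T" "R'' 1 = q" by (auto simp: As_def)
      show ?case
        by (intro exI[of _ R''] conjI R'' reach_cast[OF reach_trans[OF R'(1) R''(1)]]) auto
    qed
    then obtain R3 where
      R3: "reach P V s2 R2 (flat (As 0)) (J * (exp_steps e B + 1 + com_steps body B + 2)) s2 R3 (flat (As J))"
      "R3 0 = length T" "R3 1 = q" by blast
    from test[OF R3(2,3), of J] zero obtain R4 where
      R4: "reach P V s2 R3 (flat (As J)) (exp_steps e B + 1) s4 R4 (flat (As J))"
      "R4 0 = length T" "R4 1 = q" by (auto simp: As_def)
    have "\<exists>R'. reach P V s4 R4 (flat (As J)) (com_steps final B) (s4 + com_len final) R'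
        (flat (sem final q (\<lambda>v. R4 (?\<mu> v)) (As J))) \<and> (\<forall>r<2. R' r = R4 r)"
      by (rule com_reach[OF loc(8)]) (use le_B As_le size wf R4 in auto)
    then obtain R5 where
      R5: "reach P V s4 R4 (flat (As J)) (com_steps final B) (length P) R5 (flat (sem final q \<rho> (As J)))"
      "R5 0 = length T" using R4(2) unfolding \<rho>'[of R4, OF R4(2)] lenP by auto
    let ?N = "exp_steps cap B + com_steps init B + J * (exp_steps e B + 1 + com_steps body B + 2) +
        (exp_steps e B + 1) + com_steps final B"
    have "reach P V 0 ?R0 (flat A) ?N (length P) R5 (flat (sem final q \<rho> (As J)))"
      by (rule reach_trans[OF reach_trans[OF reach_trans[OF reach_trans[OF R1(1) R2(1)] R3(1)] R4(1)] R5(1)])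
    then obtain t where t: "t \<le> ?N * (2 * V + 1)"
      "runs P \<lparr>pc = 0, reg = ?R0, mem = flat A\<rparr> t \<lparr>pc = length P, reg = R5, mem = flat (sem final q \<rho> (As J))\<rparr>"
      unfolding reach_def by blast
    have "J * (exp_steps e B + 1 + com_steps body B + 2) \<le> J * S B"
      by (rule mult_le_mono2) (simp add: S_def)
    moreover have "exp_steps cap B + com_steps init B + (exp_steps e B + 1) + com_steps final B \<le> S B"
      by (simp add: S_def)
    ultimately have "?N \<le> J * S B + S B" by linarith
    then have "?N \<le> (J + 1) * S B" by simp
    then have "?N * (2 * V + 1) \<le> (J + 1) * S B * (2 * V + 1)" by (rule mult_le_mono1)
    also have "\<dots> = (J + 1) * (S B * (2 * W B + 1))" by (simp only: V_def mult.assoc)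
    also have "\<dots> \<le> (J + 1) * B ^ K" by (intro mult_le_mono2 K) (simp add: B_def)
    finally have "t \<le> (J + 1) * (q + 2) ^ K" using t(1) by (simp add: B_def)
    moreover have "input_config T = \<lparr>pc = 0, reg = ?R0, mem = flat A\<rparr>"
      unfolding flatA by (simp add: input_config_def)
    with runs_exec[OF t(2)] have
      "exec P (input_config T) t \<lparr>pc = length P, reg = R5, mem = flat (sem final q \<rho> (As J))\<rparr>" by simp
    ultimately show ?thesis using R5(2) unfolding As_def by (intro exI conjI) (assumption | simp)+
  qed
  then show ?thesis unfolding P_def by blast
qed

section \<open>Binomial coefficients modulo a prime\<close>

text \<open>Lucas' theorem for the lowest digit, by Pascal's rule. The cases ask which lowest digits
  roll over: if only that of z does, p divides \<open>p choose Suc ?c\<close>; if only that of b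
  does, \<open>?u choose ?c\<close> vanishes.\<close>

lemma lucas_digit:
  assumes p: "prime (p::nat)"
  shows "[z choose a = (z mod p choose (a mod p)) * (z div p choose (a div p))] (mod p)"
proof (induction z arbitrary: a)
  case 0
  show ?case
  proof (cases "a = 0")
    case False
    then have "a mod p \<noteq> 0 \<or> a div p \<noteq> 0" by (metis div_mult_mod_eq add_0_right mult_0)
    with False show ?thesis by (auto simp: binomial_eq_0)
  qed simp
next
  case (Suc z)
  have p1: "p > 1" using p by (rule prime_gt_1_nat)
  show ?case
  proof (cases a)
    case (Suc b)
    let ?u = "z mod p" and ?w = "z div p" and ?c = "b mod p" and ?d = "b div p"
    have "[Suc z choose a = (?u choose ?c) * (?w choose ?d) + (?u choose (Suc b mod p)) * (?w choose (Suc b div p))] (mod p)"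
      unfolding Suc binomial_Suc_Suc by (intro cong_add Suc.IH)
    also have "[(?u choose ?c) * (?w choose ?d) + (?u choose (Suc b mod p)) * (?w choose (Suc b div p)) =
       (Suc z mod p choose (Suc b mod p)) * (Suc z div p choose (Suc b div p))] (mod p)"
    proof (cases "Suc ?u = p"; cases "Suc ?c = p")
      assume u: "Suc ?u = p" and c: "Suc ?c = p"
      then have "?u = ?c" by simp
      with u c show ?thesis by (simp add: mod_Suc div_Suc)
    next
      assume u: "Suc ?u = p" and c: "Suc ?c \<noteq> p"
      have "?c < p" using p1 by simp
      with c have "Suc ?c < p" by linarith
      then have "p dvd (p choose Suc ?c)"
        using p1 p by (intro dvd_choose_prime) auto
      then have "[(p choose Suc ?c) * (?w choose ?d) = 0] (mod p)" by (simp add: cong_0_iff)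
      moreover have "(p choose Suc ?c) = (?u choose ?c) + (?u choose Suc ?c)"
        using u binomial_Suc_Suc[of ?u ?c] by simp
      ultimately show ?thesis using u c by (simp add: mod_Suc div_Suc algebra_simps)
    next
      assume u: "Suc ?u \<noteq> p" and c: "Suc ?c = p"
      have "?u < p" using p1 by simp
      with u c have "?u < ?c" by linarith
      with u c show ?thesis by (simp add: mod_Suc div_Suc binomial_eq_0)
    next
      assume u: "Suc ?u \<noteq> p" and c: "Suc ?c \<noteq> p"
      then show ?thesis by (simp add: mod_Suc div_Suc algebra_simps)
    qed
    finally show ?thesis unfolding Suc .
  qed simp
qed

text \<open>Newton interpolation: the matrix of the numbers e choose b is unitriangular, so the
  coefficients are integers.\<close>

lemma binomial_interpolation:
  "\<exists>\<gamma>::nat \<Rightarrow> int. \<forall>e<m. (\<Sum>b<m. \<gamma> b * int (e choose b)) = g e"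
proof (induction m)
  case (Suc m)
  then obtain \<gamma> :: "nat \<Rightarrow> int" where \<gamma>: "\<forall>e<m. (\<Sum>b<m. \<gamma> b * int (e choose b)) = g e" by blast
  let ?\<gamma> = "\<gamma>(m := g m - (\<Sum>b<m. \<gamma> b * int (m choose b)))"
  have "(\<Sum>b<Suc m. ?\<gamma> b * int (e choose b)) = g e" if "e < Suc m" for e
    using \<gamma> that by (cases "e = m") (auto simp: binomial_eq_0)
  then show ?case by blast
qed simp

text \<open>A flag of spaces of functions modulo p, with the binomial functions as basis. Rotations
  will act on this flag unitriangularly.\<close>

definition low :: "nat \<Rightarrow> nat \<Rightarrow> nat \<Rightarrow> (nat \<Rightarrow> int) set" where
  "low p N a = {g. \<exists>s. \<forall>z<N. [g z = (\<Sum>c<a. s c * int (z choose c))] (mod int p)}"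

lemma lowI: "(\<And>z. z < N \<Longrightarrow> [g z = (\<Sum>c<a. s c * int (z choose c))] (mod int p)) \<Longrightarrow> g \<in> low p N a"
  unfolding low_def by blast

lemma lowE:
  assumes "g \<in> low p N a"
  obtains s where "\<And>z. z < N \<Longrightarrow> [g z = (\<Sum>c<a. s c * int (z choose c))] (mod int p)"
  using assms unfolding low_def by blast

lemma low_zero: "(\<lambda>_. 0) \<in> low p N a"
  by (rule lowI[where s = "\<lambda>_. 0"]) simp

lemma low_add:
  assumes "f \<in> low p N a" "g \<in> low p N a"
  shows "(\<lambda>z. f z + g z) \<in> low p N a"
proof -
  from assms obtain s t where
    st: "\<And>z. z < N \<Longrightarrow> [f z = (\<Sum>c<a. s c * int (z choose c))] (mod int p)"
      "\<And>z. z < N \<Longrightarrow> [g z = (\<Sum>c<a. t c * int (z choose c))] (mod int p)" by (metis lowE)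
  have "(\<Sum>c<a. (s c + t c) * int (z choose c)) =
      (\<Sum>c<a. s c * int (z choose c)) + (\<Sum>c<a. t c * int (z choose c))" for z
    by (simp add: distrib_right sum.distrib)
  with st show ?thesis by (intro lowI[where s = "\<lambda>c. s c + t c"]) (simp add: cong_add)
qed

lemma low_scale:
  assumes "f \<in> low p N a"
  shows "(\<lambda>z. r * f z) \<in> low p N a"
proof -
  from assms obtain s where
    s: "\<And>z. z < N \<Longrightarrow> [f z = (\<Sum>c<a. s c * int (z choose c))] (mod int p)" by (metis lowE)
  have "(\<Sum>c<a. (r * s c) * int (z choose c)) = r * (\<Sum>c<a. s c * int (z choose c))" for z
    by (simp add: sum_distrib_left mult.assoc)
  with s show ?thesis by (intro lowI[where s = "\<lambda>c. r * s c"]) (simp add: cong_scalar_left)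
qed

lemma low_sum: "(\<And>i. i \<in> I \<Longrightarrow> f i \<in> low p N a) \<Longrightarrow> (\<lambda>z. \<Sum>i\<in>I. f i z) \<in> low p N a"
  by (induction I rule: infinite_finite_induct) (simp_all add: low_zero low_add)

lemma low_basis: "c < a \<Longrightarrow> (\<lambda>z. int (z choose c)) \<in> low p N a"
proof (rule lowI[where s = "\<lambda>c'. of_bool (c' = c)"])
  fix z assume "c < a"
  then have "(\<Sum>c'<a. of_bool (c' = c) * int (z choose c')) = int (z choose c)"
    by (subst sum.remove[of _ c]) auto
  then show "[int (z choose c) = (\<Sum>c'<a. of_bool (c' = c) * int (z choose c'))] (mod int p)" by simp
qed

lemma low_cong:
  assumes "g \<in> low p N a" "\<And>z. z < N \<Longrightarrow> [f z = g z] (mod int p)"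
  shows "f \<in> low p N a"
proof -
  from assms(1) obtain s where "\<forall>z<N. [g z = (\<Sum>c<a. s c * int (z choose c))] (mod int p)"
    unfolding low_def by blast
  with assms(2) have "\<forall>z<N. [f z = (\<Sum>c<a. s c * int (z choose c))] (mod int p)"
    by (meson cong_trans)
  then show ?thesis unfolding low_def by blast
qed

section \<open>The Sylow subgroup of the symmetric group\<close>

text \<open>Numbers below \<open>p\<^sup>k\<close> are the leaves of a \<open>p\<close>-ary tree, the least significant digit deciding at
  the root. Tree automorphisms that rotate the children of every vertex form a Sylow \<open>p\<close>-subgroup.\<close>

definition rotating :: "nat \<Rightarrow> nat \<Rightarrow> (nat \<Rightarrow> nat) \<Rightarrow> bool" where
  "rotating p k \<sigma> \<longleftrightarrow> (\<forall>z<p^k. \<sigma> z < p^k) \<and>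
     (\<forall>i<k. \<forall>z<p^k. \<forall>z'<p^k. [z = z'] (mod p^i) \<longrightarrow>
        [int (\<sigma> z) - int z = int (\<sigma> z') - int z'] (mod int (p^Suc i)))"

lemma rotating_less: "rotating p k \<sigma> \<Longrightarrow> z < p^k \<Longrightarrow> \<sigma> z < p^k"
  by (simp add: rotating_def)

lemma rotating_cong:
  "rotating p k \<sigma> \<Longrightarrow> i < k \<Longrightarrow> z < p^k \<Longrightarrow> z' < p^k \<Longrightarrow> [z = z'] (mod p^i) \<Longrightarrow>
    [int (\<sigma> z) - int z = int (\<sigma> z') - int z'] (mod int (p^Suc i))"
  unfolding rotating_def by blast

text \<open>The wreath product decomposition: a rotation by f at the root, and below each lowest
  digit e a rotating map of a tree of height k.\<close>

lemma rotating_section: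
  assumes p: "p > 0" and \<sigma>: "rotating p (Suc k) \<sigma>"
  defines "f \<equiv> \<sigma> 0 mod p"
  shows "\<And>z. z < p^Suc k \<Longrightarrow> \<sigma> z mod p = (z mod p + f) mod p"
    and "\<And>e. e < p \<Longrightarrow> rotating p k (\<lambda>u. \<sigma> (e + p * u) div p)"
proof -
  show *: "\<sigma> z mod p = (z mod p + f) mod p" if "z < p^Suc k" for z
  proof -
    have "[int (\<sigma> z) - int z = int (\<sigma> 0) - int 0] (mod int (p ^ Suc 0))"
      by (rule rotating_cong[OF \<sigma>]) (use that p in auto)
    from cong_add[OF this cong_refl[of "int z"]]
    have "[int (\<sigma> z) = int (z + \<sigma> 0)] (mod int p)" by (simp add: algebra_simps)
    then have "[\<sigma> z = z + \<sigma> 0] (mod p)" by (simp only: cong_int_iff)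
    then show ?thesis unfolding f_def cong_def by (simp add: mod_add_eq)
  qed
  fix e assume e: "e < p"
  let ?\<tau> = "\<lambda>u. \<sigma> (e + p * u) div p"
  have lt: "e + p * u < p ^ Suc k" if "u < p^k" for u
  proof -
    have "e + p * u < p * (u + 1)" using e by simp
    also have "\<dots> \<le> p * p ^ k" using that by (intro mult_le_mono2) simp
    finally show ?thesis by simp
  qed
  have dm: "int (\<sigma> (e + p * u)) = int p * int (?\<tau> u) + int ((e + f) mod p)" if "u < p^k" for u
  proof -
    have "\<sigma> (e + p * u) = p * ?\<tau> u + \<sigma> (e + p * u) mod p" by simp
    then show ?thesis using *[OF lt[OF that]] e by (metis mod_mult_self2 of_nat_add of_nat_mult mod_less)
  qed
  show "rotating p k ?\<tau>"
    unfolding rotating_def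
  proof (intro conjI allI impI)
    fix z assume "z < p^k"
    then have "\<sigma> (e + p * z) < p ^ Suc k" by (intro rotating_less[OF \<sigma>] lt)
    then show "?\<tau> z < p ^ k" using p by (simp add: less_mult_imp_div_less mult.commute)
  next
    fix i z z' assume i: "i < k" and z: "z < p^k" "z' < p^k" and zz: "[z = z'] (mod p^i)"
    have "[e + p * z = e + p * z'] (mod p ^ Suc i)"
      using zz by (simp add: cong_add_lcancel_nat) (simp add: cong_def mult_mod_right[symmetric])
    then have "[int (\<sigma> (e + p * z)) - int (e + p * z) = int (\<sigma> (e + p * z')) - int (e + p * z')]
        (mod int (p ^ Suc (Suc i)))"
      using i by (intro rotating_cong[OF \<sigma>] lt z) simp
    then have "int (p ^ Suc (Suc i)) dvd
       int p * ((int (?\<tau> z) - int z) - (int (?\<tau> z') - int z'))"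
      unfolding dm[OF z(1)] dm[OF z(2)] cong_iff_dvd_diff by (simp add: algebra_simps)
    then have "int (p ^ Suc i) dvd (int (?\<tau> z) - int z) - (int (?\<tau> z') - int z')"
      using p by (simp only: power_Suc[of p "Suc i"] of_nat_mult) simp
    then show "[int (?\<tau> z) - int z = int (?\<tau> z') - int z'] (mod int (p ^ Suc i))"
      by (simp add: cong_iff_dvd_diff)
  qed
qed

text \<open>The converse of \<open>rotating_section\<close>: the maps below the root may be
  prescribed independently.\<close>

lemma rotating_combine:
  assumes p: "p > 0" and \<tau>: "\<And>e. e < p \<Longrightarrow> rotating p k (\<tau> e)"
    and \<sigma>: "\<And>e z. e < p \<Longrightarrow> z < p^k \<Longrightarrow> \<sigma> (e + p * z) = (e + f) mod p + p * \<tau> e z"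
  shows "rotating p (Suc k) \<sigma>"
proof -
  have dec: "\<exists>e u. z = e + p * u \<and> e < p \<and> u < p^k" if "z < p ^ Suc k" for z
    using that p
    by (intro exI[of _ "z mod p"] exI[of _ "z div p"]) (auto simp: less_mult_imp_div_less mult.commute)
  show ?thesis unfolding rotating_def
  proof (intro conjI allI impI)
    fix z assume "z < p ^ Suc k"
    with dec obtain e u where eu: "z = e + p * u" "e < p" "u < p^k" by blast
    have "(e + f) mod p + p * \<tau> e u < p * (\<tau> e u + 1)" using p by simp
    also have "\<dots> \<le> p * p^k" using \<tau>[OF eu(2)] eu(3) unfolding rotating_def
      by (intro mult_le_mono2) (simp add: Suc_leI)
    finally show "\<sigma> z < p ^ Suc k" unfolding eu(1) \<sigma>[OF eu(2,3)] by simp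
  next
    fix i z z' assume i: "i < Suc k" and z: "z < p ^ Suc k" "z' < p ^ Suc k" and zz: "[z = z'] (mod p^i)"
    from dec[OF z(1)] obtain e u where eu: "z = e + p * u" "e < p" "u < p^k" by blast
    from dec[OF z(2)] obtain e' u' where eu': "z' = e' + p * u'" "e' < p" "u' < p^k" by blast
    have shift: "[int ((e + f) mod p) - int e = int f] (mod int p)" for e
    proof -
      have "[int ((e + f) mod p) = int (e + f)] (mod int p)" by (simp add: cong_def zmod_int)
      from cong_diff[OF this cong_refl[of "int e"]] show ?thesis by simp
    qed
    show "[int (\<sigma> z) - int z = int (\<sigma> z') - int z'] (mod int (p ^ Suc i))"
    proof (cases i)
      case 0
      have "[int (\<sigma> (e + p * u)) - int (e + p * u) = int f] (mod int p)" if "e < p" "u < p^k" for e u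
      proof -
        have "[int ((e + f) mod p) - int e + int p * (int (\<tau> e u) - int u) = int f + 0] (mod int p)"
          by (intro cong_add shift) (simp add: cong_0_iff)
        moreover have "int (\<sigma> (e + p * u)) - int (e + p * u) =
            int ((e + f) mod p) - int e + int p * (int (\<tau> e u) - int u)"
          unfolding \<sigma>[OF that] by (simp add: algebra_simps)
        ultimately show ?thesis by (simp only: add_0_right)
      qed
      from cong_trans[OF this[OF eu(2,3)] cong_sym[OF this[OF eu'(2,3)]]]
      show ?thesis unfolding eu(1) eu'(1) 0 by simp
    next
      case (Suc j)
      from zz have "[z = z'] (mod p)" unfolding Suc by (simp add: cong_def) (metis mod_mult_self1 mod_mult2_eq mod_mult_left_eq mod_mod_cancel dvd_triv_left)
      with eu eu' have e: "e = e'" by (simp add: cong_def)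
      from zz have "[p * u = p * u'] (mod p * p ^ j)" unfolding Suc eu(1) eu'(1) e by (simp add: cong_add_lcancel_nat)
      then have "[u = u'] (mod p^j)" using p by (simp add: cong_def mult_mod_right[symmetric])
      with \<tau>[OF eu(2)] i Suc eu eu'
      have "[int (\<tau> e u) - int u = int (\<tau> e u') - int u'] (mod int (p ^ Suc j))"
        unfolding rotating_def by simp
      then have "int (p ^ Suc i) dvd int p * ((int (\<tau> e u) - int u) - (int (\<tau> e u') - int u'))"
        unfolding Suc cong_iff_dvd_diff by (simp only: power_Suc[of p "Suc j"] of_nat_mult) simp
      moreover have "int p * ((int (\<tau> e u) - int u) - (int (\<tau> e u') - int u')) =
         (int (\<sigma> z) - int z) - (int (\<sigma> z') - int z')"
        unfolding eu(1) eu'(1) \<sigma>[OF eu(2,3)] \<sigma>[OF eu'(2,3)] e[symmetric]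
          \<sigma>[OF eu(2) eu'(3)] by (simp add: algebra_simps)
      ultimately show ?thesis by (simp only: cong_iff_dvd_diff)
    qed
  qed
qed

text \<open>Write a = a0 + p a1 and z = e + p u. By Lucas the coefficient of the image is the
  product of (e + f choose a0) and (\<tau> e u choose a1). Vandermonde expands the first factor into
  terms of lower index, the induction hypothesis the second. Its coefficients depend on e
  arbitrarily, but by interpolation any function of e costs only indices below p, and b + p c < p a1
  whenever b < p and c < a1.\<close>

lemma binomial_rotating:
  assumes p: "prime p" and "rotating p k \<sigma>"
  shows "(\<lambda>z. int (\<sigma> z choose a) - int (z choose a)) \<in> low p (p^k) a"
  using assms(2)
proof (induction k arbitrary: \<sigma> a)
  case 0
  then show ?case by (intro low_cong[OF low_zero]) (auto simp: rotating_def)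
next
  case (Suc k)
  let ?N = "p ^ Suc k"
  have p0: "p > 0" using p by (rule prime_gt_0_nat)
  define f where "f = \<sigma> 0 mod p"
  define a0 a1 where "a0 = a mod p" and "a1 = a div p"
  have a: "a = a0 + p * a1" "a0 < p" unfolding a0_def a1_def using p0 by auto
  note sec = rotating_section[OF p0 Suc.prems, folded f_def]
  define \<tau> where "\<tau> e = (\<lambda>u. \<sigma> (e + p * u) div p)" for e
  from Suc.IH[OF sec(2), of _ a1, folded \<tau>_def] have
    "\<forall>e. \<exists>s. e < p \<longrightarrow> (\<forall>u<p^k. [int (\<tau> e u choose a1) - int (u choose a1) = (\<Sum>c<a1. s c * int (u choose c))] (mod int p))"
    unfolding low_def \<tau>_def by blast
  then obtain s where s: "\<And>e u. e < p \<Longrightarrow> u < p^k \<Longrightarrow>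
    [int (\<tau> e u choose a1) - int (u choose a1) = (\<Sum>c<a1. s e c * int (u choose c))] (mod int p)"
    by metis
  have lucas: "[int (z choose (b + p * c)) = int (z mod p choose b) * int (z div p choose c)] (mod int p)"
    if "b < p" for z b c
    using lucas_digit[OF p, of z "b + p * c"] that p0 by (simp flip: of_nat_mult add: cong_int_iff)
  have low1: "(\<lambda>z. int (z mod p choose b) * int (z div p choose c)) \<in> low p ?N a"
    if "b < p" "b + p * c < a" for b c
    by (rule low_cong[OF low_basis[OF that(2)]]) (rule cong_sym[OF lucas[OF that(1)]])
  have low2: "(\<lambda>z. g (z mod p) * int (z div p choose c)) \<in> low p ?N a" if "c < a1" for g c
  proof -
    from binomial_interpolation[of p g] obtain \<gamma> :: "nat \<Rightarrow> int" where
      \<gamma>: "\<forall>e<p. (\<Sum>b<p. \<gamma> b * int (e choose b)) = g e" by blast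
    have "(\<lambda>z. \<Sum>b<p. \<gamma> b * (int (z mod p choose b) * int (z div p choose c))) \<in> low p ?N a"
    proof (intro low_sum low_scale low1)
      fix b assume "b \<in> {..<p}"
      then have "b + p * c < p * (c + 1)" by simp
      also have "\<dots> \<le> p * a1" using that by (intro mult_le_mono2) simp
      finally show "b + p * c < a" using a by simp
    qed auto
    then show ?thesis
      by (rule low_cong) (use \<gamma> p0 in \<open>simp add: sum_distrib_right mult.assoc flip: \<gamma>\<close>)
  qed
  \<comment> \<open>\<open>?A\<close> collects the lower terms of Vandermonde's identity,
    \<open>?B\<close> those of the induction hypothesis.\<close>
  let ?A = "\<lambda>z. \<Sum>b<a0. int (f choose (a0 - b)) * (int (z mod p choose b) * int (z div p choose a1))"
  let ?B = "\<lambda>z. \<Sum>c<a1. (int ((z mod p + f) choose a0) * s (z mod p) c) * int (z div p choose c)"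
  have "(\<lambda>z. ?A z + ?B z) \<in> low p ?N a"
  proof (intro low_add low_sum low_scale low1)
    fix c assume "c \<in> {..<a1}"
    then show "(\<lambda>z. (int ((z mod p + f) choose a0) * s (z mod p) c) * int (z div p choose c)) \<in> low p ?N a"
      by (intro low2[of c "\<lambda>e. int ((e + f) choose a0) * s e c"]) simp
  qed (use a in auto)
  then show ?case
  proof (rule low_cong)
    fix z assume z: "z < ?N"
    let ?e = "z mod p" and ?u = "z div p"
    have e: "?e < p" and u: "?u < p^k" using z p0 by (auto simp: less_mult_imp_div_less mult.commute)
    have zeu: "?e + p * ?u = z" by simp
    \<comment> \<open>As a0 < p, only the lowest digit of e + f matters modulo p; hence the
      reduction modulo p in the root rotation does no harm.\<close>
    have "[int (?e + f choose a0) = int ((?e + f) mod p choose a0) * 1] (mod int p)"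
      using lucas[OF a(2), of "?e + f" 0] by simp
    then have ef: "[int ((?e + f) mod p choose a0) = int (?e + f choose a0)] (mod int p)"
      by (simp add: cong_sym)
    have \<tau>z: "\<sigma> z div p = \<tau> ?e ?u" unfolding \<tau>_def zeu ..
    have su: "[int (\<tau> ?e ?u choose a1) = int (?u choose a1) + (\<Sum>c<a1. s ?e c * int (?u choose c))] (mod int p)"
      using cong_add[OF s[OF e u] cong_refl[of "int (?u choose a1)"]] by (simp add: algebra_simps)
    have vander: "int (?e + f choose a0) = int (?e choose a0) + (\<Sum>b<a0. int (f choose (a0 - b)) * int (?e choose b))"
      unfolding vandermonde[of ?e f a0, symmetric]
      by (simp add: atMost_Suc lessThan_Suc_atMost[symmetric] mult.commute)
    have "[int (\<sigma> z choose a) = int (\<sigma> z mod p choose a0) * int (\<sigma> z div p choose a1)] (mod int p)"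
      unfolding a(1) by (rule lucas[OF a(2)])
    also have "\<sigma> z mod p = (?e + f) mod p" by (rule sec(1)[OF z])
    also have "[int ((?e + f) mod p choose a0) * int (\<sigma> z div p choose a1) =
        int (?e + f choose a0) * (int (?u choose a1) + (\<Sum>c<a1. s ?e c * int (?u choose c)))] (mod int p)"
      unfolding \<tau>z by (intro cong_mult ef su)
    also have "int (?e + f choose a0) * (int (?u choose a1) + (\<Sum>c<a1. s ?e c * int (?u choose c))) =
        int (?e choose a0) * int (?u choose a1) + (?A z + ?B z)"
    proof -
      have "int (?e + f choose a0) * int (?u choose a1) = int (?e choose a0) * int (?u choose a1) + ?A z"
        unfolding vander by (simp add: distrib_right sum_distrib_right mult.assoc)
      moreover have "int (?e + f choose a0) * (\<Sum>c<a1. s ?e c * int (?u choose c)) = ?B z"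
        by (simp add: sum_distrib_left mult.assoc)
      ultimately show ?thesis by (simp add: distrib_left)
    qed
    also have "[int (?e choose a0) * int (?u choose a1) + (?A z + ?B z) = int (z choose a) + (?A z + ?B z)] (mod int p)"
      unfolding a(1) by (intro cong_add cong_refl cong_sym[OF lucas[OF a(2)]])
    finally show "[int (\<sigma> z choose a) - int (z choose a) = ?A z + ?B z] (mod int p)"
      by (simp add: cong_iff_dvd_diff algebra_simps)
  qed
qed

lemma cong_power_le: "[x = y] (mod p^j) \<Longrightarrow> i \<le> j \<Longrightarrow> [x = y] (mod p^i)" for x y p :: nat
  by (rule cong_dvd_modulus_nat) (auto intro: le_imp_power_dvd)

text \<open>Points that agree modulo p^i have equal displacements modulo p^(i+1), so their
  difference modulo p^(i+1) is preserved. Climbing level by level, the map is seen to be a tree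
  automorphism.\<close>

lemma rotating_cong_iff:
  assumes \<sigma>: "rotating p k \<sigma>" and "i \<le> k" "z < p^k" "z' < p^k"
  shows "[\<sigma> z = \<sigma> z'] (mod p^i) \<longleftrightarrow> [z = z'] (mod p^i)"
  using assms(2)
proof (induction i)
  case (Suc i)
  have iff: "[\<sigma> z = \<sigma> z'] (mod p^Suc i) \<longleftrightarrow> [z = z'] (mod p^Suc i)" if "[z = z'] (mod p^i)"
  proof -
    have "int (p^Suc i) dvd (int (\<sigma> z) - int z) - (int (\<sigma> z') - int z')"
      using rotating_cong[OF \<sigma> _ assms(3,4) that] Suc.prems by (simp only: cong_iff_dvd_diff)
    then have "int (p^Suc i) dvd (int (\<sigma> z) - int (\<sigma> z')) - (int z - int z')"
      by (simp add: algebra_simps)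
    then show ?thesis
      unfolding cong_int_iff[symmetric] cong_iff_dvd_diff by (metis dvd_diff_commute dvd_diff_right_iff dvd_diff_left_iff)
  qed
  from Suc iff show ?case using cong_power_le[of _ _ p "Suc i" i] by (metis le_SucI Suc_leD lessI less_imp_le)
qed simp

lemma rotating_permutes:
  assumes \<sigma>: "rotating p k \<sigma>" and "\<And>z. z \<ge> p^k \<Longrightarrow> \<sigma> z = z"
  shows "\<sigma> permutes {..<p^k}"
proof (rule bij_imp_permutes)
  have "inj_on \<sigma> {..<p^k}"
  proof (rule inj_onI)
    fix x y assume xy: "x \<in> {..<p^k}" "y \<in> {..<p^k}" "\<sigma> x = \<sigma> y"
    then have "[x = y] (mod p^k)" using rotating_cong_iff[OF \<sigma> order_refl, of x y] by simp
    with xy show "x = y" by (simp add: cong_def)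
  qed
  moreover have "\<sigma> ` {..<p^k} \<subseteq> {..<p^k}" using rotating_less[OF \<sigma>] by auto
  ultimately show "bij_betw \<sigma> {..<p^k} {..<p^k}"
    by (simp add: bij_betw_def endo_inj_surj)
qed (use assms(2) in auto)

section \<open>Permutation groups and their additive characters\<close>

abbreviation pinv :: "(nat \<Rightarrow> nat) \<Rightarrow> nat \<Rightarrow> nat" where
  "pinv \<equiv> inv_into UNIV"

definition perm_group :: "(nat \<Rightarrow> nat) set \<Rightarrow> bool" where
  "perm_group S \<longleftrightarrow> id \<in> S \<and> (\<forall>\<sigma>\<in>S. bij \<sigma> \<and> pinv \<sigma> \<in> S \<and> (\<forall>\<tau>\<in>S. \<sigma> \<circ> \<tau> \<in> S))"

lemma perm_group_funpow: "perm_group S \<Longrightarrow> \<sigma> \<in> S \<Longrightarrow> \<sigma> ^^ e \<in> S"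
  by (induction e) (auto simp: perm_group_def)

text \<open>Two kinds occur: displacements of a leaf, with m a power of p, and changes of a moment,
  with m = p. Integer values taken up to congruence avoid a type of residues.\<close>

definition character :: "(nat \<Rightarrow> nat) set \<Rightarrow> int \<Rightarrow> ((nat \<Rightarrow> nat) \<Rightarrow> int) \<Rightarrow> bool" where
  "character S m h \<longleftrightarrow> (\<forall>\<sigma>\<in>S. \<forall>\<tau>\<in>S. [h (\<sigma> \<circ> \<tau>) = h \<sigma> + h \<tau>] (mod m))"

lemma character_comp:
  "character S m h \<Longrightarrow> \<sigma> \<in> S \<Longrightarrow> \<tau> \<in> S \<Longrightarrow> [h (\<sigma> \<circ> \<tau>) = h \<sigma> + h \<tau>] (mod m)"
  by (simp add: character_def)

lemma character_id:
  assumes "perm_group S" "character S m h"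
  shows "[h id = 0] (mod m)"
proof -
  have "id \<in> S" using assms(1) by (simp add: perm_group_def)
  then have "[h (id \<circ> id) = h id + h id] (mod m)" by (intro character_comp[OF assms(2)])
  then show ?thesis by (simp add: cong_iff_dvd_diff)
qed

lemma character_funpow:
  assumes "perm_group S" "character S m h" "\<sigma> \<in> S"
  shows "[h (\<sigma> ^^ e) = int e * h \<sigma>] (mod m)"
proof (induction e)
  case 0
  then show ?case
    using character_id[OF assms(1,2)] by (simp only: funpow.simps of_nat_0 mult_zero_left)
next
  case (Suc e)
  have "[h (\<sigma> \<circ> \<sigma> ^^ e) = h \<sigma> + h (\<sigma> ^^ e)] (mod m)"
    using assms perm_group_funpow by (intro character_comp) auto
  also have "[h \<sigma> + h (\<sigma> ^^ e) = h \<sigma> + int e * h \<sigma>] (mod m)" by (intro cong_add cong_refl Suc.IH)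
  also have "h \<sigma> + int e * h \<sigma> = int (Suc e) * h \<sigma>" by (simp add: algebra_simps)
  also have "\<sigma> \<circ> \<sigma> ^^ e = \<sigma> ^^ Suc e" by simp
  finally show ?case .
qed

lemma character_inv:
  assumes "perm_group S" "character S m h" "\<sigma> \<in> S"
  shows "[h (pinv \<sigma>) = - h \<sigma>] (mod m)"
proof -
  have "pinv \<sigma> \<circ> \<sigma> = id" using assms by (auto simp: perm_group_def bij_is_inj)
  moreover have "[h (pinv \<sigma> \<circ> \<sigma>) = h (pinv \<sigma>) + h \<sigma>] (mod m)"
    using assms by (intro character_comp) (auto simp: perm_group_def)
  ultimately have "[h (pinv \<sigma>) + h \<sigma> = 0] (mod m)"
    using character_id[OF assms(1,2)] by (metis cong_sym cong_trans)
  then show ?thesis by (simp add: cong_iff_dvd_diff)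
qed

definition ker :: "(nat \<Rightarrow> nat) set \<Rightarrow> int \<Rightarrow> ((nat \<Rightarrow> nat) \<Rightarrow> int) \<Rightarrow> (nat \<Rightarrow> nat) set" where
  "ker S m h = {\<sigma> \<in> S. [h \<sigma> = 0] (mod m)}"

lemma perm_group_ker:
  assumes "perm_group S" "character S m h"
  shows "perm_group (ker S m h)"
proof -
  have "[h (\<sigma> \<circ> \<tau>) = 0] (mod m)" if "\<sigma> \<in> ker S m h" "\<tau> \<in> ker S m h" for \<sigma> \<tau>
    using cong_trans[OF character_comp[OF assms(2)] cong_add[of "h \<sigma>" 0 m "h \<tau>" 0]] that
    by (auto simp: ker_def)
  moreover have "[h (pinv \<sigma>) = 0] (mod m)" if "\<sigma> \<in> ker S m h" for \<sigma>
    using cong_trans[OF character_inv[OF assms], of \<sigma> 0] that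
    by (auto simp: ker_def cong_iff_dvd_diff)
  ultimately show ?thesis
    using assms(1) character_id[OF assms] unfolding perm_group_def ker_def by auto
qed

definition rot_group :: "nat \<Rightarrow> nat \<Rightarrow> (nat \<Rightarrow> nat) set" where
  "rot_group p k = {\<sigma>. \<sigma> permutes {..<p^k} \<and> rotating p k \<sigma>}"

lemma perm_group_rot_group: "perm_group (rot_group p k)"
  unfolding perm_group_def
proof (intro conjI ballI)
  show "id \<in> rot_group p k"
    by (auto simp: rot_group_def rotating_def permutes_id[unfolded id_def])
next
  fix \<sigma> assume "\<sigma> \<in> rot_group p k"
  then show "bij \<sigma>" by (auto simp: rot_group_def permutes_bij)
next
  fix \<sigma> assume "\<sigma> \<in> rot_group p k"
  then have perm: "\<sigma> permutes {..<p^k}" and \<sigma>: "rotating p k \<sigma>" by (auto simp: rot_group_def)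
  have inv_lt: "pinv \<sigma> z < p^k" if "z < p^k" for z
    using permutes_in_image[OF permutes_inv[OF perm], of z] that by simp
  have "rotating p k (pinv \<sigma>)"
    unfolding rotating_def
  proof (intro conjI allI impI)
    fix i z z' assume i: "i < k" and z: "z < p^k" "z' < p^k" and zz: "[z = z'] (mod p^i)"
    have eq: "\<sigma> (pinv \<sigma> z) = z" for z using permutes_inverses(1)[OF perm] .
    have "[pinv \<sigma> z = pinv \<sigma> z'] (mod p^i)"
      using rotating_cong_iff[OF \<sigma> _ inv_lt[OF z(1)] inv_lt[OF z(2)], of i] i zz by (simp add: eq)
    from rotating_cong[OF \<sigma> i inv_lt[OF z(1)] inv_lt[OF z(2)] this]
    have "[int z - int (pinv \<sigma> z) = int z' - int (pinv \<sigma> z')] (mod int (p ^ Suc i))" unfolding eq .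
    then have "[- (int z - int (pinv \<sigma> z)) = - (int z' - int (pinv \<sigma> z'))] (mod int (p ^ Suc i))"
      by (simp only: cong_minus_minus_iff)
    then show "[int (pinv \<sigma> z) - int z = int (pinv \<sigma> z') - int z'] (mod int (p ^ Suc i))" by simp
  qed (use inv_lt in auto)
  then show "pinv \<sigma> \<in> rot_group p k" using permutes_inv[OF perm] by (simp add: rot_group_def)
next
  fix \<sigma> \<tau> assume "\<sigma> \<in> rot_group p k" "\<tau> \<in> rot_group p k"
  then have perm: "\<sigma> permutes {..<p^k}" "\<tau> permutes {..<p^k}"
    and rot: "rotating p k \<sigma>" "rotating p k \<tau>" by (auto simp: rot_group_def)
  have "rotating p k (\<sigma> \<circ> \<tau>)"
    unfolding rotating_def
  proof (intro conjI allI impI)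
    fix i z z' assume i: "i < k" and z: "z < p^k" "z' < p^k" and zz: "[z = z'] (mod p^i)"
    have \<tau>: "\<tau> z < p^k" "\<tau> z' < p^k" using rotating_less[OF rot(2)] z by auto
    have "[\<tau> z = \<tau> z'] (mod p^i)" using rotating_cong_iff[OF rot(2) _ z] i zz by simp
    from cong_add[OF rotating_cong[OF rot(1) i \<tau> this] rotating_cong[OF rot(2) i z zz]]
    show "[int ((\<sigma> \<circ> \<tau>) z) - int z = int ((\<sigma> \<circ> \<tau>) z') - int z'] (mod int (p ^ Suc i))" by simp
  qed (use rotating_less[OF rot(1)] rotating_less[OF rot(2)] in auto)
  then show "\<sigma> \<circ> \<tau> \<in> rot_group p k" using permutes_compose[OF perm(2,1)] by (simp add: rot_group_def)
qed

section \<open>Echelon generating sequences\<close>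

definition disp :: "nat \<Rightarrow> (nat \<Rightarrow> nat) \<Rightarrow> int" where
  "disp v \<sigma> = int (\<sigma> v) - int v"

locale prime_power =
  fixes p k :: nat
  assumes prime: "prime p"
begin

abbreviation N :: nat where "N \<equiv> p ^ k"
abbreviation \<Gamma> :: "(nat \<Rightarrow> nat) set" where "\<Gamma> \<equiv> rot_group p k"

lemma p_pos: "p > 0"
  using prime by (rule prime_gt_0_nat)

lemma N_pos: "N > 0"
  using p_pos by simp

text \<open>The pair of a tree level \<open>i < k\<close> and a leaf \<open>v < N\<close> is encoded as \<open>i * N + v\<close>; the vertex on
  level \<open>i\<close> is the residue class of \<open>v\<close> modulo \<open>p\<^sup>i\<close>.\<close>

definition deep :: "nat \<Rightarrow> (nat \<Rightarrow> nat) set" where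
  "deep m = {\<sigma> \<in> \<Gamma>. \<forall>l<m. [disp (l mod N) \<sigma> = 0] (mod int (p ^ Suc (l div N)))}"

abbreviation twist :: "nat \<Rightarrow> (nat \<Rightarrow> nat) \<Rightarrow> int" where
  "twist m \<equiv> disp (m mod N)"

abbreviation modulus :: "nat \<Rightarrow> int" where
  "modulus m \<equiv> int (p ^ Suc (m div N))"

lemma deep_0: "deep 0 = \<Gamma>"
  by (auto simp: deep_def)

lemma deep_antimono: "m \<le> m' \<Longrightarrow> deep m' \<subseteq> deep m"
  by (auto simp: deep_def)

lemma deep_Suc: "deep (Suc m) = ker (deep m) (modulus m) (twist m)"
  by (auto simp: deep_def ker_def less_Suc_eq)

lemma level_less: "m < k * N \<Longrightarrow> m div N < k"
  by (simp add: less_mult_imp_div_less)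

text \<open>All pairs of the level above that of m precede m in the encoding, and the condition at
  that level is divisibility by p^(m div N) for every leaf.\<close>

lemma twist_dvd:
  assumes "\<sigma> \<in> deep m" "v < N"
  shows "int (p ^ (m div N)) dvd disp v \<sigma>"
proof (cases "m div N")
  case (Suc i)
  have "N * i + v < N * (i + 1)" using assms(2) by simp
  also have "\<dots> \<le> m" using Suc by (metis Suc_eq_plus1 mult.commute times_div_less_eq_dividend)
  finally have "[disp ((N * i + v) mod N) \<sigma> = 0] (mod int (p ^ Suc ((N * i + v) div N)))"
    using assms(1) unfolding deep_def by blast
  moreover have "(N * i + v) mod N = v" "(N * i + v) div N = i" using assms(2) p_pos by simp_all
  ultimately show ?thesis using Suc by (simp add: cong_0_iff)
qed simp

text \<open>An element \<tau> of \<open>deep m\<close> moves the leaf v only within its vertex at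
  the level of m, and there \<sigma> displaces v and \<tau> v equally; hence displacements
  add.\<close>

lemma character_twist:
  assumes "m < k * N"
  shows "character (deep m) (modulus m) (twist m)"
  unfolding character_def
proof (intro ballI)
  fix \<sigma> \<tau> assume \<sigma>: "\<sigma> \<in> deep m" and \<tau>: "\<tau> \<in> deep m"
  let ?v = "m mod N"
  have v: "?v < N" using N_pos by simp
  have rot: "rotating p k \<sigma>" "rotating p k \<tau>" using \<sigma> \<tau> by (auto simp: deep_def rot_group_def)
  have "[\<tau> ?v = ?v] (mod p ^ (m div N))"
    using twist_dvd[OF \<tau> v] unfolding cong_int_iff[symmetric] cong_iff_dvd_diff disp_def .
  from rotating_cong[OF rot(1) level_less[OF assms] rotating_less[OF rot(2) v] v this]
  have "[disp (\<tau> ?v) \<sigma> = disp ?v \<sigma>] (mod modulus m)" unfolding disp_def .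
  from cong_add[OF this cong_refl[of "disp ?v \<tau>"]]
  show "[twist m (\<sigma> \<circ> \<tau>) = twist m \<sigma> + twist m \<tau>] (mod modulus m)"
    by (simp add: disp_def)
qed

lemma perm_group_deep: "m \<le> k * N \<Longrightarrow> perm_group (deep m)"
proof (induction m)
  case 0
  then show ?case by (simp add: deep_0 perm_group_rot_group)
next
  case (Suc m)
  then show ?case unfolding deep_Suc by (intro perm_group_ker character_twist) auto
qed

text \<open>Below the last level every displacement is a multiple of N, hence zero.\<close>

lemma deep_top: "deep (k * N) = {id}"
proof (rule equalityI; rule subsetI)
  fix \<sigma> assume \<sigma>: "\<sigma> \<in> deep (k * N)"
  then have perm: "\<sigma> permutes {..<N}" and rot: "rotating p k \<sigma>" by (auto simp: deep_def rot_group_def)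
  have "\<sigma> z = z" if z: "z < N" for z
  proof -
    have "int (p ^ (k * N div N)) dvd disp z \<sigma>" by (rule twist_dvd[OF \<sigma> z])
    then have "int N dvd int (\<sigma> z) - int z" using N_pos p_pos by (simp add: disp_def)
    then have "[\<sigma> z = z] (mod N)" by (simp only: flip: cong_iff_dvd_diff cong_int_iff)
    then show ?thesis using rotating_less[OF rot z] z by (simp add: cong_def)
  qed
  then have "\<sigma> = id" using permutes_not_in[OF perm] by (metis eq_id_iff lessThan_iff)
  then show "\<sigma> \<in> {id}" by simp
next
  fix \<sigma> :: "nat \<Rightarrow> nat" assume "\<sigma> \<in> {id}"
  then show "\<sigma> \<in> deep (k * N)" using perm_group_deep[of "k * N"] by (simp add: perm_group_def)
qed

text \<open>A strong generating sequence along the filtration \<open>deep\<close>: its factors, cut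
  down to S, are cyclic. A trivial factor is served by the identity, so the index set is the same
  for every S.\<close>

definition echelon :: "(nat \<Rightarrow> nat) set \<Rightarrow> (nat \<Rightarrow> nat \<Rightarrow> nat) \<Rightarrow> bool" where
  "echelon S b \<longleftrightarrow> (\<forall>m<k*N. b m \<in> S \<inter> deep m \<and>
     (\<forall>\<sigma>\<in>S \<inter> deep m. \<exists>e. \<exists>\<tau>\<in>S \<inter> deep (Suc m). \<sigma> = b m ^^ e \<circ> \<tau>))"

text \<open>An element is peeled off generator by generator, from level to level, until the trivial
  group at the bottom of the filtration is reached.\<close>

lemma echelon_character:
  assumes "perm_group S" "character S c h" "echelon S b" "m \<le> k * N"
    and zero: "\<And>l. m \<le> l \<Longrightarrow> l < k * N \<Longrightarrow> [h (b l) = 0] (mod c)"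
    and "\<sigma> \<in> S \<inter> deep m"
  shows "[h \<sigma> = 0] (mod c)"
  using assms(4-6)
proof (induction m arbitrary: \<sigma> rule: inc_induct)
  case base
  then have "\<sigma> = id" by (simp add: deep_top)
  then show ?case using character_id[OF assms(1,2)] by (simp only:)
next
  case (step m)
  from step.hyps step.prems(2) assms(3) obtain e \<tau> where
    \<tau>: "\<tau> \<in> S \<inter> deep (Suc m)" "\<sigma> = b m ^^ e \<circ> \<tau>" and b: "b m \<in> S"
    unfolding echelon_def by blast
  have "[h \<tau> = 0] (mod c)" using step \<tau>(1) by auto
  moreover have "[h (b m ^^ e) = int e * 0] (mod c)"
    using cong_trans[OF character_funpow[OF assms(1,2) b] cong_mult[OF cong_refl step.prems(1)]] step.hyps
    by simp
  moreover have "[h \<sigma> = h (b m ^^ e) + h \<tau>] (mod c)"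
    unfolding \<tau>(2) using \<tau>(1) b perm_group_funpow[OF assms(1)] by (intro character_comp[OF assms(2)]) auto
  ultimately show ?case using cong_trans[OF _ cong_add[of "h (b m ^^ e)" 0 c "h \<tau>" 0]] by simp
qed

lemma echelon_trivial:
  assumes "perm_group S" "S \<subseteq> \<Gamma>" "character S c h" "echelon S b"
    and "\<And>l. l < k * N \<Longrightarrow> [h (b l) = 0] (mod c)"
  shows "ker S c h = S"
  using echelon_character[OF assms(1,3,4), of 0] assms(2,5) by (auto simp: ker_def deep_0)

text \<open>Restriction to the kernel of a character: a generator outside the kernel and as deep as
  possible is used to correct the others, then it is dropped.\<close>

lemma echelon_ker:
  assumes S: "perm_group S" "character S (int p) h" "echelon S b" and q: "q < k * N"
    and nz: "\<not> [h (b q) = 0] (mod int p)"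
    and zero: "\<And>m. q < m \<Longrightarrow> m < k * N \<Longrightarrow> [h (b m) = 0] (mod int p)"
    and low: "\<And>m. m < q \<Longrightarrow> \<exists>c. b' m = b q ^^ c \<circ> b m" "\<And>m. m < q \<Longrightarrow> [h (b' m) = 0] (mod int p)"
    and "b' q = id" and high: "\<And>m. q < m \<Longrightarrow> m < k * N \<Longrightarrow> b' m = b m"
  shows "echelon (ker S (int p) h) b'"
  unfolding echelon_def
proof (intro allI impI)
  fix m assume m: "m < k * N"
  let ?K = "ker S (int p) h"
  have K: "perm_group ?K" using S by (intro perm_group_ker)
  have b: "b m \<in> S" "b m \<in> deep m" and bq: "b q \<in> S" "b q \<in> deep q"
    and dec: "\<And>m \<sigma>. m < k * N \<Longrightarrow> \<sigma> \<in> S \<Longrightarrow> \<sigma> \<in> deep m \<Longrightarrow> \<exists>e. \<exists>\<tau>\<in>S \<inter> deep (Suc m). \<sigma> = b m ^^ e \<circ> \<tau>"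
    using S(3) m q unfolding echelon_def by auto
  consider "m < q" | "m = q" | "q < m" by linarith
  then show "b' m \<in> ?K \<inter> deep m \<and>
    (\<forall>\<sigma>\<in>?K \<inter> deep m. \<exists>e. \<exists>\<tau>\<in>?K \<inter> deep (Suc m). \<sigma> = b' m ^^ e \<circ> \<tau>)"
  proof cases
    case 1
    from low[OF 1] obtain c where c: "b' m = b q ^^ c \<circ> b m" "[h (b' m) = 0] (mod int p)" by blast
    have dm: "perm_group (deep m)" and ch: "character (deep m) (modulus m) (twist m)"
      using m by (intro perm_group_deep character_twist; simp)+
    \<comment> \<open>The correcting element lies deeper than m. So it has twist zero at m, and the
      corrected generator represents the same factor as the old one.\<close>
    have bq': "b q \<in> deep (Suc m)" using bq(2) deep_antimono[of "Suc m" q] 1 by auto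
    then have bq'': "b q \<in> deep m" "[twist m (b q) = 0] (mod modulus m)" by (auto simp: deep_Suc ker_def)
    have b'm: "b' m \<in> ?K" "b' m \<in> deep m"
      using c b bq(1) bq''(1) perm_group_funpow[OF S(1)] perm_group_funpow[OF dm] S(1) dm
      unfolding ker_def perm_group_def by auto
    have "[twist m (b' m) = twist m (b q ^^ c) + twist m (b m)] (mod modulus m)"
      unfolding c(1) by (rule character_comp[OF ch]) (use b bq'' perm_group_funpow[OF dm] in auto)
    moreover have "[twist m (b q ^^ c) = int c * 0] (mod modulus m)"
      by (rule cong_trans[OF character_funpow[OF dm ch bq''(1)] cong_mult[OF cong_refl bq''(2)]])
    ultimately have tw: "[twist m (b' m) = twist m (b m)] (mod modulus m)"
      using cong_trans[OF _ cong_add[of "twist m (b q ^^ c)" 0 _ "twist m (b m)"]] by auto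
    show ?thesis
    proof (intro conjI ballI)
      fix \<sigma> assume \<sigma>: "\<sigma> \<in> ?K \<inter> deep m"
      with dec[OF m, of \<sigma>] obtain e \<tau> where \<tau>: "\<tau> \<in> S \<inter> deep (Suc m)" "\<sigma> = b m ^^ e \<circ> \<tau>"
        by (auto simp: ker_def)
      have \<tau>': "\<tau> \<in> deep m" "[twist m \<tau> = 0] (mod modulus m)"
        using \<tau>(1) by (auto simp: deep_Suc ker_def)
      let ?\<tau> = "pinv (b' m ^^ e) \<circ> \<sigma>"
      have be: "b' m ^^ e \<in> ?K" "b' m ^^ e \<in> deep m" using b'm perm_group_funpow K dm by auto
      then have \<tau>K: "?\<tau> \<in> ?K" "?\<tau> \<in> deep m" using \<sigma> K dm unfolding perm_group_def by auto
      have "[twist m ?\<tau> = twist m (pinv (b' m ^^ e)) + twist m \<sigma>] (mod modulus m)"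
        by (rule character_comp[OF ch]) (use be \<sigma> dm in \<open>auto simp: perm_group_def\<close>)
      also have "[twist m (pinv (b' m ^^ e)) + twist m \<sigma> = - twist m (b' m ^^ e) + twist m \<sigma>] (mod modulus m)"
        by (intro cong_add cong_refl character_inv[OF dm ch] be)
      also have "[- twist m (b' m ^^ e) + twist m \<sigma> = - (int e * twist m (b m)) + (twist m (b m ^^ e) + twist m \<tau>)] (mod modulus m)"
      proof (intro cong_add)
        show "[- twist m (b' m ^^ e) = - (int e * twist m (b m))] (mod modulus m)"
          unfolding cong_minus_minus_iff
          by (rule cong_trans[OF character_funpow[OF dm ch b'm(2)] cong_mult[OF cong_refl tw]])
        show "[twist m \<sigma> = twist m (b m ^^ e) + twist m \<tau>] (mod modulus m)"
          unfolding \<tau>(2) by (rule character_comp[OF ch]) (use b \<tau>' perm_group_funpow[OF dm] in auto)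
      qed
      also have "[- (int e * twist m (b m)) + (twist m (b m ^^ e) + twist m \<tau>) =
          - (int e * twist m (b m)) + (int e * twist m (b m) + 0)] (mod modulus m)"
        by (intro cong_add cong_refl character_funpow[OF dm ch b(2)] \<tau>'(2))
      finally have "[twist m ?\<tau> = 0] (mod modulus m)" by simp
      then have "?\<tau> \<in> ?K \<inter> deep (Suc m)" using \<tau>K by (simp add: deep_Suc ker_def)
      moreover have "\<sigma> = b' m ^^ e \<circ> ?\<tau>"
        using be(1) K by (auto simp: perm_group_def fun_eq_iff bij_is_surj surj_f_inv_f)
      ultimately show "\<exists>e. \<exists>\<tau>\<in>?K \<inter> deep (Suc m). \<sigma> = b' m ^^ e \<circ> \<tau>" by blast
    qed (use b'm in auto)
  next
    case 2
    have dm: "perm_group (deep m)" and ch: "character (deep m) (modulus m) (twist m)"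
      using m by (intro perm_group_deep character_twist; simp)+
    have id: "id \<in> ?K \<inter> deep m" using K dm by (auto simp: perm_group_def)
    \<comment> \<open>The kernel has nothing left in this factor. Deeper elements have h = 0, so a
      power of the pivot in the kernel has an exponent divisible by p; and p-th powers fall into the
      next term, because the twist of the pivot is already divisible by p^(m div N).\<close>
    have "\<sigma> \<in> deep (Suc m)" if \<sigma>: "\<sigma> \<in> ?K \<inter> deep m" for \<sigma>
    proof -
      from \<sigma> dec[OF m, of \<sigma>] obtain e \<tau> where \<tau>: "\<tau> \<in> S \<inter> deep (Suc m)" "\<sigma> = b m ^^ e \<circ> \<tau>"
        by (auto simp: ker_def)
      have \<tau>': "\<tau> \<in> deep m" "[twist m \<tau> = 0] (mod modulus m)"
        using \<tau>(1) by (auto simp: deep_Suc ker_def)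
      have "[h \<tau> = 0] (mod int p)"
        by (rule echelon_character[OF S, of "Suc m"]) (use zero 2 m \<tau> in auto)
      moreover have "[h \<sigma> = h (b m ^^ e) + h \<tau>] (mod int p)"
        unfolding \<tau>(2) using \<tau>(1) b perm_group_funpow[OF S(1)] by (intro character_comp[OF S(2)]) auto
      moreover have "[h (b m ^^ e) = int e * h (b m)] (mod int p)"
        by (rule character_funpow[OF S(1,2) b(1)])
      ultimately have "[h \<sigma> = int e * h (b m) + 0] (mod int p)"
        by (meson cong_add cong_trans)
      moreover have "[h \<sigma> = 0] (mod int p)" using \<sigma> by (simp add: ker_def)
      ultimately have "[int e * h (b m) = 0] (mod int p)" by (metis add_0_right cong_sym cong_trans)
      then have "int p dvd int e" using nz 2 prime by (simp add: cong_0_iff prime_dvd_mult_iff)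
      moreover have "int (p ^ (m div N)) dvd twist m (b m)"
        by (rule twist_dvd[OF b(2)]) (use N_pos in simp)
      ultimately have "int p * int (p ^ (m div N)) dvd int e * twist m (b m)" by (rule mult_dvd_mono)
      then have e: "[int e * twist m (b m) = 0] (mod modulus m)" by (simp add: cong_0_iff)
      have "[twist m \<sigma> = twist m (b m ^^ e) + twist m \<tau>] (mod modulus m)"
        unfolding \<tau>(2) by (rule character_comp[OF ch]) (use b \<tau>' perm_group_funpow[OF dm] in auto)
      also have "[twist m (b m ^^ e) + twist m \<tau> = 0 + 0] (mod modulus m)"
        by (intro cong_add \<tau>'(2) cong_trans[OF character_funpow[OF dm ch b(2)] e])
      finally show ?thesis using \<sigma> by (simp add: deep_Suc ker_def)
    qed
    then show ?thesis using id \<open>b' q = id\<close> 2 by (auto intro!: exI[of _ 0])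
  next
    case 3
    \<comment> \<open>Below the pivot all generators lie in the kernel, so there S and the kernel
      coincide.\<close>
    have z: "[h \<sigma> = 0] (mod int p)" if "\<sigma> \<in> S \<inter> deep m" for \<sigma>
      by (rule echelon_character[OF S, of m]) (use zero 3 m that in auto)
    have "\<exists>e. \<exists>\<tau>\<in>?K \<inter> deep (Suc m). \<sigma> = b m ^^ e \<circ> \<tau>" if \<sigma>: "\<sigma> \<in> ?K \<inter> deep m" for \<sigma>
    proof -
      from \<sigma> dec[OF m, of \<sigma>] obtain e \<tau> where \<tau>: "\<tau> \<in> S \<inter> deep (Suc m)" "\<sigma> = b m ^^ e \<circ> \<tau>"
        by (auto simp: ker_def)
      then have "\<tau> \<in> ?K" using z[of \<tau>] deep_antimono[of m "Suc m"] by (auto simp: ker_def)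
      with \<tau> show ?thesis by blast
    qed
    then show ?thesis using b z[of "b m"] high[OF 3 m] by (auto simp: ker_def)
  qed
qed

text \<open>For \<open>v \<ge> p\<^sup>i\<close> this is the identity.\<close>

definition rotation :: "nat \<Rightarrow> nat \<Rightarrow> nat \<Rightarrow> nat" where
  "rotation i v z =
     (if z < N \<and> z mod p^i = v then z - z mod p^Suc i + (z mod p^Suc i + p^i) mod p^Suc i else z)"

text \<open>Adding p^i to a residue modulo p^(i+1) wraps around at most once.\<close>

lemma disp_rotation:
  assumes "z < N"
  shows "disp z (rotation i v) =
    (if z mod p^i = v
     then int (p^i) - (if z mod p^Suc i + p^i < p^Suc i then 0 else int (p^Suc i)) else 0)"
proof -
  have le: "z mod p^Suc i \<le> z" by simp
  have lt: "z mod p^Suc i < p^Suc i" "p^i < p^Suc i"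
    using p_pos prime_gt_1_nat[OF prime] by auto
  show ?thesis
  proof (cases "z mod p^Suc i + p^i < p^Suc i")
    case True
    then have "(z mod p^Suc i + p^i) mod p^Suc i = z mod p^Suc i + p^i" by (rule mod_less)
    with assms le True show ?thesis by (simp add: disp_def rotation_def of_nat_diff del: power_Suc)
  next
    case False
    with lt have "(z mod p^Suc i + p^i) mod p^Suc i = z mod p^Suc i + p^i - p^Suc i"
      by (metis add_mono le_mod_geq linorder_not_less mod_less add_less_le_mono less_diff_conv2 less_imp_le)
    then have "rotation i v z = z + p^i - p^Suc i" if "z mod p^i = v"
      using that assms le False unfolding rotation_def by (simp del: power_Suc)
    moreover have "int (z + p^i - p^Suc i) = int z + int (p^i) - int (p^Suc i)"
      using False le by (subst of_nat_diff) linarith+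
    ultimately show ?thesis using False
      by (auto simp: disp_def rotation_def simp del: power_Suc of_nat_power)
  qed
qed

text \<open>Compare displacements at level j: for j < i they vanish modulo p^(j+1); for j = i they
  are p^i or 0 according to the vertex; for j > i the digits that determine them are already known
  to agree.\<close>

lemma rotation_in_\<Gamma>:
  assumes i: "i < k"
  shows "rotation i v \<in> \<Gamma>"
proof -
  have rot: "rotating p k (rotation i v)"
    unfolding rotating_def
  proof (intro conjI allI impI)
    fix z assume z: "z < N"
    let ?Q = "p^Suc i"
    have Q: "?Q > 0" using p_pos by simp
    have dvd: "?Q dvd N" using i by (intro le_imp_power_dvd) simp
    have "z - z mod ?Q = ?Q * (z div ?Q)" by (simp add: minus_mod_eq_mult_div)
    moreover have "(z mod ?Q + p^i) mod ?Q < ?Q" using Q by simp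
    moreover have "?Q * (z div ?Q) + ?Q \<le> N"
    proof -
      have "z div ?Q < N div ?Q" using z dvd Q by (simp add: div_less_iff_less_mult dvd_div_mult_self)
      then have "?Q * (z div ?Q + 1) \<le> ?Q * (N div ?Q)" by (intro mult_le_mono2) simp
      then show ?thesis using dvd by simp
    qed
    ultimately show "rotation i v z < N" using z unfolding rotation_def by auto
  next
    fix j z z' assume j: "j < k" and z: "z < N" "z' < N" and zz: "[z = z'] (mod p^j)"
    have "[disp z (rotation i v) = disp z' (rotation i v)] (mod int (p^Suc j))"
    proof (cases "j < i")
      case True
      have "[disp z (rotation i v) = 0] (mod int (p^Suc j))" if "z < N" for z
      proof -
        have "p^Suc j dvd p^i" "p^Suc j dvd p^Suc i" using True by (simp_all only: le_imp_power_dvd Suc_leI Suc_le_mono less_imp_le)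
        then have "int (p^Suc j) dvd int (p^i)" "int (p^Suc j) dvd int (p^Suc i)"
          by (simp_all only: int_dvd_int_iff)
        then show ?thesis unfolding disp_rotation[OF that] cong_0_iff by simp
      qed
      with z show ?thesis by (meson cong_sym cong_trans)
    next
      case False
      then have same: "z mod p^i = z' mod p^i" using zz cong_power_le[of z z' p j i] by (simp add: cong_def)
      show ?thesis
      proof (cases "j = i")
        case True
        have "[disp z (rotation i v) = (if z mod p^i = v then int (p^i) else 0)] (mod int (p^Suc j))"
          if "z < N" for z
          unfolding disp_rotation[OF that] cong_iff_dvd_diff True by simp
        from this[OF z(1)] this[OF z(2)] same show ?thesis by (metis cong_sym cong_trans)
      next
        case ji: False
        with False have "Suc i \<le> j" by simp
        then have "z mod p^Suc i = z' mod p^Suc i" using zz cong_power_le[of z z' p j "Suc i"] by (simp add: cong_def)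
        with same show ?thesis unfolding disp_rotation[OF z(1)] disp_rotation[OF z(2)] by simp
      qed
    qed
    then show "[int (rotation i v z) - int z = int (rotation i v z') - int z'] (mod int (p^Suc j))"
      unfolding disp_def .
  qed
  moreover have "rotation i v permutes {..<N}"
    by (rule rotating_permutes[OF rot]) (simp add: rotation_def)
  ultimately show ?thesis by (simp add: rot_group_def)
qed

text \<open>For v < p^i the rotation at v has twist p^i, and every twist in \<open>deep m\<close> is
  a multiple of p^i, so a power of the rotation cancels it. For v \<ge> p^i the leaf v lies under
  the vertex v mod p^i, whose pair came earlier, so the twist vanishes already and the identity
  suffices.\<close>

lemma echelon_rotations:
  assumes b: "\<And>m. m < k * N \<Longrightarrow> b m = rotation (m div N) (m mod N)"
  shows "echelon \<Gamma> b"
  unfolding echelon_def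
proof (intro allI impI)
  fix m assume m: "m < k * N"
  define i v where "i = m div N" and "v = m mod N"
  have i: "i < k" using level_less[OF m] by (simp add: i_def)
  have v: "v < N" using N_pos by (simp add: v_def)
  have bm: "b m = rotation i v" using b[OF m] by (simp add: i_def v_def)
  have dm: "perm_group (deep m)" and ch: "character (deep m) (modulus m) (twist m)"
    using m by (intro perm_group_deep character_twist; simp)+
  have modm: "modulus m = int (p ^ Suc i)" by (simp add: i_def)
  have deep: "b m \<in> deep m"
    unfolding deep_def
  proof (intro CollectI conjI allI impI)
    fix l assume l: "l < m"
    have lN: "l mod N < N" using N_pos by simp
    have "l div N \<le> i" unfolding i_def using l by (intro div_le_mono) simp
    then consider "l div N < i" | "l div N = i" "l mod N < v"
      using l unfolding i_def v_def by (metis div_mult_mod_eq le_neq_implies_less nat_add_left_cancel_less)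
    then show "[disp (l mod N) (b m) = 0] (mod int (p ^ Suc (l div N)))"
    proof cases
      case 1
      then have "p^Suc (l div N) dvd p^i" "p^Suc (l div N) dvd p^Suc i"
        by (simp_all only: le_imp_power_dvd Suc_leI Suc_le_mono less_imp_le)
      then have "int (p^Suc (l div N)) dvd int (p^i)" "int (p^Suc (l div N)) dvd int (p^Suc i)"
        by (simp_all only: int_dvd_int_iff)
      then show ?thesis unfolding bm disp_rotation[OF lN] cong_0_iff by simp
    next
      case 2
      then have "(l mod N) mod p^i \<noteq> v" by (metis mod_less_eq_dividend not_le)
      then show ?thesis unfolding bm disp_rotation[OF lN] by simp
    qed
  qed (simp add: bm rotation_in_\<Gamma> i)
  moreover have "\<exists>e. \<exists>\<tau>\<in>\<Gamma> \<inter> deep (Suc m). \<sigma> = b m ^^ e \<circ> \<tau>" if \<sigma>: "\<sigma> \<in> \<Gamma> \<inter> deep m" for \<sigma>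
  proof (cases "v < p^i")
    case True
    have bt: "[twist m (b m) = int (p^i)] (mod modulus m)"
      unfolding modm bm v_def[symmetric] disp_rotation[OF v] cong_iff_dvd_diff using True by simp
    have "int (p^i) dvd twist m \<sigma>"
      using twist_dvd[of \<sigma> m v] \<sigma> v unfolding i_def v_def by blast
    then obtain g where g: "twist m \<sigma> = int (p^i) * g" by blast
    let ?e = "nat (g mod int p)"
    have "int ?e = g mod int p" using p_pos by simp
    then have "[int ?e = g] (mod int p)" by (simp add: cong_def)
    then have ge: "[int ?e * int (p^i) = twist m \<sigma>] (mod modulus m)"
      unfolding g modm cong_iff_dvd_diff
      by (simp add: right_diff_distrib[symmetric] mult.commute[of _ "int p ^ i"])
    let ?\<beta> = "b m ^^ ?e"
    have \<beta>: "?\<beta> \<in> deep m" using perm_group_funpow[OF dm deep] .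
    let ?\<tau> = "pinv ?\<beta> \<circ> \<sigma>"
    have "[twist m ?\<beta> = int ?e * twist m (b m)] (mod modulus m)"
      by (rule character_funpow[OF dm ch deep])
    also have "[int ?e * twist m (b m) = int ?e * int (p^i)] (mod modulus m)"
      by (intro cong_mult cong_refl bt)
    also note ge
    finally have t\<beta>: "[twist m ?\<beta> = twist m \<sigma>] (mod modulus m)" .
    have "[twist m ?\<tau> = twist m (pinv ?\<beta>) + twist m \<sigma>] (mod modulus m)"
      by (rule character_comp[OF ch]) (use \<beta> \<sigma> dm in \<open>auto simp: perm_group_def\<close>)
    also have "[twist m (pinv ?\<beta>) + twist m \<sigma> = - twist m ?\<beta> + twist m \<sigma>] (mod modulus m)"
      by (intro cong_add cong_refl character_inv[OF dm ch \<beta>])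
    also have "[- twist m ?\<beta> + twist m \<sigma> = - twist m \<sigma> + twist m \<sigma>] (mod modulus m)"
      by (intro cong_add cong_refl) (simp only: cong_minus_minus_iff t\<beta>)
    finally have "[twist m ?\<tau> = 0] (mod modulus m)" by simp
    moreover have "?\<tau> \<in> deep m" using \<beta> \<sigma> dm unfolding perm_group_def by auto
    ultimately have "?\<tau> \<in> \<Gamma> \<inter> deep (Suc m)" by (simp add: deep_Suc ker_def) (simp add: deep_def)
    moreover have "\<sigma> = ?\<beta> \<circ> ?\<tau>"
      using \<beta> dm by (auto simp: perm_group_def fun_eq_iff bij_is_surj surj_f_inv_f)
    ultimately show ?thesis by blast
  next
    case False
    let ?v = "v mod p^i"
    have v': "?v < p^i" using p_pos by simp
    with False have "i * N + ?v < m" unfolding i_def v_def by (metis div_mult_mod_eq linorder_not_less nat_add_left_cancel_less order_less_le_trans)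
    moreover have "?v < N" using v by (meson mod_less_eq_dividend le_less_trans)
    then have "(i * N + ?v) mod N = ?v" "(i * N + ?v) div N = i"
      using p_pos by simp_all
    ultimately have "[disp ?v \<sigma> = 0] (mod int (p^Suc i))"
      using \<sigma> unfolding deep_def by (metis (mono_tags, lifting) IntD2 mem_Collect_eq)
    moreover have "[disp v \<sigma> = disp ?v \<sigma>] (mod int (p^Suc i))"
      unfolding disp_def
      by (rule rotating_cong[OF _ i]) (use \<sigma> v v' False in \<open>auto simp: rot_group_def cong_def\<close>)
    ultimately have "[twist m \<sigma> = 0] (mod modulus m)" unfolding modm v_def[symmetric] by (metis cong_trans)
    then have "\<sigma> \<in> \<Gamma> \<inter> deep (Suc m)" using \<sigma> by (simp add: deep_Suc ker_def)
    then show ?thesis by (intro exI[of _ 0] bexI[of _ \<sigma>]) auto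
  qed
  ultimately show "b m \<in> \<Gamma> \<inter> deep m \<and> (\<forall>\<sigma>\<in>\<Gamma> \<inter> deep m. \<exists>e. \<exists>\<tau>\<in>\<Gamma> \<inter> deep (Suc m). \<sigma> = b m ^^ e \<circ> \<tau>)"
    by (auto simp: deep_def)
qed

end

section \<open>Moments of a labelled multiplication\<close>

text \<open>The sum runs over group elements and l names them. So f stays fixed while the labelling
  varies, and a rotation acts by composition with l.\<close>

definition moment :: "nat \<Rightarrow> (nat \<Rightarrow> nat \<Rightarrow> nat) \<Rightarrow> (nat \<Rightarrow> nat) \<Rightarrow> nat \<Rightarrow> nat \<Rightarrow> nat \<Rightarrow> int" where
  "moment n f l a b c = (\<Sum>x<n. \<Sum>y<n. int (l x choose a) * int (l y choose b) * int (l (f x y) choose c))"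

text \<open>The base n digits of t are a, b and c. What matters about this order is that
  componentwise smaller triples come earlier.\<close>

definition nth_moment :: "nat \<Rightarrow> (nat \<Rightarrow> nat \<Rightarrow> nat) \<Rightarrow> nat \<Rightarrow> (nat \<Rightarrow> nat) \<Rightarrow> int" where
  "nth_moment n f t l = moment n f l (t div n div n) (t div n mod n) (t mod n)"

lemma moment_cong:
  assumes "\<And>x y. x < n \<Longrightarrow> y < n \<Longrightarrow> f x y < n" "\<And>x. x < n \<Longrightarrow> l x = l' x"
  shows "moment n f l a b c = moment n f l' a b c"
  unfolding moment_def using assms by (intro sum.cong refl) auto

lemma sum_swap3:
  "(\<Sum>x\<in>X. \<Sum>y\<in>Y. \<Sum>a\<in>A. F x y a) = (\<Sum>a\<in>A. \<Sum>x\<in>X. \<Sum>y\<in>Y. F x y a)"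
proof -
  have "(\<Sum>x\<in>X. \<Sum>y\<in>Y. \<Sum>a\<in>A. F x y a) = (\<Sum>x\<in>X. \<Sum>a\<in>A. \<Sum>y\<in>Y. F x y a)"
    by (intro sum.cong refl sum.swap)
  also have "\<dots> = (\<Sum>a\<in>A. \<Sum>x\<in>X. \<Sum>y\<in>Y. F x y a)" by (rule sum.swap)
  finally show ?thesis .
qed

lemma sum_product3:
  fixes f g h :: "nat \<Rightarrow> int"
  shows "(\<Sum>a\<in>A. f a) * (\<Sum>b\<in>B. g b) * (\<Sum>c\<in>C. h c) = (\<Sum>a\<in>A. \<Sum>b\<in>B. \<Sum>c\<in>C. f a * g b * h c)"
proof -
  have "(\<Sum>a\<in>A. f a) * (\<Sum>b\<in>B. g b) * (\<Sum>c\<in>C. h c) = (\<Sum>a\<in>A. \<Sum>b\<in>B. f a * g b * (\<Sum>c\<in>C. h c))"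
    unfolding sum_product[of f A g B] by (simp only: sum_distrib_right)
  then show ?thesis by (simp only: sum_distrib_left)
qed

lemma moment_reindex:
  assumes "bij_betw \<theta> {..<n} {..<n}"
    and "\<And>x y. x < n \<Longrightarrow> y < n \<Longrightarrow> f' (\<theta> x) (\<theta> y) = \<theta> (f x y)"
  shows "moment n f' l a b c = moment n f (l \<circ> \<theta>) a b c"
proof -
  have "moment n f' l a b c =
    (\<Sum>x<n. \<Sum>y<n. int (l (\<theta> x) choose a) * int (l (\<theta> y) choose b) * int (l (f' (\<theta> x) (\<theta> y)) choose c))"
    unfolding moment_def
    by (subst sum.reindex_bij_betw[OF assms(1), symmetric])
      (intro sum.cong refl sum.reindex_bij_betw[OF assms(1), symmetric])
  then show ?thesis unfolding moment_def by (simp add: assms(2))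
qed

context prime_power
begin

text \<open>Expand each of the three factors by \<open>binomial_rotating\<close>. The quantifiers
  matter: the unitriangular coefficients depend on \<sigma> alone, so they are shared by all
  labellings.\<close>

lemma moment_rotating:
  assumes \<sigma>: "\<sigma> \<in> \<Gamma>"
  shows "\<exists>s. (\<forall>a. s a a = 1) \<and> (\<forall>f l a b c. (\<forall>x<N. l x < N) \<longrightarrow> (\<forall>x<N. \<forall>y<N. f x y < N) \<longrightarrow>
    [moment N f (\<sigma> \<circ> l) a b c =
     (\<Sum>a'\<le>a. \<Sum>b'\<le>b. \<Sum>c'\<le>c. s a a' * s b b' * s c c' * moment N f l a' b' c')] (mod int p))"
proof -
  from \<sigma> have "rotating p k \<sigma>" by (simp add: rot_group_def)
  then have "\<forall>a. \<exists>s. \<forall>z<N. [int (\<sigma> z choose a) - int (z choose a) = (\<Sum>c<a. s c * int (z choose c))] (mod int p)"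
    using binomial_rotating[OF prime] unfolding low_def by blast
  then obtain s where s: "\<And>a z. z < N \<Longrightarrow>
      [int (\<sigma> z choose a) - int (z choose a) = (\<Sum>c<a. s a c * int (z choose c))] (mod int p)" by metis
  define s' where "s' a c = (if c = a then 1 else s a c)" for a c :: nat
  have s': "[int (\<sigma> z choose a) = (\<Sum>c\<le>a. s' a c * int (z choose c))] (mod int p)" if "z < N" for a z
  proof -
    have "[int (\<sigma> z choose a) - int (z choose a) + int (z choose a) =
        (\<Sum>c<a. s a c * int (z choose c)) + int (z choose a)] (mod int p)"
      by (intro cong_add s that cong_refl)
    then show ?thesis by (simp add: s'_def flip: lessThan_Suc_atMost)
  qed
  have "[moment N f (\<sigma> \<circ> l) a b c =
     (\<Sum>a'\<le>a. \<Sum>b'\<le>b. \<Sum>c'\<le>c. s' a a' * s' b b' * s' c c' * moment N f l a' b' c')] (mod int p)"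
    if "\<forall>x<N. l x < N" "\<forall>x<N. \<forall>y<N. f x y < N" for f l a b c
  proof -
    let ?S = "\<lambda>a x. \<Sum>a'\<le>a. s' a a' * int (x choose a')"
    have "[moment N f (\<sigma> \<circ> l) a b c = (\<Sum>x<N. \<Sum>y<N. ?S a (l x) * ?S b (l y) * ?S c (l (f x y)))] (mod int p)"
      unfolding moment_def comp_apply using that by (intro cong_sum cong_mult s') auto
    also have "(\<Sum>x<N. \<Sum>y<N. ?S a (l x) * ?S b (l y) * ?S c (l (f x y))) =
      (\<Sum>x<N. \<Sum>y<N. \<Sum>a'\<le>a. \<Sum>b'\<le>b. \<Sum>c'\<le>c. s' a a' * s' b b' * s' c c' *
        (int (l x choose a') * int (l y choose b') * int (l (f x y) choose c')))"
      unfolding sum_product3 by (intro sum.cong refl) (simp only: mult_ac)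
    also have "\<dots> = (\<Sum>a'\<le>a. \<Sum>x<N. \<Sum>y<N. \<Sum>b'\<le>b. \<Sum>c'\<le>c. s' a a' * s' b b' * s' c c' *
        (int (l x choose a') * int (l y choose b') * int (l (f x y) choose c')))"
      by (rule sum_swap3)
    also have "\<dots> = (\<Sum>a'\<le>a. \<Sum>b'\<le>b. \<Sum>x<N. \<Sum>y<N. \<Sum>c'\<le>c. s' a a' * s' b b' * s' c c' *
        (int (l x choose a') * int (l y choose b') * int (l (f x y) choose c')))"
      by (rule sum.cong[OF refl], rule sum_swap3)
    also have "\<dots> = (\<Sum>a'\<le>a. \<Sum>b'\<le>b. \<Sum>c'\<le>c. \<Sum>x<N. \<Sum>y<N. s' a a' * s' b b' * s' c c' *
        (int (l x choose a') * int (l y choose b') * int (l (f x y) choose c')))"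
      by (rule sum.cong[OF refl], rule sum.cong[OF refl], rule sum_swap3)
    also have "\<dots> = (\<Sum>a'\<le>a. \<Sum>b'\<le>b. \<Sum>c'\<le>c. s' a a' * s' b b' * s' c c' * moment N f l a' b' c')"
      unfolding moment_def by (simp only: sum_distrib_left)
    finally show ?thesis .
  qed
  moreover have "s' a a = 1" for a by (simp add: s'_def)
  ultimately show ?thesis by blast
qed

lemma nth_moment_decode:
  assumes "a < N" "b < N" "c < N"
  shows "nth_moment N f ((a * N + b) * N + c) l = moment N f l a b c"
proof -
  have "((a * N + b) * N + c) div N = a * N + b" "((a * N + b) * N + c) mod N = c"
    "(a * N + b) div N = a" "(a * N + b) mod N = b"
    using assms p_pos by simp_all
  then show ?thesis by (simp add: nth_moment_def)
qed

text \<open>Subtract the two expansions. All terms except the top one compare earlier moments, which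
  agree modulo p, and the top coefficient is 1.\<close>

lemma nth_moment_rotating:
  assumes \<sigma>: "\<sigma> \<in> \<Gamma>" and t: "t < N * N * N"
    and l: "\<forall>x<N. l x < N" "\<forall>x<N. l' x < N" and f: "\<forall>x<N. \<forall>y<N. f x y < N"
    and eq: "\<forall>u<t. [nth_moment N f u l = nth_moment N f u l'] (mod int p)"
  shows "[nth_moment N f t (\<sigma> \<circ> l) - nth_moment N f t l =
    nth_moment N f t (\<sigma> \<circ> l') - nth_moment N f t l'] (mod int p)"
proof -
  define a b c where "a = t div N div N" and "b = t div N mod N" and "c = t mod N"
  have t_eq: "t = (a * N + b) * N + c" unfolding a_def b_def c_def div_mult_mod_eq ..
  have abc: "a < N" "b < N" "c < N"
  proof -
    have "t div N < N * N" using t by (rule less_mult_imp_div_less)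
    then show "a < N" unfolding a_def by (rule less_mult_imp_div_less)
  qed (use N_pos in \<open>simp_all add: b_def c_def\<close>)
  let ?m = "\<lambda>l. moment N f l"
  have nth: "nth_moment N f t l = ?m l a b c" for l by (simp add: nth_moment_def a_def b_def c_def)
  from moment_rotating[OF \<sigma>] obtain s where s1: "\<forall>a. s a a = 1" and
    s0: "\<forall>f l a b c. (\<forall>x<N. l x < N) \<longrightarrow> (\<forall>x<N. \<forall>y<N. f x y < N) \<longrightarrow>
    [moment N f (\<sigma> \<circ> l) a b c =
     (\<Sum>a'\<le>a. \<Sum>b'\<le>b. \<Sum>c'\<le>c. s a a' * s b b' * s c c' * moment N f l a' b' c')] (mod int p)"
    by (elim exE conjE)
  have s: "[?m (\<sigma> \<circ> l) a b c =
     (\<Sum>a'\<le>a. \<Sum>b'\<le>b. \<Sum>c'\<le>c. s a a' * s b b' * s c c' * ?m l a' b' c')] (mod int p)"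
    if "\<forall>x<N. l x < N" for l a b c
    by (rule s0[rule_format, OF that[rule_format] f[rule_format]])
  let ?D = "\<lambda>a b c. ?m l a b c - ?m l' a b c"
  have D0: "[?D a' b' c' = 0] (mod int p)"
    if "a' \<le> a" "b' \<le> b" "c' \<le> c" "\<not> (a' = a \<and> b' = b \<and> c' = c)" for a' b' c'
  proof -
    let ?u = "(a' * N + b') * N + c'"
    have u: "a' < N" "b' < N" "c' < N" using that abc by auto
    have "?u \<le> t" unfolding t_eq using that by (intro add_mono mult_le_mono1) auto
    moreover have "?u \<noteq> t"
    proof
      assume ut: "?u = t"
      have "?u div N = a' * N + b'" "?u mod N = c'" "(a' * N + b') div N = a'" "(a' * N + b') mod N = b'"
        using u p_pos by simp_all
      then have "a' = a" "b' = b" "c' = c" unfolding ut a_def b_def c_def by simp_all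
      with that(4) show False by blast
    qed
    ultimately have "[nth_moment N f ?u l = nth_moment N f ?u l'] (mod int p)" using eq by simp
    then show ?thesis unfolding nth_moment_decode[OF u] cong_iff_dvd_diff by simp
  qed
  have "[?m (\<sigma> \<circ> l) a b c - ?m (\<sigma> \<circ> l') a b c =
      (\<Sum>a'\<le>a. \<Sum>b'\<le>b. \<Sum>c'\<le>c. s a a' * s b b' * s c c' * ?m l a' b' c') -
      (\<Sum>a'\<le>a. \<Sum>b'\<le>b. \<Sum>c'\<le>c. s a a' * s b b' * s c c' * ?m l' a' b' c')] (mod int p)"
    by (intro cong_diff s l)
  also have "(\<Sum>a'\<le>a. \<Sum>b'\<le>b. \<Sum>c'\<le>c. s a a' * s b b' * s c c' * ?m l a' b' c') -
      (\<Sum>a'\<le>a. \<Sum>b'\<le>b. \<Sum>c'\<le>c. s a a' * s b b' * s c c' * ?m l' a' b' c') =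
      (\<Sum>a'\<le>a. \<Sum>b'\<le>b. \<Sum>c'\<le>c. s a a' * s b b' * s c c' * ?D a' b' c')"
    by (simp only: sum_subtractf right_diff_distrib)
  also have "[\<dots> = (\<Sum>a'\<le>a. \<Sum>b'\<le>b. \<Sum>c'\<le>c.
      if a' = a then if b' = b then if c' = c then ?D a b c else 0 else 0 else 0)] (mod int p)"
  proof (intro cong_sum)
    fix a' b' c' assume "a' \<in> {..a}" "b' \<in> {..b}" "c' \<in> {..c}"
    then show "[s a a' * s b b' * s c c' * ?D a' b' c' =
        (if a' = a then if b' = b then if c' = c then ?D a b c else 0 else 0 else 0)] (mod int p)"
      using cong_mult[OF cong_refl[of "s a a' * s b b' * s c c'"] D0[of a' b' c']]
      by (cases "a' = a \<and> b' = b \<and> c' = c") (auto simp: s1)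
  qed
  also have "(\<Sum>a'\<le>a. \<Sum>b'\<le>b. \<Sum>c'\<le>c.
      if a' = a then if b' = b then if c' = c then ?D a b c else 0 else 0 else 0) = ?D a b c"
  proof -
    have "(\<Sum>c'\<le>c. if a' = a then if b' = b then if c' = c then ?D a b c else 0 else 0 else 0) =
      (if a' = a then if b' = b then ?D a b c else 0 else 0)" for a' b' by simp
    moreover have "(\<Sum>b'\<le>b. if a' = a then if b' = b then ?D a b c else 0 else 0) =
      (if a' = a then ?D a b c else 0)" for a' by simp
    ultimately show ?thesis by (simp only: sum.delta finite_atMost atMost_iff order_refl if_True)
  qed
  finally have "[?m (\<sigma> \<circ> l) a b c - ?m (\<sigma> \<circ> l') a b c = ?D a b c] (mod int p)" .
  moreover have "[v - w = v' - w'] (mod m)" if "[v - v' = w - w'] (mod m)" for v v' w w' m :: int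
    using that by (simp add: cong_iff_dvd_diff algebra_simps)
  ultimately show ?thesis unfolding nth by blast
qed

section \<open>Stabilizers of moments and normal labellings\<close>

definition stab :: "(nat \<Rightarrow> nat \<Rightarrow> nat) \<Rightarrow> nat \<Rightarrow> (nat \<Rightarrow> nat) \<Rightarrow> (nat \<Rightarrow> nat) set" where
  "stab f t l = {\<sigma> \<in> \<Gamma>. \<forall>u<t. [nth_moment N f u (\<sigma> \<circ> l) = nth_moment N f u l] (mod int p)}"

definition change :: "(nat \<Rightarrow> nat \<Rightarrow> nat) \<Rightarrow> nat \<Rightarrow> (nat \<Rightarrow> nat) \<Rightarrow> (nat \<Rightarrow> nat) \<Rightarrow> int" where
  "change f t l \<sigma> = nth_moment N f t (\<sigma> \<circ> l) - nth_moment N f t l"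

text \<open>A nonzero character into the integers modulo p is onto, so a moment is either fixed by
  the freedom left or can be moved to zero; in the second case zero is demanded.\<close>

definition normal :: "(nat \<Rightarrow> nat \<Rightarrow> nat) \<Rightarrow> nat \<Rightarrow> (nat \<Rightarrow> nat) \<Rightarrow> bool" where
  "normal f t l \<longleftrightarrow> (\<forall>u<t. [nth_moment N f u l = 0] (mod int p) \<or>
     (\<forall>\<sigma>\<in>stab f u l. [change f u l \<sigma> = 0] (mod int p)))"

lemma stab_0: "stab f 0 l = \<Gamma>"
  by (auto simp: stab_def)

lemma stab_Suc: "stab f (Suc t) l = ker (stab f t l) (int p) (change f t l)"
  by (auto simp: stab_def ker_def change_def less_Suc_eq cong_iff_dvd_diff)

context
  fixes f :: "nat \<Rightarrow> nat \<Rightarrow> nat"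
  assumes f: "\<forall>x<N. \<forall>y<N. f x y < N"
begin

lemma change_cong:
  assumes "\<sigma> \<in> \<Gamma>" "t < N * N * N" "\<forall>x<N. l x < N" "\<forall>x<N. l' x < N"
    and "\<forall>u<t. [nth_moment N f u l = nth_moment N f u l'] (mod int p)"
  shows "[change f t l \<sigma> = change f t l' \<sigma>] (mod int p)"
  unfolding change_def using assms f by (intro nth_moment_rotating)

text \<open>Each stabilizer is the kernel of a character on the previous one, and these characters
  depend on the labelling only through the earlier moments.\<close>

lemma stab_cong:
  assumes "t \<le> N * N * N" "\<forall>x<N. l x < N" "\<forall>x<N. l' x < N"
    and "\<forall>u<t. [nth_moment N f u l = nth_moment N f u l'] (mod int p)"
  shows "stab f t l = stab f t l'"
  using assms(1,4)
proof (induction t)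
  case (Suc t)
  then have IH: "stab f t l = stab f t l'" by simp
  have "[change f t l \<sigma> = change f t l' \<sigma>] (mod int p)" if "\<sigma> \<in> stab f t l" for \<sigma>
    using that Suc.prems assms(2,3) by (intro change_cong) (auto simp: stab_def)
  then show ?case unfolding stab_Suc IH[symmetric] ker_def by (metis (mono_tags, lifting) cong_sym cong_trans)
qed (simp add: stab_0)

lemma range_rotating: "\<sigma> \<in> \<Gamma> \<Longrightarrow> \<forall>x<N. l x < N \<Longrightarrow> \<forall>x<N. (\<sigma> \<circ> l) x < N"
  by (auto simp: rot_group_def intro: rotating_less)

text \<open>An element \<tau> of the stabilizer keeps the earlier moments, so \<sigma> changes the
  next moment of l and of \<tau> \<circ> l by the same amount.\<close>

lemma character_change:
  assumes "t < N * N * N" "\<forall>x<N. l x < N"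
  shows "character (stab f t l) (int p) (change f t l)"
  unfolding character_def
proof (intro ballI)
  fix \<sigma> \<tau> assume \<sigma>: "\<sigma> \<in> stab f t l" and \<tau>: "\<tau> \<in> stab f t l"
  have "[change f t (\<tau> \<circ> l) \<sigma> = change f t l \<sigma>] (mod int p)"
    using \<sigma> \<tau> assms range_rotating by (intro change_cong) (auto simp: stab_def)
  from cong_add[OF this cong_refl[of "change f t l \<tau>"]]
  show "[change f t l (\<sigma> \<circ> \<tau>) = change f t l \<sigma> + change f t l \<tau>] (mod int p)"
    by (simp add: change_def comp_assoc)
qed

lemma perm_group_stab: "t \<le> N * N * N \<Longrightarrow> \<forall>x<N. l x < N \<Longrightarrow> perm_group (stab f t l)"
proof (induction t)
  case 0
  then show ?case by (simp add: stab_0 perm_group_rot_group)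
next
  case (Suc t)
  then show ?case unfolding stab_Suc by (intro perm_group_ker character_change) auto
qed

text \<open>While the earlier moments agree, both labellings have the same stabilizer and the same
  character on it. If the character is trivial, the moment is the same for both, because the element
  that links them lies in the stabilizer; otherwise both moments are zero.\<close>

lemma normal_unique:
  assumes l: "\<forall>x<N. l x < N" and norm: "normal f (N * N * N) l" "normal f (N * N * N) l'"
    and \<sigma>: "\<sigma> \<in> \<Gamma>" "\<forall>x<N. l' x = \<sigma> (l x)" and "u < N * N * N"
  shows "[nth_moment N f u l = nth_moment N f u l'] (mod int p)"
  using assms(6)
proof (induction u rule: less_induct)
  case (less u)
  have l': "\<forall>x<N. l' x < N" using range_rotating[OF \<sigma>(1) l] \<sigma>(2) by simp
  have l'_eq: "nth_moment N f u l' = nth_moment N f u (\<sigma> \<circ> l)" for u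
    unfolding nth_moment_def using f \<sigma>(2) by (intro moment_cong) auto
  have eq: "\<forall>v<u. [nth_moment N f v l = nth_moment N f v l'] (mod int p)" using less by auto
  then have "\<sigma> \<in> stab f u l" using \<sigma>(1) unfolding stab_def l'_eq by (auto intro: cong_sym)
  show ?case
  proof (cases "\<forall>\<sigma>\<in>stab f u l. [change f u l \<sigma> = 0] (mod int p)")
    case True
    with \<open>\<sigma> \<in> stab f u l\<close> have "[change f u l \<sigma> = 0] (mod int p)" by blast
    then show ?thesis unfolding l'_eq change_def by (simp add: cong_iff_dvd_diff dvd_diff_commute)
  next
    case False
    then obtain \<tau> where \<tau>: "\<tau> \<in> stab f u l" "\<not> [change f u l \<tau> = 0] (mod int p)" by blast
    have "stab f u l = stab f u l'" by (rule stab_cong) (use less.prems l l' eq in auto)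
    moreover have "[change f u l \<tau> = change f u l' \<tau>] (mod int p)"
      using \<tau>(1) less.prems l l' eq by (intro change_cong) (auto simp: stab_def)
    ultimately have "\<tau> \<in> stab f u l'" "\<not> [change f u l' \<tau> = 0] (mod int p)"
      using \<tau> by (auto dest: cong_trans)
    then have "[nth_moment N f u l = 0] (mod int p)" "[nth_moment N f u l' = 0] (mod int p)"
      using norm \<tau> less.prems unfolding normal_def by blast+
    then show ?thesis by (metis cong_sym cong_trans)
  qed
qed

text \<open>One round of the algorithm in abstract form. The pivot q is the last generator that
  changes moment t, with q = k N if there is none. A power of it brings the moment to zero, and
  others correct the generators before it. Everything about earlier moments carries over, as l'
  arises from l by an element of the stabilizer.\<close>

lemma normal_step:
  assumes t: "t < N * N * N" and l: "\<forall>x<N. l x < N"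
    and b: "echelon (stab f t l) b" and norm: "normal f t l" and q: "q \<le> k * N"
    and q_moves: "q < k * N \<Longrightarrow> \<not> [change f t l (b q) = 0] (mod int p)"
    and last: "\<And>m. m < k * N \<Longrightarrow> q < m \<or> q = k * N \<Longrightarrow> [change f t l (b m) = 0] (mod int p)"
    and l': "q < k * N \<Longrightarrow> \<exists>r. \<forall>x<N. l' x = (b q ^^ r) (l x)" "q = k * N \<Longrightarrow> \<forall>x<N. l' x = l x"
      "q < k * N \<Longrightarrow> [nth_moment N f t l' = 0] (mod int p)"
    and b': "\<And>m. m < q \<Longrightarrow> q < k * N \<Longrightarrow> \<exists>c. b' m = b q ^^ c \<circ> b m"
      "\<And>m. m < q \<Longrightarrow> q < k * N \<Longrightarrow> [change f t l' (b' m) = 0] (mod int p)"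
      "q < k * N \<Longrightarrow> b' q = id" "\<And>m. q < m \<or> q = k * N \<Longrightarrow> m < k * N \<Longrightarrow> b' m = b m"
  shows "echelon (stab f (Suc t) l') b'" "normal f (Suc t) l'" "\<exists>\<sigma>\<in>\<Gamma>. \<forall>x<N. l' x = \<sigma> (l x)"
proof -
  have S: "perm_group (stab f t l)" "character (stab f t l) (int p) (change f t l)"
    using t l by (auto intro: perm_group_stab character_change)
  have sub: "stab f t l \<subseteq> \<Gamma>" by (auto simp: stab_def)
  obtain \<sigma> where \<sigma>: "\<sigma> \<in> stab f t l" "\<forall>x<N. l' x = \<sigma> (l x)"
  proof (cases "q < k * N")
    case True
    then have "b q \<in> stab f t l" using b unfolding echelon_def by blast
    with l'(1)[OF True] that perm_group_funpow[OF S(1)] show ?thesis by blast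
  next
    case False
    with l'(2) q that[of id] S(1) show ?thesis by (auto simp: perm_group_def)
  qed
  with sub show "\<exists>\<sigma>\<in>\<Gamma>. \<forall>x<N. l' x = \<sigma> (l x)" by blast
  have l'N: "\<forall>x<N. l' x < N" using range_rotating[of \<sigma> l] \<sigma> sub l by auto
  have l'_eq: "nth_moment N f u l' = nth_moment N f u (\<sigma> \<circ> l)" for u
    unfolding nth_moment_def using f \<sigma>(2) by (intro moment_cong) auto
  have eq: "\<forall>u<t. [nth_moment N f u l = nth_moment N f u l'] (mod int p)"
    using \<sigma>(1) unfolding stab_def l'_eq by (auto intro: cong_sym)
  have stab_eq: "stab f u l' = stab f u l" if "u \<le> t" for u
    by (rule stab_cong[symmetric]) (use that t l l'N eq in auto)
  have change_eq: "[change f u l \<tau> = change f u l' \<tau>] (mod int p)" if "\<tau> \<in> \<Gamma>" "u \<le> t" for u \<tau>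
    by (rule change_cong) (use that t l l'N eq in auto)
  have ker_eq: "stab f (Suc t) l' = ker (stab f t l) (int p) (change f t l)"
    unfolding stab_Suc stab_eq[OF order_refl] ker_def
    using change_eq[OF _ order_refl] sub by (auto dest: cong_trans intro: cong_trans[OF cong_sym])
  have bm: "b m \<in> stab f t l" if "m < k * N" for m using b that unfolding echelon_def by blast
  show "echelon (stab f (Suc t) l') b'"
  proof (cases "q < k * N")
    case True
    have "[change f t l (b' m) = 0] (mod int p)" if m: "m < q" for m
    proof -
      from b'(1)[OF m True] obtain c where "b' m = b q ^^ c \<circ> b m" by blast
      then have "b' m \<in> \<Gamma>"
        using sub bm[of m] bm[of q] m True perm_group_funpow[OF S(1)] S(1) unfolding perm_group_def by auto
      from cong_trans[OF change_eq[OF this order_refl] b'(2)[OF m True]] show ?thesis .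
    qed
    then show ?thesis unfolding ker_eq
      using True q_moves last b' by (intro echelon_ker[OF S b True]) auto
  next
    case False
    with q have qN: "q = k * N" by simp
    have "ker (stab f t l) (int p) (change f t l) = stab f t l"
      using last qN by (intro echelon_trivial[OF S(1) sub S(2) b]) auto
    then show ?thesis using b b'(4) qN unfolding ker_eq echelon_def by auto
  qed
  have "[nth_moment N f t l' = 0] (mod int p) \<or> (\<forall>\<sigma>\<in>stab f t l'. [change f t l' \<sigma> = 0] (mod int p))"
  proof (cases "q < k * N")
    case True
    then show ?thesis using l'(3) by simp
  next
    case False
    with q have qN: "q = k * N" by simp
    have "ker (stab f t l) (int p) (change f t l) = stab f t l"
      using last qN by (intro echelon_trivial[OF S(1) sub S(2) b]) auto
    then have "stab f (Suc t) l' = stab f t l'" unfolding ker_eq stab_eq[OF order_refl] .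
    then show ?thesis unfolding stab_Suc ker_def by blast
  qed
  moreover have "[nth_moment N f u l' = 0] (mod int p) \<or> (\<forall>\<sigma>\<in>stab f u l'. [change f u l' \<sigma> = 0] (mod int p))"
    if "u < t" for u
  proof -
    from norm that consider "[nth_moment N f u l = 0] (mod int p)"
      | "\<forall>\<sigma>\<in>stab f u l. [change f u l \<sigma> = 0] (mod int p)" unfolding normal_def by blast
    then show ?thesis
    proof cases
      case 1
      then show ?thesis using eq that by (metis cong_sym cong_trans)
    next
      case 2
      then have "\<forall>\<sigma>\<in>stab f u l'. [change f u l' \<sigma> = 0] (mod int p)"
        unfolding stab_eq[OF less_imp_le[OF that]]
        using change_eq[OF _ less_imp_le[OF that]] by (auto simp: stab_def intro: cong_trans[OF cong_sym])
      then show ?thesis by blast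
    qed
  qed
  ultimately show "normal f (Suc t) l'" unfolding normal_def less_Suc_eq by blast
qed

end

section \<open>The moments determine the multiplication\<close>

lemma binomial_moments_zero:
  assumes "\<And>a. a < n \<Longrightarrow> [(\<Sum>z<n. g z * int (z choose a)) = 0] (mod m)" and "z < n"
  shows "[g z = 0] (mod m)"
proof -
  have "\<forall>z. a \<le> z \<longrightarrow> z < n \<longrightarrow> [g z = 0] (mod m)" if "a \<le> n" for a
    using that
  proof (induction a rule: inc_induct)
    case (step a)
    \<comment> \<open>Terms with z < a vanish because z choose a is zero, those with z > a by the
      downward induction; the remaining coefficient is a choose a = 1.\<close>
    have "[(\<Sum>z\<in>{..<n} - {a}. g z * int (z choose a)) = (\<Sum>z\<in>{..<n} - {a}. 0)] (mod m)"
    proof (intro cong_sum)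
      fix z assume "z \<in> {..<n} - {a}"
      then show "[g z * int (z choose a) = 0] (mod m)"
        using step.IH by (cases "z < a") (auto simp: binomial_eq_0 cong_0_iff)
    qed
    moreover have "(\<Sum>z<n. g z * int (z choose a)) = g a + (\<Sum>z\<in>{..<n} - {a}. g z * int (z choose a))"
      using step.hyps by (subst sum.remove[of _ a]) auto
    ultimately have "[g a = 0] (mod m)"
      using assms(1)[OF step.hyps(2)] by (simp add: cong_0_iff dvd_add_left_iff)
    then show ?case using step.IH by (metis Suc_leI le_neq_implies_less)
  qed simp
  from this[of 0] assms(2) show ?thesis by simp
qed

text \<open>Inverting the triangular systems for a and b leaves, for every pair of labels, the
  coefficients (value choose c) modulo p. If two values differed, taking the larger one for c would
  give 1 on one side and 0 on the other.\<close>

lemma moments_determine: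
  assumes f: "\<forall>x<N. \<forall>y<N. f x y < N" "\<forall>x<N. \<forall>y<N. f' x y < N"
    and l: "bij_betw l {..<N} {..<N}" "bij_betw l' {..<N} {..<N}"
    and eq: "\<forall>u<N * N * N. [nth_moment N f u l = nth_moment N f' u l'] (mod int p)"
    and xy: "x < N" "y < N" "x' < N" "y' < N" "l x = l' x'" "l y = l' y'"
  shows "l (f x y) = l' (f' x' y')"
proof -
  define M :: "(nat \<Rightarrow> nat \<Rightarrow> nat) \<Rightarrow> (nat \<Rightarrow> nat) \<Rightarrow> nat \<Rightarrow> nat \<Rightarrow> nat" where "M f l z w = l (f (inv_into {..<N} l z) (inv_into {..<N} l w))" for f l z w
  have moment_M: "moment N f l a b c = (\<Sum>z<N. (\<Sum>w<N. int (M f l z w choose c) * int (w choose b)) * int (z choose a))"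
    if l: "bij_betw l {..<N} {..<N}" for f l a b c
  proof -
    have inv: "inv_into {..<N} l (l x) = x" if "x < N" for x
      using l that by (simp add: bij_betw_def)
    have "(\<Sum>z<N. (\<Sum>w<N. int (M f l z w choose c) * int (w choose b)) * int (z choose a)) =
        (\<Sum>x<N. (\<Sum>y<N. int (M f l (l x) (l y) choose c) * int (l y choose b)) * int (l x choose a))"
      by (subst sum.reindex_bij_betw[OF l, symmetric])
        (intro sum.cong refl arg_cong2[where f = "(*)"] sum.reindex_bij_betw[OF l, symmetric])
    also have "\<dots> = moment N f l a b c"
      unfolding moment_def by (intro sum.cong refl) (simp add: M_def inv sum_distrib_left sum_distrib_right mult_ac)
    finally show ?thesis by simp
  qed
  have M_less: "M f l z w < N" if "bij_betw l {..<N} {..<N}" "\<forall>x<N. \<forall>y<N. f x y < N" "z < N" "w < N" for f l z w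
  proof -
    have "inv_into {..<N} l z < N" "inv_into {..<N} l w < N"
      using inv_into_into[of z l "{..<N}"] inv_into_into[of w l "{..<N}"] that by (auto simp: bij_betw_def)
    then show ?thesis using that unfolding M_def by (auto simp: bij_betw_def)
  qed
  let ?g = "\<lambda>c z w. int (M f l z w choose c) - int (M f' l' z w choose c)"
  have z: "[?g c z w = 0] (mod int p)" if "c < N" "z < N" "w < N" for c z w
  proof (rule binomial_moments_zero[of N "\<lambda>w. ?g c z w"])
    fix b assume b: "b < N"
    show "[(\<Sum>w<N. ?g c z w * int (w choose b)) = 0] (mod int p)"
    proof (rule binomial_moments_zero[of N "\<lambda>z. \<Sum>w<N. ?g c z w * int (w choose b)"])
      fix a assume a: "a < N"
      have "(a * N + b) * N + c < N * N * N"
      proof -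
        have "(a * N + b) * N + c < (a * N + b + 1) * N" using that(1) by simp
        also have "\<dots> \<le> (a * N + N) * N" using b by (intro mult_le_mono1) simp
        also have "\<dots> = (a + 1) * N * N" by (simp add: algebra_simps)
        also have "\<dots> \<le> N * N * N" using a by (intro mult_le_mono1) simp
        finally show ?thesis .
      qed
      with eq have "[nth_moment N f ((a * N + b) * N + c) l = nth_moment N f' ((a * N + b) * N + c) l'] (mod int p)"
        by blast
      then have "[moment N f l a b c - moment N f' l' a b c = 0] (mod int p)"
        unfolding nth_moment_decode[OF a b that(1)] by (simp add: cong_iff_dvd_diff)
      then show "[(\<Sum>z<N. (\<Sum>w<N. ?g c z w * int (w choose b)) * int (z choose a)) = 0] (mod int p)"
        unfolding moment_M[OF l(1)] moment_M[OF l(2)]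
        by (simp only: sum_subtractf left_diff_distrib)
    qed (use that in auto)
  qed (use that in auto)
  let ?z = "l x" and ?w = "l y"
  have zw: "?z < N" "?w < N" using bij_betwE[OF l(1)] xy(1,2) by auto
  have "inv_into {..<N} l ?z = x" "inv_into {..<N} l ?w = y"
    using inv_into_f_f[OF bij_betw_imp_inj_on[OF l(1)]] xy(1,2) by blast+
  then have M1: "M f l ?z ?w = l (f x y)" by (simp add: M_def)
  have "inv_into {..<N} l' ?z = x'" "inv_into {..<N} l' ?w = y'"
    unfolding xy(5,6) using inv_into_f_f[OF bij_betw_imp_inj_on[OF l(2)]] xy(3,4) by blast+
  then have M2: "M f' l' ?z ?w = l' (f' x' y')" by (simp add: M_def)
  have lt: "M f l ?z ?w < N" "M f' l' ?z ?w < N" using M_less l f zw by auto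
  have one: "\<not> [(1 :: int) = 0] (mod int p)" "\<not> [(-1 :: int) = 0] (mod int p)"
    using prime_gt_1_nat[OF prime] by (simp_all add: cong_0_iff)
  show ?thesis
  proof (rule ccontr)
    assume "l (f x y) \<noteq> l' (f' x' y')"
    then consider "M f l ?z ?w < M f' l' ?z ?w" | "M f' l' ?z ?w < M f l ?z ?w"
      unfolding M1 M2 by linarith
    then show False
    proof cases
      case 1
      with z[OF lt(2) zw] one show False by (simp add: binomial_eq_0)
    next
      case 2
      with z[OF lt(1) zw] one show False by (simp add: binomial_eq_0)
    qed
  qed
qed

lemma normal_transport:
  assumes \<theta>: "bij_betw \<theta> {..<N} {..<N}"
    and hom: "\<And>x y. x < N \<Longrightarrow> y < N \<Longrightarrow> f' (\<theta> x) (\<theta> y) = \<theta> (f x y)"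
  shows "normal f' t l \<longleftrightarrow> normal f t (l \<circ> \<theta>)"
proof -
  have nth: "nth_moment N f' u l = nth_moment N f u (l \<circ> \<theta>)" for u l
    unfolding nth_moment_def using moment_reindex[of \<theta> N f' f] \<theta> hom by blast
  show ?thesis unfolding normal_def stab_def change_def nth comp_assoc ..
qed

end

section \<open>Subgroup chains with cyclic factors\<close>

lemma prime_power_dvd_not_one:
  assumes "prime (p::nat)" "d dvd p ^ i" "d \<noteq> 1"
  shows "p dvd d"
proof -
  from assms(1,2) obtain j where "d = p ^ j" using divides_primepow_nat[of p d i] by auto
  with assms(3) show ?thesis by (cases j) auto
qed

context group
begin

lemma subgroup_of_finite:
  assumes fin: "finite (carrier G)" and "H \<subseteq> carrier G" "\<one> \<in> H"
    and closed: "\<And>x y. x \<in> H \<Longrightarrow> y \<in> H \<Longrightarrow> x \<otimes> y \<in> H"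
  shows "subgroup H G"
proof (rule subgroupI)
  fix a assume a: "a \<in> H"
  have pow: "a [^] (n::nat) \<in> H" for n
    by (induction n) (use a assms in auto)
  have aG: "a \<in> carrier G" using a assms by auto
  have "order G > 0" using fin by (simp add: order_gt_0_iff_finite)
  then have "a [^] (order G - 1) \<otimes> a = \<one>"
    using pow_order_eq_1[OF aG] by (metis Suc_diff_1 nat_pow_Suc)
  then have "inv a = a [^] (order G - 1)"
    using aG by (metis inv_equality nat_pow_closed)
  with pow show "inv a \<in> H" by simp
qed (use assms in auto)

text \<open>The group \<open>H\<close> permutes its right cosets; a fixed coset other than \<open>H\<close> gives a
  normalizing element outside \<open>H\<close>.\<close>

lemma normalizer_grows:
  assumes fin: "finite (carrier G)" and p: "prime p" and G: "order G = p ^ k"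
    and H: "subgroup H G" "card H = p ^ i" and i: "i < k"
  shows "\<exists>x\<in>carrier G - H. \<forall>u\<in>H. \<exists>v\<in>H. u \<otimes> x = x \<otimes> v"
proof -
  let ?H = "G\<lparr>carrier := H\<rparr>"
  let ?E = "rcosets H"
  \<comment> \<open>The inverse turns right multiplication into a left action.\<close>
  let ?\<phi> = "\<lambda>n. \<lambda>M\<in>?E. M #> inv n"
  have HG: "H \<subseteq> carrier G" using H(1) by (rule subgroup.subset)
  interpret H: group ?H using H(1) by (rule subgroup_imp_group)
  have closed: "M #> inv n \<in> ?E" if M: "M \<in> ?E" "n \<in> H" for M n
  proof -
    obtain x where x: "x \<in> carrier G" "M = H #> x" using M(1) unfolding RCOSETS_def by auto
    have "n \<in> carrier G" using M(2) HG by auto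
    then have "M #> inv n = H #> (x \<otimes> inv n)" "x \<otimes> inv n \<in> carrier G"
      unfolding x(2) using x(1) HG by (simp_all add: coset_mult_assoc)
    then show ?thesis unfolding RCOSETS_def by auto
  qed
  have inv_inv: "(M #> inv n) #> n = M" "(M #> n) #> inv n = M" if "M \<in> ?E" "n \<in> H" for M n
  proof -
    have "M \<subseteq> carrier G" using that(1) rcosets_part_G[OF H(1)] by auto
    then show "(M #> inv n) #> n = M" "(M #> n) #> inv n = M"
      using that(2) HG by (auto simp: coset_mult_assoc subset_iff)
  qed
  have closed': "M #> n \<in> ?E" if "M \<in> ?E" "n \<in> H" for M n
    using closed[OF that(1), of "inv n"] that(2) HG H(1) by (auto simp: subgroup.m_inv_closed subset_iff)
  have bij: "?\<phi> n \<in> Bij ?E" if n: "n \<in> H" for n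
    unfolding Bij_def
  proof (intro IntI CollectI)
    show "bij_betw (?\<phi> n) ?E ?E"
      by (rule bij_betw_byWitness[where f' = "\<lambda>M. M #> n"]) (use n closed closed' inv_inv in auto)
  qed simp
  interpret act: group_action ?H ?E ?\<phi>
    unfolding group_action_def group_hom_def group_hom_axioms_def
  proof (intro conjI homI)
    show "group ?H" by (rule H.is_group)
    show "group (BijGroup ?E)" by (rule group_BijGroup)
    fix n assume n: "n \<in> carrier ?H"
    then show "?\<phi> n \<in> carrier (BijGroup ?E)" using bij by (simp add: BijGroup_def)
    fix m assume m: "m \<in> carrier ?H"
    have "M #> inv (n \<otimes> m) = (M #> inv m) #> inv n" if "M \<in> ?E" for M
    proof -
      have "M \<subseteq> carrier G" using that rcosets_part_G[OF H(1)] by auto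
      then show ?thesis using m n HG by (auto simp: coset_mult_assoc subset_iff inv_mult_group)
    qed
    then show "?\<phi> (n \<otimes>\<^bsub>?H\<^esub> m) = ?\<phi> n \<otimes>\<^bsub>BijGroup ?E\<^esub> ?\<phi> m"
      using bij n m closed by (auto simp: BijGroup_def compose_def restrict_def fun_eq_iff)
  qed
  have finE: "finite ?E"
    using rcosets_subset_PowG[OF H(1)] fin by (meson finite_Pow_iff finite_subset)
  have "p ^ (k - i) * p ^ i = p ^ k" using i by (simp flip: power_add)
  moreover have "card ?E * p ^ i = p ^ k" using lagrange[OF H(1)] G H(2) by simp
  ultimately have "card ?E * p ^ i = p ^ (k - i) * p ^ i" by simp
  then have cardE: "card ?E = p ^ (k - i)" using prime_gt_0_nat[OF p] by simp
  have orb: "card (orbit ?H ?\<phi> M) dvd p ^ i" if "M \<in> ?E" for M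
  proof -
    have "order ?H = p ^ i" using H(2) by (simp add: order_def)
    with act.orbit_stabilizer_theorem[OF that] show ?thesis by (metis dvd_triv_left)
  qed
  have M0: "H \<in> ?E" using subgroup.subgroup_in_rcosets[OF H(1) is_group] .
  \<comment> \<open>Orbits have sizes dividing p^i, and the number p^(k-i) of cosets is divisible by
    p. If H were the only fixed coset, the sizes would add up to 1 modulo p.\<close>
  have "\<exists>M\<in>?E. M \<noteq> H \<and> (\<forall>n\<in>H. M #> inv n = M)"
  proof (rule ccontr)
    assume none: "\<not> ?thesis"
    let ?O = "orbits ?H ?E ?\<phi>"
    have H0: "orbit ?H ?\<phi> H = {H}"
    proof -
      have "H #> inv n = H" if "n \<in> H" for n
        using that H(1) HG by (intro coset_join2) (auto simp: subgroup.m_inv_closed)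
      then show ?thesis using M0 H.one_closed unfolding orbit_def by auto
    qed
    then have O0: "{H} \<in> ?O" 
      unfolding orbits_def by (intro CollectI exI[of _ H]) (simp add: M0 H0)
    have other: "p dvd card X" if "X \<in> ?O - {{H}}" for X
    proof -
      from that obtain M where M: "M \<in> ?E" "X = orbit ?H ?\<phi> M" unfolding orbits_def by auto
      with H0 that have "M \<noteq> H" by auto
      with none M(1) obtain n where n: "n \<in> H" "M #> inv n \<noteq> M" by blast
      have "M \<in> X" unfolding M(2) by (rule act.orbit_refl[OF M(1)])
      moreover have "M #> inv n \<in> X" unfolding M(2) orbit_def using n M(1) by auto
      ultimately have "card X \<noteq> 1" using n(2) by (auto simp: card_1_singleton_iff)
      then show ?thesis using orb[OF M(1)] M(2) p by (auto intro: prime_power_dvd_not_one)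
    qed
    have finO: "finite ?O" using finE unfolding orbits_def Setcompr_eq_image by (rule finite_imageI)
    have "(\<Sum>X\<in>?O. card X) = card ?E"
      using act.disjoint_sum[OF finE, of "\<lambda>_. 1 :: nat"] by simp
    moreover have "(\<Sum>X\<in>?O. card X) = card {H} + (\<Sum>X\<in>?O - {{H}}. card X)"
      using O0 finO by (subst sum.remove[of _ "{H}"]) auto
    moreover have "p dvd (\<Sum>X\<in>?O - {{H}}. card X)" by (rule dvd_sum) (rule other)
    moreover have "p dvd card ?E" unfolding cardE using i by (intro dvd_power) simp
    ultimately have "p dvd card {H}" by (metis dvd_add_left_iff)
    then show False using prime_gt_1_nat[OF p] by simp
  qed
  then obtain g where g: "g \<in> carrier G" "H #> g \<noteq> H" "\<forall>n\<in>H. (H #> g) #> inv n = H #> g"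
    unfolding RCOSETS_def by auto
  have gH: "g \<notin> H" using g(2) H(1) coset_join2[OF g(1) H(1)] by blast
  \<comment> \<open>That H g is fixed means that g u = v g with v in H for every u in H; read as u
    times the inverse of g, this is the normalizing condition for the inverse.\<close>
  have "inv g \<in> carrier G - H"
    using gH g(1) H(1) by (auto dest: subgroup.m_inv_closed)
  moreover have "\<exists>v\<in>H. u \<otimes> inv g = inv g \<otimes> v" if u: "u \<in> H" for u
  proof -
    have uG: "u \<in> carrier G" using u HG by auto
    have "(H #> g) #> inv (inv u) = H #> g" using g(3) u H(1) by (auto dest: subgroup.m_inv_closed)
    then have "H #> (g \<otimes> u) = H #> g" using uG g(1) HG by (simp add: coset_mult_assoc)
    then have "g \<otimes> u \<in> H #> g" using rcos_self[OF _ H(1), of "g \<otimes> u"] g(1) uG by auto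
    then obtain v where v: "v \<in> H" "g \<otimes> u = v \<otimes> g" unfolding r_coset_def by auto
    have vG: "v \<in> carrier G" using v(1) HG by auto
    have "g \<otimes> (u \<otimes> inv g) = g \<otimes> (inv g \<otimes> v)"
      using v(2) vG uG g(1) by (simp add: m_assoc[symmetric]) (simp add: m_assoc)
    with v(1) show ?thesis using uG vG g(1) by (intro bexI[of _ v]) auto
  qed
  ultimately show ?thesis by blast
qed

end

text \<open>The label of the group element \<open>x\<^sub>i\<^sub>-\<^sub>1\<^bsup>e\<^esup> \<dots> x\<^sub>0\<^bsup>e'\<^esup>\<close> has the base \<open>p\<close> digits \<open>e, \<dots>, e'\<close>,
  the least significant one first.\<close>

fun elem :: "('a, 'b) monoid_scheme \<Rightarrow> nat \<Rightarrow> (nat \<Rightarrow> 'a) \<Rightarrow> nat \<Rightarrow> nat \<Rightarrow> 'a" where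
  "elem G p x 0 z = \<one>\<^bsub>G\<^esub>"
| "elem G p x (Suc i) z = x i [^]\<^bsub>G\<^esub> (z mod p) \<otimes>\<^bsub>G\<^esub> elem G p x i (z div p)"

definition elems :: "('a, 'b) monoid_scheme \<Rightarrow> nat \<Rightarrow> (nat \<Rightarrow> 'a) \<Rightarrow> nat \<Rightarrow> 'a set" where
  "elems G p x i = elem G p x i ` {..<p^i}"

text \<open>A polycyclic sequence in which each \<open>elems\<close> is normal of index p in the
  next. Normality is expressed without inverses so that a program can test it by table
  lookups.\<close>

definition chain :: "('a, 'b) monoid_scheme \<Rightarrow> nat \<Rightarrow> (nat \<Rightarrow> 'a) \<Rightarrow> nat \<Rightarrow> bool" where
  "chain G p x i \<longleftrightarrow> (\<forall>j<i. x j \<in> carrier G \<and> x j \<notin> elems G p x j \<and> x j [^]\<^bsub>G\<^esub> p \<in> elems G p x j \<and>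
     (\<forall>u\<in>elems G p x j. \<exists>v\<in>elems G p x j. u \<otimes>\<^bsub>G\<^esub> x j = x j \<otimes>\<^bsub>G\<^esub> v))"

lemma elem_cong: "(\<And>j. j < i \<Longrightarrow> x j = y j) \<Longrightarrow> elem G p x i z = elem G p y i z"
  by (induction i arbitrary: z) auto

lemma elems_cong: "(\<And>j. j < i \<Longrightarrow> x j = y j) \<Longrightarrow> elems G p x i = elems G p y i"
  unfolding elems_def using elem_cong[of i x y G p] by simp

lemma chain_cong:
  assumes "\<And>j. j < i \<Longrightarrow> x j = y j"
  shows "chain G p x i \<longleftrightarrow> chain G p y i"
proof -
  have "elems G p x j = elems G p y j" if "j < i" for j
    using that assms by (intro elems_cong) auto
  with assms show ?thesis unfolding chain_def by simp
qed

lemma elem_Suc_digit: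
  "e < p \<Longrightarrow> elem G p x (Suc i) (e + p * z) = x i [^]\<^bsub>G\<^esub> e \<otimes>\<^bsub>G\<^esub> elem G p x i z"
  by simp

lemma digit_split: "p > 0 \<Longrightarrow> z < p ^ Suc i \<Longrightarrow> \<exists>e u. z = e + p * u \<and> e < p \<and> u < p ^ i" for p :: nat
  by (intro exI[of _ "z mod p"] exI[of _ "z div p"])
    (auto simp: less_mult_imp_div_less mult.commute)

lemma digit_join: "e < p \<Longrightarrow> u < p ^ i \<Longrightarrow> e + p * u < p ^ Suc i" for p :: nat
proof -
  assume "e < p" "u < p ^ i"
  then have "e + p * u < p * (u + 1)" "u + 1 \<le> p ^ i" by simp_all
  then have "e + p * u < p * p ^ i" by (meson less_le_trans mult_le_mono2)
  then show ?thesis by simp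
qed

lemma elems_Suc:
  assumes "p > 0"
  shows "elems G p x (Suc i) = {x i [^]\<^bsub>G\<^esub> e \<otimes>\<^bsub>G\<^esub> u |e u. e < p \<and> u \<in> elems G p x i}"
proof (intro equalityI subsetI)
  fix a assume "a \<in> elems G p x (Suc i)"
  then obtain z where z: "z < p ^ Suc i" "a = elem G p x (Suc i) z" unfolding elems_def by auto
  from digit_split[OF assms z(1)] obtain e u where "z = e + p * u" "e < p" "u < p ^ i" by blast
  then show "a \<in> {x i [^]\<^bsub>G\<^esub> e \<otimes>\<^bsub>G\<^esub> u |e u. e < p \<and> u \<in> elems G p x i}"
    using z(2) unfolding elems_def by (auto simp only: elem_Suc_digit)
next
  fix a assume "a \<in> {x i [^]\<^bsub>G\<^esub> e \<otimes>\<^bsub>G\<^esub> u |e u. e < p \<and> u \<in> elems G p x i}"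
  then obtain e u where eu: "a = x i [^]\<^bsub>G\<^esub> e \<otimes>\<^bsub>G\<^esub> elem G p x i u" "e < p" "u < p ^ i"
    unfolding elems_def by auto
  then have "a = elem G p x (Suc i) (e + p * u)"
    by (simp only: elem_Suc_digit)
  then show "a \<in> elems G p x (Suc i)" unfolding elems_def using digit_join[OF eu(2,3)] by blast
qed

locale finite_group = group G for G (structure) +
  fixes p :: nat
  assumes finite_carrier: "finite (carrier G)" and prime_p: "prime p"
begin

lemma p_positive: "p > 0"
  using prime_p by (rule prime_gt_0_nat)

lemma commute_pow:
  assumes H: "H \<subseteq> carrier G" and x: "x \<in> carrier G"
    and comm: "\<And>u. u \<in> H \<Longrightarrow> \<exists>v\<in>H. u \<otimes> x = x \<otimes> v" and "u \<in> H"
  shows "\<exists>v\<in>H. u \<otimes> x [^] (e::nat) = x [^] e \<otimes> v"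
proof (induction e)
  case 0
  then show ?case using assms by (intro bexI[of _ u]) auto
next
  case (Suc e)
  then obtain v where v: "v \<in> H" "u \<otimes> x [^] e = x [^] e \<otimes> v" by blast
  from comm[OF v(1)] obtain w where w: "w \<in> H" "v \<otimes> x = x \<otimes> w" by blast
  have G: "u \<in> carrier G" "v \<in> carrier G" "w \<in> carrier G" using H v w \<open>u \<in> H\<close> by auto
  have "u \<otimes> x [^] Suc e = (x [^] e \<otimes> v) \<otimes> x" using G x v(2) by (simp add: m_assoc[symmetric])
  also have "\<dots> = x [^] Suc e \<otimes> w" using G x w(2) by (simp add: m_assoc)
  finally show ?case using w(1) by blast
qed

lemma chain_Suc: "chain G p x (Suc i) \<longleftrightarrow> chain G p x i \<and> x i \<in> carrier G \<and> x i \<notin> elems G p x i \<and>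
    x i [^] p \<in> elems G p x i \<and> (\<forall>u\<in>elems G p x i. \<exists>v\<in>elems G p x i. u \<otimes> x i = x i \<otimes> v)"
  unfolding chain_def less_Suc_eq by blast

text \<open>Products reduce to the form x^e u with e < p because x normalizes the previous subgroup
  and its p-th power lies in it. The form is unique because no smaller positive power of x lies
  there.\<close>

lemma chain_subgroup:
  "chain G p x i \<Longrightarrow> subgroup (elems G p x i) G \<and> inj_on (elem G p x i) {..<p^i}"
proof (induction i)
  case 0
  have "elems G p x 0 = {\<one>}" by (auto simp: elems_def)
  then show ?case using triv_subgroup by (auto simp: inj_on_def)
next
  case (Suc i)
  let ?H = "elems G p x i" and ?x = "x i"
  from Suc.prems have ch: "chain G p x i" and x: "?x \<in> carrier G" "?x \<notin> ?H" "?x [^] p \<in> ?H"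
    and comm: "\<And>u. u \<in> ?H \<Longrightarrow> \<exists>v\<in>?H. u \<otimes> ?x = ?x \<otimes> v" unfolding chain_Suc by auto
  from Suc.IH[OF ch] have H: "subgroup ?H G" and inj: "inj_on (elem G p x i) {..<p^i}" by auto
  have HG: "?H \<subseteq> carrier G" using H by (rule subgroup.subset)
  note S = elems_Suc[OF p_positive, of G x i]
  have pow_p: "?x [^] (p * m) \<in> ?H" for m
    using x(1,3) H by (simp add: nat_pow_pow[symmetric])
      (induction m, auto simp: subgroup.one_closed subgroup.m_closed)
  have pow_red: "\<exists>w\<in>?H. ?x [^] (n::nat) = ?x [^] (n mod p) \<otimes> w" for n
  proof -
    have "?x [^] n = ?x [^] (n mod p + p * (n div p))" by simp
    also have "\<dots> = ?x [^] (n mod p) \<otimes> ?x [^] (p * (n div p))" using x(1) by (simp only: nat_pow_mult)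
    finally show ?thesis using pow_p by blast
  qed
  have "subgroup (elems G p x (Suc i)) G"
  proof (rule subgroup_of_finite[OF finite_carrier])
    show "elems G p x (Suc i) \<subseteq> carrier G" unfolding S using HG x(1) by auto
    have "\<one> = ?x [^] (0::nat) \<otimes> \<one>" by simp
    then show "\<one> \<in> elems G p x (Suc i)" unfolding S using subgroup.one_closed[OF H] p_positive by blast
    fix a b assume "a \<in> elems G p x (Suc i)" "b \<in> elems G p x (Suc i)"
    then obtain e f :: nat and u v where a: "a = ?x [^] e \<otimes> u" "u \<in> ?H" and b: "b = ?x [^] f \<otimes> v" "v \<in> ?H"
      unfolding S by blast
    from commute_pow[OF HG x(1) comm a(2)] obtain u' where u': "u' \<in> ?H" "u \<otimes> ?x [^] f = ?x [^] f \<otimes> u'" by blast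
    from pow_red[of "e + f"] obtain w where w: "w \<in> ?H" "?x [^] (e + f) = ?x [^] ((e + f) mod p) \<otimes> w" by blast
    have G: "u \<in> carrier G" "v \<in> carrier G" "u' \<in> carrier G" "w \<in> carrier G" using HG a b u' w by auto
    have "a \<otimes> b = ?x [^] e \<otimes> (u \<otimes> ?x [^] f) \<otimes> v" unfolding a b using G x(1) by (simp add: m_assoc)
    also have "\<dots> = ?x [^] (e + f) \<otimes> (u' \<otimes> v)" unfolding u'(2) using G x(1) by (simp add: m_assoc nat_pow_mult[symmetric])
    also have "\<dots> = ?x [^] ((e + f) mod p) \<otimes> (w \<otimes> (u' \<otimes> v))" unfolding w(2) using G x(1) by (simp add: m_assoc)
    finally have "a \<otimes> b = ?x [^] ((e + f) mod p) \<otimes> (w \<otimes> (u' \<otimes> v))" .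
    moreover have "w \<otimes> (u' \<otimes> v) \<in> ?H" using H w u' b by (auto intro: subgroup.m_closed)
    moreover have "(e + f) mod p < p" using p_positive by (rule mod_less_divisor)
    ultimately show "a \<otimes> b \<in> elems G p x (Suc i)" unfolding S by blast
  qed
  moreover have "inj_on (elem G p x (Suc i)) {..<p ^ Suc i}"
  proof (rule inj_onI)
    \<comment> \<open>Bezout: d r = p s + 1, so x would be a quotient of two powers that both lie in
      the subgroup.\<close>
    have no: False if "0 < d" "d < p" "?x [^] (d::nat) \<in> ?H" for d
    proof -
      have "coprime d p" using that prime_p by (metis coprime_commute nat_dvd_not_less prime_imp_coprime)
      with that obtain r s where rs: "d * r = p * s + 1"
        using bezout_nat[of d p] by (metis coprime_imp_gcd_eq_1 less_numeral_extra(3))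
      have "?x [^] (d * r) \<in> ?H"
        using x(1) that(3) H by (simp add: nat_pow_pow[symmetric])
          (induction r, auto simp: subgroup.one_closed subgroup.m_closed)
      then have "?x [^] (p * s) \<otimes> ?x \<in> ?H" unfolding rs by simp
      then have "inv (?x [^] (p * s)) \<otimes> (?x [^] (p * s) \<otimes> ?x) \<in> ?H"
        using pow_p H by (auto intro: subgroup.m_closed subgroup.m_inv_closed)
      then show False using x(1,2) by (simp add: m_assoc[symmetric])
    qed
    have aux: "e = f \<and> a = b" if "e \<le> f" "f < p" "a \<in> ?H" "b \<in> ?H" "?x [^] e \<otimes> a = ?x [^] f \<otimes> b" for e f :: nat and a b
    proof -
      have G: "a \<in> carrier G" "b \<in> carrier G" using that HG by auto
      have "?x [^] f = ?x [^] e \<otimes> ?x [^] (f - e)" using that(1) x(1) by (simp add: nat_pow_mult)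
      then have "?x [^] e \<otimes> a = ?x [^] e \<otimes> (?x [^] (f - e) \<otimes> b)" using that(5) G x(1) by (simp add: m_assoc)
      then have ab: "a = ?x [^] (f - e) \<otimes> b" using G x(1) by simp
      then have "?x [^] (f - e) = a \<otimes> inv b" using G x(1) by (simp add: m_assoc)
      then have "?x [^] (f - e) \<in> ?H" using that H by (simp add: subgroup.m_closed subgroup.m_inv_closed)
      then have "\<not> (0 < f - e \<and> f - e < p)" using no[of "f - e"] by blast
      then have "f - e = 0" using that(2) by linarith
      then show ?thesis using that(1) ab G by simp
    qed
    fix z z' assume z: "z \<in> {..<p ^ Suc i}" "z' \<in> {..<p ^ Suc i}" and eq: "elem G p x (Suc i) z = elem G p x (Suc i) z'"
    from digit_split[OF p_positive, of z i] z(1) obtain e u where eu: "z = e + p * u" "e < p" "u < p ^ i" by auto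
    from digit_split[OF p_positive, of z' i] z(2) obtain f v where fv: "z' = f + p * v" "f < p" "v < p ^ i" by auto
    have eq': "?x [^] e \<otimes> elem G p x i u = ?x [^] f \<otimes> elem G p x i v"
      using eq unfolding eu(1) fv(1) elem_Suc_digit[OF eu(2)] elem_Suc_digit[OF fv(2)] .
    have mem: "elem G p x i u \<in> ?H" "elem G p x i v \<in> ?H" using eu fv by (auto simp: elems_def)
    have "e = f \<and> elem G p x i u = elem G p x i v"
      using aux[OF _ fv(2) mem eq'] aux[OF _ eu(2) mem(2,1) eq'[symmetric]] by (cases "e \<le> f") auto
    with inj eu fv show "z = z'" by (auto dest: inj_onD)
  qed
  ultimately show ?case by blast
qed

lemma card_elems: "chain G p x i \<Longrightarrow> card (elems G p x i) = p ^ i"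
  using chain_subgroup unfolding elems_def by (simp add: card_image)

text \<open>Start from a normalizing element g outside the subgroup. Among the powers of g with
  exponent p^l, the last one outside the subgroup has its p-th power inside.\<close>

lemma chain_extend:
  assumes "order G = p ^ k" "chain G p x i" "i < k"
  shows "\<exists>y. chain G p (x(i := y)) (Suc i)"
proof -
  let ?H = "elems G p x i"
  have H: "subgroup ?H G" using chain_subgroup[OF assms(2)] by blast
  have HG: "?H \<subseteq> carrier G" using H by (rule subgroup.subset)
  from normalizer_grows[OF finite_carrier prime_p assms(1) H card_elems[OF assms(2)] assms(3)]
  obtain g where g: "g \<in> carrier G" "g \<notin> ?H" "\<And>u. u \<in> ?H \<Longrightarrow> \<exists>v\<in>?H. u \<otimes> g = g \<otimes> v" by blast
  define j where "j = (LEAST j. g [^] (p ^ j) \<in> ?H)"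
  have "g [^] (p ^ k) \<in> ?H" using pow_order_eq_1[OF g(1)] assms(1) subgroup.one_closed[OF H] by simp
  then have j: "g [^] (p ^ j) \<in> ?H" unfolding j_def by (rule LeastI)
  have "j \<noteq> 0" using j g(1,2) by (intro notI) simp
  then obtain l where l: "j = Suc l" by (cases j) auto
  let ?y = "g [^] (p ^ l)"
  have nin: "?y \<notin> ?H" using not_less_Least[of l "\<lambda>j. g [^] (p ^ j) \<in> ?H"] l unfolding j_def by simp
  have "?y [^] p \<in> ?H" using j g(1) unfolding l by (simp add: nat_pow_pow mult.commute)
  moreover have "\<exists>v\<in>?H. u \<otimes> ?y = ?y \<otimes> v" if "u \<in> ?H" for u
    using commute_pow[OF HG g(1,3) that] .
  moreover have "elems G p (x(i := ?y)) i = ?H" by (rule elems_cong) simp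
  moreover have "chain G p (x(i := ?y)) i \<longleftrightarrow> chain G p x i" by (rule chain_cong) simp
  ultimately have "chain G p (x(i := ?y)) (Suc i)" unfolding chain_Suc using nin g(1) assms(2) by simp
  then show ?thesis by blast
qed

lemma chain_exists:
  assumes "order G = p ^ k"
  shows "\<exists>x. chain G p x k"
proof -
  have "i \<le> k \<Longrightarrow> \<exists>x. chain G p x i" for i
  proof (induction i)
    case (Suc i)
    then show ?case using chain_extend[OF assms] by (metis Suc_le_eq less_imp_le)
  qed (simp add: chain_def)
  then show ?thesis by blast
qed

section \<open>Labellings that belong to the same choice of cosets\<close>

definition same_chain :: "(nat \<Rightarrow> 'a) \<Rightarrow> (nat \<Rightarrow> 'a) \<Rightarrow> nat \<Rightarrow> bool" where
  "same_chain x y i \<longleftrightarrow> (\<forall>j<i. \<exists>n\<in>elems G p x j. y j = x j \<otimes> n)"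

text \<open>Another choice of coset representatives changes the digit labelling by a rotating map.
  The factor u makes the induction work: replacing x_i by y_i and moving powers of y_i to the front
  leaves a factor from the smaller subgroup, which acts on the remaining digits.\<close>

lemma same_chain_rotating:
  "chain G p x i \<Longrightarrow> same_chain x y i \<Longrightarrow>
   chain G p y i \<and> elems G p y i = elems G p x i \<and>
   (\<forall>u\<in>elems G p x i. \<exists>\<tau>. rotating p i \<tau> \<and> (\<forall>z<p^i. u \<otimes> elem G p x i z = elem G p y i (\<tau> z)))"
proof (induction i)
  case 0
  have "rotating p 0 id" by (simp add: rotating_def)
  then show ?case by (auto simp: chain_def elems_def intro!: exI[of _ id])
next
  case (Suc i)
  let ?H = "elems G p x i" and ?x = "x i" and ?y = "y i"
  from Suc.prems(1) have ch: "chain G p x i" and x: "?x \<in> carrier G" "?x \<notin> ?H" "?x [^] p \<in> ?H"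
    and comm: "\<And>u. u \<in> ?H \<Longrightarrow> \<exists>v\<in>?H. u \<otimes> ?x = ?x \<otimes> v" unfolding chain_Suc by auto
  from Suc.prems(2) have sc: "same_chain x y i" by (auto simp: same_chain_def)
  from Suc.prems(2) obtain n where n: "n \<in> ?H" "?y = ?x \<otimes> n" unfolding same_chain_def by blast
  from Suc.IH[OF ch sc] have IH: "chain G p y i" "elems G p y i = ?H"
    "\<And>u. u \<in> ?H \<Longrightarrow> \<exists>\<tau>. rotating p i \<tau> \<and> (\<forall>z<p^i. u \<otimes> elem G p x i z = elem G p y i (\<tau> z))" by blast+
  have H: "subgroup ?H G" using chain_subgroup[OF ch] by blast
  have HG: "?H \<subseteq> carrier G" using H by (rule subgroup.subset)
  have nG: "n \<in> carrier G" and yG: "?y \<in> carrier G" using n HG x(1) by auto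
  have pow: "\<exists>w\<in>?H. ?y [^] (e::nat) = ?x [^] e \<otimes> w" for e
  proof (induction e)
    case 0
    then show ?case using subgroup.one_closed[OF H] by (intro bexI[of _ \<one>]) auto
  next
    case (Suc e)
    then obtain w where w: "w \<in> ?H" "?y [^] e = ?x [^] e \<otimes> w" by blast
    from comm[OF w(1)] obtain v where v: "v \<in> ?H" "w \<otimes> ?x = ?x \<otimes> v" by blast
    have G: "w \<in> carrier G" "v \<in> carrier G" using w v HG by auto
    have "?y [^] Suc e = ?x [^] e \<otimes> (w \<otimes> ?x) \<otimes> n" using w(2) n(2) G nG x(1) by (simp add: m_assoc)
    also have "\<dots> = ?x [^] Suc e \<otimes> (v \<otimes> n)" unfolding v(2) using G nG x(1) by (simp add: m_assoc)
    finally show ?case using H v(1) n(1) by (auto intro: subgroup.m_closed)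
  qed
  have pow': "\<exists>w\<in>?H. ?x [^] (e::nat) = ?y [^] e \<otimes> w" for e
  proof -
    from pow[of e] obtain w where w: "w \<in> ?H" "?y [^] e = ?x [^] e \<otimes> w" by blast
    have "w \<in> carrier G" using w HG by auto
    then have "?x [^] e = ?y [^] e \<otimes> inv w" using w(2) x(1) by (simp add: m_assoc)
    then show ?thesis using subgroup.m_inv_closed[OF H w(1)] by blast
  qed
  have ynin: "?y \<notin> ?H"
  proof
    assume "?y \<in> ?H"
    then have "?y \<otimes> inv n \<in> ?H" using H n(1) by (simp add: subgroup.m_closed subgroup.m_inv_closed)
    then show False using x n(2) nG by (simp add: m_assoc)
  qed
  have yp: "?y [^] p \<in> ?H" using pow[of p] x(3) H by (auto simp: subgroup.m_closed)
  have ycomm: "\<exists>v\<in>?H. u \<otimes> ?y = ?y \<otimes> v" if u: "u \<in> ?H" for u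
  proof -
    from comm[OF u] obtain v where v: "v \<in> ?H" "u \<otimes> ?x = ?x \<otimes> v" by blast
    have G: "u \<in> carrier G" "v \<in> carrier G" using u v HG by auto
    have "u \<otimes> ?y = (u \<otimes> ?x) \<otimes> n" unfolding n(2) using G nG x(1) by (simp add: m_assoc)
    also have "\<dots> = ?y \<otimes> (inv n \<otimes> v \<otimes> n)" unfolding v(2) n(2) using G nG x(1)
      by (simp add: m_assoc) (simp add: m_assoc[symmetric])
    finally show ?thesis using H v(1) n(1) by (auto simp: subgroup.m_closed subgroup.m_inv_closed)
  qed
  have chy: "chain G p y (Suc i)" unfolding chain_Suc IH(2) using IH(1) yG ynin yp ycomm by blast
  have elems_eq: "elems G p y (Suc i) = elems G p x (Suc i)"
  proof (intro equalityI subsetI)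
    fix a assume "a \<in> elems G p y (Suc i)"
    then obtain e :: nat and u where a: "a = ?y [^] e \<otimes> u" "e < p" "u \<in> ?H" unfolding elems_Suc[OF p_positive] IH(2) by blast
    from pow[of e] obtain w where w: "w \<in> ?H" "?y [^] e = ?x [^] e \<otimes> w" by blast
    have "a = ?x [^] e \<otimes> (w \<otimes> u)" unfolding a w using w a HG x(1) by (auto simp: m_assoc subset_iff)
    then show "a \<in> elems G p x (Suc i)" unfolding elems_Suc[OF p_positive]
      using a w H by (blast intro: subgroup.m_closed)
  next
    fix a assume "a \<in> elems G p x (Suc i)"
    then obtain e :: nat and u where a: "a = ?x [^] e \<otimes> u" "e < p" "u \<in> ?H" unfolding elems_Suc[OF p_positive] by blast
    from pow'[of e] obtain w where w: "w \<in> ?H" "?x [^] e = ?y [^] e \<otimes> w" by blast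
    have "a = ?y [^] e \<otimes> (w \<otimes> u)" unfolding a w using w a HG yG by (auto simp: m_assoc subset_iff)
    then show "a \<in> elems G p y (Suc i)" unfolding elems_Suc[OF p_positive] IH(2)
      using a w H by (blast intro: subgroup.m_closed)
  qed
  have "\<exists>\<tau>. rotating p (Suc i) \<tau> \<and> (\<forall>z<p^Suc i. u \<otimes> elem G p x (Suc i) z = elem G p y (Suc i) (\<tau> z))"
    if u: "u \<in> elems G p x (Suc i)" for u
  proof -
    from u obtain f :: nat and v where fv: "u = ?y [^] f \<otimes> v" "f < p" "v \<in> ?H"
      unfolding elems_eq[symmetric] elems_Suc[OF p_positive, of G y i] IH(2) by blast
    have vG: "v \<in> carrier G" using fv HG by auto
    \<comment> \<open>With u = y^f v the lowest digit e becomes e + f modulo p. The leftover w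
      depends on e only, so every branch gets its own rotating map from the induction
      hypothesis.\<close>
    have "\<exists>w\<in>?H. u \<otimes> ?x [^] e = ?y [^] ((e + f) mod p) \<otimes> w" for e
    proof -
      from commute_pow[OF HG x(1) comm fv(3)] obtain v' where v': "v' \<in> ?H" "v \<otimes> ?x [^] e = ?x [^] e \<otimes> v'" by blast
      from pow'[of e] obtain w where w: "w \<in> ?H" "?x [^] e = ?y [^] e \<otimes> w" by blast
      have ypm: "?y [^] (p * m) \<in> ?H" for m
        using yG yp H by (simp add: nat_pow_pow[symmetric])
          (induction m, auto simp: subgroup.one_closed subgroup.m_closed)
      let ?r = "?y [^] (p * ((e + f) div p))"
      have G: "v' \<in> carrier G" "w \<in> carrier G" "?r \<in> carrier G" using v' w HG yG by auto
      have "?y [^] (f + e) = ?y [^] ((e + f) mod p + p * ((e + f) div p))" by (simp add: add.commute)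
      then have red: "?y [^] f \<otimes> ?y [^] e = ?y [^] ((e + f) mod p) \<otimes> ?r"
        using yG by (simp only: nat_pow_mult)
      have "u \<otimes> ?x [^] e = ?y [^] f \<otimes> (v \<otimes> ?x [^] e)" unfolding fv using vG yG x(1) by (simp add: m_assoc)
      also have "\<dots> = (?y [^] f \<otimes> ?y [^] e) \<otimes> (w \<otimes> v')" unfolding v'(2) unfolding w(2) using G yG by (simp add: m_assoc)
      also have "\<dots> = ?y [^] ((e + f) mod p) \<otimes> (?r \<otimes> (w \<otimes> v'))" unfolding red using G yG by (simp add: m_assoc)
      finally show ?thesis using ypm v' w H by (blast intro: subgroup.m_closed)
    qed
    then obtain w where w: "\<And>e. w e \<in> ?H" "\<And>e. u \<otimes> ?x [^] e = ?y [^] ((e + f) mod p) \<otimes> w e" by metis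
    from IH(3)[OF w(1)] have "\<forall>e. \<exists>\<tau>. rotating p i \<tau> \<and> (\<forall>z<p^i. w e \<otimes> elem G p x i z = elem G p y i (\<tau> z))" by blast
    then obtain \<tau> where \<tau>: "\<And>e. rotating p i (\<tau> e)" "\<And>e z. z < p^i \<Longrightarrow> w e \<otimes> elem G p x i z = elem G p y i (\<tau> e z)"
      by metis
    let ?\<sigma> = "\<lambda>z. (z mod p + f) mod p + p * \<tau> (z mod p) (z div p)"
    have "rotating p (Suc i) ?\<sigma>"
      by (rule rotating_combine[OF p_positive \<tau>(1), of _ f]) (use p_positive in auto)
    moreover have "u \<otimes> elem G p x (Suc i) z = elem G p y (Suc i) (?\<sigma> z)" if z: "z < p ^ Suc i" for z
    proof -
      from digit_split[OF p_positive z] obtain e z' where ez: "z = e + p * z'" "e < p" "z' < p ^ i" by blast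
      have eH: "elem G p x i z' \<in> ?H" using ez by (auto simp: elems_def)
      have G: "elem G p x i z' \<in> carrier G" "w e \<in> carrier G" "u \<in> carrier G"
        using eH w(1)[of e] HG fv vG yG by auto
      have "u \<otimes> elem G p x (Suc i) z = (u \<otimes> ?x [^] e) \<otimes> elem G p x i z'"
        unfolding ez(1) elem_Suc_digit[OF ez(2)] using G x(1) by (simp add: m_assoc)
      also have "\<dots> = ?y [^] ((e + f) mod p) \<otimes> (w e \<otimes> elem G p x i z')"
        unfolding w(2) using G yG by (simp add: m_assoc)
      also have "\<dots> = ?y [^] ((e + f) mod p) \<otimes> elem G p y i (\<tau> e z')" by (simp only: \<tau>(2)[OF ez(3)])
      also have "\<dots> = elem G p y (Suc i) ((e + f) mod p + p * \<tau> e z')"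
        by (rule elem_Suc_digit[symmetric]) (use p_positive in simp)
      also have "(e + f) mod p + p * \<tau> e z' = ?\<sigma> z" unfolding ez(1) using ez(2) by simp
      finally show ?thesis .
    qed
    ultimately show ?thesis by blast
  qed
  with chy elems_eq show ?case by blast
qed

end

section \<open>Candidates for the canonical form\<close>

definition fun_group :: "nat \<Rightarrow> (nat \<Rightarrow> nat \<Rightarrow> nat) \<Rightarrow> nat monoid" where
  "fun_group n f = \<lparr>carrier = {..<n}, monoid.mult = f,
     one = (THE e. e < n \<and> (\<forall>i<n. f e i = i \<and> f i e = i))\<rparr>"

lemma table_group_eq: "table_group T = fun_group (length T) (\<lambda>i j. T ! i ! j)"
  by (simp add: table_group_def fun_group_def)

lemma fun_group_simps [simp]:
  "carrier (fun_group n f) = {..<n}" "monoid.mult (fun_group n f) = f" "order (fun_group n f) = n"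
  by (simp_all add: fun_group_def order_def)

lemma group_fun_groupI:
  assumes G: "group G" and \<theta>: "bij_betw \<theta> (carrier G) {..<n}"
    and f: "\<And>x y. x \<in> carrier G \<Longrightarrow> y \<in> carrier G \<Longrightarrow> f (\<theta> x) (\<theta> y) = \<theta> (x \<otimes>\<^bsub>G\<^esub> y)"
  shows "group (fun_group n f)" "\<theta> \<in> iso G (fun_group n f)"
proof -
  interpret G: group G by (rule G)
  let ?H = "fun_group n f" and ?e = "\<theta> \<one>\<^bsub>G\<^esub>"
  have im: "\<And>i. i < n \<Longrightarrow> \<exists>x\<in>carrier G. i = \<theta> x" "\<And>x. x \<in> carrier G \<Longrightarrow> \<theta> x < n"
    using \<theta> by (auto simp: bij_betw_def)
  have e0: "?e < n" by (rule im(2)) simp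
  have e: "f ?e i = i \<and> f i ?e = i" if i: "i < n" for i
  proof -
    from im(1)[OF i] obtain x where "x \<in> carrier G" "i = \<theta> x" by blast
    then show ?thesis using f[of "\<one>\<^bsub>G\<^esub>" x] f[of x "\<one>\<^bsub>G\<^esub>"] by simp
  qed
  have "\<one>\<^bsub>?H\<^esub> = ?e"
    unfolding fun_group_def monoid.select_convs
  proof (rule the_equality)
    fix e' assume e': "e' < n \<and> (\<forall>i<n. f e' i = i \<and> f i e' = i)"
    then have "f e' ?e = ?e" using e0 by blast
    with e[of e'] e' show "e' = ?e" by simp
  qed (use e0 e in auto)
  have ex: "\<exists>a\<in>carrier G. x = \<theta> a" if "x \<in> carrier ?H" for x using im(1) that by simp
  show "group ?H"
  proof (rule groupI)
    fix x y assume xy: "x \<in> carrier ?H" "y \<in> carrier ?H"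
    from ex[OF xy(1)] ex[OF xy(2)] obtain a b where
      ab: "a \<in> carrier G" "b \<in> carrier G" "x = \<theta> a" "y = \<theta> b" by blast
    then show "x \<otimes>\<^bsub>?H\<^esub> y \<in> carrier ?H" using f[OF ab(1,2)] im(2)[of "a \<otimes>\<^bsub>G\<^esub> b"] by simp
  next
    show "\<one>\<^bsub>?H\<^esub> \<in> carrier ?H" using e0 \<open>\<one>\<^bsub>?H\<^esub> = ?e\<close> by simp
  next
    fix x y z assume xyz: "x \<in> carrier ?H" "y \<in> carrier ?H" "z \<in> carrier ?H"
    from ex[OF xyz(1)] ex[OF xyz(2)] ex[OF xyz(3)] obtain a b c where
      "a \<in> carrier G" "b \<in> carrier G" "c \<in> carrier G" "x = \<theta> a" "y = \<theta> b" "z = \<theta> c" by blast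
    then show "x \<otimes>\<^bsub>?H\<^esub> y \<otimes>\<^bsub>?H\<^esub> z = x \<otimes>\<^bsub>?H\<^esub> (y \<otimes>\<^bsub>?H\<^esub> z)" using f by (simp add: G.m_assoc)
  next
    fix x assume "x \<in> carrier ?H"
    then show "\<one>\<^bsub>?H\<^esub> \<otimes>\<^bsub>?H\<^esub> x = x" using e \<open>\<one>\<^bsub>?H\<^esub> = ?e\<close> by simp
  next
    fix x assume "x \<in> carrier ?H"
    from ex[OF this] obtain a where a: "a \<in> carrier G" "x = \<theta> a" by blast
    then have "\<theta> (inv\<^bsub>G\<^esub> a) \<otimes>\<^bsub>?H\<^esub> x = \<one>\<^bsub>?H\<^esub>"
      using f[of "inv\<^bsub>G\<^esub> a" a] \<open>\<one>\<^bsub>?H\<^esub> = ?e\<close> by simp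
    moreover have "\<theta> (inv\<^bsub>G\<^esub> a) \<in> carrier ?H" using a(1) im(2) by simp
    ultimately show "\<exists>y\<in>carrier ?H. y \<otimes>\<^bsub>?H\<^esub> x = \<one>\<^bsub>?H\<^esub>" by blast
  qed
  show "\<theta> \<in> iso G ?H" using \<theta> f im by (auto simp: iso_def hom_def)
qed

lemma elem_hom:
  assumes "group_hom G H \<theta>" "\<And>j. j < i \<Longrightarrow> x j \<in> carrier G"
  shows "elem G p x i z \<in> carrier G \<and> elem H p (\<theta> \<circ> x) i z = \<theta> (elem G p x i z)"
  using assms(2)
proof (induction i arbitrary: z)
  case 0
  interpret group_hom G H \<theta> by (rule assms(1))
  show ?case by simp
next
  case (Suc i)
  interpret group_hom G H \<theta> by (rule assms(1))
  from Suc.IH[of "z div p"] Suc.prems show ?case by (simp add: hom_nat_pow)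
qed

lemma chain_iso:
  assumes G: "group G" and H: "group H" and \<theta>: "\<theta> \<in> iso G H" and ch: "chain G p x k"
  shows "chain H p (\<theta> \<circ> x) k"
proof -
  interpret group_hom G H \<theta>
    using G H \<theta> by (simp add: group_hom_def group_hom_axioms_def iso_def)
  have inj: "inj_on \<theta> (carrier G)" using \<theta> by (simp add: iso_def bij_betw_def)
  have x: "x j \<in> carrier G" if "j < k" for j using ch that by (simp add: chain_def)
  have elems: "elems H p (\<theta> \<circ> x) j = \<theta> ` elems G p x j" "elems G p x j \<subseteq> carrier G" if "j < k" for j
    using elem_hom[OF group_hom_axioms, of j x p] x that
    unfolding elems_def by (auto simp: image_image less_trans intro!: image_cong)
  show ?thesis
    unfolding chain_def
  proof (intro allI impI)
    fix j assume j: "j < k"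
    then have c: "x j \<in> carrier G" "x j \<notin> elems G p x j" "x j [^]\<^bsub>G\<^esub> p \<in> elems G p x j"
      "\<forall>u\<in>elems G p x j. \<exists>v\<in>elems G p x j. u \<otimes>\<^bsub>G\<^esub> x j = x j \<otimes>\<^bsub>G\<^esub> v"
      using ch unfolding chain_def by auto
    have "\<theta> (x j) \<notin> \<theta> ` elems G p x j" using c(1,2) elems(2)[OF j] inj by (auto dest: inj_onD)
    moreover have "\<theta> (x j) [^]\<^bsub>H\<^esub> p \<in> \<theta> ` elems G p x j"
      using c(1,3) by (simp flip: hom_nat_pow)
    moreover have "\<exists>v\<in>\<theta> ` elems G p x j. u \<otimes>\<^bsub>H\<^esub> \<theta> (x j) = \<theta> (x j) \<otimes>\<^bsub>H\<^esub> v" if "u \<in> \<theta> ` elems G p x j" for u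
    proof -
      from that obtain w where w: "w \<in> elems G p x j" "u = \<theta> w" by blast
      with c(4) obtain v where v: "v \<in> elems G p x j" "w \<otimes>\<^bsub>G\<^esub> x j = x j \<otimes>\<^bsub>G\<^esub> v" by blast
      then have "u \<otimes>\<^bsub>H\<^esub> \<theta> (x j) = \<theta> (x j) \<otimes>\<^bsub>H\<^esub> \<theta> v"
        using w c(1) elems(2)[OF j] by (metis hom_mult subsetD)
      with v(1) show ?thesis by blast
    qed
    ultimately show "(\<theta> \<circ> x) j \<in> carrier H \<and> (\<theta> \<circ> x) j \<notin> elems H p (\<theta> \<circ> x) j \<and>
        (\<theta> \<circ> x) j [^]\<^bsub>H\<^esub> p \<in> elems H p (\<theta> \<circ> x) j \<and>
        (\<forall>u\<in>elems H p (\<theta> \<circ> x) j. \<exists>v\<in>elems H p (\<theta> \<circ> x) j. u \<otimes>\<^bsub>H\<^esub> (\<theta> \<circ> x) j = (\<theta> \<circ> x) j \<otimes>\<^bsub>H\<^esub> v)"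
      using c(1) elems(1)[OF j] by simp
  qed
qed

context prime_power
begin

definition normal_labelling :: "(nat \<Rightarrow> nat \<Rightarrow> nat) \<Rightarrow> (nat \<Rightarrow> nat) \<Rightarrow> (nat \<Rightarrow> nat) \<Rightarrow> bool" where
  "normal_labelling f x l \<longleftrightarrow> chain (fun_group N f) p x k \<and> normal f (N * N * N) l \<and>
     (\<exists>\<sigma>\<in>\<Gamma>. \<forall>z<N. l (elem (fun_group N f) p x k z) = \<sigma> z)"

definition relabelled :: "(nat \<Rightarrow> nat \<Rightarrow> nat) \<Rightarrow> (nat \<Rightarrow> nat) \<Rightarrow> nat list \<Rightarrow> bool" where
  "relabelled f l M \<longleftrightarrow> length M = N * N \<and> (\<forall>x<N. \<forall>y<N. M ! (l x * N + l y) = l (f x y))"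

text \<open>No program is mentioned here. The set is an isomorphism invariant, so its least element
  is canonical however the search finds it.\<close>

definition candidates :: "(nat \<Rightarrow> nat \<Rightarrow> nat) \<Rightarrow> nat list set" where
  "candidates f = {M. \<exists>x l. normal_labelling f x l \<and> relabelled f l M}"

lemma finite_group_fun_group:
  "group (fun_group N f) \<Longrightarrow> finite_group (fun_group N f) p"
  by (simp add: finite_group_def finite_group_axioms_def prime)

lemma fun_group_closed:
  assumes "group (fun_group N f)"
  shows "\<forall>x<N. \<forall>y<N. f x y < N"
proof (intro allI impI)
  fix x y assume "x < N" "y < N"
  then show "f x y < N"
    using monoid.m_closed[OF group.is_monoid[OF assms], of x y] by simp
qed

lemma bij_elem:
  assumes "group (fun_group N f)" "chain (fun_group N f) p x k"
  shows "bij_betw (elem (fun_group N f) p x k) {..<N} {..<N}"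
proof -
  interpret finite_group "fun_group N f" p by (rule finite_group_fun_group[OF assms(1)])
  from chain_subgroup[OF assms(2)] have "subgroup (elems (fun_group N f) p x k) (fun_group N f)"
    and inj: "inj_on (elem (fun_group N f) p x k) {..<N}" by blast+
  from subgroup.subset[OF this(1)] have "elem (fun_group N f) p x k ` {..<N} \<subseteq> {..<N}"
    by (simp add: elems_def)
  with inj show ?thesis by (simp add: bij_betw_def endo_inj_surj)
qed

lemma bij_labelling:
  assumes "group (fun_group N f)" "normal_labelling f x l"
  shows "bij_betw l {..<N} {..<N}"
proof -
  let ?e = "elem (fun_group N f) p x k"
  from assms(2) obtain \<sigma> where ch: "chain (fun_group N f) p x k" and \<sigma>: "\<sigma> \<in> \<Gamma>" "\<forall>z<N. l (?e z) = \<sigma> z"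
    unfolding normal_labelling_def by blast
  have e: "bij_betw ?e {..<N} {..<N}" by (rule bij_elem[OF assms(1) ch])
  have "\<sigma> permutes {..<N}" using \<sigma>(1) by (simp add: rot_group_def)
  then have "bij_betw \<sigma> {..<N} {..<N}" by (rule permutes_imp_bij)
  moreover have "bij_betw (l \<circ> ?e) {..<N} {..<N} \<longleftrightarrow> bij_betw \<sigma> {..<N} {..<N}"
    by (rule bij_betw_cong) (use \<sigma>(2) in simp)
  ultimately show ?thesis using bij_betw_comp_iff[OF e, of l "{..<N}"] by blast
qed

lemma bij_labelling_less:
  assumes "group (fun_group N f)" "normal_labelling f x l"
  shows "\<forall>x<N. l x < N"
  using bij_betwE[OF bij_labelling[OF assms]] by auto

text \<open>Both labellings are rotations of digit labellings, and these differ by a rotating map,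
  by \<open>same_chain_rotating\<close> with u the identity. So one arises from the other by an
  element of \<Gamma>, and \<open>normal_unique\<close> applies.\<close>

lemma normal_labelling_moments:
  assumes G: "group (fun_group N f)" and l: "normal_labelling f x l" "normal_labelling f y l'"
    and same: "finite_group.same_chain (fun_group N f) p x y k" and u: "u < N * N * N"
  shows "[nth_moment N f u l = nth_moment N f u l'] (mod int p)"
proof -
  let ?G = "fun_group N f"
  interpret finite_group ?G p by (rule finite_group_fun_group[OF G])
  from l obtain \<sigma> \<sigma>' where ch: "chain ?G p x k" "chain ?G p y k"
    and \<sigma>: "\<sigma> \<in> \<Gamma>" "\<forall>z<N. l (elem ?G p x k z) = \<sigma> z"
    and \<sigma>': "\<sigma>' \<in> \<Gamma>" "\<forall>z<N. l' (elem ?G p y k z) = \<sigma>' z"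
    unfolding normal_labelling_def by blast
  have "\<one>\<^bsub>?G\<^esub> \<in> elems ?G p x k" using chain_subgroup[OF ch(1)] subgroup.one_closed by blast
  with same_chain_rotating[OF ch(1) same] obtain \<tau> where
    \<tau>: "rotating p k \<tau>" "\<forall>z<N. \<one>\<^bsub>?G\<^esub> \<otimes>\<^bsub>?G\<^esub> elem ?G p x k z = elem ?G p y k (\<tau> z)" by blast
  \<comment> \<open>Extended by the identity to become a permutation of all numbers.\<close>
  define \<tau>' where "\<tau>' z = (if z < N then \<tau> z else z)" for z
  have \<tau>': "\<tau>' \<in> \<Gamma>"
  proof -
    have "rotating p k \<tau>'" using \<tau>(1) unfolding rotating_def \<tau>'_def by auto
    moreover from this have "\<tau>' permutes {..<N}" by (rule rotating_permutes) (simp add: \<tau>'_def)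
    ultimately show ?thesis by (simp add: rot_group_def)
  qed
  have inv: "pinv \<sigma> \<in> \<Gamma>" and bij: "bij \<sigma>"
    using perm_group_rot_group \<sigma>(1) by (auto simp: perm_group_def)
  have \<rho>: "\<sigma>' \<circ> \<tau>' \<circ> pinv \<sigma> \<in> \<Gamma>"
    using perm_group_rot_group \<sigma>'(1) \<tau>' inv by (auto simp: perm_group_def)
  have "l' a = (\<sigma>' \<circ> \<tau>' \<circ> pinv \<sigma>) (l a)" if a: "a < N" for a
  proof -
    from bij_elem[OF G ch(1)] a obtain z where z: "z < N" "a = elem ?G p x k z"
      unfolding bij_betw_def by blast
    have "elem ?G p x k z \<in> carrier ?G" using a z by auto
    then have "a = \<one>\<^bsub>?G\<^esub> \<otimes>\<^bsub>?G\<^esub> elem ?G p x k z" unfolding z(2) by (rule l_one[symmetric])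
    also have "\<dots> = elem ?G p y k (\<tau>' z)" using \<tau>(2) z(1) by (simp add: \<tau>'_def del: fun_group_simps)
    finally have "a = elem ?G p y k (\<tau>' z)" .
    moreover have "\<tau>' z < N" using rotating_less[OF \<tau>(1) z(1)] z(1) by (simp add: \<tau>'_def)
    ultimately have "l' a = \<sigma>' (\<tau>' z)" using \<sigma>'(2) by simp
    moreover have "l a = \<sigma> z" using \<sigma>(2) z by simp
    ultimately show ?thesis using bij by (simp add: bij_is_inj inv_f_f)
  qed
  then show ?thesis
    using l u \<rho> unfolding normal_labelling_def
    by (intro normal_unique[OF fun_group_closed[OF G] bij_labelling_less[OF G l(1)] _ _ \<rho>]) auto
qed

text \<open>A choice of cosets has only one candidate. Hence the search has to meet every choice
  once, with any representatives and any normalized labelling.\<close>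

lemma relabelled_unique:
  assumes G: "group (fun_group N f)" and l: "normal_labelling f x l" "normal_labelling f y l'"
    and same: "finite_group.same_chain (fun_group N f) p x y k"
    and M: "relabelled f l M" "relabelled f l' M'"
  shows "M = M'"
proof (rule nth_equalityI)
  show "length M = length M'" using M by (simp add: relabelled_def)
  fix i assume "i < length M"
  then have i: "i < N * N" using M by (simp add: relabelled_def)
  have "i div N < N" "i mod N < N" using i p_pos by (auto simp: less_mult_imp_div_less)
  moreover have surj: "\<exists>a<N. g a = v" if "bij_betw g {..<N} {..<N}" "v < N" for g v
  proof -
    have "v \<in> g ` {..<N}" using that by (simp add: bij_betw_def)
    then show ?thesis by auto
  qed
  ultimately obtain a b a' b' where ab: "a < N" "l a = i div N" "b < N" "l b = i mod N"
    "a' < N" "l' a' = i div N" "b' < N" "l' b' = i mod N"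
    using surj[OF bij_labelling[OF G l(1)]] surj[OF bij_labelling[OF G l(2)]] by meson
  have "l (f a b) = l' (f a' b')"
    by (rule moments_determine[OF fun_group_closed[OF G] fun_group_closed[OF G]
      bij_labelling[OF G l(1)] bij_labelling[OF G l(2)]])
      (use normal_labelling_moments[OF G l same] ab in auto)
  moreover have "M ! (l a * N + l b) = l (f a b)" "M' ! (l' a' * N + l' b') = l' (f a' b')"
    using M ab(1,3,5,7) unfolding relabelled_def by blast+
  ultimately show "M ! i = M' ! i" unfolding ab(2,4,6,8) div_mult_mod_eq by simp
qed

text \<open>Carry the chain over by \<theta> and the labelling by its inverse; moments and
  relabelled table stay the same.\<close>

lemma candidates_iso_subset:
  assumes G: "group (fun_group N f)" "group (fun_group N f')" and \<theta>: "\<theta> \<in> iso (fun_group N f) (fun_group N f')"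
  shows "candidates f \<subseteq> candidates f'"
proof
  fix M assume "M \<in> candidates f"
  then obtain x l where l: "normal_labelling f x l" and M: "relabelled f l M"
    unfolding candidates_def by blast
  from l obtain \<sigma> where ch: "chain (fun_group N f) p x k" and norm: "normal f (N * N * N) l"
    and \<sigma>: "\<sigma> \<in> \<Gamma>" "\<forall>z<N. l (elem (fun_group N f) p x k z) = \<sigma> z"
    unfolding normal_labelling_def by blast
  have bij: "bij_betw \<theta> {..<N} {..<N}" and hom: "\<And>a b. a < N \<Longrightarrow> b < N \<Longrightarrow> \<theta> (f a b) = f' (\<theta> a) (\<theta> b)"
    using \<theta> by (auto simp: iso_def hom_def)
  let ?\<theta>' = "inv_into {..<N} \<theta>"
  have inv: "?\<theta>' (\<theta> a) = a" if "a < N" for a using bij that by (simp add: bij_betw_def)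
  have lt: "\<theta> a < N" if "a < N" for a using bij_betwE[OF bij] that by auto
  have "group_hom (fun_group N f) (fun_group N f') \<theta>"
    using G \<theta> by (simp add: group_hom_def group_hom_axioms_def iso_def)
  from elem_hom[OF this, of k x p] have el: "elem (fun_group N f') p (\<theta> \<circ> x) k z = \<theta> (elem (fun_group N f) p x k z)"
    "elem (fun_group N f) p x k z < N" for z
    using ch by (auto simp: chain_def)
  \<comment> \<open>The inverse cancels \<theta> only below N, so the moments are compared instead
    of the functions.\<close>
  have nth: "nth_moment N f u (l \<circ> ?\<theta>' \<circ> \<theta>) = nth_moment N f u l" for u l
    unfolding nth_moment_def using fun_group_closed[OF G(1)] inv by (intro moment_cong) auto
  have "normal f (N * N * N) (l \<circ> ?\<theta>' \<circ> \<theta>) \<longleftrightarrow> normal f (N * N * N) l"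
    unfolding normal_def stab_def change_def comp_assoc[symmetric] nth[of _ l] nth[of _ "\<sigma> \<circ> l" for \<sigma>] ..
  with norm have "normal f' (N * N * N) (l \<circ> ?\<theta>')"
    using normal_transport[OF bij, of f' f] hom by simp
  moreover have "chain (fun_group N f') p (\<theta> \<circ> x) k" by (rule chain_iso[OF G \<theta> ch])
  moreover have "\<forall>z<N. (l \<circ> ?\<theta>') (elem (fun_group N f') p (\<theta> \<circ> x) k z) = \<sigma> z"
    using \<sigma>(2) el inv by simp
  ultimately have "normal_labelling f' (\<theta> \<circ> x) (l \<circ> ?\<theta>')"
    using \<sigma>(1) unfolding normal_labelling_def by blast
  moreover have "relabelled f' (l \<circ> ?\<theta>') M"
    unfolding relabelled_def
  proof (intro conjI allI impI)
    fix a b assume "a < N" "b < N"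
    then have "a \<in> \<theta> ` {..<N}" "b \<in> \<theta> ` {..<N}" using bij by (simp_all add: bij_betw_def)
    then obtain c d where cd: "c < N" "a = \<theta> c" "d < N" "b = \<theta> d" by blast
    then have "f' a b = \<theta> (f c d)" "f c d < N" using hom fun_group_closed[OF G(1)] by auto
    with cd show "M ! ((l \<circ> ?\<theta>') a * N + (l \<circ> ?\<theta>') b) = (l \<circ> ?\<theta>') (f' a b)"
      using M inv by (simp add: relabelled_def)
  qed (use M in \<open>simp add: relabelled_def\<close>)
  ultimately show "M \<in> candidates f'" unfolding candidates_def by blast
qed

lemma candidates_iso:
  assumes "group (fun_group N f)" "group (fun_group N f')" "fun_group N f \<cong> fun_group N f'"
  shows "candidates f = candidates f'"
proof -
  from assms(3) obtain \<theta> where "\<theta> \<in> iso (fun_group N f) (fun_group N f')" by (auto simp: is_iso_def)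
  moreover from assms obtain \<theta>' where "\<theta>' \<in> iso (fun_group N f') (fun_group N f)"
    using group.iso_sym by (auto simp: is_iso_def)
  ultimately show ?thesis using candidates_iso_subset assms(1,2) by blast
qed

lemma candidates_group:
  assumes "group (fun_group N f)" "M \<in> candidates f"
  shows "length M = N * N" "group (fun_group N (\<lambda>i j. M ! (i * N + j)))"
    "fun_group N f \<cong> fun_group N (\<lambda>i j. M ! (i * N + j))" "i < N \<Longrightarrow> j < N \<Longrightarrow> M ! (i * N + j) < N"
proof -
  from assms(2) obtain x l where l: "normal_labelling f x l" and M: "relabelled f l M"
    unfolding candidates_def by blast
  show "length M = N * N" using M by (simp add: relabelled_def)
  let ?g = "\<lambda>i j. M ! (i * N + j)"
  have "bij_betw l (carrier (fun_group N f)) {..<N}" using bij_labelling[OF assms(1) l] by simp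
  moreover have "?g (l x) (l y) = l (x \<otimes>\<^bsub>fun_group N f\<^esub> y)"
    if "x \<in> carrier (fun_group N f)" "y \<in> carrier (fun_group N f)" for x y
    using M that by (simp add: relabelled_def)
  ultimately show g: "group (fun_group N ?g)" and "fun_group N f \<cong> fun_group N ?g"
    using group_fun_groupI[OF assms(1), of l N ?g] unfolding is_iso_def by blast+
  show "i < N \<Longrightarrow> j < N \<Longrightarrow> M ! (i * N + j) < N" using fun_group_closed[OF g] by simp
qed

section \<open>Minimal coset representatives\<close>

text \<open>Every left coset is represented by its least member.\<close>

definition minimal_rep :: "(nat \<Rightarrow> nat \<Rightarrow> nat) \<Rightarrow> nat set \<Rightarrow> nat \<Rightarrow> bool" where
  "minimal_rep f H y \<longleftrightarrow> (\<forall>u\<in>H. y \<le> f y u)"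

text \<open>Ranks number the cosets consecutively without storing them; the counter of the search
  ranges over ranks.\<close>

definition rep_rank :: "(nat \<Rightarrow> nat \<Rightarrow> nat) \<Rightarrow> nat set \<Rightarrow> nat \<Rightarrow> nat" where
  "rep_rank f H y = card {y'. y' < y \<and> minimal_rep f H y'}"

text \<open>Distinct minimal representatives lie in distinct cosets, so there are at most N / p^i of
  them. This bounds the ranks by p^(k-i), the radix of digit i of the counter.\<close>

lemma minimal_rep_exists:
  assumes G: "group (fun_group N f)" and H: "subgroup H (fun_group N f)" "card H = p ^ i" "i \<le> k" and g: "g < N"
  shows "\<exists>y<N. (\<exists>u\<in>H. y = f g u) \<and> minimal_rep f H y \<and> rep_rank f H y < p ^ (k - i)"
proof -
  interpret group "fun_group N f" by (rule G)
  have HN: "H \<subseteq> {..<N}" using subgroup.subset[OF H(1)] by simp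
  have cl: "f a b < N" if "a < N" "b < N" for a b using fun_group_closed[OF G] that by blast
  have assoc: "f (f a b) c = f a (f b c)" if "a < N" "b < N" "c < N" for a b c
    using m_assoc[of a b c] that by simp
  have HH: "f u v \<in> H" if "u \<in> H" "v \<in> H" for u v using subgroup.m_closed[OF H(1) that] by simp
  have finH: "finite H" using HN finite_subset by blast
  have neH: "H \<noteq> {}" using subgroup.one_closed[OF H(1)] by blast
  define y where "y = Min (f g ` H)"
  have "y \<in> f g ` H" unfolding y_def by (rule Min_in) (use finH neH in auto)
  then obtain u where u: "u \<in> H" "y = f g u" by blast
  have yN: "y < N" using u g HN cl by auto
  have min: "minimal_rep f H y"
    unfolding minimal_rep_def
  proof
    fix v assume v: "v \<in> H"
    have "f y v = f g (f u v)" unfolding u(2) using u(1) v g HN by (intro assoc) auto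
    then show "y \<le> f y v" unfolding y_def using finH HH[OF u(1) v] by (intro Min_le) auto
  qed
  let ?R = "{y. y < N \<and> minimal_rep f H y}"
  \<comment> \<open>If two products agree, each of the two representatives lies in the coset of the
    other, so minimality makes them equal.\<close>
  have inj: "inj_on (\<lambda>(y, u). f y u) (?R \<times> H)"
  proof (rule inj_onI, clarify)
    fix a u b v assume a: "a < N" "minimal_rep f H a" and b: "b < N" "minimal_rep f H b"
      and uv: "u \<in> H" "v \<in> H" and eq: "f a u = f b v"
    have le: "a \<le> b" if "a < N" "minimal_rep f H a" "b < N" "u \<in> H" "v \<in> H" "f a u = f b v" for a b u v
    proof -
      have v': "inv\<^bsub>fun_group N f\<^esub> v \<in> H" by (rule subgroup.m_inv_closed[OF H(1)]) fact
      have "b = f (f b v) (inv\<^bsub>fun_group N f\<^esub> v)"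
        using inv_solve_right[of b "f b v" v] that HN cl by auto
      also have "\<dots> = f a (f u (inv\<^bsub>fun_group N f\<^esub> v))"
        unfolding that(6)[symmetric] using that HN v' by (intro assoc) auto
      finally show ?thesis using that(2) HH[OF that(4) v'] unfolding minimal_rep_def by metis
    qed
    from le[OF a b(1) uv eq] le[OF b a(1) uv(2,1) eq[symmetric]] have ab: "a = b" by simp
    with eq uv a HN have "u = v" using Units_l_cancel[of a u v] Units_eq by auto
    with ab show "a = b \<and> u = v" by simp
  qed
  have "(\<lambda>(y, u). f y u) ` (?R \<times> H) \<subseteq> {..<N}" using cl HN by auto
  from card_inj_on_le[OF inj this] have "card ?R * p ^ i \<le> N" by (simp add: card_cartesian_product H(2))
  also have "N = p ^ (k - i) * p ^ i" using H(3) by (simp flip: power_add)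
  finally have "card ?R \<le> p ^ (k - i)" using p_pos by simp
  moreover have "rep_rank f H y < card ?R"
    unfolding rep_rank_def by (rule psubset_card_mono) (use yN min in auto)
  ultimately have "rep_rank f H y < p ^ (k - i)" by (rule less_le_trans[rotated])
  with u yN min show ?thesis by blast
qed

lemma minimal_rep_rank_unique:
  assumes "minimal_rep f H y" "minimal_rep f H y'" "rep_rank f H y = rep_rank f H y'"
  shows "y = y'"
proof -
  have "rep_rank f H a < rep_rank f H b" if "a < b" "minimal_rep f H a" for a b
    unfolding rep_rank_def by (rule psubset_card_mono) (use that in auto)
  with assms show ?thesis by (metis less_irrefl linorder_neqE_nat)
qed

end

section \<open>The program\<close>

text \<open>A raw cell may belong to any of the arrays.\<close>

fun writes :: "com \<Rightarrow> nat set" where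
  "writes (Assign a i e) = {a}"
| "writes (SetCell i e) = UNIV"
| "writes (Seq c d) = writes c \<union> writes d"
| "writes (Cond e c) = writes c"
| "writes (For v e c) = writes c"

lemma sem_frame: "a \<notin> writes c \<Longrightarrow> sem c q \<rho> A a = A a"
proof (induction c arbitrary: \<rho> A)
  case (For v e c)
  have "fold (\<lambda>i. sem c q (\<rho>(v := i))) xs A a = A a" for xs
    by (induction xs arbitrary: A) (use For in auto)
  then show ?case by simp
qed auto

text \<open>A Hoare rule that also supplies the frame condition relative to the store before the
  loop, so invariants need not mention arrays that the body leaves alone.\<close>

lemma For_rule:
  assumes "eval e \<rho> A = m" "I 0 A"
    and "\<And>i A'. i < m \<Longrightarrow> (\<And>a. a \<notin> writes c \<Longrightarrow> A' a = A a) \<Longrightarrow> I i A' \<Longrightarrow>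
      I (Suc i) (sem c q (\<rho>(v := i)) A')"
  shows "I m (sem (For v e c) q \<rho> A)"
proof -
  define g where "g i = sem c q (\<rho>(v := i))" for i
  have g_frame: "g i A' a = A' a" if "a \<notin> writes c" for i A' a
    unfolding g_def using that by (rule sem_frame)
  have step: "I (Suc i) (g i A')" if "i < m" "\<And>a. a \<notin> writes c \<Longrightarrow> A' a = A a" "I i A'" for i A'
    unfolding g_def by (rule assms(3)) (use that in blast)+
  have "j \<le> m \<Longrightarrow> (\<forall>a. a \<notin> writes c \<longrightarrow> fold g [0..<j] A a = A a) \<and> I j (fold g [0..<j] A)" for j
  proof (induction j)
    case 0
    then show ?case using assms(2) by simp
  next
    case (Suc j)
    then show ?case using step[of j] by (auto simp: g_frame)
  qed
  then show ?thesis using assms(1) unfolding sem.simps g_def[symmetric] by simp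
qed

lemma index_eq_iff:
  fixes i j a b n :: nat
  assumes "a < n" "b < n"
  shows "i * n + a = j * n + b \<longleftrightarrow> i = j \<and> a = b"
proof
  assume *: "i * n + a = j * n + b"
  from arg_cong[OF this, of "\<lambda>x. x div n"] have "i = j" using assms by simp
  with * show "i = j \<and> a = b" by simp
qed simp

lemma index_less:
  fixes i j a b n :: nat
  assumes "i < m" "a < n"
  shows "i * n + a < m * n"
proof -
  have "i * n + a < (i + 1) * n" using assms(2) by simp
  also have "\<dots> \<le> m * n" using assms(1) by (intro mult_le_mono1) simp
  finally show ?thesis .
qed

text \<open>Truth values are 0 and 1.\<close>

definition "NotE e = Minus (Num 1) e"
definition "LeE e f = NotE (Minus e f)"
definition "LtE e f = LeE (Plus e (Num 1)) f"
definition "EqE e f = NotE (Plus (Minus e f) (Minus f e))"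
definition "AllE v m e = NotE (Summ v m (NotE e))"
definition "ExE v m e = NotE (NotE (Summ v m e))"

lemma eval_bool [simp]:
  "eval (NotE e) \<rho> A = of_bool (eval e \<rho> A = 0)"
  "eval (LeE e f) \<rho> A = of_bool (eval e \<rho> A \<le> eval f \<rho> A)"
  "eval (LtE e f) \<rho> A = of_bool (eval e \<rho> A < eval f \<rho> A)"
  "eval (EqE e f) \<rho> A = of_bool (eval e \<rho> A = eval f \<rho> A)"
  "eval (AllE v m e) \<rho> A = of_bool (\<forall>i<eval m \<rho> A. eval e (\<rho>(v := i)) A \<noteq> 0)"
  "eval (ExE v m e) \<rho> A = of_bool (\<exists>i<eval m \<rho> A. eval e (\<rho>(v := i)) A \<noteq> 0)"
proof -
  show not: "eval (NotE e) \<rho> A = of_bool (eval e \<rho> A = 0)" for e \<rho>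
    by (simp add: NotE_def)
  show le: "eval (LeE e f) \<rho> A = of_bool (eval e \<rho> A \<le> eval f \<rho> A)" for e f
    by (simp add: LeE_def not)
  show "eval (LtE e f) \<rho> A = of_bool (eval e \<rho> A < eval f \<rho> A)"
    by (simp add: LtE_def le Suc_le_eq)
  show "eval (EqE e f) \<rho> A = of_bool (eval e \<rho> A = eval f \<rho> A)"
    by (auto simp: EqE_def not)
  show "eval (AllE v m e) \<rho> A = of_bool (\<forall>i<eval m \<rho> A. eval e (\<rho>(v := i)) A \<noteq> 0)"
    by (auto simp: AllE_def not)
  show "eval (ExE v m e) \<rho> A = of_bool (\<exists>i<eval m \<rho> A. eval e (\<rho>(v := i)) A \<noteq> 0)"
    by (auto simp: ExE_def not)
qed

text \<open>Variable 0 is never bound and holds the order \<open>n\<close> of the group.\<close>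

abbreviation nE :: exp where "nE \<equiv> Var 0"
abbreviation n2E :: exp where "n2E \<equiv> Times nE nE"

text \<open>\<open>TAB\<close> receives the input, \<open>CHOICE\<close> holds the digits of the
  search counter and \<open>CARRY\<close> its overflow. \<open>GEN\<close> and \<open>ELEM\<close>
  hold the chain generators and row by row the lists of their subgroups, \<open>LAB\<close> the
  labelling, \<open>ROT\<close> the generators of the current stabilizer, \<open>OUT\<close> and
  \<open>BEST\<close> the present table and the least one so far.\<close>

abbreviation (input) TAB :: nat where "TAB \<equiv> 0"
abbreviation (input) PRIME :: nat where "PRIME \<equiv> 1"
abbreviation (input) POW :: nat where "POW \<equiv> 2"
abbreviation (input) EXPO :: nat where "EXPO \<equiv> 3"
abbreviation (input) BINOM :: nat where "BINOM \<equiv> 4"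
abbreviation (input) CHOICE :: nat where "CHOICE \<equiv> 5"
abbreviation (input) CARRY :: nat where "CARRY \<equiv> 6"
abbreviation (input) FOUND :: nat where "FOUND \<equiv> 7"
abbreviation (input) BEST :: nat where "BEST \<equiv> 8"
abbreviation (input) GEN :: nat where "GEN \<equiv> 9"
abbreviation (input) ELEM :: nat where "ELEM \<equiv> 10"
abbreviation (input) LAB :: nat where "LAB \<equiv> 11"
abbreviation (input) ROT :: nat where "ROT \<equiv> 12"
abbreviation (input) PIVOT :: nat where "PIVOT \<equiv> 13"
abbreviation (input) OUT :: nat where "OUT \<equiv> 14"

abbreviation pE :: exp where "pE \<equiv> Arr PRIME (Num 0)"
abbreviation kE :: exp where "kE \<equiv> Arr EXPO (Num 0)"
abbreviation powE :: "exp \<Rightarrow> exp" where "powE i \<equiv> Arr POW i"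

definition idx :: "exp \<Rightarrow> exp \<Rightarrow> exp" where
  "idx i j = Plus (Times i nE) j"

lemma eval_idx [simp]: "eval (idx i j) \<rho> A = eval i \<rho> A * \<rho> 0 + eval j \<rho> A"
  by (simp add: idx_def)

abbreviation multE :: "exp \<Rightarrow> exp \<Rightarrow> exp" where "multE x y \<equiv> Arr TAB (idx x y)"

text \<open>Input cell m moves to address 32 m. Copying from the last cell downwards never
  overwrites a cell that is still to be read.\<close>

definition copy_in :: com where
  "copy_in = For 1 n2E (Assign TAB (Minus (Minus n2E (Num 1)) (Var 1)) (Cell (Minus (Minus n2E (Num 1)) (Var 1))))"

text \<open>The least divisor of \<open>n\<close> from 2 on; for \<open>n = 1\<close> the value is 3.\<close>

definition set_prime :: com where
  "set_prime = Assign PRIME (Num 0)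
     (Plus (Num 2) (Summ 1 nE (AllE 2 (Plus (Var 1) (Num 1)) (Rem nE (Plus (Var 2) (Num 2))))))"

text \<open>Powers beyond the cut-off are stored as q, which exceeds n, so the number of stored
  powers below n is still k.\<close>

definition set_powers :: com where
  "set_powers = Seq (Assign POW (Num 0) (Num 1))
     (Seq (For 1 nE (Assign POW (Plus (Var 1) (Num 1)) (Times (powE (Var 1)) pE)))
       (Assign EXPO (Num 0) (Summ 1 nE (LtE (powE (Var 1)) nE))))"

text \<open>Pascal's triangle modulo p. The first summand produces column 0; the doubly negated
  factors suppress the recursion in row 0 and column 0, where truncated subtraction would address a
  wrong entry.\<close>

definition set_binomials :: com where
  "set_binomials = For 1 nE (For 2 nE (Assign BINOM (idx (Var 1) (Var 2))
     (Plus (NotE (Var 2)) (Times (Times (NotE (NotE (Var 1))) (NotE (NotE (Var 2))))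
       (Rem (Plus (Arr BINOM (idx (Minus (Var 1) (Num 1)) (Minus (Var 2) (Num 1))))
         (Arr BINOM (idx (Minus (Var 1) (Num 1)) (Var 2)))) pE)))))"

definition set_counter :: com where
  "set_counter = Seq (For 1 nE (Assign CHOICE (Var 1) (Num 0)))
     (Seq (Assign CARRY (Num 0) (Num 0)) (Assign FOUND (Num 0) (Num 0)))"

definition init :: com where
  "init = Seq copy_in (Seq set_prime (Seq set_powers (Seq set_binomials set_counter)))"

definition minrepE :: "exp \<Rightarrow> exp" where
  "minrepE y = AllE 4 (powE (Var 1)) (LeE y (multE y (Arr ELEM (idx (Var 1) (Var 4)))))"

text \<open>Selection by summation: at most one element passes both tests. If none does, the value
  is 0, and \<open>validE\<close> decides whether the result is a chain.\<close>

definition choose_generator :: com where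
  "choose_generator = Assign GEN (Var 1) (Summ 2 nE (Times (Var 2) (Times (minrepE (Var 2))
     (EqE (Summ 3 (Var 2) (minrepE (Var 3))) (Arr CHOICE (Var 1))))))"

text \<open>Entry p z + e of the next row is the e-th power of the generator times entry z of the
  present row: a copy for e = 0, then one multiplication for each further e.\<close>

definition first_element :: com where
  "first_element = Assign ELEM (idx (Plus (Var 1) (Num 1)) (Times pE (Var 2))) (Arr ELEM (idx (Var 1) (Var 2)))"

definition next_element :: com where
  "next_element = Assign ELEM
       (idx (Plus (Var 1) (Num 1)) (Plus (Plus (Times pE (Var 2)) (Var 3)) (Num 1)))
       (multE (Arr GEN (Var 1)) (Arr ELEM (idx (Plus (Var 1) (Num 1)) (Plus (Times pE (Var 2)) (Var 3)))))"

definition next_elements :: com where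
  "next_elements = For 3 (Minus pE (Num 1)) next_element"

definition fill_coset :: com where
  "fill_coset = Seq first_element next_elements"

definition extend_elements :: com where
  "extend_elements = For 2 (powE (Var 1)) fill_coset"

lemmas fill_defs = first_element_def next_element_def next_elements_def fill_coset_def

text \<open>The identity may carry any name; it is found as the only idempotent.\<close>

definition build_chain :: com where
  "build_chain = Seq
     (Assign ELEM (Num 0) (Summ 1 nE (Times (Var 1) (EqE (multE (Var 1) (Var 1)) (Var 1)))))
     (For 1 kE (Seq choose_generator extend_elements))"

text \<open>The p-th power of a generator is obtained as its product with entry p - 1 of the next
  row, which is its power with exponent p - 1.\<close>

definition validE :: exp where
  "validE = AllE 1 kE (Times
     (AllE 2 (powE (Var 1)) (Times
       (ExE 3 (powE (Var 1)) (EqE (multE (Arr ELEM (idx (Var 1) (Var 2))) (Arr GEN (Var 1)))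
          (multE (Arr GEN (Var 1)) (Arr ELEM (idx (Var 1) (Var 3))))))
       (NotE (EqE (Arr GEN (Var 1)) (Arr ELEM (idx (Var 1) (Var 2)))))))
     (ExE 3 (powE (Var 1)) (EqE
        (multE (Arr GEN (Var 1)) (Arr ELEM (idx (Plus (Var 1) (Num 1)) (Minus pE (Num 1)))))
        (Arr ELEM (idx (Var 1) (Var 3))))))"

definition set_labels :: com where
  "set_labels = For 1 nE (Assign LAB (Arr ELEM (idx kE (Var 1))) (Var 1))"

text \<open>Row \<open>k n\<close> of the array of rotations holds the identity.\<close>

definition knE :: exp where "knE = Times kE nE"

abbreviation rotE :: "exp \<Rightarrow> exp \<Rightarrow> exp" where "rotE m z \<equiv> Arr ROT (idx m z)"

definition rotationE :: exp where
  "rotationE =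
    (let P = powE (Var 1); Q = powE (Plus (Var 1) (Num 1)); c = EqE (Rem (Var 3) P) (Var 2)
     in Plus (Times c (Plus (Minus (Var 3) (Rem (Var 3) Q)) (Rem (Plus (Rem (Var 3) Q) P) Q)))
       (Times (NotE c) (Var 3)))"

definition set_rotations :: com where
  "set_rotations = Seq
     (For 1 kE (For 2 nE (For 3 nE (Assign ROT (idx (idx (Var 1) (Var 2)) (Var 3)) rotationE))))
     (For 1 nE (Assign ROT (idx knE (Var 1)) (Var 1)))"

text \<open>The moment, with indices in variables 1 to 3, of the labelling followed by the
  permutation in row m. With m = k n, the identity row, it is the moment of the labelling
  itself.\<close>

definition momentE :: "exp \<Rightarrow> exp" where
  "momentE m = Rem (Summ 4 nE (Summ 5 nE (Times (Times
     (Arr BINOM (idx (rotE m (Arr LAB (Var 4))) (Var 1)))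
     (Arr BINOM (idx (rotE m (Arr LAB (Var 5))) (Var 2))))
     (Arr BINOM (idx (rotE m (Arr LAB (multE (Var 4) (Var 5)))) (Var 3)))))) pE"

abbreviation pivotE :: exp where "pivotE \<equiv> Arr PIVOT (Num 0)"

definition changesE :: exp where
  "changesE = NotE (EqE (momentE (Var 6)) (momentE knE))"

text \<open>Later hits overwrite earlier ones, so the last generator that changes the moment
  remains. The default k n, the identity row, stands for no pivot.\<close>

definition find_pivot :: com where
  "find_pivot = Seq (Assign PIVOT (Num 0) knE)
     (For 6 knE (Cond changesE (Assign PIVOT (Num 0) (Var 6))))"

text \<open>The multiples of a nonzero residue exhaust the residues modulo p, so fewer than p
  applications of the pivot reach moment zero; the remaining rounds do nothing.\<close>

definition adjust_labels :: com where
  "adjust_labels = For 6 pE (Cond (momentE knE)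
     (For 7 nE (Assign LAB (Var 7) (rotE pivotE (Arr LAB (Var 7))))))"

text \<open>Each row before the pivot is multiplied by the pivot until it no longer changes the
  moment.\<close>

definition adjust_rotations :: com where
  "adjust_rotations = For 6 pivotE (For 7 pE (Cond changesE
     (For 8 nE (Assign ROT (idx (Var 6) (Var 8)) (rotE pivotE (rotE (Var 6) (Var 8)))))))"

definition drop_pivot :: com where
  "drop_pivot = For 6 nE (Assign ROT (idx pivotE (Var 6)) (Var 6))"

text \<open>The three nested loops visit the moments in the order of
  \<open>nth_moment\<close>.\<close>

definition normalize :: com where
  "normalize = For 1 nE (For 2 nE (For 3 nE
     (Seq find_pivot (Seq adjust_labels (Seq adjust_rotations drop_pivot)))))"

definition set_output :: com where
  "set_output = For 1 nE (For 2 nE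
     (Assign OUT (idx (Arr LAB (Var 1)) (Arr LAB (Var 2))) (Arr LAB (multE (Var 1) (Var 2)))))"

definition lessE :: exp where
  "lessE = ExE 1 n2E (Times (LtE (Arr OUT (Var 1)) (Arr BEST (Var 1)))
     (AllE 2 (Var 1) (EqE (Arr OUT (Var 2)) (Arr BEST (Var 2)))))"

definition update_best :: com where
  "update_best = Cond (Times validE (Plus (NotE (Arr FOUND (Num 0))) lessE))
     (Seq (For 1 n2E (Assign BEST (Var 1) (Arr OUT (Var 1)))) (Assign FOUND (Num 0) (Num 1)))"

text \<open>Increment in mixed radix: the comparison with p^(k-i) resets an overflowing digit to
  zero.\<close>

definition next_choice :: com where
  "next_choice = Seq (Assign CARRY (Num 0) (Num 1)) (For 1 kE (Seq
     (Assign CHOICE (Var 1) (Times (Plus (Arr CHOICE (Var 1)) (Arr CARRY (Num 0)))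
        (LtE (Plus (Arr CHOICE (Var 1)) (Arr CARRY (Num 0))) (powE (Minus kE (Var 1))))))
     (Assign CARRY (Num 0) (Times (Arr CARRY (Num 0)) (NotE (Arr CHOICE (Var 1)))))))"

definition body :: com where
  "body = Seq build_chain (Seq set_labels (Seq set_rotations (Seq normalize
     (Seq set_output (Seq update_best next_choice)))))"

text \<open>Here the ascending order is safe: entry i is read at address 32 i + 8, and only cells
  below i have been overwritten.\<close>

definition copy_out :: com where
  "copy_out = For 1 n2E (SetCell (Var 1) (Arr BEST (Var 1)))"

text \<open>The cut-off leaves room for the row index k n and, when n = 1, for the value 3 of the
  prime.\<close>

definition capE :: exp where
  "capE = Plus n2E (Num 2)"

definition runningE :: exp where
  "runningE = NotE (Arr CARRY (Num 0))"

lemmas macro_defs = NotE_def LeE_def LtE_def EqE_def AllE_def ExE_def idx_def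

lemma wf_program: "wf_exp capE" "wf_com init" "wf_exp runningE" "wf_com body" "wf_com copy_out"
  by (simp_all add: macro_defs Let_def capE_def init_def runningE_def body_def copy_out_def copy_in_def
    set_prime_def set_powers_def set_binomials_def set_counter_def minrepE_def choose_generator_def
    fill_defs extend_elements_def build_chain_def validE_def set_labels_def knE_def rotationE_def
    set_rotations_def momentE_def changesE_def find_pivot_def adjust_labels_def adjust_rotations_def
    drop_pivot_def normalize_def set_output_def lessE_def update_best_def next_choice_def)

section \<open>Correctness of the program\<close>

text \<open>The order 1 determines no prime. The assumption on k = 0 fixes the value that
  \<open>set_prime\<close> computes in this case.\<close>

locale table_run = prime_power +
  fixes f :: "nat \<Rightarrow> nat \<Rightarrow> nat" and q :: nat and \<rho> :: "nat \<Rightarrow> nat"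
  assumes group_f: "group (fun_group N f)" and exponent_0: "k = 0 \<Longrightarrow> p = 3" and q_def: "q = N * N + 2" and \<rho>0: "\<rho> 0 = N"
begin

abbreviation G :: "nat monoid" where "G \<equiv> fun_group N f"

sublocale finite_group G p
  by (rule finite_group_fun_group[OF group_f])

text \<open>What the initialization provides and the search never overwrites.\<close>

definition static :: "store \<Rightarrow> bool" where
  "static A \<longleftrightarrow> (\<forall>x<N. \<forall>y<N. A TAB (x * N + y) = f x y) \<and> A PRIME 0 = p \<and> (\<forall>i\<le>k. A POW i = p ^ i) \<and>
     A EXPO 0 = k \<and> (\<forall>z<N. \<forall>a<N. A BINOM (z * N + a) = (z choose a) mod p)"

lemma static_cong: "static A \<Longrightarrow> (\<And>a. a \<le> 4 \<Longrightarrow> A' a = A a) \<Longrightarrow> static A'"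
  by (simp add: static_def)

lemma f_closed: "x < N \<Longrightarrow> y < N \<Longrightarrow> f x y < N"
  using fun_group_closed[OF group_f] by blast

lemma le_N: "i \<le> k \<Longrightarrow> p ^ i \<le> N"
  using p_pos by (intro power_increasing) auto

lemma N_le_q: "x \<le> N \<Longrightarrow> x \<le> q"
  unfolding q_def by (metis le_add1 le_square order_trans)

section \<open>Building and testing a chain\<close>

lemma elem_closed: "(\<And>j. j < i \<Longrightarrow> x j < N) \<Longrightarrow> elem G p x i z < N"
proof (induction i arbitrary: z)
  case 0
  then show ?case using one_closed by simp
next
  case (Suc i)
  then have "elem G p x i (z div p) \<in> carrier G" "x i \<in> carrier G" by auto
  then have "x i [^]\<^bsub>G\<^esub> (z mod p) \<otimes>\<^bsub>G\<^esub> elem G p x i (z div p) \<in> carrier G"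
    by (intro m_closed nat_pow_closed)
  then show ?case by simp
qed

lemma elem_zero: "elem G p x i 0 = \<one>\<^bsub>G\<^esub>"
  using one_closed l_one by (induction i) (auto simp del: fun_group_simps)

lemma eval_minrepE:
  assumes A: "static A" and \<rho>': "\<rho>' 0 = N" "\<rho>' 1 = i" and i: "i \<le> k"
    and el: "\<forall>z<p^i. A ELEM (i * N + z) = elem G p x i z" and x: "\<And>j. j < i \<Longrightarrow> x j < N"
    and v: "v \<noteq> 4" "\<rho>' v < N"
  shows "eval (minrepE (Var v)) \<rho>' A = of_bool (minimal_rep f (elems G p x i) (\<rho>' v))"
proof -
  have less: "elem G p x i u < N" for u by (rule elem_closed) (rule x)
  have "A TAB (\<rho>' v * N + A ELEM (i * N + u)) = f (\<rho>' v) (elem G p x i u)" if "u < p^i" for u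
    using A el v(2) less[of u] that unfolding static_def by auto
  moreover have "A POW i = p^i" using A i by (simp add: static_def)
  ultimately show ?thesis
    using \<rho>' v(1) by (auto simp: minrepE_def minimal_rep_def elems_def)
qed

lemma sum_of_bool_card: "(\<Sum>y<m. of_bool (P y)) = card {y. y < m \<and> P y}" for m :: nat
proof -
  have "{..<m} \<inter> Collect P = {y. y < m \<and> P y}" by auto
  then show ?thesis by simp
qed

lemma choose_generator:
  assumes A: "static A" and \<rho>': "\<rho>' 0 = N" "\<rho>' 1 = i" and i: "i < k"
    and el: "\<forall>z<p^i. A ELEM (i * N + z) = elem G p x i z" and x: "\<And>j. j < i \<Longrightarrow> x j < N"
  shows "\<exists>y<N. sem choose_generator q \<rho>' A = A(GEN := (A GEN)(i := y)) \<and>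
    (\<forall>y'<N. minimal_rep f (elems G p x i) y' \<longrightarrow> rep_rank f (elems G p x i) y' = A CHOICE i \<longrightarrow> y = y')"
proof -
  let ?H = "elems G p x i"
  let ?P = "\<lambda>y. minimal_rep f ?H y \<and> rep_rank f ?H y = A CHOICE i"
  let ?X = "\<Sum>y<N. y * (of_bool (minimal_rep f ?H y) * of_bool (rep_rank f ?H y = A CHOICE i))"
  have X_unique: "?X = y" if "y < N" "?P y" for y
  proof -
    have "\<not> ?P y'" if "y' \<noteq> y" for y'
      using minimal_rep_rank_unique[of f ?H y y'] \<open>?P y\<close> that by auto
    then have "y' * (of_bool (minimal_rep f ?H y') * of_bool (rep_rank f ?H y' = A CHOICE i)) = (if y' = y then y else 0)" for y'
      using \<open>?P y\<close> by auto
    then have "?X = (\<Sum>y'<N. if y' = y then y else 0)" by simp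
    with \<open>y < N\<close> show ?thesis by simp
  qed
  have X_less: "?X < N"
  proof (cases "\<exists>y<N. ?P y")
    case True
    then obtain y where y: "y < N" "?P y" by blast
    show ?thesis unfolding X_unique[OF y] by (rule y(1))
  next
    case False
    then have "?X = 0" by (intro sum.neutral) auto
    with N_pos show ?thesis by (simp only:)
  qed
  have mr: "eval (minrepE (Var v)) \<rho>'' A = of_bool (minimal_rep f ?H (\<rho>'' v))"
    if "\<rho>'' 0 = N" "\<rho>'' 1 = i" "v \<noteq> 4" "\<rho>'' v < N" for v \<rho>''
    using eval_minrepE[OF A that(1,2) less_imp_le[OF i] el x that(3,4)] .
  have rank: "eval (Summ 3 (Var 2) (minrepE (Var 3))) (\<rho>'(2 := y)) A = rep_rank f ?H y" if "y < N" for y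
  proof -
    have "eval (Summ 3 (Var 2) (minrepE (Var 3))) (\<rho>'(2 := y)) A = (\<Sum>y'<y. of_bool (minimal_rep f ?H y'))"
      unfolding eval.simps using that \<rho>' by (intro sum.cong) (auto simp: mr)
    then show ?thesis by (simp add: sum_of_bool_card rep_rank_def)
  qed
  have "eval (Summ 2 nE (Times (Var 2) (Times (minrepE (Var 2))
     (EqE (Summ 3 (Var 2) (minrepE (Var 3))) (Arr CHOICE (Var 1)))))) \<rho>' A = ?X"
    unfolding eval.simps(9)
    by (intro sum.cong) (use \<rho>' in \<open>auto simp: mr rank simp del: eval.simps(9)\<close>)
  then have "sem choose_generator q \<rho>' A = A(GEN := (A GEN)(i := ?X))"
    using \<rho>' X_less N_le_q[of ?X] unfolding choose_generator_def sem.simps by (simp add: min_absorb1)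
  then show ?thesis using X_less X_unique by blast
qed

lemma elem_Suc_next:
  assumes "e + 1 < p" "x i < N" "\<And>j. j < i \<Longrightarrow> x j < N"
  shows "elem G p x (Suc i) (p * z + e + 1) = f (x i) (elem G p x (Suc i) (p * z + e))"
proof -
  have c: "x i \<in> carrier G" "elem G p x i z \<in> carrier G"
    using assms elem_closed[of i x z] by auto
  have "elem G p x (Suc i) ((e + 1) + p * z) = x i [^]\<^bsub>G\<^esub> (Suc e) \<otimes>\<^bsub>G\<^esub> elem G p x i z"
    using elem_Suc_digit[OF assms(1), of G x i z] by (simp only: Suc_eq_plus1)
  also have "\<dots> = x i \<otimes>\<^bsub>G\<^esub> (x i [^]\<^bsub>G\<^esub> e \<otimes>\<^bsub>G\<^esub> elem G p x i z)"
    using c by (simp only: nat_pow_Suc2 m_assoc nat_pow_closed)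
  also have "x i [^]\<^bsub>G\<^esub> e \<otimes>\<^bsub>G\<^esub> elem G p x i z = elem G p x (Suc i) (e + p * z)"
    using assms(1) by (intro elem_Suc_digit[symmetric]) simp
  finally show ?thesis by (simp add: algebra_simps del: elem.simps)
qed

lemma extend_elements:
  assumes A: "static A" and \<rho>': "\<rho>' 0 = N" "\<rho>' 1 = i" and i: "i < k"
    and x: "\<And>j. j \<le> i \<Longrightarrow> A GEN j < N"
    and el: "\<forall>i'\<le>i. \<forall>z<p^i'. A ELEM (i' * N + z) = elem G p (A GEN) i' z"
  shows "\<forall>i'\<le>Suc i. \<forall>z<p^i'. sem extend_elements q \<rho>' A ELEM (i' * N + z) = elem G p (A GEN) i' z"
proof -
  let ?x = "A GEN"
  have lt: "p * z + e < N" if "z < p^i" "e < p" for z e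
    using digit_join[OF that(2,1)] le_N[of "Suc i"] i by simp
  have rowlt: "w < N" if "i' \<le> i" "w < p^i'" for i' w
    using that le_N[of i'] i by simp
  have next_less: "elem G p ?x (Suc i) w < N" for w
    by (rule elem_closed) (use x in auto)
  \<comment> \<open>Rows up to i are intact and the first m entries of row i + 1 are in place. Row
    indices stay below N, so writing the new row does not touch the old ones.\<close>
  define I where "I m A' \<longleftrightarrow> (\<forall>i'\<le>i. \<forall>z<p^i'. A' ELEM (i' * N + z) = elem G p ?x i' z) \<and>
    (\<forall>w<m. A' ELEM (Suc i * N + w) = elem G p ?x (Suc i) w)" for m and A' :: store
  have assign: "I (Suc m) (A'(ELEM := (A' ELEM)(Suc i * N + m := elem G p ?x (Suc i) m)))"
    if "I m A'" "m < N" for m A'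
  proof -
    have "A' ELEM (Suc i * N + w) = elem G p ?x (Suc i) w" if "w < m" for w
      using \<open>I m A'\<close> that by (simp add: I_def del: elem.simps)
    moreover have "i' * N + w \<noteq> Suc i * N + m" if "i' \<le> i" "w < p^i'" for i' w
      using index_eq_iff[of w N m i' "Suc i"] rowlt[OF that] \<open>m < N\<close> that by simp
    moreover have "A' ELEM (i' * N + w) = elem G p ?x i' w" if "i' \<le> i" "w < p^i'" for i' w
      using \<open>I m A'\<close> that by (simp add: I_def)
    ultimately show ?thesis unfolding I_def by (auto simp: less_Suc_eq simp del: elem.simps)
  qed
  have "I (p * p^i) (sem extend_elements q \<rho>' A)"
    unfolding extend_elements_def
  proof (rule For_rule[where I = "\<lambda>z. I (p * z)"])
    show "eval (powE (Var 1)) \<rho>' A = p^i" using A \<rho>' i by (simp add: static_def)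
    show "I (p * 0) A" using el by (simp add: I_def)
    fix z A'
    assume z: "z < p^i" and fr: "\<And>a. a \<notin> writes fill_coset \<Longrightarrow> A' a = A a"
      and IA: "I (p * z) A'"
    have A': "static A'" using A by (rule static_cong) (use fr in \<open>auto simp: fill_defs\<close>)
    let ?\<rho> = "\<rho>'(2 := z)"
    let ?A1 = "sem first_element q ?\<rho> A'"
    have e0: "elem G p ?x (Suc i) (p * z) = elem G p ?x i z"
    proof -
      have "elem G p ?x i z < N" by (rule elem_closed) (use x in auto)
      then have "\<one>\<^bsub>G\<^esub> \<otimes>\<^bsub>G\<^esub> elem G p ?x i z = elem G p ?x i z" by (intro l_one) simp
      then show ?thesis using p_pos by simp
    qed
    have "elem G p ?x i z < N" by (rule elem_closed) (use x in auto)
    moreover have "A' ELEM (i * N + z) = elem G p ?x i z" using IA z by (simp add: I_def)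
    ultimately have A1: "?A1 = A'(ELEM := (A' ELEM)(Suc i * N + p * z := elem G p ?x (Suc i) (p * z)))"
      using A' \<rho>' N_le_q[of "elem G p ?x i z"] unfolding e0 by (simp add: first_element_def static_def min_absorb1)
    have I1: "I (Suc (p * z)) ?A1" unfolding A1 by (rule assign[OF IA]) (use lt[OF z, of 0] p_pos in simp)
    have static1: "static ?A1" using A' by (rule static_cong) (simp add: first_element_def)
    have gen1: "?A1 GEN = ?x" using fr by (simp add: fill_defs)
    have "I (Suc (p * z + (p - 1))) (sem next_elements q ?\<rho> ?A1)"
      unfolding next_elements_def
    proof (rule For_rule[where I = "\<lambda>e. I (Suc (p * z + e))"])
      show "eval (Minus pE (Num 1)) ?\<rho> ?A1 = p - 1" using static1 by (simp add: static_def)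
      show "I (Suc (p * z + 0)) ?A1" using I1 by simp
      fix e A2
      assume e: "e < p - 1" and fr2: "\<And>a. a \<notin> writes next_element \<Longrightarrow> A2 a = ?A1 a"
        and I2: "I (Suc (p * z + e)) A2"
      have A2: "static A2" using static1 by (rule static_cong) (use fr2 in \<open>auto simp: next_element_def\<close>)
      have gen2: "A2 GEN = ?x" using fr2[of GEN] gen1 by (simp add: next_element_def)
      have val: "A2 ELEM (Suc i * N + (p * z + e)) = elem G p ?x (Suc i) (p * z + e)"
        using I2 by (simp add: I_def del: elem.simps)
      have "A2 TAB (?x i * N + elem G p ?x (Suc i) (p * z + e)) = elem G p ?x (Suc i) (p * z + e + 1)"
        using A2 x[of i] next_less[of "p * z + e"] e elem_Suc_next[of e ?x i z] x
        unfolding static_def by simp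
      then have "sem next_element q (?\<rho>(3 := e)) A2 =
        A2(ELEM := (A2 ELEM)(Suc i * N + Suc (p * z + e) := elem G p ?x (Suc i) (Suc (p * z + e))))"
        using A2 \<rho>' val gen2 N_le_q[OF less_imp_le[OF next_less[of "Suc (p * z + e)"]]]
        by (simp add: next_element_def static_def min_absorb1 ac_simps del: elem.simps)
      then show "I (Suc (p * z + Suc e)) (sem next_element q (?\<rho>(3 := e)) A2)"
        using assign[OF I2] lt[OF z, of "Suc e"] e by simp
    qed
    moreover have "Suc (p * z + (p - 1)) = p * Suc z" using p_pos by simp
    ultimately show "I (p * Suc z) (sem fill_coset q ?\<rho> A')"
      by (simp only: fill_coset_def sem.simps(3))
  qed
  then show ?thesis unfolding I_def by (auto simp: le_Suc_eq simp del: elem.simps)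
qed

text \<open>Deliberately weak: if the digit is not the rank of a minimal representative, only the
  range of the generator is known.\<close>

definition chosen :: "(nat \<Rightarrow> nat) \<Rightarrow> (nat \<Rightarrow> nat) \<Rightarrow> nat \<Rightarrow> bool" where
  "chosen c x i \<longleftrightarrow> x i < N \<and>
     (\<forall>y<N. minimal_rep f (elems G p x i) y \<longrightarrow> rep_rank f (elems G p x i) y = c i \<longrightarrow> x i = y)"

definition elements_ok :: "store \<Rightarrow> nat \<Rightarrow> bool" where
  "elements_ok A m \<longleftrightarrow> (\<forall>i\<le>m. \<forall>z<p^i. A ELEM (i * N + z) = elem G p (A GEN) i z)"

lemma chosen_cong:
  assumes "\<And>j. j \<le> i \<Longrightarrow> x j = y j"
  shows "chosen c x i \<longleftrightarrow> chosen c y i"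
proof -
  have "elems G p x i = elems G p y i" using assms by (intro elems_cong) auto
  with assms show ?thesis by (simp add: chosen_def)
qed

lemma build_chain:
  assumes A: "static A"
  shows "\<forall>i<k. chosen (A CHOICE) (sem build_chain q \<rho> A GEN) i" "elements_ok (sem build_chain q \<rho> A) k"
proof -
  let ?E = "Assign ELEM (Num 0) (Summ 1 nE (Times (Var 1) (EqE (multE (Var 1) (Var 1)) (Var 1))))"
  let ?A0 = "sem ?E q \<rho> A"
  have one: "\<one>\<^bsub>G\<^esub> < N" using one_closed by simp
  \<comment> \<open>Cancellation leaves the identity as the only idempotent of a group.\<close>
  have idem: "f e e = e \<longleftrightarrow> e = \<one>\<^bsub>G\<^esub>" if "e < N" for e
    using l_cancel_one[of e e] that by simp
  have "eval (Summ 1 nE (Times (Var 1) (EqE (multE (Var 1) (Var 1)) (Var 1)))) \<rho> A =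
      (\<Sum>e<N. if e = \<one>\<^bsub>G\<^esub> then e else 0)"
    unfolding eval.simps using A \<rho>0 idem by (intro sum.cong) (auto simp: static_def)
  then have A0: "?A0 = A(ELEM := (A ELEM)(0 := \<one>\<^bsub>G\<^esub>))"
    using one N_le_q[of "\<one>\<^bsub>G\<^esub>"] by (simp add: min_absorb1)
  have "(\<forall>i<k. chosen (A CHOICE) (sem build_chain q \<rho> A GEN) i) \<and> elements_ok (sem build_chain q \<rho> A) k"
    unfolding build_chain_def sem.simps(3)
  proof (rule For_rule[where I = "\<lambda>m A'. (\<forall>i<m. chosen (A CHOICE) (A' GEN) i) \<and> elements_ok A' m"])
    show "eval kE \<rho> ?A0 = k" using A unfolding A0 by (simp add: static_def)
    show "(\<forall>i<0. chosen (A CHOICE) (?A0 GEN) i) \<and> elements_ok ?A0 0"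
      unfolding A0 by (simp add: elements_ok_def)
    fix i A'
    assume i: "i < k" and fr: "\<And>a. a \<notin> writes (Seq choose_generator extend_elements) \<Longrightarrow> A' a = ?A0 a"
      and I: "(\<forall>j<i. chosen (A CHOICE) (A' GEN) j) \<and> elements_ok A' i"
    have w: "writes (Seq choose_generator extend_elements) = {GEN, ELEM}"
      by (auto simp: choose_generator_def extend_elements_def fill_defs)
    have fr': "A' a = A a" if "a \<noteq> GEN" "a \<noteq> ELEM" for a
      using fr[of a] that unfolding w A0 by simp
    have A': "static A'" using A by (rule static_cong) (simp add: fr')
    have ch: "A' CHOICE = A CHOICE" by (simp add: fr')
    let ?\<rho> = "\<rho>(1 := i)"
    have x: "A' GEN j < N" if "j < i" for j using I that by (simp add: chosen_def)
    have el: "\<forall>z<p^i. A' ELEM (i * N + z) = elem G p (A' GEN) i z" using I by (simp add: elements_ok_def)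
    from choose_generator[OF A' _ _ i el x, of ?\<rho>] \<rho>0 obtain y where
      y: "y < N" "sem choose_generator q ?\<rho> A' = A'(GEN := (A' GEN)(i := y))"
        "\<forall>y'<N. minimal_rep f (elems G p (A' GEN) i) y' \<longrightarrow>
           rep_rank f (elems G p (A' GEN) i) y' = A' CHOICE i \<longrightarrow> y = y'" by auto
    let ?A1 = "A'(GEN := (A' GEN)(i := y))"
    have el1: "elem G p (?A1 GEN) j z = elem G p (A' GEN) j z" if "j \<le> i" for j z
      using that by (intro elem_cong) auto
    have ok1: "elements_ok ?A1 i" using I el1 unfolding elements_ok_def by simp
    have ch1: "chosen (A CHOICE) (?A1 GEN) j" if "j < Suc i" for j
    proof (cases "j = i")
      case True
      have "elems G p (?A1 GEN) i = elems G p (A' GEN) i" by (rule elems_cong) simp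
      then show ?thesis using y True ch by (simp add: chosen_def)
    next
      case False
      with that have "chosen (A CHOICE) (?A1 GEN) j \<longleftrightarrow> chosen (A CHOICE) (A' GEN) j"
        by (intro chosen_cong) auto
      with I that False show ?thesis by auto
    qed
    let ?A2 = "sem extend_elements q ?\<rho> ?A1"
    have gen2: "?A2 GEN = ?A1 GEN"
      by (rule sem_frame) (simp add: extend_elements_def fill_defs)
    have "static ?A1" using A' by (rule static_cong) auto
    then have "\<forall>i'\<le>Suc i. \<forall>z<p^i'. ?A2 ELEM (i' * N + z) = elem G p (?A1 GEN) i' z"
      by (rule extend_elements) (use \<rho>0 i ch1 ok1 in \<open>auto simp: chosen_def elements_ok_def\<close>)
    then have "elements_ok ?A2 (Suc i)" unfolding elements_ok_def gen2 .
    then show "(\<forall>j<Suc i. chosen (A CHOICE) (sem (Seq choose_generator extend_elements) q ?\<rho> A' GEN) j) \<and>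
        elements_ok (sem (Seq choose_generator extend_elements) q ?\<rho> A') (Suc i)"
      unfolding sem.simps(3) y(2) gen2 using ch1 by blast
  qed
  then show "\<forall>i<k. chosen (A CHOICE) (sem build_chain q \<rho> A GEN) i" "elements_ok (sem build_chain q \<rho> A) k"
    by blast+
qed

lemma eval_validE:
  assumes A: "static A" and x: "\<forall>i<k. A GEN i < N" and el: "elements_ok A k"
  shows "eval validE \<rho> A = of_bool (chain G p (A GEN) k)"
proof -
  let ?x = "A GEN"
  have elN: "elem G p ?x i z < N" if "i \<le> k" for i z using that x by (intro elem_closed) auto
  have E: "A ELEM (i * N + z) = elem G p ?x i z" if "i \<le> k" "z < p^i" for i z
    using el that by (simp add: elements_ok_def)
  have F: "A TAB (a * N + b) = f a b" if "a < N" "b < N" for a b using A that by (simp add: static_def)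
  have P: "A POW i = p^i" if "i \<le> k" for i using A that by (simp add: static_def)
  have pow: "?x i [^]\<^bsub>G\<^esub> p = f (?x i) (A ELEM (Suc i * N + (p - 1)))" if "i < k" for i
  proof -
    have c: "?x i \<in> carrier G" using x that by simp
    have "p - 1 < p ^ Suc i" using digit_join[of "p - 1" p 0 i] p_pos by simp
    then have "A ELEM (Suc i * N + (p - 1)) = elem G p ?x (Suc i) ((p - 1) + p * 0)"
      using E[of "Suc i" "p - 1"] that by simp
    also have "\<dots> = ?x i [^]\<^bsub>G\<^esub> (p - 1) \<otimes>\<^bsub>G\<^esub> \<one>\<^bsub>G\<^esub>"
      using elem_Suc_digit[of "p - 1" p G ?x i 0] p_pos elem_zero[of ?x i] by (simp del: elem.simps fun_group_simps)
    also have "\<dots> = ?x i [^]\<^bsub>G\<^esub> (p - 1)" using c by (intro r_one nat_pow_closed)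
    finally have "f (?x i) (A ELEM (Suc i * N + (p - 1))) = ?x i \<otimes>\<^bsub>G\<^esub> ?x i [^]\<^bsub>G\<^esub> (p - 1)" by simp
    also have "\<dots> = ?x i [^]\<^bsub>G\<^esub> Suc (p - 1)" using c by (rule nat_pow_Suc2[symmetric])
    finally show ?thesis using p_pos by simp
  qed
  have lt: "A ELEM (Suc i * N + (p - 1)) < N" if "i < k" for i
    using E[of "Suc i" "p - 1"] elN[of "Suc i" "p - 1"] digit_join[of "p - 1" p 0 i] p_pos that by simp
  have el': "elems G p ?x i = (\<lambda>z. A ELEM (i * N + z)) ` {..<p^i}" if "i < k" for i
    unfolding elems_def by (rule image_cong) (use E[of i] that in auto)
  have "(\<exists>z<p^i. f (?x i) (A ELEM (Suc i * N + (p - 1))) = A ELEM (i * N + z)) \<longleftrightarrow>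
      ?x i [^]\<^bsub>G\<^esub> p \<in> elems G p ?x i" if "i < k" for i
    unfolding pow[OF that] el'[OF that] by auto
  moreover have "(\<forall>z<p^i. (\<exists>z'<p^i. f (A ELEM (i * N + z)) (?x i) = f (?x i) (A ELEM (i * N + z'))) \<and> ?x i \<noteq> A ELEM (i * N + z)) \<longleftrightarrow>
      ?x i \<notin> elems G p ?x i \<and> (\<forall>u\<in>elems G p ?x i. \<exists>v\<in>elems G p ?x i. u \<otimes>\<^bsub>G\<^esub> ?x i = ?x i \<otimes>\<^bsub>G\<^esub> v)" if "i < k" for i
    unfolding el'[OF that] by auto
  ultimately have "chain G p ?x k \<longleftrightarrow> (\<forall>i<k.
      (\<forall>z<p^i. (\<exists>z'<p^i. f (A ELEM (i * N + z)) (?x i) = f (?x i) (A ELEM (i * N + z'))) \<and> ?x i \<noteq> A ELEM (i * N + z)) \<and>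
      (\<exists>z<p^i. f (?x i) (A ELEM (Suc i * N + (p - 1))) = A ELEM (i * N + z)))"
    unfolding chain_def using x by (simp del: power_Suc) blast
  moreover have "A EXPO 0 = k" "A PRIME 0 = p" using A by (auto simp: static_def)
  ultimately show ?thesis
    using \<rho>0 x E elN lt by (simp add: validE_def P F del: elem.simps power_Suc mult_Suc cong: conj_cong imp_cong) 
qed

text \<open>A valid chain lists every element exactly once, so no label is overwritten and the
  labelling inverts the list.\<close>

lemma set_labels:
  assumes A: "static A" and el: "elements_ok A k" and ch: "chain G p (A GEN) k"
  shows "\<forall>z<N. sem set_labels q \<rho> A LAB (elem G p (A GEN) k z) = z"
proof -
  let ?e = "elem G p (A GEN) k"
  have inj: "inj_on ?e {..<N}" using bij_elem[OF group_f ch] by (simp add: bij_betw_def)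
  show ?thesis
    unfolding set_labels_def
  proof (rule For_rule[where I = "\<lambda>m A'. \<forall>z<m. A' LAB (?e z) = z"])
    show "eval nE \<rho> A = N" using \<rho>0 by simp
    fix m A'
    assume m: "m < N" and fr: "\<And>a. a \<notin> writes (Assign LAB (Arr ELEM (idx kE (Var 1))) (Var 1)) \<Longrightarrow> A' a = A a"
      and I: "\<forall>z<m. A' LAB (?e z) = z"
    have "A' EXPO = A EXPO" "A' ELEM = A ELEM" using fr by auto
    then have "sem (Assign LAB (Arr ELEM (idx kE (Var 1))) (Var 1)) q (\<rho>(1 := m)) A' = A'(LAB := (A' LAB)(?e m := m))"
      using A el m \<rho>0 N_le_q[of m] by (simp add: static_def elements_ok_def min_absorb1)
    moreover have "?e z \<noteq> ?e m" if "z < m" for z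
      using inj that m by (auto dest: inj_onD)
    ultimately show "\<forall>z<Suc m. sem (Assign LAB (Arr ELEM (idx kE (Var 1))) (Var 1)) q (\<rho>(1 := m)) A' LAB (?e z) = z"
      using I by (auto simp: less_Suc_eq)
  qed simp
qed

text \<open>Extended by the identity, so that rows can be members of \<Gamma>.\<close>

definition row :: "store \<Rightarrow> nat \<Rightarrow> nat \<Rightarrow> nat" where
  "row A m z = (if z < N then A ROT (m * N + z) else z)"

lemma eval_rotationE:
  assumes A: "static A" and \<rho>': "\<rho>' 0 = N" "\<rho>' 1 = i" "\<rho>' 2 = v" "\<rho>' 3 = z" and "i < k" "z < N"
  shows "eval rotationE \<rho>' A = rotation i v z"
proof -
  have "A POW i = p^i" "A POW (i + 1) = p^Suc i" using A assms(6) by (auto simp: static_def)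
  then show ?thesis using \<rho>' \<open>z < N\<close> by (simp add: rotationE_def Let_def rotation_def del: power_Suc)
qed

text \<open>The three loops fill the array in the order of its addresses, so the same condition on
  an initial segment is the invariant of all of them.\<close>

lemma set_rotations:
  assumes A: "static A"
  shows "\<forall>m<k*N. row (sem set_rotations q \<rho> A) m = rotation (m div N) (m mod N)"
    and "row (sem set_rotations q \<rho> A) (k * N) = id"
proof -
  let ?R = "\<lambda>t. rotation (t div N div N) (t div N mod N) (t mod N)"
  let ?I = "\<lambda>t A'. \<forall>t'<t. A' ROT t' = ?R t'"
  let ?c3 = "Assign ROT (idx (idx (Var 1) (Var 2)) (Var 3)) rotationE"
  let ?A1 = "sem (For 1 kE (For 2 nE (For 3 nE ?c3))) q \<rho> A"
  have R: "?R ((i * N + v) * N + z) = rotation i v z" if "v < N" "z < N" for i v z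
    using that p_pos by simp
  have R_less: "rotation i v z < N" if "i < k" "z < N" for i v z
    using rotation_in_\<Gamma>[OF that(1)] that(2) by (auto simp: rot_group_def intro: rotating_less)
  have "?I (k * N * N) ?A1"
  proof (rule For_rule[where I = "\<lambda>i. ?I (i * N * N)"])
    show "eval kE \<rho> A = k" using A by (simp add: static_def)
    fix i A' assume i: "i < k" and fr: "\<And>a. a \<notin> writes (For 2 nE (For 3 nE ?c3)) \<Longrightarrow> A' a = A a"
      and I: "?I (i * N * N) A'"
    have "?I ((i * N + N) * N) (sem (For 2 nE (For 3 nE ?c3)) q (\<rho>(1 := i)) A')"
    proof (rule For_rule[where I = "\<lambda>v. ?I ((i * N + v) * N)"])
      show "eval nE (\<rho>(1 := i)) A' = N" using \<rho>0 by simp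
      fix v A2 assume v: "v < N" and fr2: "\<And>a. a \<notin> writes (For 3 nE ?c3) \<Longrightarrow> A2 a = A' a"
        and I2: "?I ((i * N + v) * N) A2"
      have "?I ((i * N + v) * N + N) (sem (For 3 nE ?c3) q (\<rho>(1 := i, 2 := v)) A2)"
      proof (rule For_rule[where I = "\<lambda>z. ?I ((i * N + v) * N + z)"])
        show "eval nE (\<rho>(1 := i, 2 := v)) A2 = N" using \<rho>0 by simp
        fix z A3 assume z: "z < N" and fr3: "\<And>a. a \<notin> writes ?c3 \<Longrightarrow> A3 a = A2 a"
          and I3: "?I ((i * N + v) * N + z) A3"
        have "static A3" using A by (rule static_cong) (use fr fr2 fr3 in auto)
        then have "eval rotationE (\<rho>(1 := i, 2 := v, 3 := z)) A3 = rotation i v z"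
          by (rule eval_rotationE) (use \<rho>0 i z in auto)
        then have "sem ?c3 q (\<rho>(1 := i, 2 := v, 3 := z)) A3 =
            A3(ROT := (A3 ROT)((i * N + v) * N + z := rotation i v z))"
          using \<rho>0 N_le_q[of "rotation i v z"] R_less[OF i z, of v] by (simp add: min_absorb1)
        then show "?I ((i * N + v) * N + Suc z) (sem ?c3 q (\<rho>(1 := i, 2 := v, 3 := z)) A3)"
          using I3 R[OF v z, of i] by (auto simp: less_Suc_eq)
      qed (use I2 in simp)
      then show "?I ((i * N + Suc v) * N) (sem (For 3 nE ?c3) q (\<rho>(1 := i, 2 := v)) A2)"
        by (simp add: algebra_simps)
    qed (use I in simp)
    then show "?I (Suc i * N * N) (sem (For 2 nE (For 3 nE ?c3)) q (\<rho>(1 := i)) A')"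
      by (simp add: algebra_simps)
  qed simp
  note A1 = this
  have A1s: "static ?A1" using A by (rule static_cong) (rule sem_frame, simp)
  let ?c1 = "Assign ROT (idx knE (Var 1)) (Var 1)"
  have "?I (k * N * N) (sem (For 1 nE ?c1) q \<rho> ?A1) \<and>
      (\<forall>z<N. sem (For 1 nE ?c1) q \<rho> ?A1 ROT (k * N * N + z) = z)"
  proof (rule For_rule[where I = "\<lambda>m A'. ?I (k * N * N) A' \<and> (\<forall>z<m. A' ROT (k * N * N + z) = z)"])
    show "eval nE \<rho> ?A1 = N" using \<rho>0 by simp
    show "?I (k * N * N) ?A1 \<and> (\<forall>z<0. ?A1 ROT (k * N * N + z) = z)" using A1 by simp
    fix m A' assume m: "m < N" and fr: "\<And>a. a \<notin> writes ?c1 \<Longrightarrow> A' a = ?A1 a"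
      and I: "?I (k * N * N) A' \<and> (\<forall>z<m. A' ROT (k * N * N + z) = z)"
    have "static A'" using A1s by (rule static_cong) (use fr in auto)
    then have "sem ?c1 q (\<rho>(1 := m)) A' = A'(ROT := (A' ROT)(k * N * N + m := m))"
      using \<rho>0 N_le_q[of m] m by (simp add: knE_def static_def min_absorb1)
    with I show "?I (k * N * N) (sem ?c1 q (\<rho>(1 := m)) A') \<and>
        (\<forall>z<Suc m. sem ?c1 q (\<rho>(1 := m)) A' ROT (k * N * N + z) = z)"
      by (auto simp: less_Suc_eq)
  qed
  then have fin: "?I (k * N * N) (sem set_rotations q \<rho> A)"
    "\<forall>z<N. sem set_rotations q \<rho> A ROT (k * N * N + z) = z"
    unfolding set_rotations_def sem.simps(3) by blast+
  show "\<forall>m<k*N. row (sem set_rotations q \<rho> A) m = rotation (m div N) (m mod N)"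
  proof (intro allI impI ext)
    fix m z assume m: "m < k * N"
    show "row (sem set_rotations q \<rho> A) m z = rotation (m div N) (m mod N) z"
    proof (cases "z < N")
      case True
      have "m * N + z < k * N * N" using index_less[OF m True] .
      with fin(1) True p_pos show ?thesis by (simp add: row_def)
    qed (simp add: row_def rotation_def)
  qed
  show "row (sem set_rotations q \<rho> A) (k * N) = id"
    using fin(2) by (auto simp: row_def fun_eq_iff)
qed

section \<open>Normalizing a labelling in the program\<close>

definition at_moment :: "nat \<Rightarrow> (nat \<Rightarrow> nat) \<Rightarrow> bool" where
  "at_moment t \<rho>' \<longleftrightarrow> \<rho>' 0 = N \<and> \<rho>' 1 = t div N div N \<and> \<rho>' 2 = t div N mod N \<and> \<rho>' 3 = t mod N"

lemma at_moment_upd: "at_moment t \<rho>' \<Longrightarrow> v > 3 \<Longrightarrow> at_moment t (\<rho>'(v := x))"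
  by (auto simp: at_moment_def)

lemma eval_momentE:
  assumes A: "static A" and t: "t < N * N * N" and \<rho>': "at_moment t \<rho>'"
    and m: "\<And>x. eval m (\<rho>'(4 := x)) A = mv" "\<And>x y. eval m (\<rho>'(4 := x, 5 := y)) A = mv"
    and l: "\<forall>x<N. A LAB x < N" and r: "\<forall>z<N. row A mv z < N"
  shows "int (eval (momentE m) \<rho>' A) = nth_moment N f t (row A mv \<circ> A LAB) mod int p"
proof -
  define a b c where abc: "a = t div N div N" "b = t div N mod N" "c = t mod N"
  have abcN: "a < N" "b < N" "c < N"
  proof -
    have "t div N < N * N" using t by (rule less_mult_imp_div_less)
    then show "a < N" unfolding abc by (rule less_mult_imp_div_less)
  qed (use N_pos in \<open>simp_all add: abc\<close>)
  let ?L = "row A mv \<circ> A LAB"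
  have B: "A BINOM (A ROT (mv * N + A LAB x) * N + d) = (?L x choose d) mod p" if "x < N" "d < N" for x d
  proof -
    have "A LAB x < N" using l that by blast
    moreover from this r have "row A mv (A LAB x) < N" by blast
    ultimately show ?thesis using A that by (simp add: static_def row_def)
  qed
  have tab: "A TAB (x * N + y) = f x y" if "x < N" "y < N" for x y using A that by (simp add: static_def)
  have "eval (momentE m) \<rho>' A = (\<Sum>x<N. \<Sum>y<N. (?L x choose a) mod p * ((?L y choose b) mod p) * ((?L (f x y) choose c) mod p)) mod p"
    using \<rho>' A unfolding momentE_def eval.simps
    by (intro arg_cong2[where f = "(mod)"] sum.cong)
      (auto simp: m tab f_closed at_moment_def static_def abc[symmetric] abcN B simp del: comp_apply)
  also have "\<dots> = (\<Sum>x<N. \<Sum>y<N. (?L x choose a) * (?L y choose b) * (?L (f x y) choose c)) mod p"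
  proof -
    have "[(\<Sum>x<N. \<Sum>y<N. (?L x choose a) mod p * ((?L y choose b) mod p) * ((?L (f x y) choose c) mod p)) =
      (\<Sum>x<N. \<Sum>y<N. (?L x choose a) * (?L y choose b) * (?L (f x y) choose c))] (mod p)"
      by (intro cong_sum cong_mult) (simp_all add: cong_def)
    then show ?thesis by (simp add: cong_def)
  qed
  finally show ?thesis
    unfolding nth_moment_def moment_def abc[symmetric] by (simp add: zmod_int)
qed

lemma eval_changesE:
  assumes A: "static A" and t: "t < N * N * N" and \<rho>': "at_moment t \<rho>'" "\<rho>' 6 = m"
    and l: "\<forall>x<N. A LAB x < N" and r: "\<forall>z<N. row A m z < N" "row A (k * N) = id"
  shows "eval changesE \<rho>' A \<noteq> 0 \<longleftrightarrow> \<not> [change f t (A LAB) (row A m) = 0] (mod int p)"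
proof -
  have 1: "int (eval (momentE (Var 6)) \<rho>' A) = nth_moment N f t (row A m \<circ> A LAB) mod int p"
    by (rule eval_momentE[OF A t \<rho>'(1)]) (use \<rho>' l r in auto)
  have "A EXPO 0 = k" using A by (simp add: static_def)
  then have 2: "int (eval (momentE knE) \<rho>' A) = nth_moment N f t (row A (k * N) \<circ> A LAB) mod int p"
    by (intro eval_momentE[OF A t \<rho>'(1)]) (use \<rho>' l r in \<open>auto simp: knE_def at_moment_def\<close>)
  have "eval changesE \<rho>' A \<noteq> 0 \<longleftrightarrow> int (eval (momentE (Var 6)) \<rho>' A) \<noteq> int (eval (momentE knE) \<rho>' A)"
    by (simp add: changesE_def)
  also have "\<dots> \<longleftrightarrow> \<not> [nth_moment N f t (row A m \<circ> A LAB) = nth_moment N f t (A LAB)] (mod int p)"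
    unfolding 1 2 r(2) id_comp cong_def ..
  finally show ?thesis by (simp add: change_def cong_iff_dvd_diff)
qed

lemma kN_le_q: "k * N \<le> q"
proof -
  have "k < p ^ k" using power_gt_expt[of p k] prime_gt_1_nat[OF prime] by simp
  then have "k * N \<le> N * N" by (intro mult_le_mono1 less_imp_le)
  then show ?thesis unfolding q_def by (rule trans_le_add1)
qed

lemma static_upd: "static A \<Longrightarrow> a > 4 \<Longrightarrow> static (A(a := R))"
  by (rule static_cong) auto

lemma row_upd [simp]: "a \<noteq> ROT \<Longrightarrow> row (A(a := R)) = row A"
  by (simp add: row_def fun_eq_iff)

lemma find_pivot:
  assumes A: "static A" and t: "t < N * N * N" and \<rho>': "at_moment t \<rho>'"
    and l: "\<forall>x<N. A LAB x < N" and r: "\<forall>m<k*N. \<forall>z<N. row A m z < N" "row A (k * N) = id"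
  shows "\<exists>v\<le>k*N. sem find_pivot q \<rho>' A = A(PIVOT := (A PIVOT)(0 := v)) \<and>
    (v < k * N \<longrightarrow> \<not> [change f t (A LAB) (row A v) = 0] (mod int p)) \<and>
    (\<forall>m<k*N. v < m \<or> v = k * N \<longrightarrow> [change f t (A LAB) (row A m) = 0] (mod int p))"
proof -
  let ?Z = "\<lambda>m. [change f t (A LAB) (row A m) = 0] (mod int p)"
  let ?S = "\<lambda>v. A(PIVOT := (A PIVOT)(0 := v))"
  let ?A0 = "sem (Assign PIVOT (Num 0) knE) q \<rho>' A"
  have S: "static (?S v)" for v using A by (rule static_upd) simp
  have ev: "eval knE \<rho>'' (?S v) = k * N" if "at_moment t \<rho>''" for v \<rho>''
    using S[of v] that by (simp add: knE_def static_def at_moment_def)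
  have "eval knE \<rho>' A = k * N" using A \<rho>' by (simp add: knE_def static_def at_moment_def)
  then have A0: "?A0 = ?S (k * N)" using kN_le_q by (simp add: min_absorb1)
  let ?I = "\<lambda>j A'. \<exists>v. A' = ?S v \<and> (v = k * N \<and> (\<forall>m<j. ?Z m) \<or> v < j \<and> \<not> ?Z v \<and> (\<forall>m<j. v < m \<longrightarrow> ?Z m))"
  have "?I (k * N) (sem find_pivot q \<rho>' A)"
    unfolding find_pivot_def sem.simps(3) A0
  proof (rule For_rule[where I = ?I])
    show "eval knE \<rho>' (?S (k * N)) = k * N" by (rule ev[OF \<rho>'])
    show "?I 0 (?S (k * N))" by blast
    fix j A' assume j: "j < k * N" and "?I j A'"
    then obtain v where v: "A' = ?S v"
      "v = k * N \<and> (\<forall>m<j. ?Z m) \<or> v < j \<and> \<not> ?Z v \<and> (\<forall>m<j. v < m \<longrightarrow> ?Z m)" by blast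
    let ?\<rho> = "\<rho>'(6 := j)"
    have am: "at_moment t ?\<rho>" using \<rho>' by (rule at_moment_upd) simp
    have "eval changesE ?\<rho> (?S v) \<noteq> 0 \<longleftrightarrow> \<not> [change f t (?S v LAB) (row (?S v) j) = 0] (mod int p)"
      by (rule eval_changesE[OF S t am]) (use l r j in auto)
    then have e: "eval changesE ?\<rho> (?S v) \<noteq> 0 \<longleftrightarrow> \<not> ?Z j" by simp
    show "?I (Suc j) (sem (Cond changesE (Assign PIVOT (Num 0) (Var 6))) q ?\<rho> A')"
    proof (cases "?Z j")
      case True
      with e v(1) have "sem (Cond changesE (Assign PIVOT (Num 0) (Var 6))) q ?\<rho> A' = ?S v" by simp
      with v(2) True show ?thesis by (auto simp: less_Suc_eq)
    next
      case False
      have "sem (Cond changesE (Assign PIVOT (Num 0) (Var 6))) q ?\<rho> A' = (?S v)(PIVOT := (?S v PIVOT)(0 := j))"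
        using e v(1) False j kN_le_q by (simp add: min_absorb1 del: fun_upd_upd fun_upd_same)
      then have "sem (Cond changesE (Assign PIVOT (Num 0) (Var 6))) q ?\<rho> A' = ?S j"
        by (simp only: fun_upd_upd fun_upd_same)
      with False show ?thesis by (intro exI[of _ j]) auto
    qed
  qed
  then obtain v where v: "sem find_pivot q \<rho>' A = ?S v"
    "v = k * N \<and> (\<forall>m<k*N. ?Z m) \<or> v < k * N \<and> \<not> ?Z v \<and> (\<forall>m<k*N. v < m \<longrightarrow> ?Z m)" by blast
  then show ?thesis by (intro exI[of _ v]) auto
qed

text \<open>A bounded loop with a guarded body acts as a while loop: s counts the executed bodies,
  and once the guard P fails the state no longer changes.\<close>

lemma For_until:
  assumes "eval b \<rho>' A = m" and start: "St 0 A"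
    and test: "\<And>i s A'. St s A' \<Longrightarrow> eval e (\<rho>'(v := i)) A' \<noteq> 0 \<longleftrightarrow> P s"
    and step: "\<And>i s A'. St s A' \<Longrightarrow> P s \<Longrightarrow> St (Suc s) (sem c q (\<rho>'(v := i)) A')"
  shows "\<exists>s. St s (sem (For v b (Cond e c)) q \<rho>' A) \<and> ((\<exists>s<m. \<not> P s) \<longrightarrow> \<not> P s)"
proof -
  have "\<exists>s. St s (sem (For v b (Cond e c)) q \<rho>' A) \<and> (\<not> P s \<or> s = m \<and> (\<forall>s'<m. P s'))"
  proof (rule For_rule[where I = "\<lambda>i A'. \<exists>s. St s A' \<and> (\<not> P s \<or> s = i \<and> (\<forall>s'<i. P s'))"])
    show "eval b \<rho>' A = m" by (rule assms(1))
    show "\<exists>s. St s A \<and> (\<not> P s \<or> s = 0 \<and> (\<forall>s'<0. P s'))" using start by blast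
    fix i A' assume "\<exists>s. St s A' \<and> (\<not> P s \<or> s = i \<and> (\<forall>s'<i. P s'))"
    then obtain s where s: "St s A'" "\<not> P s \<or> s = i \<and> (\<forall>s'<i. P s')" by blast
    show "\<exists>s. St s (sem (Cond e c) q (\<rho>'(v := i)) A') \<and> (\<not> P s \<or> s = Suc i \<and> (\<forall>s'<Suc i. P s'))"
    proof (cases "P s")
      case True
      with s test[OF s(1), of i] have "sem (Cond e c) q (\<rho>'(v := i)) A' = sem c q (\<rho>'(v := i)) A'" by simp
      with step[OF s(1) True, of i] s(2) True show ?thesis
        by (intro exI[of _ "Suc s"]) (auto simp: less_Suc_eq)
    next
      case False
      with s test[OF s(1), of i] have "sem (Cond e c) q (\<rho>'(v := i)) A' = A'" by simp
      with s(1) False show ?thesis by auto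
    qed
  qed
  then show ?thesis by blast
qed

text \<open>Since h is invertible modulo p, its multiples reach every residue; the bound s < p
  matches the number of rounds in the program.\<close>

lemma linear_solve:
  assumes "\<not> [h = 0] (mod int p)"
  shows "\<exists>s<p. [e + int s * h = 0] (mod int p)"
proof -
  have "coprime h (int p)"
    using assms prime_imp_coprime[of "int p" h] prime by (simp add: cong_0_iff coprime_commute)
  then obtain g where g: "[h * g = 1] (mod int p)" using cong_solve_coprime_int by blast
  let ?s = "nat ((- e * g) mod int p)"
  have s: "int ?s = (- e * g) mod int p" using p_pos by simp
  have "[e + int ?s * h = e + (- e * g) * h] (mod int p)"
    unfolding s by (intro cong_add cong_mult) (simp_all add: cong_def)
  also have "e + (- e * g) * h = e - e * (h * g)" by simp
  also have "[e - e * (h * g) = e - e * 1] (mod int p)" by (intro cong_diff cong_mult cong_refl g)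
  finally have "[e + int ?s * h = 0] (mod int p)" by simp
  moreover have "?s < p" using p_pos s by (metis of_nat_less_iff pos_mod_bound of_nat_0_less_iff)
  ultimately show ?thesis by blast
qed

lemma adjust_labels:
  assumes A: "static A" and t: "t < N * N * N" and \<rho>': "at_moment t \<rho>'"
    and l: "\<forall>x<N. A LAB x < N" and r: "row A (k * N) = id"
    and v: "A PIVOT 0 = v" "\<forall>z<N. row A v z < N"
  shows "\<exists>l' s. sem adjust_labels q \<rho>' A = A(LAB := l') \<and> (\<forall>x<N. l' x = (row A v ^^ s) (A LAB x)) \<and>
    ((\<exists>s<p. [nth_moment N f t (row A v ^^ s \<circ> A LAB) = 0] (mod int p)) \<longrightarrow> [nth_moment N f t l' = 0] (mod int p))"
proof -
  let ?b = "row A v" and ?l = "A LAB"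
  have bl: "(?b ^^ s) (?l x) < N" if "x < N" for s x
    using that l v(2) by (induction s) auto
  let ?P = "\<lambda>s. \<not> [nth_moment N f t (?b ^^ s \<circ> ?l) = 0] (mod int p)"
  let ?St = "\<lambda>s A'. \<exists>l'. A' = A(LAB := l') \<and> (\<forall>x<N. l' x = (?b ^^ s) (?l x))"
  let ?c = "For 7 nE (Assign LAB (Var 7) (rotE pivotE (Arr LAB (Var 7))))"
  have nth: "nth_moment N f t l' = nth_moment N f t (?b ^^ s \<circ> ?l)"
    if "\<forall>x<N. l' x = (?b ^^ s) (?l x)" for l' s
    unfolding nth_moment_def using fun_group_closed[OF group_f] that by (intro moment_cong) auto
  have "\<exists>s. ?St s (sem adjust_labels q \<rho>' A) \<and> ((\<exists>s<p. \<not> ?P s) \<longrightarrow> \<not> ?P s)"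
    unfolding adjust_labels_def
  proof (rule For_until)
    show "eval pE \<rho>' A = p" using A by (simp add: static_def)
    show "?St 0 A" by (intro exI[of _ ?l]) simp
    fix i s A' assume "?St s A'"
    then obtain l' where A': "A' = A(LAB := l')" and l': "\<forall>x<N. l' x = (?b ^^ s) (?l x)" by blast
    have l'N: "l' x < N" if "x < N" for x using l' bl that by simp
    let ?\<rho> = "\<rho>'(6 := i)"
    have am: "at_moment t ?\<rho>" using \<rho>' by (rule at_moment_upd) simp
    have S: "static A'" unfolding A' using A by (rule static_upd) simp
    have row': "row A' = row A" unfolding A' by simp
    have "A' EXPO 0 = k" using S by (simp add: static_def)
    then have "int (eval (momentE knE) ?\<rho> A') = nth_moment N f t (row A' (k * N) \<circ> A' LAB) mod int p"
      by (intro eval_momentE[OF S t am]) (use am l'N r in \<open>auto simp: knE_def at_moment_def A'\<close>)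
    then have "int (eval (momentE knE) ?\<rho> A') = nth_moment N f t (A' LAB) mod int p"
      unfolding row' r id_comp .
    moreover have "A' LAB = l'" unfolding A' by simp
    ultimately have "int (eval (momentE knE) ?\<rho> A') = nth_moment N f t (?b ^^ s \<circ> ?l) mod int p"
      unfolding nth[OF l', symmetric] by simp
    then have "eval (momentE knE) ?\<rho> A' \<noteq> 0 \<longleftrightarrow> nth_moment N f t (?b ^^ s \<circ> ?l) mod int p \<noteq> 0"
      by (metis of_nat_eq_0_iff)
    then show "eval (momentE knE) ?\<rho> A' \<noteq> 0 \<longleftrightarrow> ?P s" by (simp add: cong_def)
    have "\<exists>l''. sem ?c q ?\<rho> A' = A(LAB := l'') \<and> (\<forall>x<N. l'' x = ?b (l' x)) \<and> (\<forall>x\<ge>N. l'' x = l' x)"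
    proof (rule For_rule[where I = "\<lambda>m A2. \<exists>l''. A2 = A(LAB := l'') \<and> (\<forall>x<m. l'' x = ?b (l' x)) \<and> (\<forall>x\<ge>m. l'' x = l' x)"])
      show "eval nE ?\<rho> A' = N" using \<rho>' by (simp add: at_moment_def)
      show "\<exists>l''. A' = A(LAB := l'') \<and> (\<forall>x<0. l'' x = ?b (l' x)) \<and> (\<forall>x\<ge>0. l'' x = l' x)" using A' by auto
      fix m A2 assume m: "m < N" and "\<exists>l''. A2 = A(LAB := l'') \<and> (\<forall>x<m. l'' x = ?b (l' x)) \<and> (\<forall>x\<ge>m. l'' x = l' x)"
      then obtain l'' where A2: "A2 = A(LAB := l'')" "\<forall>x<m. l'' x = ?b (l' x)" "\<forall>x\<ge>m. l'' x = l' x" by blast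
      have "A ROT (v * N + l' m) = ?b (l' m)" "?b (l' m) < N" using l'N[OF m] v(2) by (simp_all add: row_def)
      then have "sem (Assign LAB (Var 7) (rotE pivotE (Arr LAB (Var 7)))) q (?\<rho>(7 := m)) A2 = A(LAB := l''(m := ?b (l' m)))"
        using A2 v(1) \<rho>' N_le_q[of "?b (l' m)"] by (simp add: at_moment_def min_absorb1)
      then show "\<exists>l''. sem (Assign LAB (Var 7) (rotE pivotE (Arr LAB (Var 7)))) q (?\<rho>(7 := m)) A2 = A(LAB := l'') \<and>
          (\<forall>x<Suc m. l'' x = ?b (l' x)) \<and> (\<forall>x\<ge>Suc m. l'' x = l' x)"
        using A2 by (intro exI[of _ "l''(m := ?b (l' m))"]) (auto simp: less_Suc_eq)
    qed
    then show "?St (Suc s) (sem ?c q ?\<rho> A')" using l' by auto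
  qed
  then obtain s l' where sl: "sem adjust_labels q \<rho>' A = A(LAB := l')" "\<forall>x<N. l' x = (?b ^^ s) (?l x)"
    "(\<exists>s<p. \<not> ?P s) \<longrightarrow> \<not> ?P s" by blast
  then show ?thesis using nth[OF sl(2)] by (intro exI[of _ l'] exI[of _ s]) auto
qed

text \<open>The composition is done in place. Each entry is read just before it is overwritten, and
  the pivot row is a different one.\<close>

lemma compose_row:
  assumes \<rho>': "\<rho>' 0 = N" "\<rho>' 6 = m" and v: "A PIVOT 0 = v" "m \<noteq> v"
    and r: "\<forall>z<N. row A v z < N" "\<forall>z<N. row A m z < N"
  shows "\<exists>R. sem (For 8 nE (Assign ROT (idx (Var 6) (Var 8)) (rotE pivotE (rotE (Var 6) (Var 8))))) q \<rho>' A = A(ROT := R) \<and>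
    row (A(ROT := R)) m = row A v \<circ> row A m \<and> (\<forall>m'. m' \<noteq> m \<longrightarrow> row (A(ROT := R)) m' = row A m')"
proof -
  let ?c = "Assign ROT (idx (Var 6) (Var 8)) (rotE pivotE (rotE (Var 6) (Var 8)))"
  let ?I = "\<lambda>z A'. \<exists>R. A' = A(ROT := R) \<and> (\<forall>z'<N. row (A(ROT := R)) m z' = (if z' < z then row A v (row A m z') else row A m z')) \<and>
    (\<forall>m'. m' \<noteq> m \<longrightarrow> row (A(ROT := R)) m' = row A m')"
  have "?I N (sem (For 8 nE ?c) q \<rho>' A)"
  proof (rule For_rule[where I = ?I])
    show "eval nE \<rho>' A = N" using \<rho>' by simp
    show "?I 0 A" by (intro exI[of _ "A ROT"]) simp
    fix z A' assume z: "z < N" and "?I z A'"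
    then obtain R where R: "A' = A(ROT := R)"
      "\<forall>z'<N. row (A(ROT := R)) m z' = (if z' < z then row A v (row A m z') else row A m z')"
      "\<forall>m'. m' \<noteq> m \<longrightarrow> row (A(ROT := R)) m' = row A m'" by blast
    let ?w = "row A m z"
    have w: "?w < N" "row A v ?w < N" using r z by auto
    have "R (m * N + z) = ?w" using R(2) z by (simp add: row_def)
    moreover have "R (v * N + ?w) = row A v ?w"
      using R(3) v(2) w(1) by (metis row_def fun_upd_same)
    ultimately have sem: "sem ?c q (\<rho>'(8 := z)) A' = A(ROT := R(m * N + z := row A v ?w))"
      using \<rho>' v N_le_q[of "row A v ?w"] w unfolding R(1) by (simp add: min_absorb1)
    have "row (A(ROT := R(m * N + z := y))) m' z' = (if m' = m \<and> z' = z then y else row (A(ROT := R)) m' z')" for y m' z'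
      using index_eq_iff[of z' N z m' m] z by (auto simp: row_def)
    then show "?I (Suc z) (sem ?c q (\<rho>'(8 := z)) A')"
      unfolding sem using R(2,3)
      by (intro exI[of _ "R(m * N + z := row A v ?w)"]) (auto simp: less_Suc_eq fun_eq_iff)
  qed
  then obtain R where R: "sem (For 8 nE ?c) q \<rho>' A = A(ROT := R)"
      "\<forall>z'<N. row (A(ROT := R)) m z' = (if z' < N then row A v (row A m z') else row A m z')"
      "\<forall>m'. m' \<noteq> m \<longrightarrow> row (A(ROT := R)) m' = row A m'" by blast
  moreover have "row (A(ROT := R)) m = row A v \<circ> row A m"
    using R(2) by (auto simp: fun_eq_iff row_def)
  ultimately show ?thesis by blast
qed

lemma funpow_comp_less:
  assumes "\<forall>z<N. b z < N" "\<forall>z<N. g z < N" "z < N"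
  shows "((b ^^ s) \<circ> g) z < N"
  using assms by (induction s) auto

lemma adjust_row:
  assumes A: "static A" and t: "t < N * N * N" and \<rho>': "at_moment t \<rho>'" "\<rho>' 6 = m" and m: "m < v" "v \<le> k * N"
    and l: "\<forall>x<N. A LAB x < N" and r: "\<forall>m\<le>k*N. \<forall>z<N. row A m z < N" "row A (k * N) = id"
    and v: "A PIVOT 0 = v"
  shows "\<exists>R s. sem (For 7 pE (Cond changesE
       (For 8 nE (Assign ROT (idx (Var 6) (Var 8)) (rotE pivotE (rotE (Var 6) (Var 8))))))) q \<rho>' A = A(ROT := R) \<and>
    row (A(ROT := R)) m = row A v ^^ s \<circ> row A m \<and> (\<forall>m'. m' \<noteq> m \<longrightarrow> row (A(ROT := R)) m' = row A m') \<and>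
    ((\<exists>s<p. [change f t (A LAB) (row A v ^^ s \<circ> row A m) = 0] (mod int p)) \<longrightarrow>
      [change f t (A LAB) (row (A(ROT := R)) m) = 0] (mod int p))"
proof -
  let ?c = "For 8 nE (Assign ROT (idx (Var 6) (Var 8)) (rotE pivotE (rotE (Var 6) (Var 8))))"
  let ?g = "\<lambda>s. row A v ^^ s \<circ> row A m"
  let ?P = "\<lambda>s. \<not> [change f t (A LAB) (?g s) = 0] (mod int p)"
  let ?St = "\<lambda>s A'. \<exists>R. A' = A(ROT := R) \<and> row (A(ROT := R)) m = ?g s \<and> (\<forall>m'. m' \<noteq> m \<longrightarrow> row (A(ROT := R)) m' = row A m')"
  have gN: "\<forall>z<N. ?g s z < N" for s using funpow_comp_less[of "row A v" "row A m"] r(1) m by auto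
  have "\<exists>s. ?St s (sem (For 7 pE (Cond changesE ?c)) q \<rho>' A) \<and> ((\<exists>s<p. \<not> ?P s) \<longrightarrow> \<not> ?P s)"
  proof (rule For_until)
    show "eval pE \<rho>' A = p" using A by (simp add: static_def)
    show "?St 0 A" by (intro exI[of _ "A ROT"]) simp
    fix i s A' assume "?St s A'"
    then obtain R where R: "A' = A(ROT := R)" "row A' m = ?g s" "\<forall>m'. m' \<noteq> m \<longrightarrow> row A' m' = row A m'"
      by blast
    let ?\<rho> = "\<rho>'(7 := i)"
    have am: "at_moment t ?\<rho>" using \<rho>'(1) by (rule at_moment_upd) simp
    have S: "static A'" unfolding R(1) using A by (rule static_upd) simp
    have lab: "A' LAB = A LAB" and piv: "A' PIVOT 0 = v" unfolding R(1) using v by simp_all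
    have rv: "row A' v = row A v" "row A' (k * N) = id" using R(3) m r(2) by auto
    have vN: "\<forall>z<N. row A v z < N" using r(1) m(2) by blast
    have "eval changesE ?\<rho> A' \<noteq> 0 \<longleftrightarrow> \<not> [change f t (A' LAB) (row A' m) = 0] (mod int p)"
      by (rule eval_changesE[OF S t am]) (use \<rho>'(2) l gN R(2) rv(2) lab in auto)
    then show "eval changesE ?\<rho> A' \<noteq> 0 \<longleftrightarrow> ?P s" unfolding lab R(2) .
    have "\<exists>R'. sem ?c q ?\<rho> A' = A'(ROT := R') \<and> row (A'(ROT := R')) m = row A' v \<circ> row A' m \<and>
        (\<forall>m'. m' \<noteq> m \<longrightarrow> row (A'(ROT := R')) m' = row A' m')"
      by (rule compose_row) (use am \<rho>'(2) piv m(1) gN vN R(2) rv(1) in \<open>auto simp: at_moment_def\<close>)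
    then obtain R' where R': "sem ?c q ?\<rho> A' = A'(ROT := R')" "row (A'(ROT := R')) m = row A' v \<circ> row A' m"
        "\<forall>m'. m' \<noteq> m \<longrightarrow> row (A'(ROT := R')) m' = row A' m'" by blast
    have upd: "A'(ROT := R') = A(ROT := R')" unfolding R(1) by simp
    have "row A' v \<circ> row A' m = ?g (Suc s)" unfolding rv(1) R(2) by (simp add: comp_assoc)
    then show "?St (Suc s) (sem ?c q ?\<rho> A')"
      using R' R(3) unfolding upd by (intro exI[of _ R']) simp
  qed
  then obtain s R where "sem (For 7 pE (Cond changesE ?c)) q \<rho>' A = A(ROT := R)"
    "row (A(ROT := R)) m = ?g s" "\<forall>m'. m' \<noteq> m \<longrightarrow> row (A(ROT := R)) m' = row A m'"
    "(\<exists>s<p. \<not> ?P s) \<longrightarrow> \<not> ?P s" by blast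
  then show ?thesis by (intro exI[of _ R] exI[of _ s]) simp
qed

lemma adjust_rotations:
  assumes A: "static A" and t: "t < N * N * N" and \<rho>': "at_moment t \<rho>'" and v: "A PIVOT 0 = v" "v \<le> k * N"
    and l: "\<forall>x<N. A LAB x < N" and r: "\<forall>m\<le>k*N. \<forall>z<N. row A m z < N" "row A (k * N) = id"
  shows "\<exists>R. sem adjust_rotations q \<rho>' A = A(ROT := R) \<and> (\<forall>m\<ge>v. row (A(ROT := R)) m = row A m) \<and>
    (\<forall>m<v. (\<exists>s. row (A(ROT := R)) m = row A v ^^ s \<circ> row A m) \<and>
      ((\<exists>s<p. [change f t (A LAB) (row A v ^^ s \<circ> row A m) = 0] (mod int p)) \<longrightarrow>
        [change f t (A LAB) (row (A(ROT := R)) m) = 0] (mod int p)))"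
proof -
  let ?c = "For 7 pE (Cond changesE
       (For 8 nE (Assign ROT (idx (Var 6) (Var 8)) (rotE pivotE (rotE (Var 6) (Var 8))))))"
  define Q where "Q m g \<longleftrightarrow> (\<exists>s. g = row A v ^^ s \<circ> row A m) \<and>
      ((\<exists>s<p. [change f t (A LAB) (row A v ^^ s \<circ> row A m) = 0] (mod int p)) \<longrightarrow>
        [change f t (A LAB) g = 0] (mod int p))" for m g
  let ?I = "\<lambda>j A'. \<exists>R. A' = A(ROT := R) \<and> (\<forall>m\<ge>j. row (A(ROT := R)) m = row A m) \<and> (\<forall>m<j. Q m (row (A(ROT := R)) m))"
  have "?I v (sem adjust_rotations q \<rho>' A)"
    unfolding adjust_rotations_def
  proof (rule For_rule[where I = ?I])
    show "eval pivotE \<rho>' A = v" using v by simp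
    show "?I 0 A" by (intro exI[of _ "A ROT"]) simp
    fix j A' assume j: "j < v" and "?I j A'"
    then obtain R where R: "A' = A(ROT := R)" "\<forall>m\<ge>j. row A' m = row A m" "\<forall>m<j. Q m (row A' m)" by blast
    let ?\<rho> = "\<rho>'(6 := j)"
    have am: "at_moment t ?\<rho>" using \<rho>' by (rule at_moment_upd) simp
    have S: "static A'" unfolding R(1) using A by (rule static_upd) simp
    have lab: "A' LAB = A LAB" and piv: "A' PIVOT 0 = v" unfolding R(1) using v by simp_all
    have rN: "\<forall>z<N. row A' m z < N" if "m \<le> k * N" for m
    proof (cases "m < j")
      case True
      then obtain s where "row A' m = row A v ^^ s \<circ> row A m" using R(3) unfolding Q_def by blast
      then show ?thesis using funpow_comp_less[of "row A v" "row A m"] r(1) v that by auto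
    qed (use R(2) r that in auto)
    have rv: "row A' v = row A v" "row A' j = row A j" "row A' (k * N) = id" using R(2) j v(2) r(2) by auto
    obtain R' s where R': "sem ?c q ?\<rho> A' = A'(ROT := R')"
      "row (A'(ROT := R')) j = row A' v ^^ s \<circ> row A' j" "\<forall>m'. m' \<noteq> j \<longrightarrow> row (A'(ROT := R')) m' = row A' m'"
      "(\<exists>s<p. [change f t (A' LAB) (row A' v ^^ s \<circ> row A' j) = 0] (mod int p)) \<longrightarrow>
        [change f t (A' LAB) (row (A'(ROT := R')) j) = 0] (mod int p)"
      using adjust_row[OF S t am, of j v] j v(2) lab l rN rv(3) piv by auto
    have upd: "A'(ROT := R') = A(ROT := R')" unfolding R(1) by simp
    have "Q j (row (A(ROT := R')) j)"
      using R'(2,4) unfolding Q_def upd rv lab by blast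
    then show "?I (Suc j) (sem ?c q ?\<rho> A')"
      using R' R(2,3) unfolding upd by (intro exI[of _ R']) (simp add: less_Suc_eq)
  qed
  then show ?thesis unfolding Q_def by blast
qed

lemma drop_pivot:
  assumes \<rho>': "\<rho>' 0 = N" and v: "A PIVOT 0 = v"
  shows "\<exists>R. sem drop_pivot q \<rho>' A = A(ROT := R) \<and> row (A(ROT := R)) v = id \<and>
    (\<forall>m. m \<noteq> v \<longrightarrow> row (A(ROT := R)) m = row A m)"
proof -
  let ?I = "\<lambda>j A'. \<exists>R. A' = A(ROT := R) \<and> (\<forall>z<j. R (v * N + z) = z) \<and>
    (\<forall>m. m \<noteq> v \<longrightarrow> row (A(ROT := R)) m = row A m)"
  have "?I N (sem drop_pivot q \<rho>' A)"
    unfolding drop_pivot_def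
  proof (rule For_rule[where I = ?I])
    show "eval nE \<rho>' A = N" using \<rho>' by simp
    show "?I 0 A" by (intro exI[of _ "A ROT"]) simp
    fix j A' assume j: "j < N" and "?I j A'"
    then obtain R where R: "A' = A(ROT := R)" "\<forall>z<j. R (v * N + z) = z"
      "\<forall>m. m \<noteq> v \<longrightarrow> row (A(ROT := R)) m = row A m" by blast
    have sem: "sem (Assign ROT (idx pivotE (Var 6)) (Var 6)) q (\<rho>'(6 := j)) A' = A(ROT := R(v * N + j := j))"
      unfolding R(1) using \<rho>' v N_le_q[of j] j by (simp add: min_absorb1)
    have "row (A(ROT := R(v * N + j := j))) m = row (A(ROT := R)) m" if "m \<noteq> v" for m
      using index_eq_iff[of _ N j m v] j that by (auto simp: row_def fun_eq_iff)
    then show "?I (Suc j) (sem (Assign ROT (idx pivotE (Var 6)) (Var 6)) q (\<rho>'(6 := j)) A')"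
      unfolding sem using R(2,3) by (intro exI[of _ "R(v * N + j := j)"]) (auto simp: less_Suc_eq)
  qed
  then obtain R where R: "sem drop_pivot q \<rho>' A = A(ROT := R)" "\<forall>z<N. R (v * N + z) = z"
    "\<forall>m. m \<noteq> v \<longrightarrow> row (A(ROT := R)) m = row A m" by blast
  moreover have "row (A(ROT := R)) v = id" using R(2) by (auto simp: row_def fun_eq_iff)
  ultimately show ?thesis by blast
qed

text \<open>The invariant of \<open>normalize\<close>. Here l is the labelling at the start; staying
  in its orbit is what \<open>normal_labelling\<close> asks for in the end.\<close>

definition normal_upto :: "(nat \<Rightarrow> nat) \<Rightarrow> nat \<Rightarrow> store \<Rightarrow> bool" where
  "normal_upto l t A \<longleftrightarrow> static A \<and> (\<forall>x<N. A LAB x < N) \<and> (\<exists>\<sigma>\<in>\<Gamma>. \<forall>x<N. A LAB x = \<sigma> (l x)) \<and>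
     echelon (stab f t (A LAB)) (row A) \<and> normal f t (A LAB) \<and> row A (k * N) = id"

lemma rot_group_less: "\<sigma> \<in> \<Gamma> \<Longrightarrow> z < N \<Longrightarrow> \<sigma> z < N"
  by (auto simp: rot_group_def intro: rotating_less)

text \<open>The lemmas on the program are conditional: if some power of the pivot below p achieves
  zero, then zero is reached. By \<open>linear_solve\<close> such a power exists, and
  \<open>normal_step\<close> does the rest.\<close>

lemma normalize_step:
  assumes l: "normal_upto l t A" and t: "t < N * N * N" and \<rho>': "at_moment t \<rho>'"
  shows "normal_upto l (Suc t) (sem (Seq find_pivot (Seq adjust_labels (Seq adjust_rotations drop_pivot))) q \<rho>' A)"
proof -
  have A: "static A" and LN: "\<forall>x<N. A LAB x < N" and ech: "echelon (stab f t (A LAB)) (row A)"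
    and norm: "normal f t (A LAB)" and rid: "row A (k * N) = id"
    using l by (auto simp: normal_upto_def)
  have fN: "\<forall>x<N. \<forall>y<N. f x y < N" using f_closed by blast
  let ?l = "A LAB"
  let ?h = "change f t ?l"
  have S: "perm_group (stab f t ?l)" using perm_group_stab[OF fN _ LN] t by simp
  have ch: "character (stab f t ?l) (int p) ?h" by (rule character_change[OF fN t LN])
  have rS: "row A m \<in> stab f t ?l" if "m < k * N" for m using ech that by (simp add: echelon_def)
  have r: "\<forall>m\<le>k*N. \<forall>z<N. row A m z < N"
  proof (intro allI impI)
    fix m z assume "m \<le> k * N" "z < N"
    then show "row A m z < N"
      using rS[of m] rid rot_group_less[of "row A m" z] by (cases "m = k * N") (auto simp: stab_def)
  qed
  obtain v where v: "v \<le> k * N" "sem find_pivot q \<rho>' A = A(PIVOT := (A PIVOT)(0 := v))"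
    and vz: "v < k * N \<Longrightarrow> \<not> [?h (row A v) = 0] (mod int p)"
    and last: "\<And>m. m < k * N \<Longrightarrow> v < m \<or> v = k * N \<Longrightarrow> [?h (row A m) = 0] (mod int p)"
    using find_pivot[OF A t \<rho>' LN _ rid] r by auto
  let ?b = "row A v"
  let ?A1 = "A(PIVOT := (A PIVOT)(0 := v))"
  have A1: "static ?A1" using A by (rule static_upd) simp
  have bN: "\<forall>z<N. ?b z < N" using r v(1) by blast
  obtain l' s where l's: "sem adjust_labels q \<rho>' ?A1 = ?A1(LAB := l')" "\<forall>x<N. l' x = (?b ^^ s) (?l x)"
    and l'z: "(\<exists>s<p. [nth_moment N f t (?b ^^ s \<circ> ?l) = 0] (mod int p)) \<longrightarrow> [nth_moment N f t l' = 0] (mod int p)"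
    using adjust_labels[OF A1 t \<rho>', of v] LN rid bN by auto
  let ?A2 = "?A1(LAB := l')"
  have A2: "static ?A2" using A1 by (rule static_upd) simp
  have l'N: "\<forall>x<N. l' x < N" using l's(2) funpow_comp_less[OF bN LN] by auto
  obtain R where R: "sem adjust_rotations q \<rho>' ?A2 = ?A2(ROT := R)" "\<forall>m\<ge>v. row (?A2(ROT := R)) m = row A m"
    "\<forall>m<v. (\<exists>s. row (?A2(ROT := R)) m = ?b ^^ s \<circ> row A m) \<and>
      ((\<exists>s<p. [change f t l' (?b ^^ s \<circ> row A m) = 0] (mod int p)) \<longrightarrow>
        [change f t l' (row (?A2(ROT := R)) m) = 0] (mod int p))"
    using adjust_rotations[OF A2 t \<rho>', of v] v(1) l'N r rid by auto
  let ?A3 = "?A2(ROT := R)"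
  obtain R' where R': "sem drop_pivot q \<rho>' ?A3 = ?A3(ROT := R')" "row (?A3(ROT := R')) v = id"
    "\<forall>m. m \<noteq> v \<longrightarrow> row (?A3(ROT := R')) m = row ?A3 m"
    using drop_pivot[of \<rho>' ?A3 v] \<rho>' by (auto simp: at_moment_def)
  define A4 where "A4 = ?A3(ROT := R')"
  have sem: "sem (Seq find_pivot (Seq adjust_labels (Seq adjust_rotations drop_pivot))) q \<rho>' A = A4"
    unfolding sem.simps(3) v(2) l's(1) R(1) R'(1) A4_def ..
  have A4: "static A4" "A4 LAB = l'"
    unfolding A4_def using A2 by (auto intro!: static_upd)
  have R4: "row A4 v = id" "\<forall>m>v. row A4 m = row A m" "\<forall>m<v. \<exists>s. row A4 m = ?b ^^ s \<circ> row A m"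
    "\<forall>m<v. (\<exists>s<p. [change f t l' (?b ^^ s \<circ> row A m) = 0] (mod int p)) \<longrightarrow> [change f t l' (row A4 m) = 0] (mod int p)"
    using R'(2,3) R(2,3) unfolding A4_def by auto
  have pow: "[?h (?b ^^ s) = int s * ?h ?b] (mod int p)" if "v < k * N" for s
    by (rule character_funpow[OF S ch rS[OF that]])
  \<comment> \<open>Applying the pivot s times adds s times its nonzero character value to the
    moment.\<close>
  have moment0: "[nth_moment N f t l' = 0] (mod int p)" if vk: "v < k * N"
  proof -
    obtain s where "s < p" and s: "[nth_moment N f t ?l + int s * ?h ?b = 0] (mod int p)"
      using linear_solve[OF vz[OF vk]] by blast
    have "nth_moment N f t (?b ^^ s \<circ> ?l) = nth_moment N f t ?l + ?h (?b ^^ s)" by (simp add: change_def)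
    then have "[nth_moment N f t (?b ^^ s \<circ> ?l) = 0] (mod int p)"
      using cong_trans[OF cong_add[OF cong_refl pow[OF that]] s] by simp
    with l'z \<open>s < p\<close> show ?thesis by blast
  qed
  \<comment> \<open>Without a pivot the row k N is used, whose powers are the identity, so labels
    and generators stay the same.\<close>
  have idpow: "(id ^^ s) = id" for s :: nat by (induction s) auto
  have change0: "[change f t l' (row A4 m) = 0] (mod int p)" if mv: "m < v" and vk: "v < k * N" for m
  proof -
    obtain \<sigma> where \<sigma>: "\<sigma> \<in> stab f t ?l" "\<forall>x<N. l' x = \<sigma> (?l x)"
      using l's(2) perm_group_funpow[OF S rS[OF vk]] by blast
    have l'_eq: "nth_moment N f u l' = nth_moment N f u (\<sigma> \<circ> ?l)" for u
      unfolding nth_moment_def using fN \<sigma>(2) by (intro moment_cong) auto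
    \<comment> \<open>The adjusted labelling has the same earlier moments, so the change of moment t
      may be computed at the old one, where the character property is available.\<close>
    have eq: "\<forall>u<t. [nth_moment N f u l' = nth_moment N f u ?l] (mod int p)"
      using \<sigma>(1) unfolding stab_def l'_eq by auto
    have m: "m < k * N" using that by simp
    obtain s where "s < p" and s: "[?h (row A m) + int s * ?h ?b = 0] (mod int p)"
      using linear_solve[OF vz[OF vk]] by blast
    have bs: "?b ^^ s \<in> stab f t ?l" by (rule perm_group_funpow[OF S rS[OF that(2)]])
    have "?b ^^ s \<circ> row A m \<in> stab f t ?l" using S bs rS[OF m] by (simp add: perm_group_def)
    then have "[change f t l' (?b ^^ s \<circ> row A m) = ?h (?b ^^ s \<circ> row A m)] (mod int p)"
      by (intro change_cong[OF fN _ t l'N LN eq]) (simp add: stab_def)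
    also have "[?h (?b ^^ s \<circ> row A m) = ?h (?b ^^ s) + ?h (row A m)] (mod int p)"
      by (rule character_comp[OF ch bs rS[OF m]])
    also have "[?h (?b ^^ s) + ?h (row A m) = int s * ?h ?b + ?h (row A m)] (mod int p)"
      by (intro cong_add pow[OF that(2)] cong_refl)
    also have "[int s * ?h ?b + ?h (row A m) = 0] (mod int p)" using s by (simp add: add.commute)
    finally show ?thesis using R4(4) that(1) \<open>s < p\<close> by blast
  qed
  have step: "echelon (stab f (Suc t) l') (row A4) \<and> normal f (Suc t) l' \<and> (\<exists>\<sigma>\<in>\<Gamma>. \<forall>x<N. l' x = \<sigma> (?l x))"
  proof (intro conjI)
    have 1: "\<exists>r. \<forall>x<N. l' x = (?b ^^ r) (?l x)" using l's(2) by blast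
    have 2: "\<forall>x<N. l' x = ?l x" if "v = k * N" using l's(2) that by (simp add: rid idpow)
    have 3: "\<exists>c. row A4 m = ?b ^^ c \<circ> row A m" if "m < v" for m using R4(3) that by blast
    have 4: "row A4 m = row A m" if "v < m \<or> v = k * N" "m < k * N" for m
      using R4(2,3) that by (auto simp: rid idpow)
    note step = normal_step[where l' = l' and b' = "row A4", OF fN t LN ech norm v(1) vz last 1 2 moment0 3 change0 R4(1) 4]
    show "echelon (stab f (Suc t) l') (row A4)" "normal f (Suc t) l'" "\<exists>\<sigma>\<in>\<Gamma>. \<forall>x<N. l' x = \<sigma> (?l x)"
      by (rule step; assumption)+
  qed
  obtain \<sigma> where \<sigma>: "\<sigma> \<in> \<Gamma>" "\<forall>x<N. ?l x = \<sigma> (l x)" using l unfolding normal_upto_def by blast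
  obtain \<tau> where \<tau>: "\<tau> \<in> \<Gamma>" "\<forall>x<N. l' x = \<tau> (?l x)" using step by blast
  have "\<tau> \<circ> \<sigma> \<in> \<Gamma>" using \<sigma> \<tau> perm_group_rot_group[of p k] by (simp add: perm_group_def)
  moreover have "\<forall>x<N. l' x = (\<tau> \<circ> \<sigma>) (l x)" using \<sigma>(2) \<tau>(2) by simp
  ultimately have orbit: "\<exists>\<sigma>\<in>\<Gamma>. \<forall>x<N. l' x = \<sigma> (l x)" by blast
  have "row A4 (k * N) = id" using R4(1,2) v(1) rid by (cases "v = k * N") auto
  then show ?thesis
    unfolding sem normal_upto_def A4(2) using A4(1) l'N orbit step by blast
qed

lemma normalize:
  assumes "normal_upto l 0 A"
  shows "normal_upto l (N * N * N) (sem normalize q \<rho> A)"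
proof -
  let ?c = "Seq find_pivot (Seq adjust_labels (Seq adjust_rotations drop_pivot))"
  show ?thesis
    unfolding normalize_def
  proof (rule For_rule[where I = "\<lambda>a. normal_upto l (a * N * N)"])
    show "eval nE \<rho> A = N" using \<rho>0 by simp
    show "normal_upto l (0 * N * N) A" using assms by simp
    fix a A' assume a: "a < N" and I: "normal_upto l (a * N * N) A'"
    have "normal_upto l ((a * N + N) * N) (sem (For 2 nE (For 3 nE ?c)) q (\<rho>(1 := a)) A')"
    proof (rule For_rule[where I = "\<lambda>b. normal_upto l ((a * N + b) * N)"])
      show "eval nE (\<rho>(1 := a)) A' = N" using \<rho>0 by simp
      show "normal_upto l ((a * N + 0) * N) A'" using I by simp
      fix b A2 assume b: "b < N" and I2: "normal_upto l ((a * N + b) * N) A2"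
      have "normal_upto l ((a * N + b) * N + N) (sem (For 3 nE ?c) q (\<rho>(1 := a, 2 := b)) A2)"
      proof (rule For_rule[where I = "\<lambda>c. normal_upto l ((a * N + b) * N + c)"])
        show "eval nE (\<rho>(1 := a, 2 := b)) A2 = N" using \<rho>0 by simp
        show "normal_upto l ((a * N + b) * N + 0) A2" using I2 by simp
        fix c A3 assume c: "c < N" and I3: "normal_upto l ((a * N + b) * N + c) A3"
        have "at_moment ((a * N + b) * N + c) (\<rho>(1 := a, 2 := b, 3 := c))"
          unfolding at_moment_def using \<rho>0 a b c p_pos by (simp add: div_mult_self3 del: mult_Suc)
        moreover have "(a * N + b) * N + c < N * N * N" by (intro index_less a b c)
        ultimately show "normal_upto l ((a * N + b) * N + Suc c) (sem ?c q (\<rho>(1 := a, 2 := b, 3 := c)) A3)"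
          using normalize_step[OF I3] by simp
      qed
      moreover have "(a * N + b) * N + N = (a * N + Suc b) * N" by simp
      ultimately show "normal_upto l ((a * N + Suc b) * N) (sem (For 3 nE ?c) q (\<rho>(1 := a, 2 := b)) A2)"
        by (simp only:)
    qed
    moreover have "(a * N + N) * N = Suc a * N * N" by simp
    ultimately show "normal_upto l (Suc a * N * N) (sem (For 2 nE (For 3 nE ?c)) q (\<rho>(1 := a)) A')"
      by (simp only:)
  qed
qed

lemma normal_upto_0:
  assumes A: "static A" and l: "\<forall>x<N. A LAB x < N"
  shows "normal_upto (A LAB) 0 (sem set_rotations q \<rho> A)"
proof -
  let ?A = "sem set_rotations q \<rho> A"
  have w: "writes set_rotations = {ROT}" by (simp add: set_rotations_def)
  have fr: "?A a = A a" if "a \<noteq> ROT" for a by (rule sem_frame) (use that w in simp)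
  have "echelon \<Gamma> (row ?A)" by (rule echelon_rotations) (use set_rotations(1)[OF A] in blast)
  moreover have "static ?A" using A by (rule static_cong) (simp add: fr)
  moreover have "\<exists>\<sigma>\<in>\<Gamma>. \<forall>x<N. A LAB x = \<sigma> (A LAB x)"
    using perm_group_rot_group[of p k] unfolding perm_group_def by (intro bexI[of _ id]) auto
  ultimately show ?thesis
    using l set_rotations(2)[OF A] fr[of LAB] by (simp add: normal_upto_def normal_def stab_0)
qed

section \<open>The output table and the least table so far\<close>

lemma set_output:
  assumes A: "static A" and l: "bij_betw (A LAB) {..<N} {..<N}"
  shows "\<forall>x<N. \<forall>y<N. sem set_output q \<rho> A OUT (A LAB x * N + A LAB y) = A LAB (f x y)"
proof -
  let ?l = "A LAB"
  let ?c = "Assign OUT (idx (Arr LAB (Var 1)) (Arr LAB (Var 2))) (Arr LAB (multE (Var 1) (Var 2)))"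
  have lN: "?l x < N" if "x < N" for x using l that by (auto dest: bij_betwE)
  have inj: "?l u = ?l u' \<longleftrightarrow> u = u'" if "u < N" "u' < N" for u u'
    using l that by (auto simp: bij_betw_def inj_on_def)
  show ?thesis
    unfolding set_output_def
  proof (rule For_rule[where I = "\<lambda>m A'. \<forall>x<m. \<forall>y<N. A' OUT (?l x * N + ?l y) = ?l (f x y)"])
    show "eval nE \<rho> A = N" using \<rho>0 by simp
    fix m A' assume m: "m < N" and fr: "\<And>a. a \<notin> writes (For 2 nE ?c) \<Longrightarrow> A' a = A a"
      and I: "\<forall>x<m. \<forall>y<N. A' OUT (?l x * N + ?l y) = ?l (f x y)"
    have "(\<forall>x<m. \<forall>y<N. sem (For 2 nE ?c) q (\<rho>(1 := m)) A' OUT (?l x * N + ?l y) = ?l (f x y)) \<and>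
        (\<forall>y<N. sem (For 2 nE ?c) q (\<rho>(1 := m)) A' OUT (?l m * N + ?l y) = ?l (f m y))"
    proof (rule For_rule[where I = "\<lambda>j A'. (\<forall>x<m. \<forall>y<N. A' OUT (?l x * N + ?l y) = ?l (f x y)) \<and>
        (\<forall>y<j. A' OUT (?l m * N + ?l y) = ?l (f m y))"])
      show "eval nE (\<rho>(1 := m)) A' = N" using \<rho>0 by simp
      show "(\<forall>x<m. \<forall>y<N. A' OUT (?l x * N + ?l y) = ?l (f x y)) \<and>
        (\<forall>y<0. A' OUT (?l m * N + ?l y) = ?l (f m y))" using I by simp
      fix j A2 assume j: "j < N" and fr2: "\<And>a. a \<notin> writes ?c \<Longrightarrow> A2 a = A' a"
        and I2: "(\<forall>x<m. \<forall>y<N. A2 OUT (?l x * N + ?l y) = ?l (f x y)) \<and>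
        (\<forall>y<j. A2 OUT (?l m * N + ?l y) = ?l (f m y))"
      have lab: "A2 LAB = ?l" using fr fr2 by simp
      have "static A2" using A by (rule static_cong) (use fr fr2 in simp)
      then have "A2 TAB (m * N + j) = f m j" using m j by (simp add: static_def)
      then have "sem ?c q (\<rho>(1 := m, 2 := j)) A2 = A2(OUT := (A2 OUT)(?l m * N + ?l j := ?l (f m j)))"
        using \<rho>0 lab N_le_q[OF less_imp_le[OF lN[OF f_closed[OF m j]]]] by (simp add: min_absorb1)
      then show "(\<forall>x<m. \<forall>y<N. sem ?c q (\<rho>(1 := m, 2 := j)) A2 OUT (?l x * N + ?l y) = ?l (f x y)) \<and>
        (\<forall>y<Suc j. sem ?c q (\<rho>(1 := m, 2 := j)) A2 OUT (?l m * N + ?l y) = ?l (f m y))"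
        using I2 m j by (auto simp: less_Suc_eq index_eq_iff lN inj)
    qed
    then show "\<forall>x<Suc m. \<forall>y<N. sem (For 2 nE ?c) q (\<rho>(1 := m)) A' OUT (?l x * N + ?l y) = ?l (f x y)"
      by (auto simp: less_Suc_eq)
  qed simp
qed

definition entries :: "nat \<Rightarrow> store \<Rightarrow> nat list" where
  "entries a A = map (A a) [0..<N * N]"

definition label :: com where
  "label = Seq build_chain (Seq set_labels (Seq set_rotations (Seq normalize set_output)))"

lemma writes_label: "writes label = {GEN, ELEM, LAB, ROT, PIVOT, OUT}"
  by (auto simp: label_def build_chain_def choose_generator_def extend_elements_def fill_defs set_labels_def
    set_rotations_def normalize_def find_pivot_def adjust_labels_def adjust_rotations_def drop_pivot_def set_output_def)

text \<open>For a digit sequence that yields no chain the labels and the table are meaningless,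
  hence the hypothesis of the last claim.\<close>

lemma label:
  assumes A: "static A"
  defines "A' \<equiv> sem label q \<rho> A"
  shows "\<forall>i<k. chosen (A CHOICE) (A' GEN) i" "elements_ok A' k"
    "chain G p (A' GEN) k \<Longrightarrow> \<exists>l. normal_labelling f (A' GEN) l \<and> relabelled f l (entries OUT A')"
proof -
  let ?A1 = "sem build_chain q \<rho> A"
  let ?A2 = "sem set_labels q \<rho> ?A1"
  let ?A3 = "sem set_rotations q \<rho> ?A2"
  let ?A4 = "sem normalize q \<rho> ?A3"
  have A': "A' = sem set_output q \<rho> ?A4" unfolding A'_def label_def sem.simps(3) ..
  have w: "writes build_chain = {GEN, ELEM}" "writes set_labels = {LAB}" "writes set_rotations = {ROT}"
      "writes normalize = {PIVOT, LAB, ROT}" "writes set_output = {OUT}"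
    by (auto simp: build_chain_def choose_generator_def extend_elements_def fill_defs set_labels_def
      set_rotations_def normalize_def find_pivot_def adjust_labels_def adjust_rotations_def drop_pivot_def set_output_def)
  have fr: "sem build_chain q \<rho> A a = A a" if "a \<notin> {GEN, ELEM}" for a by (rule sem_frame) (use that w in simp)
  have fr': "A' a = ?A1 a" if "a \<in> {GEN, ELEM}" for a
  proof -
    have "A' a = ?A4 a" unfolding A' by (rule sem_frame) (use that w in auto)
    also have "\<dots> = ?A3 a" by (rule sem_frame) (use that w in auto)
    also have "\<dots> = ?A2 a" by (rule sem_frame) (use that w in auto)
    also have "\<dots> = ?A1 a" by (rule sem_frame) (use that w in auto)
    finally show ?thesis .
  qed
  have GEN: "A' GEN = ?A1 GEN" and ELEM: "A' ELEM = ?A1 ELEM" by (rule fr'; simp)+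
  show "\<forall>i<k. chosen (A CHOICE) (A' GEN) i" unfolding GEN by (rule build_chain(1)[OF A])
  show "elements_ok A' k" using build_chain(2)[OF A] unfolding elements_ok_def GEN ELEM .
  assume ch: "chain G p (A' GEN) k"
  let ?e = "elem G p (A' GEN) k"
  have A1: "static ?A1" using A by (rule static_cong) (simp add: fr)
  have lab: "\<forall>z<N. ?A2 LAB (?e z) = z"
    using set_labels[OF A1 build_chain(2)[OF A]] ch unfolding GEN by blast
  have bij: "bij_betw ?e {..<N} {..<N}" by (rule bij_elem[OF group_f ch])
  have A2: "static ?A2" using A1 by (rule static_cong) (rule sem_frame, simp add: w)
  have "\<forall>x<N. ?A2 LAB x < N"
  proof (intro allI impI)
    fix x assume "x < N"
    then obtain z where "z < N" "x = ?e z" using bij by (auto simp: bij_betw_def)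
    with lab show "?A2 LAB x < N" by simp
  qed
  then have n: "normal_upto (?A2 LAB) (N * N * N) ?A4" by (intro normalize normal_upto_0 A2)
  then obtain \<sigma> where \<sigma>: "\<sigma> \<in> \<Gamma>" "\<forall>x<N. ?A4 LAB x = \<sigma> (?A2 LAB x)" unfolding normal_upto_def by blast
  have "\<forall>z<N. ?A4 LAB (?e z) = \<sigma> z" using \<sigma>(2) lab bij by (auto dest: bij_betwE)
  then have nl: "normal_labelling f (A' GEN) (?A4 LAB)"
    using n \<sigma>(1) ch unfolding normal_labelling_def normal_upto_def by blast
  have "static ?A4" using n by (simp add: normal_upto_def)
  from set_output[OF this bij_labelling[OF group_f nl]]
  have "A' OUT (?A4 LAB x * N + ?A4 LAB y) = ?A4 LAB (f x y)" if "x < N" "y < N" for x y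
    unfolding A' using that by blast
  moreover have "?A4 LAB x * N + ?A4 LAB y < N * N" if "x < N" "y < N" for x y
    using bij_labelling_less[OF group_f nl] that by (intro index_less) auto
  ultimately have "relabelled f (?A4 LAB) (entries OUT A')"
    unfolding relabelled_def entries_def by simp
  with nl show "\<exists>l. normal_labelling f (A' GEN) l \<and> relabelled f l (entries OUT A')" by blast
qed

lemma list_less_iff_nth:
  fixes v w :: "nat list"
  assumes "length v = length w"
  shows "v < w \<longleftrightarrow> (\<exists>i<length v. v ! i < w ! i \<and> (\<forall>j<i. v ! j = w ! j))"
proof -
  have "take i v = take i w \<longleftrightarrow> (\<forall>j<i. v ! j = w ! j)" if "i < length v" for i
    using that assms by (simp add: list_eq_iff_nth_eq)
  with assms show ?thesis by (auto simp: list_less_def lexord_take_index_conv)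
qed

lemma eval_lessE: "eval lessE \<rho> A = of_bool (entries OUT A < entries BEST A)"
proof -
  have "entries OUT A < entries BEST A \<longleftrightarrow> (\<exists>i<N * N. A OUT i < A BEST i \<and> (\<forall>j<i. A OUT j = A BEST j))"
    unfolding entries_def by (subst list_less_iff_nth) (simp_all cong: conj_cong imp_cong)
  then show ?thesis using \<rho>0 by (simp add: lessE_def)
qed

lemma update_best:
  assumes A: "static A" and x: "\<forall>i<k. A GEN i < N" and el: "elements_ok A k"
    and M: "chain G p (A GEN) k \<Longrightarrow> entries OUT A \<in> candidates f"
  defines "A' \<equiv> sem update_best q \<rho> A"
  shows "if chain G p (A GEN) k \<and> (A FOUND 0 = 0 \<or> entries OUT A < entries BEST A)
    then entries BEST A' = entries OUT A \<and> A' FOUND 0 = 1 else A' = A"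
proof -
  let ?b = "Seq (For 1 n2E (Assign BEST (Var 1) (Arr OUT (Var 1)))) (Assign FOUND (Num 0) (Num 1))"
  let ?e = "Times validE (Plus (NotE (Arr FOUND (Num 0))) lessE)"
  let ?P = "chain G p (A GEN) k \<and> (A FOUND 0 = 0 \<or> entries OUT A < entries BEST A)"
  have e: "eval ?e \<rho> A \<noteq> 0 \<longleftrightarrow> ?P" using eval_validE[OF A x el] by (simp add: eval_lessE)
  show ?thesis
  proof (cases ?P)
    case True
    \<comment> \<open>For a candidate the entries are names below N, so the cut-off does not distort
      the copy.\<close>
    have OUT: "A OUT a < N" if "a < N * N" for a
    proof -
      have "a div N < N" "a mod N < N" using that N_pos by (auto intro: less_mult_imp_div_less)
      then have "entries OUT A ! (a div N * N + a mod N) < N"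
        using candidates_group(4)[OF group_f M] True by blast
      with that show ?thesis unfolding div_mult_mod_eq by (simp add: entries_def)
    qed
    have "\<forall>a<N*N. sem (For 1 n2E (Assign BEST (Var 1) (Arr OUT (Var 1)))) q \<rho> A BEST a = A OUT a"
    proof (rule For_rule[where I = "\<lambda>m A2. \<forall>a<m. A2 BEST a = A OUT a"])
      show "eval n2E \<rho> A = N * N" using \<rho>0 by simp
      fix m A2 assume "m < N * N" "\<And>a. a \<notin> writes (Assign BEST (Var 1) (Arr OUT (Var 1))) \<Longrightarrow> A2 a = A a"
        "\<forall>a<m. A2 BEST a = A OUT a"
      then show "\<forall>a<Suc m. sem (Assign BEST (Var 1) (Arr OUT (Var 1))) q (\<rho>(1 := m)) A2 BEST a = A OUT a"
        using OUT[of m] N_le_q[of "A OUT m"] by (simp add: less_Suc_eq min_absorb1)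
    qed simp
    moreover have "A' = sem ?b q \<rho> A"
      unfolding A'_def update_best_def sem.simps(4) by (rule if_not_P) (use e True in blast)
    moreover have "1 \<le> q" by (simp add: q_def)
    ultimately show ?thesis using True by (simp add: entries_def min_absorb1)
  next
    case False
    then have "A' = A" unfolding A'_def update_best_def sem.simps(4) by (intro if_P) (use e in blast)
    with False show ?thesis by auto
  qed
qed

text \<open>The choices are the digits of a number in mixed radix, with weights \<open>W i\<close>.\<close>

definition W :: "nat \<Rightarrow> nat" where
  "W m = (\<Prod>i<m. p ^ (k - i))"

lemma W_Suc: "W (Suc m) = p ^ (k - m) * W m"
  by (simp add: W_def)

lemma W_pos: "W m > 0"
  using p_pos by (simp add: W_def)

definition digits_value :: "(nat \<Rightarrow> nat) \<Rightarrow> nat \<Rightarrow> nat" where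
  "digits_value c m = (\<Sum>i<m. c i * W i)"

lemma digits_value_Suc: "digits_value c (Suc m) = c m * W m + digits_value c m"
  by (simp add: digits_value_def)

lemma digits_value_less: "\<forall>i<m. c i < p ^ (k - i) \<Longrightarrow> digits_value c m < W m"
proof (induction m)
  case 0
  then show ?case by (simp add: digits_value_def W_def)
next
  case (Suc m)
  then have "c m * W m + digits_value c m < p ^ (k - m) * W m" by (intro index_less) auto
  then show ?case unfolding digits_value_Suc W_Suc .
qed

lemma digits_value_inj:
  assumes "\<forall>i<m. c i < p ^ (k - i)" "\<forall>i<m. c' i < p ^ (k - i)" "digits_value c m = digits_value c' m"
  shows "\<forall>i<m. c i = c' i"
  using assms
proof (induction m)
  case (Suc m)
  then have "digits_value c m < W m" "digits_value c' m < W m" by (auto intro: digits_value_less)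
  with Suc.prems(3) have "c m = c' m" "digits_value c m = digits_value c' m"
    unfolding digits_value_Suc by (simp_all add: index_eq_iff)
  with Suc show ?case by (simp add: less_Suc_eq)
qed simp

text \<open>At j = W k the counter has overflowed, and the carry that remains stops the outer
  loop.\<close>

definition counting :: "store \<Rightarrow> nat \<Rightarrow> bool" where
  "counting A j \<longleftrightarrow> j \<le> W k \<and> (\<forall>i<k. A CHOICE i < p ^ (k - i)) \<and>
     (if j < W k then A CARRY 0 = 0 \<and> digits_value (A CHOICE) k = j else A CARRY 0 = 1)"

lemma next_choice:
  assumes A: "static A" and c: "counting A j" and j: "j < W k"
  shows "counting (sem next_choice q \<rho> A) (Suc j)"
proof -
  let ?C = "A CHOICE"
  have C: "?C i < p ^ (k - i)" if "i < k" for i using c that by (simp add: counting_def)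
  have V: "digits_value ?C k = j" using c j by (simp add: counting_def)
  let ?ca = "Assign CHOICE (Var 1) (Times (Plus (Arr CHOICE (Var 1)) (Arr CARRY (Num 0)))
        (LtE (Plus (Arr CHOICE (Var 1)) (Arr CARRY (Num 0))) (powE (Minus kE (Var 1)))))"
  let ?cb = "Assign CARRY (Num 0) (Times (Arr CARRY (Num 0)) (NotE (Arr CHOICE (Var 1))))"
  let ?A0 = "sem (Assign CARRY (Num 0) (Num 1)) q \<rho> A"
  have q1: "1 \<le> q" by (simp add: q_def)
  \<comment> \<open>Conserved quantity: the digits already processed, with the carry at its weight,
    represent the old value of these digits plus one.\<close>
  define I where "I m A' \<longleftrightarrow> A' CARRY 0 \<le> 1 \<and> (\<forall>i<m. A' CHOICE i < p ^ (k - i)) \<and> (\<forall>i\<ge>m. A' CHOICE i = ?C i) \<and>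
    digits_value (A' CHOICE) m + A' CARRY 0 * W m = digits_value ?C m + 1" for m and A' :: store
  let ?A' = "sem next_choice q \<rho> A"
  have "I k ?A'"
    unfolding next_choice_def sem.simps(3)[of "Assign CARRY (Num 0) (Num 1)"]
  proof (rule For_rule[where I = I])
    show "eval kE \<rho> ?A0 = k" using A by (simp add: static_def)
    show "I 0 ?A0" using q1 by (simp add: I_def digits_value_def W_def min_absorb1)
    fix i A1 assume i: "i < k" and fr: "\<And>a. a \<notin> writes (Seq ?ca ?cb) \<Longrightarrow> A1 a = ?A0 a" and I: "I i A1"
    have "static A1" using A by (rule static_cong) (simp add: fr)
    then have pw: "A1 POW (A1 EXPO 0 - i) = p ^ (k - i)" by (simp add: static_def)
    define e where "e = A1 CARRY 0"
    have e: "e \<le> 1" using I by (simp add: I_def e_def)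
    have Ci: "A1 CHOICE i = ?C i" using I by (simp add: I_def)
    define d where "d = (if ?C i + e < p ^ (k - i) then ?C i + e else 0)"
    \<comment> \<open>With carry 1 the new digit is zero only on overflow, so the digit itself tells
      whether to carry on.\<close>
    define e' where "e' = (if d = 0 then e else 0)"
    have le: "p ^ (k - i) \<le> q" using le_N[of "k - i"] N_le_q by simp
    have dlt: "d < p ^ (k - i)" using p_pos by (simp add: d_def)
    have ca: "sem ?ca q (\<rho>(1 := i)) A1 = A1(CHOICE := (A1 CHOICE)(i := d))"
      using pw Ci le by (simp add: d_def e_def[symmetric] min_absorb1)
    have cb: "sem ?cb q (\<rho>(1 := i)) (A1(CHOICE := (A1 CHOICE)(i := d))) =
        A1(CHOICE := (A1 CHOICE)(i := d), CARRY := (A1 CARRY)(0 := e'))"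
      using e q1 by (simp add: e'_def e_def[symmetric] min_absorb1)
    have de: "d + e' * p ^ (k - i) = ?C i + e"
    proof (cases "e = 0")
      case True
      then show ?thesis using C[OF i] by (simp add: d_def e'_def)
    next
      case False
      then have "e = 1" using e by simp
      show ?thesis
      proof (cases "?C i + 1 < p ^ (k - i)")
        case True
        with \<open>e = 1\<close> show ?thesis by (simp add: d_def e'_def)
      next
        case False
        with C[OF i] have "p ^ (k - i) = ?C i + 1" by linarith
        with \<open>e = 1\<close> show ?thesis by (simp add: d_def e'_def)
      qed
    qed
    have dv: "digits_value ((A1 CHOICE)(i := d)) i = digits_value (A1 CHOICE) i"
      by (simp add: digits_value_def)
    have "d * W i + digits_value (A1 CHOICE) i + e' * (p ^ (k - i) * W i) =
        (d + e' * p ^ (k - i)) * W i + digits_value (A1 CHOICE) i" by (simp add: algebra_simps)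
    also have "\<dots> = ?C i * W i + (digits_value (A1 CHOICE) i + e * W i)" unfolding de by (simp add: algebra_simps)
    also have "digits_value (A1 CHOICE) i + e * W i = digits_value ?C i + 1" using I by (simp add: I_def e_def)
    finally have "digits_value ((A1 CHOICE)(i := d)) (Suc i) + e' * W (Suc i) = digits_value ?C (Suc i) + 1"
      unfolding digits_value_Suc W_Suc dv by simp
    moreover have "e' \<le> 1" using e by (simp add: e'_def)
    ultimately show "I (Suc i) (sem (Seq ?ca ?cb) q (\<rho>(1 := i)) A1)"
      using I dlt unfolding sem.simps(3) ca cb by (simp add: I_def less_Suc_eq)
  qed
  then have I: "?A' CARRY 0 \<le> 1" "\<forall>i<k. ?A' CHOICE i < p ^ (k - i)"
    "digits_value (?A' CHOICE) k + ?A' CARRY 0 * W k = Suc j" by (simp_all add: I_def V)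
  have "digits_value (?A' CHOICE) k < W k" using I(2) by (rule digits_value_less)
  from I(1) consider "?A' CARRY 0 = 0" | "?A' CARRY 0 = 1" by linarith
  then show ?thesis
  proof cases
    case 1
    with I(3) have "digits_value (?A' CHOICE) k = Suc j" by simp
    with \<open>digits_value (?A' CHOICE) k < W k\<close> 1 I(2) show ?thesis by (simp add: counting_def)
  next
    case 2
    with I(3) j have "Suc j = W k" by simp
    with 2 I(2) show ?thesis by (simp add: counting_def)
  qed
qed

section \<open>Initialization and output\<close>

lemma p_le_q: "p \<le> q"
  using exponent_0 self_le_power[of p k] p_pos N_le_q[of p] by (cases "k = 0") (auto simp: q_def)

lemma k_le_N: "k \<le> N"
  using power_gt_expt[of p k] prime_gt_1_nat[OF prime] by simp

lemma copy_in:
  assumes T: "\<And>x y. x < N \<Longrightarrow> y < N \<Longrightarrow> flat A (x * N + y) = f x y" and x: "x < N" "y < N"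
  shows "sem copy_in q \<rho> A TAB (x * N + y) = f x y"
proof -
  let ?m = "\<lambda>i. N * N - 1 - i"
  let ?c = "Assign TAB (Minus (Minus n2E (Num 1)) (Var 1)) (Cell (Minus (Minus n2E (Num 1)) (Var 1)))"
  have small: "flat A m < N" if "m < N * N" for m
  proof -
    have m: "m div N < N" "m mod N < N" using that N_pos by (auto intro: less_mult_imp_div_less)
    from T[OF this] f_closed[OF this] show ?thesis unfolding div_mult_mod_eq by simp
  qed
  let ?I = "\<lambda>i A'. \<forall>m. (m < N * N - i \<longrightarrow> flat A' m = flat A m) \<and> (N * N - i \<le> m \<longrightarrow> m < N * N \<longrightarrow> A' TAB m = flat A m)"
  have "?I (N * N) (sem copy_in q \<rho> A)"
    unfolding copy_in_def
  proof (rule For_rule[where I = ?I])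
    show "eval n2E \<rho> A = N * N" using \<rho>0 by simp
    show "?I 0 A" by simp
    fix i A' assume i: "i < N * N" and I: "?I i A'"
    have lt: "?m i < N * N - i" using i by simp
    have val: "flat A' (?m i) = flat A (?m i)" using I lt by blast
    have "?m i < N * N" using i by simp
    from small[OF this] have "flat A (?m i) \<le> q" using N_le_q[of "flat A (?m i)"] by simp
    then have sem: "sem ?c q (\<rho>(1 := i)) A' = A'(TAB := (A' TAB)(?m i := flat A (?m i)))"
      using \<rho>0 val by (simp add: flat_def min_absorb1)
    have fl: "flat (A'(TAB := (A' TAB)(?m i := v))) m = (if m = 32 * ?m i then v else flat A' m)" for v m
      using fun_cong[OF flat_upd[of TAB A' "?m i" v], of m] by simp
    show "?I (Suc i) (sem ?c q (\<rho>(1 := i)) A')"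
      unfolding sem fl
    proof (intro allI conjI impI)
      fix m assume m: "m < N * N - Suc i"
      then have "m \<noteq> 32 * ?m i" "m < N * N - i" by auto
      then show "(if m = 32 * ?m i then flat A (?m i) else flat A' m) = flat A m" using I by simp
    next
      fix m assume m: "N * N - Suc i \<le> m" "m < N * N"
      then have "m = ?m i \<or> N * N - i \<le> m" by auto
      then show "(A'(TAB := (A' TAB)(?m i := flat A (?m i)))) TAB m = flat A m" using I m by auto
    qed
  qed
  then have "sem copy_in q \<rho> A TAB (x * N + y) = flat A (x * N + y)" using index_less[OF x] by simp
  with T[OF x] show ?thesis by simp
qed

text \<open>The divisors of N from 2 on are positive powers of p. So none occurs among 2, ..., i + 2
  exactly when i + 2 < p, and counting such i gives p - 2.\<close>

lemma no_small_divisor: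
  assumes "k > 0"
  shows "(\<forall>j<i+1. \<not> (j + 2) dvd N) \<longleftrightarrow> i < p - 2"
proof
  assume *: "\<forall>j<i+1. \<not> (j + 2) dvd N"
  have "p \<ge> 2" by (rule prime_ge_2_nat[OF prime])
  moreover have "p dvd N" using assms by (simp add: dvd_power)
  ultimately show "i < p - 2" using * by (metis add_diff_inverse_nat add.commute not_less less_Suc_eq_le Suc_eq_plus1)
next
  assume i: "i < p - 2"
  show "\<forall>j<i+1. \<not> (j + 2) dvd N"
  proof (intro allI impI notI)
    fix j assume j: "j < i + 1" "(j + 2) dvd N"
    then obtain r where r: "j + 2 = p ^ r" using divides_primepow_nat[OF prime] by blast
    then have "r \<noteq> 0" by (intro notI) simp
    then have "p \<le> j + 2" unfolding r using p_pos by (simp add: self_le_power)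
    with i j show False by simp
  qed
qed

lemma set_prime: "sem set_prime q \<rho> A = A(PRIME := (A PRIME)(0 := p))"
proof -
  let ?E = "Plus (Num 2) (Summ 1 nE (AllE 2 (Plus (Var 1) (Num 1)) (Rem nE (Plus (Var 2) (Num 2)))))"
  have "eval ?E \<rho> A = 2 + card {i. i < N \<and> (\<forall>j<i+1. \<not> (j + 2) dvd N)}"
    using \<rho>0 by (simp add: sum_of_bool_card dvd_eq_mod_eq_0 del: sum_of_bool_eq)
  also have "\<dots> = p"
  proof (cases "k = 0")
    case True
    then have "{i. i < N \<and> (\<forall>j<i+1. \<not> (j + 2) dvd N)} = {0}" by auto
    then show ?thesis using exponent_0[OF True] by simp
  next
    case False
    have "p - 2 < N" using self_le_power[of p k] p_pos False N_pos by linarith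
    moreover have "(\<forall>j<i+1. \<not> (j + 2) dvd N) \<longleftrightarrow> i < p - 2" for i
      using False by (intro no_small_divisor) simp
    ultimately have "{i. i < N \<and> (\<forall>j<i+1. \<not> (j + 2) dvd N)} = {..<p - 2}" by auto
    then show ?thesis using prime_ge_2_nat[OF prime] by simp
  qed
  finally show ?thesis unfolding set_prime_def sem.simps(1) using p_le_q by (simp add: min_absorb1)
qed

lemma set_powers:
  assumes A: "A PRIME 0 = p"
  shows "\<forall>i\<le>k. sem set_powers q \<rho> A POW i = p ^ i" "sem set_powers q \<rho> A EXPO 0 = k"
proof -
  let ?c = "Assign POW (Plus (Var 1) (Num 1)) (Times (powE (Var 1)) pE)"
  let ?A1 = "sem (For 1 nE ?c) q \<rho> (sem (Assign POW (Num 0) (Num 1)) q \<rho> A)"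
  have pow: "\<forall>i\<le>N. ?A1 POW i = min (p ^ i) q"
  proof (rule For_rule[where I = "\<lambda>m A'. \<forall>i\<le>m. A' POW i = min (p ^ i) q"])
    show "eval nE \<rho> (sem (Assign POW (Num 0) (Num 1)) q \<rho> A) = N" using \<rho>0 by simp
    show "\<forall>i\<le>0. sem (Assign POW (Num 0) (Num 1)) q \<rho> A POW i = min (p ^ i) q" by simp
    fix m A' assume m: "m < N" and fr: "\<And>a. a \<notin> writes ?c \<Longrightarrow> A' a = sem (Assign POW (Num 0) (Num 1)) q \<rho> A a"
      and I: "\<forall>i\<le>m. A' POW i = min (p ^ i) q"
    have "A' PRIME 0 = p" using fr A by simp
    \<comment> \<open>Once the cut-off is reached it persists, so capped products yield capped
      powers.\<close>
    moreover have "min (min (p ^ m) q * p) q = min (p ^ Suc m) q"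
    proof (cases "p ^ m \<le> q")
      case False
      have "q \<le> q * p" "p ^ m \<le> p ^ Suc m" using p_pos by simp_all
      with False have "q \<le> q * p" "q \<le> p ^ m" "q \<le> p ^ Suc m" by linarith+
      then show ?thesis by (simp only: min_absorb2)
    qed (simp add: min_absorb1 mult.commute)
    ultimately have "sem ?c q (\<rho>(1 := m)) A' POW i = (if i = Suc m then min (p ^ Suc m) q else A' POW i)" for i
      using I by simp
    with I show "\<forall>i\<le>Suc m. sem ?c q (\<rho>(1 := m)) A' POW i = min (p ^ i) q"
      by (auto simp: le_Suc_eq)
  qed
  have small: "min (p ^ i) q < N \<longleftrightarrow> i < k" for i
    using N_le_q[of N] prime_gt_1_nat[OF prime] by (auto simp: min_less_iff_disj)
  have "eval (Summ 1 nE (LtE (powE (Var 1)) nE)) \<rho> ?A1 = (\<Sum>i<N. of_bool (?A1 POW i < N))"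
    using \<rho>0 by (simp del: sem.simps sum_of_bool_eq)
  also have "\<dots> = (\<Sum>i<N. of_bool (i < k))"
    by (rule sum.cong) (use pow small in auto)
  also have "\<dots> = card {i. i < N \<and> i < k}" by (rule sum_of_bool_card)
  also have "{i. i < N \<and> i < k} = {..<k}" using k_le_N by auto
  finally have "eval (Summ 1 nE (LtE (powE (Var 1)) nE)) \<rho> ?A1 = k" unfolding card_lessThan .
  then have sem: "sem set_powers q \<rho> A = ?A1(EXPO := (?A1 EXPO)(0 := k))"
    unfolding set_powers_def sem.simps(3) sem.simps(1)[of EXPO] using N_le_q[OF k_le_N] by (simp del: sem.simps add: min_absorb1 eval.simps)
  show "sem set_powers q \<rho> A EXPO 0 = k" unfolding sem by simp
  have "p ^ i \<le> q" if "i \<le> k" for i using le_N[OF that] N_le_q by blast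
  then show "\<forall>i\<le>k. sem set_powers q \<rho> A POW i = p ^ i"
    unfolding sem using pow k_le_N by (simp add: min_absorb1)
qed

lemma set_binomials:
  assumes A: "A PRIME 0 = p"
  shows "\<forall>z<N. \<forall>a<N. sem set_binomials q \<rho> A BINOM (z * N + a) = (z choose a) mod p"
proof -
  let ?e = "Plus (NotE (Var 2)) (Times (Times (NotE (NotE (Var 1))) (NotE (NotE (Var 2))))
       (Rem (Plus (Arr BINOM (idx (Minus (Var 1) (Num 1)) (Minus (Var 2) (Num 1))))
         (Arr BINOM (idx (Minus (Var 1) (Num 1)) (Var 2)))) pE))"
  let ?c = "Assign BINOM (idx (Var 1) (Var 2)) ?e"
  let ?B = "\<lambda>z a. (z choose a) mod p"
  have p1: "1 < p" by (rule prime_gt_1_nat[OF prime])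
  show ?thesis
    unfolding set_binomials_def
  proof (rule For_rule[where I = "\<lambda>m A'. \<forall>z<m. \<forall>a<N. A' BINOM (z * N + a) = ?B z a"])
    show "eval nE \<rho> A = N" using \<rho>0 by simp
    fix m A' assume m: "m < N" and fr: "\<And>a. a \<notin> writes (For 2 nE ?c) \<Longrightarrow> A' a = A a"
      and I: "\<forall>z<m. \<forall>a<N. A' BINOM (z * N + a) = ?B z a"
    have "(\<forall>z<m. \<forall>a<N. sem (For 2 nE ?c) q (\<rho>(1 := m)) A' BINOM (z * N + a) = ?B z a) \<and>
        (\<forall>a<N. sem (For 2 nE ?c) q (\<rho>(1 := m)) A' BINOM (m * N + a) = ?B m a)"
    proof (rule For_rule[where I = "\<lambda>j A'. (\<forall>z<m. \<forall>a<N. A' BINOM (z * N + a) = ?B z a) \<and>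
        (\<forall>a<j. A' BINOM (m * N + a) = ?B m a)"])
      show "eval nE (\<rho>(1 := m)) A' = N" using \<rho>0 by simp
      show "(\<forall>z<m. \<forall>a<N. A' BINOM (z * N + a) = ?B z a) \<and> (\<forall>a<0. A' BINOM (m * N + a) = ?B m a)" using I by simp
      fix j A2 assume j: "j < N" and fr2: "\<And>a. a \<notin> writes ?c \<Longrightarrow> A2 a = A' a"
        and I2: "(\<forall>z<m. \<forall>a<N. A2 BINOM (z * N + a) = ?B z a) \<and> (\<forall>a<j. A2 BINOM (m * N + a) = ?B m a)"
      have pr: "A2 PRIME 0 = p" using fr fr2 A by simp
      have "eval ?e (\<rho>(1 := m, 2 := j)) A2 = ?B m j"
      proof (cases "j = 0 \<or> m = 0")
        case True
        then show ?thesis using p1 by (cases "j = 0") (auto simp: binomial_eq_0)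
      next
        case False
        then have "A2 BINOM ((m - 1) * N + (j - 1)) = ?B (m - 1) (j - 1)" "A2 BINOM ((m - 1) * N + j) = ?B (m - 1) j"
          using I2[THEN conjunct1, rule_format, of "m - 1"] j False by (auto simp del: add_diff_assoc)
        moreover have "m choose j = (m - 1 choose (j - 1)) + (m - 1 choose j)"
          using False by (intro choose_reduce_nat) auto
        ultimately show ?thesis using False pr \<rho>0 by (simp add: mod_add_eq)
      qed
      moreover have "?B m j \<le> q" using p_le_q mod_less_divisor[OF p_pos, of "m choose j"] by linarith
      ultimately have sem: "sem ?c q (\<rho>(1 := m, 2 := j)) A2 = A2(BINOM := (A2 BINOM)(m * N + j := ?B m j))"
        using \<rho>0 by (simp add: min_absorb1 del: eval_bool)
      show "(\<forall>z<m. \<forall>a<N. sem ?c q (\<rho>(1 := m, 2 := j)) A2 BINOM (z * N + a) = ?B z a) \<and>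
        (\<forall>a<Suc j. sem ?c q (\<rho>(1 := m, 2 := j)) A2 BINOM (m * N + a) = ?B m a)"
        unfolding sem using I2 j by (auto simp: less_Suc_eq index_eq_iff)
    qed
    then show "\<forall>z<Suc m. \<forall>a<N. sem (For 2 nE ?c) q (\<rho>(1 := m)) A' BINOM (z * N + a) = ?B z a"
      by (auto simp: less_Suc_eq)
  qed simp
qed

lemma init:
  assumes T: "\<And>x y. x < N \<Longrightarrow> y < N \<Longrightarrow> flat A (x * N + y) = f x y"
  defines "A' \<equiv> sem init q \<rho> A"
  shows "static A'" "counting A' 0" "A' FOUND 0 = 0"
proof -
  let ?A1 = "sem copy_in q \<rho> A"
  let ?A2 = "sem set_prime q \<rho> ?A1"
  let ?A3 = "sem set_powers q \<rho> ?A2"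
  let ?A4 = "sem set_binomials q \<rho> ?A3"
  let ?c = "Assign CHOICE (Var 1) (Num 0)"
  let ?A5 = "sem (For 1 nE ?c) q \<rho> ?A4"
  have A': "A' = ?A5(CARRY := (?A5 CARRY)(0 := 0), FOUND := (?A5 FOUND)(0 := 0))"
    unfolding A'_def init_def set_counter_def sem.simps(3) by simp
  have w: "writes set_powers = {POW, EXPO}" "writes set_binomials = {BINOM}" "writes (For 1 nE ?c) = {CHOICE}"
    by (auto simp: set_powers_def set_binomials_def)
  have fr5: "?A5 a = ?A4 a" if "a \<noteq> CHOICE" for a by (rule sem_frame) (use that w in simp)
  have fr4: "?A4 a = ?A3 a" if "a \<noteq> BINOM" for a by (rule sem_frame) (use that w in simp)
  have fr3: "?A3 a = ?A2 a" if "a \<noteq> POW" "a \<noteq> EXPO" for a by (rule sem_frame) (use that w in simp)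
  have A2: "?A2 PRIME 0 = p" "?A2 TAB = ?A1 TAB" unfolding set_prime by simp_all
  have A3: "?A3 PRIME 0 = p" using A2 fr3[of PRIME] by simp
  have "A' TAB = ?A1 TAB" "A' PRIME = ?A2 PRIME" "A' POW = ?A3 POW" "A' EXPO = ?A3 EXPO" "A' BINOM = ?A4 BINOM"
    unfolding A' using fr5 fr4 fr3 A2 by simp_all
  then show "static A'"
    unfolding static_def using copy_in[OF T] A2 A3 set_powers[where A = ?A2] set_binomials[where A = ?A3] by simp
  have "\<forall>i<N. ?A5 CHOICE i = 0"
    by (rule For_rule[where I = "\<lambda>m A2. \<forall>i<m. A2 CHOICE i = 0"]) (use \<rho>0 in auto)
  then have "A' CHOICE i = 0" if "i < k" for i unfolding A' using that k_le_N by simp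
  then have "digits_value (A' CHOICE) k = 0" "\<forall>i<k. A' CHOICE i < p ^ (k - i)"
    using p_pos by (simp_all add: digits_value_def)
  moreover have "A' CARRY 0 = 0" unfolding A' by simp
  ultimately show "counting A' 0" using W_pos by (simp add: counting_def)
  show "A' FOUND 0 = 0" unfolding A' by simp
qed

lemma copy_out:
  assumes "\<And>m. m < N * N \<Longrightarrow> A BEST m \<le> q" "m < N * N"
  shows "flat (sem copy_out q \<rho> A) m = A BEST m"
proof -
  let ?c = "SetCell (Var 1) (Arr BEST (Var 1))"
  let ?I = "\<lambda>i A'. (\<forall>j<i. flat A' j = A BEST j) \<and> (\<forall>j\<ge>i. flat A' j = flat A j)"
  have "?I (N * N) (sem copy_out q \<rho> A)"
    unfolding copy_out_def
  proof (rule For_rule[where I = ?I])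
    show "eval n2E \<rho> A = N * N" using \<rho>0 by simp
    show "?I 0 A" by simp
    fix i A' assume i: "i < N * N" and I: "?I i A'"
    have "flat A' j = flat A j" if "j \<ge> i" for j using I that by blast
    from this[of "32 * i + BEST"] have "A' BEST i = A BEST i" by simp
    then have sem: "sem ?c q (\<rho>(1 := i)) A' = A'(i mod 32 := (A' (i mod 32))(i div 32 := A BEST i))"
      using assms(1)[OF i] by (simp add: min_absorb1)
    have fl: "flat (A'(i mod 32 := (A' (i mod 32))(i div 32 := A BEST i))) = (flat A')(i := A BEST i)"
      by (rule flat_upd_cell[symmetric])
    show "?I (Suc i) (sem ?c q (\<rho>(1 := i)) A')" unfolding sem fl using I by (simp add: less_Suc_eq)
  qed
  then show ?thesis using assms(2) by simp
qed

section \<open>Completeness of the search\<close>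

definition ranks :: "(nat \<Rightarrow> nat) \<Rightarrow> nat \<Rightarrow> nat" where
  "ranks x i = rep_rank f (elems G p x i) (x i)"

text \<open>The chains that the search can meet: a minimal representative in each coset, with its
  rank within the range of the digit.\<close>

definition minimal_chain :: "(nat \<Rightarrow> nat) \<Rightarrow> bool" where
  "minimal_chain x \<longleftrightarrow> chain G p x k \<and>
     (\<forall>i<k. minimal_rep f (elems G p x i) (x i) \<and> ranks x i < p ^ (k - i))"

lemma minimal_chain_less: "minimal_chain x \<Longrightarrow> i < k \<Longrightarrow> x i < N"
  by (auto simp: minimal_chain_def chain_def)

text \<open>Replacing generators within their cosets does not change the subgroups, so all
  representatives can be chosen at once with respect to the subgroups of the given chain.\<close>

lemma minimal_chain_exists:
  assumes ch: "chain G p x k"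
  shows "\<exists>y. minimal_chain y \<and> same_chain x y k"
proof -
  define y where "y i = (SOME y. (\<exists>u\<in>elems G p x i. y = f (x i) u) \<and> minimal_rep f (elems G p x i) y \<and>
    rep_rank f (elems G p x i) y < p ^ (k - i))" for i
  have y: "(\<exists>u\<in>elems G p x i. y i = f (x i) u) \<and> minimal_rep f (elems G p x i) (y i) \<and>
    rep_rank f (elems G p x i) (y i) < p ^ (k - i)" if i: "i < k" for i
  proof -
    have chi: "chain G p x i" using ch i by (simp add: chain_def)
    have xi: "x i < N" using ch i by (simp add: chain_def)
    have H: "subgroup (elems G p x i) G" using chain_subgroup[OF chi] by blast
    have "\<exists>y. (\<exists>u\<in>elems G p x i. y = f (x i) u) \<and> minimal_rep f (elems G p x i) y \<and>
        rep_rank f (elems G p x i) y < p ^ (k - i)"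
      using minimal_rep_exists[OF group_f H card_elems[OF chi] less_imp_le[OF i] xi] by blast
    then show ?thesis unfolding y_def by (rule someI_ex)
  qed
  have same: "same_chain x y i" if i: "i \<le> k" for i
    unfolding same_chain_def
  proof (intro allI impI)
    fix j assume "j < i"
    with i have "j < k" by simp
    from y[OF this] show "\<exists>n\<in>elems G p x j. y j = x j \<otimes>\<^bsub>G\<^esub> n" by (simp only: fun_group_simps)
  qed
  have el: "elems G p y i = elems G p x i" if "i \<le> k" for i
  proof -
    have "chain G p x i" using ch that by (simp add: chain_def)
    then show ?thesis using same_chain_rotating[OF _ same[OF that]] by blast
  qed
  have "chain G p y k" using same_chain_rotating[OF ch same[OF order_refl]] by blast
  then have "minimal_chain y" using y by (simp add: minimal_chain_def ranks_def el)
  then show ?thesis using same by blast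
qed

text \<open>Complete induction, since the coset that a rank denotes depends on the generators chosen
  before.\<close>

lemma chosen_minimal_chain:
  assumes y: "minimal_chain y" and x: "\<forall>i<k. chosen c x i" and c: "\<forall>i<k. c i = ranks y i"
  shows "i < k \<Longrightarrow> x i = y i"
proof (induction i rule: less_induct)
  case (less i)
  then have "elems G p x i = elems G p y i" by (intro elems_cong) auto
  with less x y c minimal_chain_less[OF y, of i] show ?case
    by (auto simp: chosen_def minimal_chain_def ranks_def)
qed

text \<open>The sequence x is what the array \<open>GEN\<close> held in that round; only its first k
  entries are under control. That M is any candidate of this chain suffices, by
  \<open>relabelled_unique\<close>.\<close>

definition explored :: "store \<Rightarrow> (nat \<Rightarrow> nat) \<Rightarrow> bool" where
  "explored A y \<longleftrightarrow> A FOUND 0 = 1 \<and> (\<exists>x l M. (\<forall>i<k. x i = y i) \<and> normal_labelling f x l \<and>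
     relabelled f l M \<and> entries BEST A \<le> M)"

definition best_upto :: "nat \<Rightarrow> store \<Rightarrow> bool" where
  "best_upto j A \<longleftrightarrow> static A \<and> counting A j \<and> (A FOUND 0 = 0 \<or> A FOUND 0 = 1 \<and> entries BEST A \<in> candidates f) \<and>
     (\<forall>y. minimal_chain y \<longrightarrow> digits_value (ranks y) k < j \<longrightarrow> explored A y)"

lemma body:
  assumes I: "best_upto j A" and j: "j < W k"
  shows "best_upto (Suc j) (sem body q \<rho> A)"
proof -
  let ?A1 = "sem label q \<rho> A"
  let ?A2 = "sem update_best q \<rho> ?A1"
  let ?A3 = "sem next_choice q \<rho> ?A2"
  have body: "sem body q \<rho> A = ?A3" unfolding body_def label_def sem.simps(3) ..
  have A: "static A" and cA: "counting A j" using I by (simp_all add: best_upto_def)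
  have fr1: "?A1 a = A a" if "a \<notin> {GEN, ELEM, LAB, ROT, PIVOT, OUT}" for a
    by (rule sem_frame) (use that writes_label in simp)
  have fr2: "?A2 a = ?A1 a" if "a \<notin> {BEST, FOUND}" for a
    by (rule sem_frame) (use that in \<open>simp add: update_best_def\<close>)
  have fr3: "?A3 a = ?A2 a" if "a \<notin> {CHOICE, CARRY}" for a
    by (rule sem_frame) (use that in \<open>simp add: next_choice_def\<close>)
  have A1: "static ?A1" using A by (rule static_cong) (simp add: fr1)
  have A2: "static ?A2" using A1 by (rule static_cong) (simp add: fr2)
  have A3: "static ?A3" using A2 by (rule static_cong) (simp add: fr3)
  have "counting ?A2 j" using cA fr1 fr2 by (simp add: counting_def)
  then have c3: "counting ?A3 (Suc j)" using next_choice[OF A2] j by blast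
  let ?x = "?A1 GEN"
  have x: "\<forall>i<k. chosen (A CHOICE) ?x i" and el: "elements_ok ?A1 k" by (rule label[OF A])+
  have xN: "\<forall>i<k. ?x i < N" using x by (simp add: chosen_def)
  have lab: "\<exists>l. normal_labelling f ?x l \<and> relabelled f l (entries OUT ?A1)" if "chain G p ?x k"
    by (rule label(3)[OF A that])
  have upd: "if chain G p ?x k \<and> (?A1 FOUND 0 = 0 \<or> entries OUT ?A1 < entries BEST ?A1)
    then entries BEST ?A2 = entries OUT ?A1 \<and> ?A2 FOUND 0 = 1 else ?A2 = ?A1"
    by (rule update_best[OF A1 xN el]) (use lab in \<open>auto simp: candidates_def\<close>)
  have same: "?A1 FOUND = A FOUND" "?A1 BEST = A BEST" "?A3 FOUND = ?A2 FOUND" "?A3 BEST = ?A2 BEST"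
    using fr1 fr3 by simp_all
  then have ent: "entries BEST ?A1 = entries BEST A" "entries BEST ?A3 = entries BEST ?A2"
    by (simp_all add: entries_def)
  have found: "A FOUND 0 = 0 \<or> A FOUND 0 = 1 \<and> entries BEST A \<in> candidates f"
    using I by (simp add: best_upto_def)
  have cand: "entries OUT ?A1 \<in> candidates f" if "chain G p ?x k"
    using lab[OF that] by (auto simp: candidates_def)
  have A23: "?A2 FOUND 0 = 0 \<or> ?A2 FOUND 0 = 1 \<and> entries BEST ?A2 \<in> candidates f"
    "A FOUND 0 = 1 \<Longrightarrow> ?A2 FOUND 0 = 1 \<and> entries BEST ?A2 \<le> entries BEST A"
    "chain G p ?x k \<Longrightarrow> ?A2 FOUND 0 = 1 \<and> entries BEST ?A2 \<le> entries OUT ?A1"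
  proof (atomize (full), cases "chain G p ?x k \<and> (A FOUND 0 = 0 \<or> entries OUT ?A1 < entries BEST A)")
    case True
    with upd have "entries BEST ?A2 = entries OUT ?A1" "?A2 FOUND 0 = 1" unfolding same(1) ent(1) by simp_all
    with True cand show "(?A2 FOUND 0 = 0 \<or> ?A2 FOUND 0 = 1 \<and> entries BEST ?A2 \<in> candidates f) \<and>
        (A FOUND 0 = 1 \<longrightarrow> ?A2 FOUND 0 = 1 \<and> entries BEST ?A2 \<le> entries BEST A) \<and>
        (chain G p ?x k \<longrightarrow> ?A2 FOUND 0 = 1 \<and> entries BEST ?A2 \<le> entries OUT ?A1)" by auto
  next
    case False
    with upd have "?A2 = ?A1" unfolding same(1) ent(1) by simp
    then have "entries BEST ?A2 = entries BEST A" "?A2 FOUND 0 = A FOUND 0" unfolding ent(1)[symmetric] same(1)[symmetric] by simp_all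
    with False found show "(?A2 FOUND 0 = 0 \<or> ?A2 FOUND 0 = 1 \<and> entries BEST ?A2 \<in> candidates f) \<and>
        (A FOUND 0 = 1 \<longrightarrow> ?A2 FOUND 0 = 1 \<and> entries BEST ?A2 \<le> entries BEST A) \<and>
        (chain G p ?x k \<longrightarrow> ?A2 FOUND 0 = 1 \<and> entries BEST ?A2 \<le> entries OUT ?A1)" by auto
  qed
  note le = A23(2) and new = A23(3)
  have found3: "?A3 FOUND 0 = 0 \<or> ?A3 FOUND 0 = 1 \<and> entries BEST ?A3 \<in> candidates f"
    using A23(1) unfolding same ent .
  have "explored ?A3 y" if y: "minimal_chain y" and yj: "digits_value (ranks y) k < Suc j" for y
  proof (cases "digits_value (ranks y) k < j")
    case True
    with I y have "explored A y" unfolding best_upto_def by blast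
    then obtain x l M where "A FOUND 0 = 1" "\<forall>i<k. x i = y i" "normal_labelling f x l" "relabelled f l M"
      "entries BEST A \<le> M" unfolding explored_def by blast
    with le show ?thesis
      unfolding explored_def same ent by (intro conjI exI[of _ x] exI[of _ l] exI[of _ M]) auto
  next
    case False
    \<comment> \<open>The present round: by uniqueness of mixed radix digits the counter equals the
      ranks of y, so the program has built y itself.\<close>
    with yj have "digits_value (ranks y) k = digits_value (A CHOICE) k" using cA j by (simp add: counting_def)
    moreover have "\<forall>i<k. ranks y i < p ^ (k - i)" using y by (simp add: minimal_chain_def)
    moreover have "\<forall>i<k. A CHOICE i < p ^ (k - i)" using cA by (simp add: counting_def)
    ultimately have "\<forall>i<k. A CHOICE i = ranks y i" by (intro digits_value_inj) simp_all
    then have xy: "?x i = y i" if "i < k" for i using that by (rule chosen_minimal_chain[OF y x])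
    then have "chain G p ?x k \<longleftrightarrow> chain G p y k" by (rule chain_cong)
    then have ch: "chain G p ?x k" using y by (simp add: minimal_chain_def)
    from lab[OF this] obtain l where "normal_labelling f ?x l" "relabelled f l (entries OUT ?A1)" by blast
    with new[OF ch] xy show ?thesis
      unfolding explored_def same ent by (intro conjI exI[of _ ?x] exI[of _ l] exI[of _ "entries OUT ?A1"]) auto
  qed
  then show ?thesis unfolding body best_upto_def using A3 c3 found3 by blast
qed

lemma best_upto_init:
  assumes "\<And>x y. x < N \<Longrightarrow> y < N \<Longrightarrow> flat A (x * N + y) = f x y"
  shows "best_upto 0 (sem init q \<rho> A)"
  using init[OF assms] by (simp add: best_upto_def)

text \<open>A candidate belongs to some chain, the same choice of cosets has a minimal chain, and
  that one has been explored. By \<open>relabelled_unique\<close> both lead to the same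
  table.\<close>

lemma best_upto_W:
  assumes "best_upto (W k) A"
  shows "entries BEST A \<in> candidates f" "M \<in> candidates f \<Longrightarrow> entries BEST A \<le> M"
proof -
  have expl: "explored A y" if "minimal_chain y" for y
  proof -
    have "\<forall>i<k. ranks y i < p ^ (k - i)" using that by (simp add: minimal_chain_def)
    then have "digits_value (ranks y) k < W k" by (rule digits_value_less)
    with assms that show ?thesis by (simp add: best_upto_def)
  qed
  obtain x where "chain G p x k" using chain_exists[of k] by auto
  with minimal_chain_exists obtain y where "minimal_chain y" by blast
  from expl[OF this] assms show "entries BEST A \<in> candidates f" by (simp add: explored_def best_upto_def)
  assume "M \<in> candidates f"
  then obtain x l where l: "normal_labelling f x l" "relabelled f l M" unfolding candidates_def by blast
  then have "chain G p x k" by (simp add: normal_labelling_def)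
  with minimal_chain_exists obtain y where y: "minimal_chain y" "same_chain x y k" by blast
  from expl[OF y(1)] obtain x' l' M' where x': "\<forall>i<k. x' i = y i" "normal_labelling f x' l'" "relabelled f l' M'"
    "entries BEST A \<le> M'" unfolding explored_def by blast
  have "same_chain x x' k" using y(2) x'(1) by (simp add: same_chain_def)
  from relabelled_unique[OF group_f l(1) x'(2) this l(2) x'(3)] x'(4) show "entries BEST A \<le> M" by simp
qed

lemma program_loop:
  assumes "\<And>x y. x < N \<Longrightarrow> y < N \<Longrightarrow> flat A (x * N + y) = f x y"
  defines "A' \<equiv> \<lambda>j. (sem body q \<rho> ^^ j) (sem init q \<rho> A)"
  shows "\<forall>j<W k. eval runningE \<rho> (A' j) \<noteq> 0" "eval runningE \<rho> (A' (W k)) = 0"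
    and "(LEAST M. M \<in> candidates f) \<in> candidates f"
    and "\<And>m. m < N * N \<Longrightarrow> flat (sem copy_out q \<rho> (A' (W k))) m = (LEAST M. M \<in> candidates f) ! m"
proof -
  have I: "best_upto j (A' j)" if "j \<le> W k" for j
    using that
  proof (induction j)
    case 0
    show ?case unfolding A'_def funpow_0 using assms(1) by (rule best_upto_init)
  next
    case (Suc j)
    have "A' (Suc j) = sem body q \<rho> (A' j)" by (simp add: A'_def)
    with Suc body[of j "A' j"] show ?case by simp
  qed
  then have c: "counting (A' j) j" if "j \<le> W k" for j using that by (simp add: best_upto_def)
  then show "\<forall>j<W k. eval runningE \<rho> (A' j) \<noteq> 0"
    using less_imp_le by (fastforce simp: counting_def runningE_def)
  show "eval runningE \<rho> (A' (W k)) = 0"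
    using c[OF order_refl] by (simp add: counting_def runningE_def)
  note best = best_upto_W[OF I[OF order_refl]]
  have least: "(LEAST M. M \<in> candidates f) = entries BEST (A' (W k))"
    by (rule Least_equality) (use best in auto)
  with best(1) show "(LEAST M. M \<in> candidates f) \<in> candidates f" by simp
  have entry: "A' (W k) BEST m = (LEAST M. M \<in> candidates f) ! m" if "m < N * N" for m
    using that unfolding least by (simp add: entries_def)
  have small: "A' (W k) BEST m \<le> q" if "m < N * N" for m
  proof -
    have "m div N < N" "m mod N < N" using that N_pos by (auto intro: less_mult_imp_div_less)
    from candidates_group(4)[OF group_f best(1) this] have "entries BEST (A' (W k)) ! m < N"
      unfolding div_mult_mod_eq .
    then show ?thesis using entry[OF that] least N_le_q[of "A' (W k) BEST m"] by simp
  qed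
  show "flat (sem copy_out q \<rho> (A' (W k))) m = (LEAST M. M \<in> candidates f) ! m" if "m < N * N" for m
    using copy_out[where A = "A' (W k)", OF small that] entry[OF that] by simp
qed

text \<open>The exponents k, ..., 1 of the radices add up to k (k + 1) / 2, and N = p^k.\<close>

lemma W_powr: "real (W k) = real N powr ((real k + 1) / 2)"
proof -
  have sum: "2 * (\<Sum>i<m. m - i) = m * (m + 1)" for m :: nat
    by (induction m) (simp_all add: sum.lessThan_Suc_shift del: sum.lessThan_Suc)
  define s where "s = (\<Sum>i<k. k - i)"
  have "2 * real s = real k * (real k + 1)"
    using arg_cong[OF sum[of k], of real] unfolding s_def[symmetric] by (simp add: algebra_simps)
  then have s: "real k * ((real k + 1) / 2) = real s" by simp
  have "W k = p ^ s" by (simp add: W_def s_def power_sum)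
  then have "real (W k) = real p powr real s" using p_pos by (simp add: powr_realpow)
  also have "\<dots> = (real p powr real k) powr ((real k + 1) / 2)" unfolding powr_powr s ..
  also have "real p powr real k = real N" using p_pos by (simp add: powr_realpow)
  finally show ?thesis .
qed

end

section \<open>The canonical form\<close>

lemma nth_concat:
  assumes "\<forall>r\<in>set T. length r = n"
  shows "length (concat T) = length T * n"
    and "x < length T \<Longrightarrow> y < n \<Longrightarrow> concat T ! (x * n + y) = T ! x ! y"
proof -
  show "length (concat T) = length T * n" using assms by (induction T) auto
  show "x < length T \<Longrightarrow> y < n \<Longrightarrow> concat T ! (x * n + y) = T ! x ! y"
    using assms
  proof (induction T arbitrary: x)
    case (Cons r T)
    then show ?case by (cases x) (auto simp: nth_append)
  qed simp
qed

definition rows :: "nat \<Rightarrow> nat list \<Rightarrow> table" where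
  "rows n M = map (\<lambda>i. map (\<lambda>j. M ! (i * n + j)) [0..<n]) [0..<n]"

lemma rows_simps [simp]:
  "length (rows n M) = n" "r \<in> set (rows n M) \<Longrightarrow> length r = n"
  "i < n \<Longrightarrow> j < n \<Longrightarrow> rows n M ! i ! j = M ! (i * n + j)"
  by (auto simp: rows_def)

lemma concat_rows:
  assumes "length M = n * n"
  shows "concat (rows n M) = M"
proof (rule nth_equalityI)
  have len: "length (concat (rows n M)) = n * n" using nth_concat(1)[of "rows n M" n] by simp
  then show "length (concat (rows n M)) = length M" using assms by simp
  fix m assume "m < length (concat (rows n M))"
  then have m: "m < n * n" using len by simp
  then have "m div n < n" by (rule less_mult_imp_div_less)
  moreover from this have "m mod n < n" by (intro mod_less_divisor) simp
  ultimately have "concat (rows n M) ! (m div n * n + m mod n) = M ! (m div n * n + m mod n)"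
    using nth_concat(2)[of "rows n M" n "m div n" "m mod n"] by simp
  then show "concat (rows n M) ! m = M ! m" unfolding div_mult_mod_eq .
qed

text \<open>One function has to serve all primes, so p and k are recovered from n; the convention p
  = 3 for k = 0 makes them unique.\<close>

definition least_table :: "nat \<Rightarrow> (nat \<Rightarrow> nat \<Rightarrow> nat) \<Rightarrow> nat list" where
  "least_table n f = (LEAST M. \<exists>p k. prime p \<and> (k = 0 \<longrightarrow> p = 3) \<and> n = p ^ k \<and> M \<in> prime_power.candidates p k f)"

lemma prime_power_unique:
  fixes p p' :: nat
  assumes "prime p" "prime p'" "k = 0 \<Longrightarrow> p = 3" "k' = 0 \<Longrightarrow> p' = 3" "p ^ k = p' ^ k'"
  shows "p = p' \<and> k = k'"
proof (cases "k = 0 \<or> k' = 0")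
  case True
  have "1 < p ^ k" if "k \<noteq> 0" using that prime_gt_1_nat[OF assms(1)] by (intro one_less_power) auto
  moreover have "1 < p' ^ k'" if "k' \<noteq> 0" using that prime_gt_1_nat[OF assms(2)] by (intro one_less_power) auto
  ultimately have "k = 0" "k' = 0" using True assms(5) by (metis less_irrefl power_0)+
  with assms(3,4) show ?thesis by simp
next
  case False
  then have "p dvd p' ^ k'" unfolding assms(5)[symmetric] by (intro dvd_power) simp
  then have "p dvd p'" by (rule prime_dvd_power[OF assms(1)])
  then have eq: "p = p'" by (rule primes_dvd_imp_eq[OF assms(1,2)])
  have "p ^ k = p ^ k'" using assms(5) unfolding eq .
  then have "k = k'" using power_inject_exp[OF prime_gt_1_nat[OF assms(1)]] by blast
  with eq show ?thesis by blast
qed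

lemma (in table_run) least_table_eq: "least_table N f = (LEAST M. M \<in> candidates f)"
proof -
  have unique: "p = p' \<and> k = k'" if "prime p'" "k' = 0 \<longrightarrow> p' = 3" "N = p' ^ k'" for p' k'
    by (rule prime_power_unique[OF prime that(1) exponent_0 _ that(3)]) (use that(2) in blast)+
  have "(\<exists>p' k'. prime p' \<and> (k' = 0 \<longrightarrow> p' = 3) \<and> N = p' ^ k' \<and> M \<in> prime_power.candidates p' k' f) \<longleftrightarrow>
      M \<in> candidates f" for M
  proof
    assume "\<exists>p' k'. prime p' \<and> (k' = 0 \<longrightarrow> p' = 3) \<and> N = p' ^ k' \<and> M \<in> prime_power.candidates p' k' f"
    then obtain p' k' where *: "prime p'" "k' = 0 \<longrightarrow> p' = 3" "N = p' ^ k'" "M \<in> prime_power.candidates p' k' f"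
      by (elim exE conjE)
    from unique[OF *(1-3)] *(4) show "M \<in> candidates f" by simp
  next
    assume "M \<in> candidates f"
    then show "\<exists>p' k'. prime p' \<and> (k' = 0 \<longrightarrow> p' = 3) \<and> N = p' ^ k' \<and> M \<in> prime_power.candidates p' k' f"
      using prime exponent_0 by (intro exI[of _ p] exI[of _ k]) simp
  qed
  then show ?thesis unfolding least_table_def by (simp only:)
qed

definition canonical_table :: "table \<Rightarrow> table" where
  "canonical_table T = rows (length T) (least_table (length T) (\<lambda>i j. T ! i ! j))"

text \<open>The prime p' used by the program can differ from p only for the trivial group, where it
  is 3; the exponent is the same.\<close>

lemma p_group_tablesE:
  assumes "T \<in> p_group_tables p" "prime p"
  obtains p' k where "length T = p ^ k" "length T = p' ^ k" "\<forall>r\<in>set T. length r = length T"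
    "table_run p' k (\<lambda>i j. T ! i ! j) (length T * length T + 2) (\<lambda>_. length T)"
proof -
  let ?f = "\<lambda>i j. T ! i ! j"
  from assms obtain k where T: "\<forall>r\<in>set T. length r = length T" "group (table_group T)" "order (table_group T) = p ^ k"
    unfolding p_group_tables_def p_group_def by blast
  then have k: "length T = p ^ k" "group (fun_group (length T) ?f)" by (simp_all add: table_group_eq)
  define p' where "p' = (if k = 0 then 3 else p)"
  have p': "length T = p' ^ k" "prime p'" "k = 0 \<Longrightarrow> p' = 3" using k assms(2) by (auto simp: p'_def)
  have "table_run p' k ?f (length T * length T + 2) (\<lambda>_. length T)"
    unfolding table_run_def table_run_axioms_def prime_power_def using p' k(2) by auto
  with that k(1) p'(1) T(1) show ?thesis by blast
qed

context table_run
begin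

lemma flat_input:
  assumes T: "\<forall>r\<in>set T. length r = N" "length T = N" "f = (\<lambda>i j. T ! i ! j)"
  defines "A \<equiv> \<lambda>a i. mem (input_config T) (32 * i + a)"
  shows "x < N \<Longrightarrow> y < N \<Longrightarrow> flat A (x * N + y) = f x y" "mem (input_config T) j \<le> q"
proof -
  have fl: "flat A j = mem (input_config T) j" for j by (simp add: flat_def A_def)
  have len: "length (concat T) = N * N" using nth_concat(1)[of T N] T by simp
  have in_T: "mem (input_config T) (x * N + y) = f x y" if "x < N" "y < N" for x y
    using nth_concat(2)[of T N x y] that T index_less[OF that] len by (simp add: input_config_def)
  then show "x < N \<Longrightarrow> y < N \<Longrightarrow> flat A (x * N + y) = f x y" by (simp add: fl)
  show "mem (input_config T) j \<le> q"
  proof (cases "j < N * N")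
    case True
    have j: "j div N < N" "j mod N < N" using True N_pos by (auto intro: less_mult_imp_div_less)
    have "mem (input_config T) j = f (j div N) (j mod N)" using in_T[OF j] unfolding div_mult_mod_eq .
    then show ?thesis using f_closed[OF j] N_le_q by simp
  next
    case False
    then show ?thesis using len by (simp add: input_config_def)
  qed
qed

end

lemma canonical_table_group:
  assumes "T \<in> p_group_tables p" "prime p"
  shows "canonical_table T \<in> p_group_tables p" "table_group (canonical_table T) \<cong> table_group T"
    "length (canonical_table T) = length T"
    "concat (canonical_table T) = least_table (length T) (\<lambda>i j. T ! i ! j)"
proof -
  let ?f = "\<lambda>i j. T ! i ! j"
  obtain p' k where k: "length T = p ^ k" "length T = p' ^ k" and rows: "\<forall>r\<in>set T. length r = length T"
    and run: "table_run p' k ?f (length T * length T + 2) (\<lambda>_. length T)"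
    using p_group_tablesE[OF assms] .
  interpret table_run p' k ?f "length T * length T + 2" "\<lambda>_. length T" by (rule run)
  let ?n = "length T" and ?C = "canonical_table T" and ?M = "least_table (length T) ?f"
  have M: "?M \<in> candidates ?f"
    using program_loop(3)[OF flat_input(1)[of T]] rows k(2) least_table_eq by simp
  note cand = candidates_group[OF group_f M]
  have len: "length ?M = ?n * ?n" using cand(1) k(2) by simp
  show "concat ?C = ?M" unfolding canonical_table_def by (rule concat_rows[OF len])
  show lenC: "length ?C = ?n" by (simp add: canonical_table_def)
  let ?g = "\<lambda>i j. ?M ! (i * ?n + j)" and ?h = "\<lambda>i j. ?C ! i ! j"
  have g: "group (fun_group ?n ?g)" and fg: "fun_group ?n ?f \<cong> fun_group ?n ?g"
    using cand(2,3) k(2) by simp_all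
  \<comment> \<open>The rows reproduce the flat table only for indices below n, so the two groups
    are related by the isomorphism \<open>id\<close> and not by equality.\<close>
  have gh: "?h (id x) (id y) = id (x \<otimes>\<^bsub>fun_group ?n ?g\<^esub> y)"
    if "x \<in> carrier (fun_group ?n ?g)" "y \<in> carrier (fun_group ?n ?g)" for x y
    using that by (simp add: canonical_table_def)
  have bij: "bij_betw id (carrier (fun_group ?n ?g)) {..<?n}" by simp
  note iso = group_fun_groupI[OF g bij, of ?h, OF gh]
  have "fun_group ?n ?f \<cong> fun_group ?n ?h"
    using fg is_isoI[OF iso(2)] by (rule iso_trans)
  then have "fun_group ?n ?h \<cong> fun_group ?n ?f" using group.iso_sym[of "fun_group ?n ?f"] group_f k(2) by simp
  then show "table_group ?C \<cong> table_group T" by (simp add: table_group_eq lenC)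
  have "group (table_group ?C)" using iso(1) by (simp add: table_group_eq lenC)
  moreover have "order (table_group ?C) = p ^ k" by (simp add: table_group_eq lenC k(1))
  ultimately show "?C \<in> p_group_tables p"
    unfolding p_group_tables_def p_group_def by (auto simp: canonical_table_def)
qed

lemma canonical_form_canonical_table:
  assumes "prime p"
  shows "canonical_form (p_group_tables p) canonical_table"
  unfolding canonical_form_def
proof (intro conjI ballI impI)
  fix S T assume S: "S \<in> p_group_tables p" and T: "T \<in> p_group_tables p" and iso: "table_group S \<cong> table_group T"
  let ?f = "\<lambda>i j. S ! i ! j" and ?g = "\<lambda>i j. T ! i ! j"
  obtain p1 k1 where 1: "length S = p1 ^ k1" "table_run p1 k1 ?f (length S * length S + 2) (\<lambda>_. length S)"
    using p_group_tablesE[OF S assms] .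
  obtain p2 k2 where 2: "length T = p2 ^ k2" "table_run p2 k2 ?g (length T * length T + 2) (\<lambda>_. length T)"
    using p_group_tablesE[OF T assms] .
  have len: "length S = length T" using iso_same_card[OF iso] by (simp add: table_group_def)
  interpret F: table_run p1 k1 ?f "length S * length S + 2" "\<lambda>_. length S" by (rule 1(2))
  interpret H: table_run p2 k2 ?g "length T * length T + 2" "\<lambda>_. length T" by (rule 2(2))
  have "p2 = p1 \<and> k2 = k1"
    using F.prime H.prime F.exponent_0 H.exponent_0 1(1) 2(1) len by (intro prime_power_unique) auto
  then have group_g: "group (fun_group (p1 ^ k1) ?g)" and g: "least_table (p1 ^ k1) ?g = (LEAST M. M \<in> F.candidates ?g)"
    using H.group_f H.least_table_eq by simp_all
  have "fun_group (p1 ^ k1) ?f \<cong> fun_group (p1 ^ k1) ?g"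
    using iso unfolding table_group_eq len[symmetric] 1(1)[symmetric] .
  from F.candidates_iso[OF F.group_f group_g this] F.least_table_eq g
  show "canonical_table S = canonical_table T"
    by (simp add: canonical_table_def len[symmetric] 1(1))
qed (use canonical_table_group[OF _ assms] in auto)

section \<open>The running time\<close>

text \<open>The constants come from w + 1 \<le> 2 w and n^2 + 4 \<le> 5 n^2. The factor n^(1/2) of w
  joins the polynomial factor, which leaves the exponent k / 2.\<close>

lemma time_bound:
  fixes n w k :: nat and t :: nat
  assumes n: "n \<ge> 1" and w: "real w = real n powr ((real k + 1) / 2)" and t: "t \<le> (w + 1) * (n * n + 2 + 2) ^ K"
  shows "real t \<le> 2 * 5 ^ K * real n powr (2 * real K + 1 / 2) * real n powr (real k / 2)"
proof -
  have "real w \<ge> 1" unfolding w using n by (intro ge_one_powr_ge_zero) auto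
  then have 1: "real (w + 1) \<le> 2 * real w" by simp
  have "n * n \<ge> 1" using n by simp
  then have "n * n + 2 + 2 \<le> 5 * (n * n)" by linarith
  then have "(n * n + 2 + 2) ^ K \<le> (5 * (n * n)) ^ K" by (rule power_mono) simp
  then have "real ((n * n + 2 + 2) ^ K) \<le> real ((5 * (n * n)) ^ K)" by (rule of_nat_mono)
  also have "\<dots> = 5 ^ K * real n powr (2 * real K)"
    using n powr_realpow[of "real n" "2 * K"] by (simp add: power_mult_distrib power_mult power2_eq_square)
  finally have 2: "real ((n * n + 2 + 2) ^ K) \<le> 5 ^ K * real n powr (2 * real K)" .
  have "real t \<le> real (w + 1) * real ((n * n + 2 + 2) ^ K)" using t by (metis of_nat_le_iff of_nat_mult)
  also have "\<dots> \<le> 2 * real w * (5 ^ K * real n powr (2 * real K))" by (intro mult_mono 1 2) auto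
  also have "real w = real n powr (1 / 2) * real n powr (real k / 2)"
    unfolding w powr_add[symmetric] by (simp add: add_divide_distrib add.commute)
  also have "2 * (real n powr (1 / 2) * real n powr (real k / 2)) * (5 ^ K * real n powr (2 * real K)) =
      2 * 5 ^ K * real n powr (2 * real K + 1 / 2) * real n powr (real k / 2)"
    by (simp add: powr_add)
  finally show ?thesis .
qed

lemma canonical_table_computed:
  "\<exists>P a b. \<forall>p T. prime p \<longrightarrow> T \<in> p_group_tables p \<longrightarrow>
     computes_in_time P T (canonical_table T)
       (a * real (length T) powr b * real (length T) powr (log (real p) (real (length T)) / 2))"
proof -
  let ?P = "program capE init runningE body copy_out"
  from program_run[OF wf_program]
  obtain K where K: "\<And>T A q \<rho> J. A = (\<lambda>a i. mem (input_config T) (32 * i + a)) \<Longrightarrow> \<rho> = (\<lambda>_. length T) \<Longrightarrow>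
    q = eval capE \<rho> A \<Longrightarrow> \<forall>j. mem (input_config T) j \<le> q \<Longrightarrow> length T \<le> q \<Longrightarrow>
    \<forall>j<J. eval runningE \<rho> ((sem body q \<rho> ^^ j) (sem init q \<rho> A)) \<noteq> 0 \<Longrightarrow>
    eval runningE \<rho> ((sem body q \<rho> ^^ J) (sem init q \<rho> A)) = 0 \<Longrightarrow>
    \<exists>t c. exec ?P (input_config T) t c \<and> reg c 0 = length T \<and>
       mem c = flat (sem copy_out q \<rho> ((sem body q \<rho> ^^ J) (sem init q \<rho> A))) \<and> t \<le> (J + 1) * (q + 2) ^ K"
    by blast
  have "computes_in_time ?P T (canonical_table T)
      (2 * 5 ^ K * real (length T) powr (2 * real K + 1 / 2) * real (length T) powr (log (real p) (real (length T)) / 2))"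
    if p: "prime p" and T: "T \<in> p_group_tables p" for p T
  proof -
    let ?f = "\<lambda>i j. T ! i ! j"
    define n where "n = length T"
    obtain p' k where k: "length T = p ^ k" "length T = p' ^ k" and rows: "\<forall>r\<in>set T. length r = length T"
      and run: "table_run p' k ?f (length T * length T + 2) (\<lambda>_. length T)"
      using p_group_tablesE[OF T p] .
    interpret table_run p' k ?f "length T * length T + 2" "\<lambda>_. length T" by (rule run)
    let ?A = "\<lambda>a i. mem (input_config T) (32 * i + a)" and ?q = "length T * length T + 2" and ?\<rho> = "\<lambda>_::nat. length T"
    have rows': "\<forall>r\<in>set T. length r = p' ^ k" using rows k(2) by simp
    note input = flat_input[OF rows' k(2) refl]
    note loop = program_loop[of ?A, OF input(1)]
    have "\<exists>t c. exec ?P (input_config T) t c \<and> reg c 0 = length T \<and>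
       mem c = flat (sem copy_out ?q ?\<rho> ((sem body ?q ?\<rho> ^^ W k) (sem init ?q ?\<rho> ?A))) \<and> t \<le> (W k + 1) * (?q + 2) ^ K"
    proof (rule K)
      show "?q = eval capE ?\<rho> ?A" by (simp add: capE_def)
      show "\<forall>j. mem (input_config T) j \<le> ?q" using input(2) by blast
      show "length T \<le> ?q" using N_le_q[of "length T"] k(2) by simp
      show "\<forall>j<W k. eval runningE ?\<rho> ((sem body ?q ?\<rho> ^^ j) (sem init ?q ?\<rho> ?A)) \<noteq> 0" using loop(1) .
      show "eval runningE ?\<rho> ((sem body ?q ?\<rho> ^^ W k) (sem init ?q ?\<rho> ?A)) = 0" using loop(2) .
    qed (rule refl)+
    then obtain t c where exec: "exec ?P (input_config T) t c" "reg c 0 = length T"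
      and mem: "mem c = flat (sem copy_out ?q ?\<rho> ((sem body ?q ?\<rho> ^^ W k) (sem init ?q ?\<rho> ?A)))"
      and t: "t \<le> (W k + 1) * (?q + 2) ^ K" by blast
    note can = canonical_table_group[OF T p]
    have "mem c m = concat (canonical_table T) ! m" if "m < length T * length T" for m
      using loop(4)[of m] that least_table_eq unfolding mem can(4) k(2)[symmetric] by simp
    moreover have "length (concat (canonical_table T)) = length T * length T"
      using nth_concat(1)[of "canonical_table T" "length T"] can(3) by (simp add: canonical_table_def)
    ultimately have "output_table c (canonical_table T)"
      unfolding output_table_def using exec(2) can(3) by simp
    moreover have "real t \<le> 2 * 5 ^ K * real (length T) powr (2 * real K + 1 / 2) * real (length T) powr (real k / 2)"
    proof (rule time_bound[OF _ _ t])
      show "length T \<ge> 1" unfolding k(2) using N_pos by linarith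
      show "real (W k) = real (length T) powr ((real k + 1) / 2)" unfolding k(2) by (rule W_powr)
    qed
    moreover have "log (real p) (real (length T)) = real k"
      using prime_gt_1_nat[OF p] unfolding k(1) by simp
    ultimately show ?thesis unfolding computes_in_time_def using exec(1) by auto
  qed
  then show ?thesis by blast
qed

theorem theorem5p6:
  shows "\<exists>f :: nat \<Rightarrow> real. f \<in> O(\<lambda>p. real p) \<and>
    p_group_canonization_in_time
      (\<lambda>n p. min (1 / 2 * log (real p) (real n) + f p) (log (real p) (real n)))"
\<comment> \<open>The term of order p can be zero: the search has n^((k+1)/2) rounds, and the excess
  n^(1/2) over n^(k/2) belongs to the polynomial factor. As the logarithm k is nonnegative, the
  minimum is its first argument.\<close>
proof (intro exI[of _ "\<lambda>_. 0"] conjI)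
  obtain P a b where P: "\<And>p T. prime p \<Longrightarrow> T \<in> p_group_tables p \<Longrightarrow> computes_in_time P T (canonical_table T)
       (a * real (length T) powr b * real (length T) powr (log (real p) (real (length T)) / 2))"
    using canonical_table_computed by blast
  have e: "min (1 / 2 * log (real p) (real (length T)) + 0) (log (real p) (real (length T))) =
      log (real p) (real (length T)) / 2" if p: "prime p" and T: "T \<in> p_group_tables p" for p T
  proof -
    obtain k where "length T = p ^ k" using p_group_tablesE[OF T p] .
    then have "log (real p) (real (length T)) = real k" using prime_gt_1_nat[OF p] by simp
    then show ?thesis by simp
  qed
  show "p_group_canonization_in_time
      (\<lambda>n p. min (1 / 2 * log (real p) (real n) + 0) (log (real p) (real n)))"
    unfolding p_group_canonization_in_time_def
  proof (rule exI[of _ P], rule exI[of _ canonical_table], rule exI[of _ a], rule exI[of _ b], intro allI impI conjI ballI)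
    fix p :: nat and T assume p: "prime p"
    then show "canonical_form (p_group_tables p) canonical_table" by (rule canonical_form_canonical_table)
    assume T: "T \<in> p_group_tables p"
    show "computes_in_time P T (canonical_table T) (a * real (length T) powr b *
        real (length T) powr min (1 / 2 * log (real p) (real (length T)) + 0) (log (real p) (real (length T))))"
      unfolding e[OF p T] by (rule P[OF p T])
  qed
qed simp

end
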